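(* Assume the setting of the context, including $(C_1)$, and consider $$\ddot\psi=f(\psi)+\varepsilon\gamma(t)\,h\Big(H^{-1}\Big(\tfrac{\dot\psi^2}{2}-F(\psi)-d\Big)\Big).\qquad( * )$$ Under assumptions $(H_4)$ and $(H_5)$, there exists $\rho>0$ such that equation $( * )$ (with $\varepsilon$ small) has unique hyperbolic periodic solutions $u_\pm(t)$ in a neighborhood of $\psi_\pm$ of radius $\rho$. Moreover, if the Melnikov function $$M_\infty(\alpha):=\int_{-\infty}^{\infty}\dot\psi_\infty(t+\alpha)\gamma(t)\,dt$$ has a simple zero at some $\alpha=\alpha_0$, then for any $\varepsilon$ sufficiently small there exists a unique $\alpha(\varepsilon)$ ($C^1$ with respect to $\varepsilon$) such that $|\alpha(\varepsilon)-\alpha_0|\to0$ as $\varepsilon\to0$ and such that equation $( * )$ has a unique heteroclinic (homoclinic) solution $\psi(t,\varepsilon)$ satisfying $$\|\psi(t,\varepsilon)-\psi_\infty(t+\alpha(\varepsilon))\|_2\le\rho .$$ Moreover $\|\psi(t,\varepsilon)-\psi_\infty(t+\alpha(\varepsilon))\|_2\to0$ as $\varepsilon\to0$ and $$\lim_{t\to\pm\infty}|\psi(t,\varepsilon)-u_\pm(t)|=0 .$$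
   Context: Setting: $f,h$ are $C^2$ real functions of a real variable, $\gamma:\mathbb R\to\mathbb R$ is $C^2$ and $1$-periodic, $\varepsilon\in\mathbb R$ is a small parameter, $d\in\mathbb R$ is a fixed constant, $F(\psi)=\int_0^\psi f(u)\,du$, $H(z)=\int_0^z h(u)\,du$. $(C_1)$: $H:I\to J$ is a diffeomorphism between open intervals $I,J\subseteq\mathbb R$, i.e. $h(z)\ne0$ for any $z\in I$; $H^{-1}:J\to I$ is its inverse. $(H_4)$: the unperturbed equation $\ddot\psi=f(\psi)$ has a heteroclinic orbit $\psi_\infty(t)$ such that $\lim_{t\to\pm\infty}\psi_\infty(t)=\psi_\pm$, and $\psi_\pm$ are hyperbolic saddles of $\ddot\psi=f(\psi)$. If $\psi_+=\psi_-$, then $\psi_\infty$ is a homoclinic orbit. $(H_5)$: $c_\infty-d\in J$, where $c_\infty$ is the constant value (in $t$) of $\frac{\dot\psi_\infty(t)^2}{2}-F(\psi_\infty(t))$. A solution of $( * )$ is required to satisfy $\frac{\dot\psi(t)^2}{2}-F(\psi(t))-d\in J$ for all $t\in\mathbb R$. The norm is $\|u\|_2=\max\{\sup_{\mathbb R}|u|,\sup_{\mathbb R}|\dot u|,\sup_{\mathbb R}|\ddot u|\}$ on the space $C_b^2(\mathbb R,\mathbb R)$ of $C^2$ functions bounded together with their first two derivatives. A simple zero of $M_\infty$ is a point $\alpha_0$ with $M_\infty(\alpha_0)=0$, $M_\infty'(\alpha_0)\ne0$.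
   Formalization: ψ(t,ε) is asserted for small ε≠0 (at ε=0 all nearby translates of ψ∞ are solutions); α(ε) is unique subject to the phase condition ∫(ψ−ψ∞(t+α))ψ̇∞(t+α)dt=0, since otherwise α(ε)+kε also works; ρ may depend on α0, as simple zeros may accumulate. *)

theory Defs
  imports "HOL-Analysis.Analysis"
begin

definition C2 :: "(real \<Rightarrow> real) \<Rightarrow> bool" where
  "C2 g \<longleftrightarrow> (\<forall>x. g differentiable (at x)) \<and> deriv g C1_differentiable_on UNIV"

definition C2_bounded :: "(real \<Rightarrow> real) \<Rightarrow> bool" where
  "C2_bounded u \<longleftrightarrow> C2 u \<and> bounded (range u) \<and> bounded (range (deriv u))
     \<and> bounded (range (deriv (deriv u)))"

text \<open>Only meaningful under \<open>C2_bounded\<close>: real suprema of unbounded sets are unspecified.\<close>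
definition C2_norm :: "(real \<Rightarrow> real) \<Rightarrow> real" where
  "C2_norm u = max (SUP t. \<bar>u t\<bar>) (max (SUP t. \<bar>deriv u t\<bar>) (SUP t. \<bar>deriv (deriv u) t\<bar>))"

definition C2_near :: "real \<Rightarrow> (real \<Rightarrow> real) \<Rightarrow> (real \<Rightarrow> real) \<Rightarrow> bool" where
  "C2_near r u v \<longleftrightarrow> C2_bounded (\<lambda>t. u t - v t) \<and> C2_norm (\<lambda>t. u t - v t) \<le> r"

text \<open>The oriented integral from \<open>0\<close> to \<open>x\<close>, so that negative \<open>x\<close> is covered.\<close>
definition primitive :: "(real \<Rightarrow> real) \<Rightarrow> real \<Rightarrow> real" where
  "primitive g x = interval_lebesgue_integral lborel (ereal 0) (ereal x) g"

definition solves2 :: "(real \<Rightarrow> real \<Rightarrow> real \<Rightarrow> real) \<Rightarrow> (real \<Rightarrow> real) \<Rightarrow> bool" where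
  "solves2 G \<psi> \<longleftrightarrow> (\<forall>t. \<psi> differentiable (at t) \<and>
     (deriv \<psi> has_real_derivative G t (\<psi> t) (deriv \<psi> t)) (at t))"

definition energy :: "(real \<Rightarrow> real) \<Rightarrow> (real \<Rightarrow> real) \<Rightarrow> real \<Rightarrow> real" where
  "energy f \<psi> t = (deriv \<psi> t)\<^sup>2 / 2 - primitive f (\<psi> t)"

definition diffeo_cond :: "(real \<Rightarrow> real) \<Rightarrow> real set \<Rightarrow> real set \<Rightarrow> bool" where
  "diffeo_cond h I J \<longleftrightarrow> open I \<and> is_interval I \<and> open J \<and> is_interval J \<and>
     bij_betw (primitive h) I J \<and> (\<forall>z\<in>I. h z \<noteq> 0)"

definition perturbed_rhs ::
  "(real \<Rightarrow> real) \<Rightarrow> (real \<Rightarrow> real) \<Rightarrow> (real \<Rightarrow> real) \<Rightarrow> real \<Rightarrow> real set \<Rightarrow> real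
    \<Rightarrow> real \<Rightarrow> real \<Rightarrow> real \<Rightarrow> real" where
  "perturbed_rhs f h \<gamma> d I \<epsilon> t x y =
     f x + \<epsilon> * \<gamma> t * h (the_inv_into I (primitive h) (y\<^sup>2 / 2 - primitive f x - d))"

definition perturbed_solution ::
  "(real \<Rightarrow> real) \<Rightarrow> (real \<Rightarrow> real) \<Rightarrow> (real \<Rightarrow> real) \<Rightarrow> real \<Rightarrow> real set \<Rightarrow> real set \<Rightarrow> real
    \<Rightarrow> (real \<Rightarrow> real) \<Rightarrow> bool" where
  "perturbed_solution f h \<gamma> d I J \<epsilon> \<psi> \<longleftrightarrow>
     solves2 (perturbed_rhs f h \<gamma> d I \<epsilon>) \<psi> \<and> (\<forall>t. energy f \<psi> t - d \<in> J)"

text \<open>In dimension two, a positive and a negative eigenvalue of the linearization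
  account for the whole spectrum.\<close>
definition planar_saddle :: "(real \<times> real \<Rightarrow> real \<times> real) \<Rightarrow> real \<times> real \<Rightarrow> bool" where
  "planar_saddle X p \<longleftrightarrow> X p = 0 \<and> (\<exists>L. (X has_derivative L) (at p) \<and>
     (\<exists>k>0. \<exists>v. v \<noteq> 0 \<and> L v = k *\<^sub>R v) \<and> (\<exists>l<0. \<exists>w. w \<noteq> 0 \<and> L w = l *\<^sub>R w))"

definition hyperbolic_saddle :: "(real \<Rightarrow> real) \<Rightarrow> real \<Rightarrow> bool" where
  "hyperbolic_saddle f p \<longleftrightarrow> planar_saddle (\<lambda>(x, y). (y, f x)) (p, 0)"

text \<open>Non-constancy only matters in the homoclinic case \<open>p = q\<close>.\<close>
definition heteroclinic_orbit ::
  "(real \<Rightarrow> real) \<Rightarrow> (real \<Rightarrow> real) \<Rightarrow> real \<Rightarrow> real \<Rightarrow> bool" where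
  "heteroclinic_orbit f \<psi> p q \<longleftrightarrow> solves2 (\<lambda>t x y. f x) \<psi> \<and> \<not> \<psi> constant_on UNIV \<and>
     (\<psi> \<longlongrightarrow> p) at_bot \<and> (\<psi> \<longlongrightarrow> q) at_top \<and>
     hyperbolic_saddle f p \<and> hyperbolic_saddle f q"

text \<open>\<open>\<mu>\<close> is a Floquet multiplier of the \<open>T\<close>-periodic equation \<open>v'' = a(t) v + b(t) v'\<close>:
  there is a nontrivial complex solution with \<open>v (t + T) = \<mu> v t\<close>.\<close>
definition floquet_multiplier ::
  "(real \<Rightarrow> real) \<Rightarrow> (real \<Rightarrow> real) \<Rightarrow> real \<Rightarrow> complex \<Rightarrow> bool" where
  "floquet_multiplier a b T \<mu> \<longleftrightarrow> (\<exists>v w. (\<exists>t. v t \<noteq> 0) \<and>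
     (\<forall>t. (v has_vector_derivative w t) (at t) \<and>
          (w has_vector_derivative of_real (a t) * v t + of_real (b t) * w t) (at t) \<and>
          v (t + T) = \<mu> * v t))"

text \<open>The multipliers are those of the linearization of \<open>u'' = G t u u'\<close> along \<open>u\<close>.\<close>
definition hyperbolic_periodic ::
  "(real \<Rightarrow> real \<Rightarrow> real \<Rightarrow> real) \<Rightarrow> real \<Rightarrow> (real \<Rightarrow> real) \<Rightarrow> bool" where
  "hyperbolic_periodic G T u \<longleftrightarrow> (\<forall>t. u (t + T) = u t) \<and>
     (\<forall>\<mu>. floquet_multiplier (\<lambda>t. deriv (\<lambda>x. G t x (deriv u t)) (u t))
                             (\<lambda>t. deriv (\<lambda>y. G t (u t) y) (deriv u t)) T \<mu> \<longrightarrow> cmod \<mu> \<noteq> 1)"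

text \<open>The hyperbolic solution has the period \<open>1\<close> of the equation; it is the only periodic
  solution, of whatever period, in the \<open>\<rho>\<close>-neighbourhood of the constant \<open>p\<close>.\<close>
definition unique_hyperbolic_periodic_near ::
  "(real \<Rightarrow> real) \<Rightarrow> (real \<Rightarrow> real) \<Rightarrow> (real \<Rightarrow> real) \<Rightarrow> real \<Rightarrow> real set \<Rightarrow> real set \<Rightarrow> real
    \<Rightarrow> real \<Rightarrow> real \<Rightarrow> (real \<Rightarrow> real) \<Rightarrow> bool" where
  "unique_hyperbolic_periodic_near f h \<gamma> d I J \<epsilon> \<rho> p u \<longleftrightarrow>
     perturbed_solution f h \<gamma> d I J \<epsilon> u \<and>
     hyperbolic_periodic (perturbed_rhs f h \<gamma> d I \<epsilon>) 1 u \<and>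
     C2_near \<rho> u (\<lambda>t. p) \<and>
     (\<forall>w. perturbed_solution f h \<gamma> d I J \<epsilon> w \<and> (\<exists>T>0. \<forall>t. w (t + T) = w t) \<and>
          C2_near \<rho> w (\<lambda>t. p) \<longrightarrow> w = u)"

definition melnikov :: "(real \<Rightarrow> real) \<Rightarrow> (real \<Rightarrow> real) \<Rightarrow> real \<Rightarrow> real" where
  "melnikov \<psi> \<gamma> \<alpha> = (LBINT t. deriv \<psi> (t + \<alpha>) * \<gamma> t)"

definition simple_zero :: "(real \<Rightarrow> real) \<Rightarrow> real \<Rightarrow> bool" where
  "simple_zero M a \<longleftrightarrow> M a = 0 \<and> (\<exists>m. m \<noteq> 0 \<and> (M has_real_derivative m) (at a))"

text \<open>Smallness of the difference does not single out the phase \<open>\<alpha>\<close>: it survives small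
  changes of \<open>\<alpha>\<close>. The phase is normalized by requiring the difference to be orthogonal in
  \<open>L\<^sup>2\<close> to the tangent of the family of translates of \<open>\<psi>\<^sub>0\<close>.\<close>
definition phase_condition :: "(real \<Rightarrow> real) \<Rightarrow> real \<Rightarrow> (real \<Rightarrow> real) \<Rightarrow> bool" where
  "phase_condition \<psi>\<^sub>0 \<alpha> \<psi> \<longleftrightarrow>
     (LBINT t. (\<psi> t - \<psi>\<^sub>0 (t + \<alpha>)) * deriv \<psi>\<^sub>0 (t + \<alpha>)) = 0"

end

theory Submission
  imports Defs "HOL-Real_Asymp.Real_Asymp"
begin

text \<open>
  Write \<open>k (\<psi>, \<psi>') = h (H\<inverse> (\<psi>'\<^sup>2 / 2 - F \<psi> - d))\<close>; this is \<open>C\<^sup>1\<close> on an open set which contains the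
  unperturbed orbit, and it has a constant value \<open>g\<^sub>0 \<noteq> 0\<close> on this orbit.

  Near a saddle, \<open>y'' - \<kappa>\<^sup>2 y\<close> is boundedly invertible on bounded functions, so a contraction gives a
  bounded solution. If \<open>y\<close> is a difference of two bounded solutions, then \<open>(y\<^sup>2)'' \<ge> \<kappa>\<^sup>2 y\<^sup>2\<close>, and a
  bounded function with this property vanishes on the line and decays on a half-line. This gives
  uniqueness, periodicity, hyperbolicity (applied to Floquet solutions with \<open>\<bar>\<mu>\<bar> = 1\<close>) and the
  asymptotics of the heteroclinic solutions.

  Along the orbit \<open>\<phi>\<close>, the equation \<open>y'' = f'(\<phi>) y + r\<close> has a bounded solution iff \<open>r\<close> is orthogonal
  to \<open>\<phi>'\<close>, and it is unique up to multiples of \<open>\<phi>'\<close>. With \<open>\<psi> (t - \<alpha>) = \<phi> t + \<epsilon> Y t\<close> the problem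
  becomes, after division by \<open>\<epsilon>\<close>, a fixed point problem for \<open>(Y, Y', \<alpha>)\<close> which is \<open>C\<^sup>1\<close> in all
  variables up to \<open>\<epsilon> = 0\<close> although \<open>f\<close> is only \<open>C\<^sup>2\<close>; at \<open>\<epsilon> = 0\<close> its solvability condition is
  \<open>g\<^sub>0 M (\<alpha>) = 0\<close>. A parametrized contraction then gives the \<open>C\<^sup>1\<close> branch \<open>\<alpha> (\<epsilon>)\<close>. Every solution near
  the orbit satisfies \<open>\<bar>y\<bar> = O (\<epsilon>)\<close> once its phase is normalized, so it comes from a fixed point.
\<close>

section \<open>Scalar differential inequalities and integrals\<close>

text \<open>At \<epsilon> = 0 every translate of the orbit is a solution, so the linearization has
  the kernel spanned by \<open>\<phi>'\<close> and no contraction argument applies to the original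
  equation. Writing it as \<open>\<alpha>0 + \<theta> * b\<close> with \<bar>b\<bar> \<le> 1 and
  small \<theta> weakens the effect of b on Y enough for a contraction in the joint unknown. The
  same degeneracy is why solutions are compared with the branch only for \<epsilon> \<noteq> 0. The
  time axis is not compact, yet superposition operators on bounded functions need estimates uniform
  in t. They come from compactness all the same: the orbit lies in a compact set, and the forcing
  depends on t only modulo 1. Uniqueness of the heteroclinic solution near a given translate is
  claimed without a phase condition. A small time shift \<tau> restores the condition, the shifted
  solution has the phase \<open>\<alpha> \<epsilon> + \<tau>\<close>, and uniqueness of the phase
  forces \<tau> = 0.\<close>

lemma primitive_has_real_derivative:
  assumes "continuous_on UNIV g"
  shows "(primitive g has_real_derivative g x) (at x)"
proof -
  \<comment> \<open>The interval has to contain the base point 0 and to have x in its interior, so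
    that the derivative within it is the full derivative.\<close>
  define a b where "a = min 0 x - 1" and "b = max 0 x + 1"
  have "a < x" "x < b" "a \<le> 0" "0 \<le> b"
    unfolding a_def b_def by linarith+
  have "(primitive g has_vector_derivative g x) (at x within {a..b})"
    unfolding primitive_def using assms
    using \<open>a < x\<close> \<open>x < b\<close> \<open>a \<le> 0\<close> \<open>0 \<le> b\<close>
    by (intro interval_integral_FTC2) (auto intro: continuous_on_subset)
  moreover have "at x within {a..b} = at x"
    using \<open>a < x\<close> \<open>x < b\<close> by (rule at_within_Icc_at)
  ultimately show ?thesis
    by (simp only: has_real_derivative_iff_has_vector_derivative)
qed

lemma primitive_0 [simp]: "primitive g 0 = 0"
  by (simp add: primitive_def zero_ereal_def[symmetric])

text \<open>The bounded antiderivative arctan gives integrability; the function serves as majorant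
  for everything that decays exponentially.\<close>

lemma integrable_inverse_one_plus_square: "integrable lborel (\<lambda>x::real. inverse (1 + x\<^sup>2))"
proof -
  have "set_integrable lborel (einterval (-\<infinity>) \<infinity>) (\<lambda>x. inverse (1 + x\<^sup>2))"
  proof (rule interval_integral_FTC_nonneg[where F = arctan])
    show "((arctan \<circ> real_of_ereal) \<longlongrightarrow> - (pi / 2)) (at_right (- \<infinity>))"
      unfolding ereal_tendsto_simps by (rule tendsto_arctan_at_bot)
    show "((arctan \<circ> real_of_ereal) \<longlongrightarrow> pi / 2) (at_left \<infinity>)"
      unfolding ereal_tendsto_simps by (rule tendsto_arctan_at_top)
    show "isCont (\<lambda>x::real. inverse (1 + x\<^sup>2)) x" for x
      by (intro continuous_intros) (simp add: add_nonneg_eq_0_iff)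
  qed (auto intro!: derivative_eq_intros AE_I2)
  then show ?thesis by (simp add: set_integrable_def)
qed

lemma integrable_exp_decay:
  fixes w :: "real \<Rightarrow> real"
  assumes "continuous_on UNIV w" and k: "0 < k" and w: "\<And>t. \<bar>w t\<bar> \<le> C * exp (- k * \<bar>t\<bar>)"
  shows "integrable lborel w"
proof -
  define M where "M = C * (1 + 2 / k\<^sup>2)"
  have C: "0 \<le> C" using w[of 0] abs_ge_zero[of "w 0"] by simp
  \<comment> \<open>The quadratic Taylor bound of exp dominates 1 and a multiple of t squared
    separately; adding the two gives the constant \<open>1 + 2 / k\<^sup>2\<close>.\<close>
  have e: "exp (- k * \<bar>t\<bar>) \<le> (1 + 2 / k\<^sup>2) * inverse (1 + t\<^sup>2)" for t
  proof -
    let ?e = "exp (k * \<bar>t\<bar>)"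
    have "1 + k * \<bar>t\<bar> + (k * \<bar>t\<bar>)\<^sup>2 / 2 \<le> ?e"
      using exp_lower_Taylor_quadratic[of "k * \<bar>t\<bar>"] k by simp
    moreover have "0 \<le> k * \<bar>t\<bar>" using k by simp
    moreover have "(k * \<bar>t\<bar>)\<^sup>2 = (k * t)\<^sup>2" by (simp add: power_mult_distrib)
    ultimately have "(k * t)\<^sup>2 \<le> 2 * ?e" and e1: "1 \<le> ?e"
      by simp_all
    then have "t\<^sup>2 \<le> (2 / k\<^sup>2) * ?e"
      using k by (simp add: power_mult_distrib field_simps)
    then have "1 + t\<^sup>2 \<le> (1 + 2 / k\<^sup>2) * ?e"
      using e1 unfolding ring_distribs by linarith
    moreover have "0 < 1 + t\<^sup>2" by (simp add: add_pos_nonneg)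
    ultimately show ?thesis by (simp add: exp_minus field_simps)
  qed
  show ?thesis
  proof (rule Bochner_Integration.integrable_bound)
    show "integrable lborel (\<lambda>t::real. M * inverse (1 + t\<^sup>2))"
      by (intro integrable_mult_right integrable_inverse_one_plus_square)
    show "w \<in> borel_measurable lborel"
      using assms(1) by (simp add: borel_measurable_continuous_onI)
    show "AE t in lborel. norm (w t) \<le> norm (M * inverse (1 + t\<^sup>2))"
    proof (intro AE_I2)
      fix t
      have "\<bar>w t\<bar> \<le> C * ((1 + 2 / k\<^sup>2) * inverse (1 + t\<^sup>2))"
        using w[of t] mult_left_mono[OF e[of t] C] by linarith
      then show "norm (w t) \<le> norm (M * inverse (1 + t\<^sup>2))"
        by (simp add: M_def mult.assoc)
    qed
  qed
qed

lemma LBINT_eq_diff_limits: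
  fixes w F :: "real \<Rightarrow> real"
  assumes "continuous_on UNIV w" "integrable lborel w"
    and "\<And>x. (F has_real_derivative w x) (at x)"
    and "(F \<longlongrightarrow> A) at_bot" "(F \<longlongrightarrow> B) at_top"
  shows "(LBINT t. w t) = B - A"
proof -
  have "(LBINT x=-\<infinity>..\<infinity>. w x) = B - A"
    using assms
    by (intro interval_integral_FTC_integrable[where F = F])
       (auto simp: ereal_tendsto_simps has_real_derivative_iff_has_vector_derivative
          continuous_on_eq_continuous_at set_integrable_def)
  then show ?thesis
    by (simp add: interval_lebesgue_integral_def set_lebesgue_integral_def)
qed

text \<open>Dominated convergence for the truncations to \<open>{..y}\<close> gives the limit at the
  right end. The left end is the right end of the reflected integrand, whose primitive has the
  opposite sign.\<close>

lemma integrable_primitive_limits: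
  fixes w :: "real \<Rightarrow> real"
  assumes "continuous_on UNIV w" "integrable lborel w"
  obtains A B where "(primitive w \<longlongrightarrow> A) at_bot" "(primitive w \<longlongrightarrow> B) at_top"
    "(LBINT t. w t) = B - A"
proof -
  have lim: "\<exists>B. (primitive w \<longlongrightarrow> B) at_top"
    if c: "continuous_on UNIV w" and i: "integrable lborel w" for w :: "real \<Rightarrow> real"
  proof -
    let ?P = "\<lambda>y. LINT x|lborel. indicator {..y} x *\<^sub>R w x"
    have "(?P \<longlongrightarrow> (LBINT t. w t)) at_top"
      using i by (intro tendsto_integral_at_top) auto
    then have "((\<lambda>y. ?P y - ?P 0) \<longlongrightarrow> (LBINT t. w t) - ?P 0) at_top"
      by (intro tendsto_intros)
    moreover have "\<forall>\<^sub>F y in at_top. ?P y - ?P 0 = primitive w y"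
      using eventually_ge_at_top[of 0]
    proof eventually_elim
      case (elim y)
      have int: "integrable lborel (\<lambda>x. indicator {..y} x *\<^sub>R w x)" for y
        using integrable_mult_indicator[OF _ i, of "{..y}"] by simp
      have "?P y - ?P 0 = (LINT x|lborel. indicator {..y} x *\<^sub>R w x - indicator {..0} x *\<^sub>R w x)"
        by (rule Bochner_Integration.integral_diff[symmetric]) (rule int)+
      also have "\<dots> = (LINT x|lborel. indicator {0<..y} x *\<^sub>R w x)"
        using elim by (intro Bochner_Integration.integral_cong) (auto split: split_indicator)
      also have "\<dots> = primitive w y"
        using elim by (simp add: primitive_def interval_integral_Ioc set_lebesgue_integral_def
            zero_ereal_def)
      finally show ?case .
    qed
    ultimately show ?thesis
      by (blast intro: Lim_transform_eventually)
  qed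
  obtain B where B: "(primitive w \<longlongrightarrow> B) at_top" using lim assms by blast
  have cm: "continuous_on UNIV (\<lambda>x. w (- x))"
    using assms(1) by (auto intro!: continuous_intros continuous_on_compose2[OF assms(1)])
  have "integrable lborel (\<lambda>x. w (- x))"
    using lborel_integrable_real_affine[OF assms(2), of "-1" 0] by simp
  then obtain A where A: "(primitive (\<lambda>x. w (- x)) \<longlongrightarrow> A) at_top" using lim cm by blast
  have "primitive (\<lambda>x. w (- x)) (- y) + primitive w y = 0" for y
  proof -
    have "((\<lambda>y. primitive (\<lambda>x. w (- x)) (- y) + primitive w y) has_real_derivative 0) (at x)" for x
      using primitive_has_real_derivative[OF cm, of "- x"]
      by (auto intro!: derivative_eq_intros primitive_has_real_derivative[OF assms(1)]
          DERIV_chain2[where f = "primitive (\<lambda>x. w (- x))" and g = uminus])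
    then have "primitive (\<lambda>x. w (- x)) (- y) + primitive w y
        = primitive (\<lambda>x. w (- x)) (- 0) + primitive w 0"
      by (intro DERIV_isconst_all) auto
    then show ?thesis by simp
  qed
  then have eq: "primitive w = (\<lambda>y. - primitive (\<lambda>x. w (- x)) (- y))"
    by (auto simp: fun_eq_iff add_eq_0_iff)
  have A': "(primitive w \<longlongrightarrow> - A) at_bot"
    unfolding eq at_bot_mirror filterlim_filtermap using A by (auto intro: tendsto_minus)
  show ?thesis
    using that[OF A' B] LBINT_eq_diff_limits[OF assms primitive_has_real_derivative[OF assms(1)] A' B]
    by simp
qed

text \<open>If \<open>N' + k N\<close> were positive somewhere, it would grow exponentially and so would \<open>N\<close>.\<close>

lemma bounded_above_imp_decay:
  fixes N N' N'' :: "real \<Rightarrow> real"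
  assumes k: "0 < k"
    and N: "\<And>t. T \<le> t \<Longrightarrow> (N has_real_derivative N' t) (at t)"
    and N': "\<And>t. T \<le> t \<Longrightarrow> (N' has_real_derivative N'' t) (at t)"
    and conv: "\<And>t. T \<le> t \<Longrightarrow> k\<^sup>2 * N t \<le> N'' t"
    and bd: "\<And>t. T \<le> t \<Longrightarrow> N t \<le> B"
    and t: "T \<le> t"
  shows "N' t \<le> - k * N t"
proof (rule ccontr)
  define D where "D t = N' t + k * N t" for t
  assume "\<not> N' t \<le> - k * N t"
  then have D0: "0 < D t" by (simp add: D_def)
  \<comment> \<open>The convexity hypothesis says D' \<ge> k D, hence \<open>D s\<close> is at least
    \<open>c * exp (k * s)\<close> from time t on.\<close>
  define c where "c = D t * exp (- k * t)"
  have c: "0 < c" using D0 by (simp add: c_def)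
  have D: "(D has_real_derivative N'' s + k * N' s) (at s)" if "T \<le> s" for s
    unfolding D_def using that by (auto intro!: derivative_eq_intros N N')
  have 1: "c \<le> D s * exp (- k * s)" if "t \<le> s" for s
    unfolding c_def
  proof (rule DERIV_nonneg_imp_nondecreasing[OF that])
    fix x assume x: "t \<le> x" "x \<le> s"
    then have x': "T \<le> x" using t by simp
    have "((\<lambda>s. D s * exp (- k * s)) has_real_derivative
        (N'' x + k * N' x - k * D x) * exp (- k * x)) (at x)"
      by (auto intro!: derivative_eq_intros D[OF x'] simp: algebra_simps)
    moreover have "0 \<le> N'' x + k * N' x - k * D x"
      using conv[OF x'] by (simp add: D_def algebra_simps power2_eq_square)
    ultimately show "\<exists>y. ((\<lambda>s. D s * exp (- k * s)) has_real_derivative y) (at x) \<and> 0 \<le> y"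
      by (intro exI[of _ "(N'' x + k * N' x - k * D x) * exp (- k * x)"]) simp
  qed
  \<comment> \<open>The derivative of \<open>N s * exp (k * s)\<close> is
    \<open>D s * exp (k * s)\<close>, at least \<open>c * exp (2 * k * s)\<close>. The subtracted
    term is an antiderivative of this lower bound, so N grows at least like
    \<open>exp (k * s)\<close>.\<close>
  have 2: "N t * exp (k * t) - c / (2 * k) * exp (2 * k * t)
      \<le> N s * exp (k * s) - c / (2 * k) * exp (2 * k * s)" if "t \<le> s" for s
  proof (rule DERIV_nonneg_imp_nondecreasing[OF that])
    fix x assume x: "t \<le> x" "x \<le> s"
    then have x': "T \<le> x" using t by simp
    have "((\<lambda>s. N s * exp (k * s) - c / (2 * k) * exp (2 * k * s)) has_real_derivative
        D x * exp (k * x) - c * exp (2 * k * x)) (at x)"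
      using k by (auto intro!: derivative_eq_intros N[OF x'] simp: algebra_simps D_def)
    moreover have "c * exp (2 * k * x) \<le> D x * exp (k * x)"
    proof -
      have "c * exp (2 * k * x) \<le> (D x * exp (- k * x)) * exp (2 * k * x)"
        using 1[OF x(1)] by (intro mult_right_mono) auto
      also have "\<dots> = D x * exp (k * x)"
        by (simp add: mult.assoc exp_add[symmetric])
      finally show ?thesis .
    qed
    ultimately show "\<exists>y. ((\<lambda>s. N s * exp (k * s) - c / (2 * k) * exp (2 * k * s))
        has_real_derivative y) (at x) \<and> 0 \<le> y"
      by (intro exI[of _ "D x * exp (k * x) - c * exp (2 * k * x)"]) simp
  qed
  define K where "K = N t * exp (k * t) - c / (2 * k) * exp (2 * k * t)"
  have 3: "K * exp (- k * s) + c / (2 * k) * exp (k * s) \<le> B" if "t \<le> s" for s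
  proof -
    have "(K + c / (2 * k) * exp (2 * k * s)) * exp (- k * s) \<le> (N s * exp (k * s)) * exp (- k * s)"
      using 2[OF that] by (intro mult_right_mono) (auto simp: K_def)
    also have "\<dots> = N s" by (simp add: mult.assoc exp_add[symmetric])
    finally show ?thesis using bd[of s] that t
      by (simp add: algebra_simps exp_add[symmetric])
  qed
  \<comment> \<open>By exp x \<ge> 1 + x the growing term is at least
    \<open>c / (2 * k) + c * s / 2\<close>. This s makes \<open>c * s / 2\<close> outweigh both the
    bound B and the constant K, and the summand \<open>c / (2 * k)\<close> gives the strict
    contradiction.\<close>
  define s where "s = max t (max 0 ((2 * (\<bar>B\<bar> + \<bar>K\<bar>) / c)))"
  have s: "t \<le> s" "0 \<le> s" by (auto simp: s_def)
  have lin: False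
    if "w1 \<le> w2" "b + m \<le> w3" "w1 = w4 + w3" "- m \<le> w5" "0 < w4" "B \<le> b" "w5 + w2 \<le> B"
    for w1 w2 w3 w4 w5 b m :: real
    using that by linarith
  have "c / (2 * k) * (1 + k * s) \<le> c / (2 * k) * exp (k * s)"
    using c k by (intro mult_left_mono) auto
  moreover have "\<bar>B\<bar> + \<bar>K\<bar> \<le> c * s / 2"
  proof -
    have "2 * (\<bar>B\<bar> + \<bar>K\<bar>) / c \<le> s" by (simp add: s_def)
    then show ?thesis using c by (simp add: pos_divide_le_eq mult.commute)
  qed
  moreover have "c / (2 * k) * (1 + k * s) = c / (2 * k) + c * s / 2"
    using k by (simp add: field_simps)
  moreover have "- \<bar>K\<bar> \<le> K * exp (- k * s)"
  proof -
    have "\<bar>K * exp (- k * s)\<bar> \<le> \<bar>K\<bar>"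
      using k s by (simp add: abs_mult mult_left_le)
    then show ?thesis by (rule abs_le_D2[THEN minus_le_iff[THEN iffD1]])
  qed
  moreover have "0 < c / (2 * k)" using c k by simp
  moreover have "B \<le> \<bar>B\<bar>" by simp
  ultimately show False using 3[OF s(1)] by (rule lin)
qed

text \<open>Gronwall's inequality. The sign of k is left open, so the same statement yields the
  growth bound \<open>R_growth\<close>.\<close>

lemma decay_of_derivative_le:
  fixes N N' :: "real \<Rightarrow> real"
  assumes N: "\<And>t. T \<le> t \<Longrightarrow> (N has_real_derivative N' t) (at t)"
    and le: "\<And>t. T \<le> t \<Longrightarrow> N' t \<le> - k * N t"
    and st: "T \<le> s" "s \<le> t"
  shows "N t \<le> N s * exp (- k * (t - s))"
proof -
  have "N t * exp (k * t) \<le> N s * exp (k * s)"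
  proof (rule DERIV_nonpos_imp_nonincreasing[OF st(2)])
    fix x assume x: "s \<le> x" "x \<le> t"
    then have x': "T \<le> x" using st by simp
    have "((\<lambda>t. N t * exp (k * t)) has_real_derivative (N' x + k * N x) * exp (k * x)) (at x)"
      by (auto intro!: derivative_eq_intros N[OF x'] simp: algebra_simps)
    moreover have "(N' x + k * N x) * exp (k * x) \<le> 0"
      using le[OF x'] by (intro mult_nonpos_nonneg) auto
    ultimately show "\<exists>y. ((\<lambda>t. N t * exp (k * t)) has_real_derivative y) (at x) \<and> y \<le> 0"
      by blast
  qed
  then have "N t * exp (k * t) * exp (- k * t) \<le> N s * exp (k * s) * exp (- k * t)"
    by (intro mult_right_mono) auto
  then show ?thesis
    by (simp add: mult.assoc exp_add[symmetric] algebra_simps)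
qed

lemma tendsto_0_of_bounded_convex:
  fixes N N' N'' :: "real \<Rightarrow> real"
  assumes k: "0 < k"
    and N: "\<And>t. T \<le> t \<Longrightarrow> (N has_real_derivative N' t) (at t)"
    and N': "\<And>t. T \<le> t \<Longrightarrow> (N' has_real_derivative N'' t) (at t)"
    and conv: "\<And>t. T \<le> t \<Longrightarrow> k\<^sup>2 * N t \<le> N'' t"
    and bd: "\<And>t. T \<le> t \<Longrightarrow> N t \<le> B" and nn: "\<And>t. T \<le> t \<Longrightarrow> 0 \<le> N t"
  shows "(N \<longlongrightarrow> 0) at_top"
proof (rule tendsto_sandwich)
  have dec: "N t \<le> N T * exp (- k * (t - T))" if "T \<le> t" for t
    using that by (intro decay_of_derivative_le[OF N] bounded_above_imp_decay[OF k N N' conv bd]) auto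
  show "\<forall>\<^sub>F t in at_top. 0 \<le> N t"
    using eventually_ge_at_top[of T] by eventually_elim (rule nn)
  show "\<forall>\<^sub>F t in at_top. N t \<le> N T * exp (- k * (t - T))"
    using eventually_ge_at_top[of T] by eventually_elim (rule dec)
  have "filterlim (\<lambda>t. k * t - k * T) at_top at_top"
    using k by real_asymp
  then have "((\<lambda>t. exp (- (k * t - k * T))) \<longlongrightarrow> 0) at_top"
    by (intro filterlim_compose[OF exp_at_bot]) (simp add: filterlim_uminus_at_bot)
  then have "((\<lambda>t. N T * exp (- k * (t - T))) \<longlongrightarrow> N T * 0) at_top"
    by (intro tendsto_intros) (simp add: algebra_simps)
  then show "((\<lambda>t. N T * exp (- k * (t - T))) \<longlongrightarrow> 0) at_top" by simp
qed auto

text \<open>The decay estimate holds from every starting time s with the same bound B; letting s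
  tend to minus infinity leaves nothing at t.\<close>

lemma eq_0_of_bounded_convex:
  fixes N N' N'' :: "real \<Rightarrow> real"
  assumes k: "0 < k"
    and N: "\<And>t. (N has_real_derivative N' t) (at t)"
    and N': "\<And>t. (N' has_real_derivative N'' t) (at t)"
    and conv: "\<And>t. k\<^sup>2 * N t \<le> N'' t"
    and bd: "\<And>t. N t \<le> B" and nn: "\<And>t. 0 \<le> N t"
  shows "N t = 0"
proof -
  have dec: "N t \<le> B * exp (- k * (t - s))" if "s \<le> t" for s
  proof -
    have "N t \<le> N s * exp (- k * (t - s))"
      using that by (intro decay_of_derivative_le[of s, OF N] bounded_above_imp_decay[of k s, OF k N N' conv bd]) auto
    also have "\<dots> \<le> B * exp (- k * (t - s))" by (intro mult_right_mono bd) auto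
    finally show ?thesis .
  qed
  have "filterlim (\<lambda>s. k * t - k * s) at_top at_bot"
    using k by real_asymp
  then have "((\<lambda>s. exp (- (k * t - k * s))) \<longlongrightarrow> 0) at_bot"
    by (intro filterlim_compose[OF exp_at_bot]) (simp add: filterlim_uminus_at_bot)
  then have "((\<lambda>s. B * exp (- k * (t - s))) \<longlongrightarrow> B * 0) at_bot"
    by (intro tendsto_intros) (simp add: algebra_simps)
  then have "N t \<le> B * 0"
    by (rule tendsto_lowerbound) (use eventually_mono[OF eventually_le_at_bot[of t] dec] in simp_all)
  then show ?thesis using nn[of t] by simp
qed

section \<open>The linearized equation along a decaying solution\<close>

text \<open>The integral of the bound over s from 0 to t is at most K / c. The mean value inequality
  against an antiderivative of the bound replaces the integration.\<close>

lemma abs_diff_le_of_exp_bound_left: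
  fixes F g :: "real \<Rightarrow> real"
  assumes c: "0 < c" and K: "0 \<le> K" and t: "0 \<le> t"
    and F: "\<And>s. (F has_real_derivative g s) (at s)"
    and g: "\<And>s. 0 \<le> s \<Longrightarrow> s \<le> t \<Longrightarrow> \<bar>g s\<bar> \<le> K * exp (- c * (t - s))"
  shows "\<bar>F t - F 0\<bar> \<le> K / c"
proof (cases "t = 0")
  case True
  then show ?thesis using c K by simp
next
  case False
  then have t: "0 < t" using t by simp
  define \<phi> where "\<phi> s = K / c * exp (- c * (t - s))" for s
  have \<phi>: "(\<phi> has_real_derivative K * exp (- c * (t - s))) (at s)" for s
    unfolding \<phi>_def using c by (auto intro!: derivative_eq_intros)
  have "norm (F t - F 0) \<le> \<phi> t - \<phi> 0"
  proof (rule differentiable_bound_general[OF t])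
    show "continuous_on {0..t} F"
      using F by (meson DERIV_continuous_on has_field_derivative_at_within)
    show "continuous_on {0..t} \<phi>"
      using \<phi> by (meson DERIV_continuous_on has_field_derivative_at_within)
    show "(F has_vector_derivative g x) (at x)" for x
      using F by (simp add: has_real_derivative_iff_has_vector_derivative)
    show "(\<phi> has_vector_derivative K * exp (- c * (t - x))) (at x)" for x
      using \<phi> by (simp add: has_real_derivative_iff_has_vector_derivative)
    show "norm (g x) \<le> K * exp (- c * (t - x))" if "0 < x" "x < t" for x
      using g[of x] that by simp
  qed
  also have "\<phi> t - \<phi> 0 \<le> K / c"
    using c K by (simp add: \<phi>_def)
  finally show ?thesis by simp
qed

text \<open>The counterpart for the integral from t to infinity: reflection reduces a finite
  interval to the previous lemma, and the bound survives the limit of the right end.\<close>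

lemma abs_diff_le_of_exp_bound_right:
  fixes F g :: "real \<Rightarrow> real"
  assumes c: "0 < c" and K: "0 \<le> K"
    and F: "\<And>s. (F has_real_derivative g s) (at s)"
    and g: "\<And>s. t \<le> s \<Longrightarrow> \<bar>g s\<bar> \<le> K * exp (- c * (s - t))"
    and L: "(F \<longlongrightarrow> L) at_top"
  shows "\<bar>F t - L\<bar> \<le> K / c"
proof -
  have "\<bar>F t - F u\<bar> \<le> K / c" if "t \<le> u" for u
  proof -
    let ?G = "\<lambda>s. F (u - s)"
    have "\<bar>?G (u - t) - ?G 0\<bar> \<le> K / c"
    proof (rule abs_diff_le_of_exp_bound_left[OF c K])
      show "(?G has_real_derivative - g (u - s)) (at s)" for s
      proof -
        have "((\<lambda>s. u - s) has_real_derivative - 1) (at s)" by (auto intro!: derivative_eq_intros)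
        from DERIV_chain2[where f = F, OF F this] show ?thesis by simp
      qed
      show "\<bar>- g (u - s)\<bar> \<le> K * exp (- c * (u - t - s))" if "0 \<le> s" "s \<le> u - t" for s
        using g[of "u - s"] that by (simp add: algebra_simps)
    qed (use that in simp)
    then show ?thesis by simp
  qed
  then have "\<forall>\<^sub>F u in at_top. \<bar>F t - F u\<bar> \<le> K / c"
    by (intro eventually_mono[OF eventually_ge_at_top[of t]])
  moreover have "((\<lambda>u. \<bar>F t - F u\<bar>) \<longlongrightarrow> \<bar>F t - L\<bar>) at_top"
    by (intro tendsto_intros L)
  ultimately show ?thesis
    by (intro tendsto_upperbound) auto
qed

text \<open>The primitive is monotone and increases strictly to the right of t0, so its two limits
  differ.\<close>

lemma LBINT_pos:
  fixes w :: "real \<Rightarrow> real"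
  assumes w: "continuous_on UNIV w" "integrable lborel w" and nn: "\<And>t. 0 \<le> w t" and pos: "0 < w t0"
  shows "0 < (LBINT t. w t)"
proof -
  obtain A B where AB: "(primitive w \<longlongrightarrow> A) at_bot" "(primitive w \<longlongrightarrow> B) at_top"
    "(LBINT t. w t) = B - A"
    using integrable_primitive_limits[OF w] .
  note d = primitive_has_real_derivative[OF w(1)]
  have mono: "primitive w s \<le> primitive w t" if "s \<le> t" for s t
    using that nn d by (meson DERIV_nonneg_imp_nondecreasing)
  obtain h where "0 < h" and h: "\<And>x. 0 < x \<Longrightarrow> x < h \<Longrightarrow> primitive w t0 < primitive w (t0 + x)"
    using DERIV_pos_inc_right[OF d pos] by blast
  have "A \<le> primitive w t0"
    by (rule tendsto_upperbound[OF AB(1)])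
       (auto intro!: eventually_mono[OF eventually_le_at_bot[of t0]] mono)
  also have "\<dots> < primitive w (t0 + h / 2)" using h[of "h / 2"] \<open>0 < h\<close> by simp
  also have "\<dots> \<le> B"
    by (rule tendsto_lowerbound[OF AB(2)])
       (auto intro!: eventually_mono[OF eventually_ge_at_top[of "t0 + h / 2"]] mono)
  finally show ?thesis using AB(3) by simp
qed

lemma continuous_on_DERIV:
  fixes F :: "real \<Rightarrow> real"
  assumes "\<And>s. (F has_real_derivative g s) (at s)"
  shows "continuous_on S F"
  using assms by (meson DERIV_continuous_on has_field_derivative_at_within)

text \<open>The variational equation along the orbit, with a = f'(\<phi>) and v = \<phi>'. The lower
  bound of \<open>a\<close> for large \<bar>t\<bar> is the hyperbolicity of the two saddles; in
  between \<open>a\<close> may have any sign and v may have zeros.\<close>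

locale decaying_solution =
  fixes a v v' :: "real \<Rightarrow> real" and A \<kappa> T :: real
  assumes a_cont: "continuous_on UNIV a" and a_le: "\<And>t. \<bar>a t\<bar> \<le> A"
    and \<kappa>: "0 < \<kappa>" and a_ge: "\<And>t. T \<le> \<bar>t\<bar> \<Longrightarrow> \<kappa> \<le> a t"
    and v: "\<And>t. (v has_real_derivative v' t) (at t)"
    and v': "\<And>t. (v' has_real_derivative a t * v t) (at t)"
    and v_top: "(v \<longlongrightarrow> 0) at_top" and v_bot: "(v \<longlongrightarrow> 0) at_bot"
    and v'_top: "(v' \<longlongrightarrow> 0) at_top" and v'_bot: "(v' \<longlongrightarrow> 0) at_bot"
    and v_nontrivial: "\<exists>t. v t \<noteq> 0"
begin

text \<open>Time reversal preserves the whole setting, so that estimates have to be proved on the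
  right half-line only.\<close>

lemma mirror: "decaying_solution (\<lambda>t. a (- t)) (\<lambda>t. v (- t)) (\<lambda>t. - v' (- t)) A \<kappa> T"
proof
  show "continuous_on UNIV (\<lambda>t. a (- t))"
    by (auto intro!: continuous_intros continuous_on_compose2[OF a_cont])
  show "\<exists>t. v (- t) \<noteq> 0" using v_nontrivial by (metis minus_minus)
  show "((\<lambda>t. v (- t)) has_real_derivative - v' (- t)) (at t)" for t
    using v[of "- t"] by (simp add: DERIV_mirror)
  show "((\<lambda>t. - v' (- t)) has_real_derivative a (- t) * v (- t)) (at t)" for t
    using DERIV_minus[OF v'[of "- t", unfolded DERIV_mirror]] by simp
  show "((\<lambda>t. v (- t)) \<longlongrightarrow> 0) at_top"
    using v_bot by (simp add: at_bot_mirror filterlim_filtermap)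
  show "((\<lambda>t. v (- t)) \<longlongrightarrow> 0) at_bot"
    using v_top by (simp add: at_top_mirror filterlim_filtermap)
  have "((\<lambda>t. v' (- t)) \<longlongrightarrow> 0) at_top" "((\<lambda>t. v' (- t)) \<longlongrightarrow> 0) at_bot"
    using v'_bot by (simp add: at_bot_mirror filterlim_filtermap)
      (use v'_top in \<open>simp add: at_top_mirror filterlim_filtermap\<close>)
  then show "((\<lambda>t. - v' (- t)) \<longlongrightarrow> 0) at_top" "((\<lambda>t. - v' (- t)) \<longlongrightarrow> 0) at_bot"
    using tendsto_minus by fastforce+
qed (use a_le a_ge \<kappa> in auto)

definition R :: "real \<Rightarrow> real" where "R t = (v t)\<^sup>2 + (v' t)\<^sup>2"

lemma A_nonneg: "0 \<le> A" using a_le[of 0] by simp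

lemma R_deriv: "(R has_real_derivative 2 * (1 + a t) * (v t * v' t)) (at t)"
  unfolding R_def by (auto intro!: derivative_eq_intros v v' simp: algebra_simps)

lemma R_nonneg: "0 \<le> R t" by (simp add: R_def)

lemma R_deriv_le: "\<bar>2 * (1 + a t) * (v t * v' t)\<bar> \<le> (1 + A) * R t"
proof -
  have "2 * \<bar>v t * v' t\<bar> \<le> R t"
    using sum_squares_bound[of "\<bar>v t\<bar>" "\<bar>v' t\<bar>"] by (simp add: R_def abs_mult)
  moreover have "\<bar>1 + a t\<bar> \<le> 1 + A" using a_le[of t] by linarith
  ultimately have "\<bar>1 + a t\<bar> * (2 * \<bar>v t * v' t\<bar>) \<le> (1 + A) * R t"
    using A_nonneg by (intro mult_mono) auto
  moreover have "\<bar>2 * (1 + a t) * (v t * v' t)\<bar> = \<bar>1 + a t\<bar> * (2 * \<bar>v t * v' t\<bar>)"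
    by (simp only: abs_mult abs_numeral mult.assoc mult.left_commute)
  ultimately show ?thesis by simp
qed

lemma R_growth: "t \<le> s \<Longrightarrow> R s \<le> R t * exp ((1 + A) * (s - t))"
proof -
  assume "t \<le> s"
  have "R s \<le> R t * exp (- (- (1 + A)) * (s - t))"
  proof (rule decay_of_derivative_le[OF R_deriv])
    show "2 * (1 + a x) * (v x * v' x) \<le> - (- (1 + A)) * R x" for x
      using R_deriv_le[of x] by linarith
  qed (use \<open>t \<le> s\<close> in auto)
  then show ?thesis by (simp only: minus_minus)
qed

text \<open>By the growth bound in both time directions, a zero of \<open>R\<close> would make (v,
  v') vanish identically.\<close>

lemma R_pos: "0 < R t"
proof (rule ccontr)
  assume "\<not> 0 < R t"
  then have R0: "R t = 0" using R_nonneg[of t] by simp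
  have fwd: "R s = 0" if "t \<le> s" for s
    using R_growth[OF that] R_nonneg[of s] R0 by simp
  interpret m: decaying_solution "\<lambda>t. a (- t)" "\<lambda>t. v (- t)" "\<lambda>t. - v' (- t)" A \<kappa> T
    by (rule mirror)
  have mR: "m.R s = R (- s)" for s by (simp add: m.R_def R_def)
  have bwd: "R s = 0" if "s \<le> t" for s
    using m.R_growth[of "- t" "- s"] that R_nonneg[of s] R0 by (simp add: mR)
  obtain s where "v s \<noteq> 0" using v_nontrivial by blast
  then have "R s \<noteq> 0" by (simp add: R_def sum_power2_eq_zero_iff)
  then show False using fwd bwd by (meson linear)
qed

text \<open>The decay is relative to \<open>R t\<close> for every starting time t, which is what the
  estimates of a kernel with one decaying and one growing factor need. On the tail the square of v
  decays by convexity and dominates the square of v'; on the compact initial piece the growth bound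
  costs only a constant.\<close>

lemma R_decay_right:
  obtains C c where "1 \<le> C" "0 < c" "\<And>t s. 0 \<le> t \<Longrightarrow> t \<le> s \<Longrightarrow> R s \<le> C * R t * exp (- c * (s - t))"
proof -
  have "\<forall>\<^sub>F t in at_top. \<bar>v t\<bar> < 1"
    using tendstoD[OF v_top, of 1] by simp
  then obtain T1 where T1: "\<And>t. T1 \<le> t \<Longrightarrow> \<bar>v t\<bar> < 1"
    by (auto simp: eventually_at_top_linorder)
  define T2 where "T2 = max T1 (max T 0)"
  have T2: "T1 \<le> T2" "T \<le> T2" "0 \<le> T2" by (auto simp: T2_def)
  \<comment> \<open>For t beyond \<open>T2\<close> the second derivative of the square of v is at
    least \<open>2 * \<kappa>\<close> times this square.\<close>
  define k where "k = sqrt (2 * \<kappa>)"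
  have k: "0 < k" "k\<^sup>2 = 2 * \<kappa>" using \<kappa> by (auto simp: k_def)
  have vv': "2 * (v t * v' t) \<le> - k * (v t)\<^sup>2" if t: "T2 \<le> t" for t
  proof -
    have "2 * v t * v' t \<le> - k * (v t)\<^sup>2"
    proof (rule bounded_above_imp_decay[OF k(1), where T = T2 and N = "\<lambda>t. (v t)\<^sup>2"
          and N' = "\<lambda>t. 2 * v t * v' t" and N'' = "\<lambda>t. 2 * (v' t)\<^sup>2 + 2 * a t * (v t)\<^sup>2"])
      show "((\<lambda>t. (v t)\<^sup>2) has_real_derivative 2 * v s * v' s) (at s)" for s
        by (auto intro!: derivative_eq_intros v)
      show "((\<lambda>t. 2 * v t * v' t) has_real_derivative 2 * (v' s)\<^sup>2 + 2 * a s * (v s)\<^sup>2) (at s)" for s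
        by (auto intro!: derivative_eq_intros v v' simp: power2_eq_square)
      show "k\<^sup>2 * (v s)\<^sup>2 \<le> 2 * (v' s)\<^sup>2 + 2 * a s * (v s)\<^sup>2" if "T2 \<le> s" for s
      proof -
        have "\<kappa> \<le> a s" using that T2 by (intro a_ge) auto
        then have "\<kappa> * (v s)\<^sup>2 \<le> a s * (v s)\<^sup>2" by (intro mult_right_mono) auto
        moreover have "0 \<le> (v' s)\<^sup>2" by simp
        ultimately show ?thesis unfolding k(2) by linarith
      qed
      show "(v s)\<^sup>2 \<le> 1" if "T2 \<le> s" for s
        using T1[of s] that T2 by (simp add: abs_square_le_1 less_imp_le)
    qed (rule t)
    then show ?thesis by simp
  qed
  \<comment> \<open>The difference \<open>?G\<close> has the derivative 2 (a - A) v v', a product of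
    two nonpositive factors up to the constant, so it increases; since it tends to 0, it is
    nonpositive.\<close>
  have v'v: "(v' t)\<^sup>2 \<le> A * (v t)\<^sup>2" if t: "T2 \<le> t" for t
  proof -
    let ?G = "\<lambda>t. (v' t)\<^sup>2 - A * (v t)\<^sup>2"
    have "?G t \<le> ?G s" if "t \<le> s" for s
    proof (rule DERIV_nonneg_imp_nondecreasing[OF that])
      fix x assume "t \<le> x"
      then have x: "T2 \<le> x" using t by simp
      have "(?G has_real_derivative (a x - A) * (2 * (v x * v' x))) (at x)"
        by (rule derivative_eq_intros v v' refl)+ (simp add: algebra_simps)
      moreover have "2 * (v x * v' x) \<le> 0"
      proof -
        have "0 \<le> k * (v x)\<^sup>2" using k(1) by simp
        then show ?thesis using vv'[OF x] by linarith
      qed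
      then have "0 \<le> (a x - A) * (2 * (v x * v' x))"
        using a_le[of x] by (intro mult_nonpos_nonpos) auto
      ultimately show "\<exists>y. (?G has_real_derivative y) (at x) \<and> 0 \<le> y" by blast
    qed
    moreover have "(?G \<longlongrightarrow> 0\<^sup>2 - A * 0\<^sup>2) at_top"
      by (intro tendsto_intros v_top v'_top)
    ultimately have "?G t \<le> 0\<^sup>2 - A * 0\<^sup>2"
      by (intro tendsto_lowerbound[where F = at_top]) (auto intro!: eventually_mono[OF eventually_ge_at_top[of t]])
    then show ?thesis by simp
  qed
  \<comment> \<open>On the tail R is at most 1 + A times the square of v, so the rate k for this
    square is the rate c for R.\<close>
  define c where "c = k / (1 + A)"
  have c: "0 < c" using k A_nonneg by (simp add: c_def)
  have tail: "R s \<le> R t * exp (- c * (s - t))" if "T2 \<le> t" "t \<le> s" for t s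
  proof (rule decay_of_derivative_le[OF R_deriv _ that])
    fix x assume x: "T2 \<le> x"
    have "R x \<le> (1 + A) * (v x)\<^sup>2" using v'v[OF x] by (simp add: R_def algebra_simps)
    then have "c * R x \<le> c * ((1 + A) * (v x)\<^sup>2)" using c by (intro mult_left_mono) auto
    also have "\<dots> = k * (v x)\<^sup>2" using A_nonneg by (simp add: c_def)
    finally have 1: "c * R x \<le> k * (v x)\<^sup>2" .
    have "0 \<le> k * (v x)\<^sup>2" using k(1) by simp
    then have "2 * (v x * v' x) \<le> 0" using vv'[OF x] by linarith
    moreover have "0 \<le> a x" using a_ge[of x] x T2 \<kappa> by simp
    ultimately have "a x * (2 * (v x * v' x)) \<le> 0" by (intro mult_nonneg_nonpos[of "a x"])
    then have "2 * (1 + a x) * (v x * v' x) \<le> 2 * (v x * v' x)" by (simp add: algebra_simps)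
    then show "2 * (1 + a x) * (v x * v' x) \<le> - c * R x" using vv'[OF x] 1 by linarith
  qed
  \<comment> \<open>Growth at rate 1 + A over a time of at most \<open>T2\<close>, together with the
    decay factor that is claimed although nothing decays there.\<close>
  define C where "C = exp ((1 + A + c) * T2)"
  have C: "1 \<le> C" using A_nonneg c T2 by (simp add: C_def)
  have head: "R s \<le> C * R t * exp (- c * (s - t))" if "0 \<le> t" "t \<le> s" "s \<le> T2" for t s
  proof -
    have "R s \<le> R t * exp ((1 + A) * (s - t))" using that by (intro R_growth) auto
    also have "\<dots> = R t * exp ((1 + A + c) * (s - t)) * exp (- c * (s - t))"
      by (simp add: mult.assoc exp_add[symmetric] algebra_simps)
    also have "\<dots> \<le> R t * C * exp (- c * (s - t))"
      unfolding C_def using that A_nonneg c R_nonneg[of t]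
      by (intro mult_right_mono mult_left_mono) auto
    finally show ?thesis by (simp add: mult.commute)
  qed
  have "R s \<le> C * R t * exp (- c * (s - t))" if ts: "0 \<le> t" "t \<le> s" for t s
  proof -
    consider "s \<le> T2" | "T2 \<le> t" | "t \<le> T2" "T2 \<le> s" by linarith
    then show ?thesis
    proof cases
      case 1 then show ?thesis using head ts by simp
    next
      case 2
      have "1 * (R t * exp (- c * (s - t))) \<le> C * (R t * exp (- c * (s - t)))"
        using C R_nonneg[of t] by (intro mult_right_mono) auto
      then show ?thesis using tail[OF 2 ts(2)] by (simp add: mult.assoc)
    next
      case 3
      have "R s \<le> R T2 * exp (- c * (s - T2))" using tail 3 by simp
      also have "\<dots> \<le> C * R t * exp (- c * (T2 - t)) * exp (- c * (s - T2))"
        using head[OF ts(1) 3(1)] by (intro mult_right_mono) auto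
      also have "\<dots> = C * R t * exp (- c * (s - t))"
        by (simp add: mult.assoc exp_add[symmetric] algebra_simps)
      finally show ?thesis .
    qed
  qed
  then show ?thesis using that C c by blast
qed

definition \<rho> :: "real \<Rightarrow> real" where "\<rho> t = sqrt (R t)"

lemma \<rho>_pos: "0 < \<rho> t" using R_pos by (simp add: \<rho>_def)

lemma \<rho>_sq: "(\<rho> t)\<^sup>2 = R t" using R_nonneg by (simp add: \<rho>_def)

lemma v_le: "\<bar>v t\<bar> \<le> \<rho> t" and v'_le: "\<bar>v' t\<bar> \<le> \<rho> t"
  unfolding \<rho>_def R_def by (simp_all add: real_le_rsqrt)

lemma \<rho>_decay:
  obtains C c where "1 \<le> C" "0 < c"
    "\<And>t s. 0 \<le> t \<Longrightarrow> t \<le> s \<Longrightarrow> \<rho> s \<le> C * \<rho> t * exp (- c * (s - t))"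
    "\<And>t s. s \<le> t \<Longrightarrow> t \<le> 0 \<Longrightarrow> \<rho> s \<le> C * \<rho> t * exp (- c * (t - s))"
proof -
  interpret m: decaying_solution "\<lambda>t. a (- t)" "\<lambda>t. v (- t)" "\<lambda>t. - v' (- t)" A \<kappa> T
    by (rule mirror)
  have mR: "m.R s = R (- s)" for s by (simp add: m.R_def R_def)
  obtain C1 c1 where 1: "1 \<le> C1" "0 < c1"
    "\<And>t s. 0 \<le> t \<Longrightarrow> t \<le> s \<Longrightarrow> R s \<le> C1 * R t * exp (- c1 * (s - t))"
    using R_decay_right by blast
  obtain C2 c2 where 2: "1 \<le> C2" "0 < c2"
    "\<And>t s. 0 \<le> t \<Longrightarrow> t \<le> s \<Longrightarrow> m.R s \<le> C2 * m.R t * exp (- c2 * (s - t))"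
    using m.R_decay_right by blast
  \<comment> \<open>Taking square roots halves the rate; the constant can be kept, as C \<ge> 1
    exceeds its root.\<close>
  define C c where "C = max C1 C2" and "c = min c1 c2 / 2"
  have Cc: "1 \<le> C" "0 < c" "C1 \<le> C" "C2 \<le> C" "2 * c \<le> c1" "2 * c \<le> c2"
    using 1 2 by (auto simp: C_def c_def)
  have *: "\<rho> s \<le> C * \<rho> t * exp (- c * u)"
    if "R s \<le> C' * R t * exp (- c' * u)" "C' \<le> C" "2 * c \<le> c'" "0 \<le> u" "1 \<le> C'" for s t u C' c'
  proof (rule power2_le_imp_le)
    have "R s \<le> C' * R t * exp (- c' * u)" by fact
    also have "\<dots> \<le> C * R t * exp (- (2 * c) * u)"
      using that R_nonneg[of t] Cc by (intro mult_mono) (auto intro: mult_right_mono)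
    also have "\<dots> \<le> (C * C) * R t * exp (- (2 * c) * u)"
      using Cc R_nonneg[of t] by (intro mult_right_mono) auto
    also have "\<dots> = (C * \<rho> t * exp (- c * u))\<^sup>2"
      by (simp add: power_mult_distrib \<rho>_sq power2_eq_square[of C] exp_double[symmetric] algebra_simps)
    finally show "(\<rho> s)\<^sup>2 \<le> (C * \<rho> t * exp (- c * u))\<^sup>2" by (simp add: \<rho>_sq)
    show "0 \<le> C * \<rho> t * exp (- c * u)" using Cc \<rho>_pos[of t] by simp
  qed
  show ?thesis
  proof (rule that[OF Cc(1,2)])
    show "\<rho> s \<le> C * \<rho> t * exp (- c * (s - t))" if "0 \<le> t" "t \<le> s" for t s
      using *[OF 1(3)[OF that]] Cc 1 that by simp
    show "\<rho> s \<le> C * \<rho> t * exp (- c * (t - s))" if "s \<le> t" "t \<le> 0" for t s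
      using 2(3)[of "- t" "- s"] that Cc 2 by (intro *[of _ C2 _ c2]) (auto simp: mR)
  qed
qed

lemma v_exp_decay:
  obtains C c where "0 < C" "0 < c" "\<And>t. \<bar>v t\<bar> \<le> C * exp (- c * \<bar>t\<bar>)" "\<And>t. \<bar>v' t\<bar> \<le> C * exp (- c * \<bar>t\<bar>)"
proof -
  obtain C c where C: "1 \<le> C" "0 < c"
    "\<And>t s. 0 \<le> t \<Longrightarrow> t \<le> s \<Longrightarrow> \<rho> s \<le> C * \<rho> t * exp (- c * (s - t))"
    "\<And>t s. s \<le> t \<Longrightarrow> t \<le> 0 \<Longrightarrow> \<rho> s \<le> C * \<rho> t * exp (- c * (t - s))"
    by (rule \<rho>_decay) blast
  have "\<rho> t \<le> C * \<rho> 0 * exp (- c * \<bar>t\<bar>)" for t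
    using C(3)[of 0 t] C(4)[of t 0] by (cases "0 \<le> t") auto
  then show ?thesis
    using C \<rho>_pos[of 0] by (intro that[of "C * \<rho> 0" c] order_trans[OF v_le] order_trans[OF v'_le]) auto
qed

lemma v_cont: "continuous_on S v" and v'_cont: "continuous_on S v'"
  by (rule continuous_on_DERIV[OF v]) (rule continuous_on_DERIV[OF v'])

lemma integrable_v_mult:
  assumes r: "continuous_on UNIV r" "\<And>t. \<bar>r t\<bar> \<le> M"
  shows "integrable lborel (\<lambda>t. v t * r t)"
proof -
  obtain C c where C: "0 < C" "0 < c" "\<And>t. \<bar>v t\<bar> \<le> C * exp (- c * \<bar>t\<bar>)"
    using v_exp_decay by metis
  show ?thesis
  proof (rule integrable_exp_decay[OF _ C(2)])
    show "continuous_on UNIV (\<lambda>t. v t * r t)" by (intro continuous_intros v_cont r)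
    fix t
    have "\<bar>v t\<bar> * \<bar>r t\<bar> \<le> C * exp (- c * \<bar>t\<bar>) * M"
      using C(1) by (intro mult_mono C r) auto
    then show "\<bar>v t * r t\<bar> \<le> C * M * exp (- c * \<bar>t\<bar>)" by (simp add: abs_mult algebra_simps)
  qed
qed

lemma v_bounded: obtains B where "0 < B" "\<And>t. \<bar>v t\<bar> \<le> B" "\<And>t. \<bar>v' t\<bar> \<le> B"
proof -
  obtain C c where C: "0 < C" "0 < c" "\<And>t. \<bar>v t\<bar> \<le> C * exp (- c * \<bar>t\<bar>)" "\<And>t. \<bar>v' t\<bar> \<le> C * exp (- c * \<bar>t\<bar>)"
    using v_exp_decay by metis
  have "C * exp (- c * \<bar>t\<bar>) \<le> C" for t using C by (simp add: mult_le_cancel_left1)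
  then show ?thesis using that[OF C(1)] C by (meson order_trans)
qed

lemma integrable_v: "integrable lborel v"
  using integrable_v_mult[of "\<lambda>_. 1" 1] by simp

lemma integrable_v_sq: "integrable lborel (\<lambda>t. v t * v t)"
proof -
  obtain B where "\<And>t. \<bar>v t\<bar> \<le> B" using v_bounded by metis
  then show ?thesis by (intro integrable_v_mult v_cont)
qed

lemma abs_LBINT_v_mult_le:
  assumes r: "continuous_on UNIV r" "\<And>t. \<bar>r t\<bar> \<le> M"
  shows "\<bar>LBINT t. v t * r t\<bar> \<le> (LBINT t. \<bar>v t\<bar>) * M"
proof -
  have "norm (LBINT t. v t * r t) \<le> (LBINT t. norm (v t * r t))"
    by (rule integral_norm_bound)
  also have "\<dots> \<le> (LBINT t. \<bar>v t\<bar> * M)"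
    using integrable_abs[OF integrable_v_mult[OF assms]] integrable_v r
    by (intro integral_mono) (auto simp: abs_mult intro: mult_left_mono)
  also have "\<dots> = (LBINT t. \<bar>v t\<bar>) * M" by simp
  finally show ?thesis by simp
qed

lemma v_sq_pos: "0 < (LBINT t. v t * v t)"
proof -
  obtain t0 where "v t0 \<noteq> 0" using v_nontrivial by blast
  then show ?thesis
    by (intro LBINT_pos[where ?t0.0 = t0] integrable_v_sq continuous_intros v_cont)
       (auto simp: zero_less_mult_iff linorder_neq_iff)
qed

text \<open>The Wronskian of v and y has the derivative \<open>v * r\<close> and vanishes at both
  ends, because v and v' decay while y and y' are bounded.\<close>

lemma solvability:
  assumes y: "\<And>t. (y has_real_derivative y' t) (at t)"
    and y': "\<And>t. (y' has_real_derivative a t * y t + r t) (at t)"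
    and r: "continuous_on UNIV r" "\<And>t. \<bar>r t\<bar> \<le> M"
    and bd: "\<And>t. \<bar>y t\<bar> \<le> B" "\<And>t. \<bar>y' t\<bar> \<le> B"
  shows "(LBINT t. v t * r t) = 0"
proof -
  let ?F = "\<lambda>t. v t * y' t - v' t * y t"
  have tend: "(?F \<longlongrightarrow> 0) F" if "(v \<longlongrightarrow> 0) F" "(v' \<longlongrightarrow> 0) F" for F
  proof -
    have b: "Bfun y F" "Bfun y' F"
      using bd by (auto intro!: BfunI eventuallyI)
    have "((\<lambda>t. v t * y' t) \<longlongrightarrow> 0) F" "((\<lambda>t. v' t * y t) \<longlongrightarrow> 0) F"
      using that b by (auto simp: tendsto_Zfun_iff intro!: bounded_bilinear.Zfun_prod_Bfun[OF bounded_bilinear_mult])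
    then show ?thesis using tendsto_diff by fastforce
  qed
  have "(LBINT t. v t * r t) = 0 - 0"
  proof (rule LBINT_eq_diff_limits)
    show "continuous_on UNIV (\<lambda>t. v t * r t)" by (intro continuous_intros v_cont r)
    show "integrable lborel (\<lambda>t. v t * r t)" by (rule integrable_v_mult[OF r])
    show "(?F has_real_derivative v t * r t) (at t)" for t
      by (auto intro!: derivative_eq_intros v v' y y' simp: algebra_simps)
    show "(?F \<longlongrightarrow> 0) at_bot" by (rule tend[OF v_bot v'_bot])
    show "(?F \<longlongrightarrow> 0) at_top" by (rule tend[OF v_top v'_top])
  qed
  then show ?thesis by simp
qed

text \<open>The Wronskian of v and y is constant and tends to 0, so (y, y') is a multiple of (v, v')
  at every time. The multiple is constant, and orthogonality makes it 0.\<close>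

lemma uniqueness:
  assumes y: "\<And>t. (y has_real_derivative y' t) (at t)"
    and y': "\<And>t. (y' has_real_derivative a t * y t) (at t)"
    and bd: "\<And>t. \<bar>y t\<bar> \<le> B" "\<And>t. \<bar>y' t\<bar> \<le> B"
    and orth: "(LBINT t. v t * y t) = 0"
  shows "y t = 0"
proof -
  let ?F = "\<lambda>t. v t * y' t - v' t * y t"
  have "(?F \<longlongrightarrow> 0) at_top"
  proof -
    have b: "Bfun y at_top" "Bfun y' at_top"
      using bd by (auto intro!: BfunI eventuallyI)
    have "((\<lambda>t. v t * y' t) \<longlongrightarrow> 0) at_top" "((\<lambda>t. v' t * y t) \<longlongrightarrow> 0) at_top"
      using v_top v'_top b by (auto simp: tendsto_Zfun_iff intro!: bounded_bilinear.Zfun_prod_Bfun[OF bounded_bilinear_mult])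
    then show ?thesis using tendsto_diff by fastforce
  qed
  moreover have "(?F has_real_derivative 0) (at t)" for t
    by (auto intro!: derivative_eq_intros v v' y y' simp: algebra_simps)
  then have "?F t = ?F 0" for t by (intro DERIV_isconst_all) auto
  then have "?F = (\<lambda>t. ?F 0)" by (rule ext)
  ultimately have "((\<lambda>t. ?F 0) \<longlongrightarrow> 0) (at_top :: real filter)" by simp
  then have "?F 0 = 0" by (simp add: tendsto_const_iff)
  then have W: "v t * y' t = v' t * y t" for t
    using \<open>?F = (\<lambda>t. ?F 0)\<close> by (metis eq_iff_diff_eq_0)
  \<comment> \<open>The coefficient of the projection of (y, y') on (v, v'). Unlike the quotient y /
    v it is defined at the zeros of v.\<close>
  define c where "c t = (y t * v t + y' t * v' t) / R t" for t
  have R0: "R t \<noteq> 0" for t using R_pos[of t] by simp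
  have yc: "y t = c t * v t" and yc': "y' t = c t * v' t" for t
  proof -
    have "c t * v t * R t = (y t * v t + y' t * v' t) * v t" using R0[of t] by (simp add: c_def)
    also have "\<dots> = y t * R t" using W[of t] by (simp add: R_def power2_eq_square algebra_simps)
    finally show "y t = c t * v t" using R0[of t] by simp
    have "c t * v' t * R t = (y t * v t + y' t * v' t) * v' t" using R0[of t] by (simp add: c_def)
    also have "\<dots> = y' t * R t" using W[of t] by (simp add: R_def power2_eq_square algebra_simps)
    finally show "y' t = c t * v' t" using R0[of t] by simp
  qed
  have "(c has_real_derivative 0) (at t)" for t
  proof -
    have "(c has_real_derivative ((y' t * v t + y t * v' t + a t * y t * v' t + y' t * (a t * v t)) * R t
        - (y t * v t + y' t * v' t) * (2 * (1 + a t) * (v t * v' t))) / (R t * R t)) (at t)"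
      unfolding c_def by (auto intro!: derivative_eq_intros v v' y y' R_deriv R0 simp: algebra_simps)
    moreover have "(y t * v t + y' t * v' t) = c t * R t" by (simp add: yc[of t] yc'[of t] R_def power2_eq_square algebra_simps)
    moreover have "y' t * v t + y t * v' t + a t * y t * v' t + y' t * (a t * v t) = c t * (2 * (1 + a t) * (v t * v' t))"
      by (subst yc[of t], subst yc[of t], subst yc'[of t], subst yc'[of t]) (simp add: algebra_simps)
    ultimately show ?thesis by (simp add: mult.commute)
  qed
  then have "c t = c 0" for t by (intro DERIV_isconst_all) auto
  then have "y = (\<lambda>t. c 0 * v t)" using yc by fastforce
  then have "c 0 * (LBINT t. v t * v t) = 0" using orth by (simp add: algebra_simps)
  then have "c 0 = 0" using v_sq_pos by simp
  then show ?thesis using \<open>y = (\<lambda>t. c 0 * v t)\<close> by simp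
qed

end

lemma abs_diff_le_of_exp_bound_to_0:
  fixes F g :: "real \<Rightarrow> real"
  assumes c: "0 < c" and K: "0 \<le> K" and F: "\<And>s. (F has_real_derivative g s) (at s)"
    and right: "\<And>s. 0 \<le> s \<Longrightarrow> s \<le> t \<Longrightarrow> \<bar>g s\<bar> \<le> K * exp (- c * (t - s))"
    and left: "\<And>s. t \<le> s \<Longrightarrow> s \<le> 0 \<Longrightarrow> \<bar>g s\<bar> \<le> K * exp (- c * (s - t))"
  shows "\<bar>F t - F 0\<bar> \<le> K / c"
proof (cases "0 \<le> t")
  case True
  then show ?thesis using abs_diff_le_of_exp_bound_left[OF c K True F right] by simp
next
  case False
  have "\<bar>(\<lambda>s. F (- s)) (- t) - (\<lambda>s. F (- s)) 0\<bar> \<le> K / c"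
  proof (rule abs_diff_le_of_exp_bound_left[OF c K])
    show "((\<lambda>s. F (- s)) has_real_derivative - g (- s)) (at s)" for s
      using F[of "- s"] by (simp add: DERIV_mirror)
    show "\<bar>- g (- s)\<bar> \<le> K * exp (- c * (- t - s))" if "0 \<le> s" "s \<le> - t" for s
      using left[of "- s"] that by (simp add: algebra_simps)
  qed (use False in simp)
  then show ?thesis by simp
qed

section \<open>Variation of constants for the linearized equation\<close>

context decaying_solution
begin

text \<open>The second solution of \<open>y'' = a y\<close> with Wronskian \<open>1\<close>, in the form
  \<open>(v\<^sub>2, v\<^sub>2') = q (v, v') + (- v', v) / R\<close> of Rofe-Beketov, which is not affected by zeros
  of \<open>v\<close>.\<close>

definition q' :: "real \<Rightarrow> real" where "q' t = (1 + a t) * ((v t)\<^sup>2 - (v' t)\<^sup>2) / (R t)\<^sup>2"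
definition q :: "real \<Rightarrow> real" where "q = primitive q'"
definition v2 :: "real \<Rightarrow> real" where "v2 t = q t * v t - v' t / R t"
definition v2' :: "real \<Rightarrow> real" where "v2' t = q t * v' t + v t / R t"

lemma R_cont: "continuous_on S R"
  by (rule continuous_on_DERIV[OF R_deriv])

lemma R_neq_0: "R t \<noteq> 0"
  using R_pos[of t] by simp

lemma q_deriv: "(q has_real_derivative q' t) (at t)"
  unfolding q_def q'_def
  by (intro primitive_has_real_derivative continuous_intros a_cont v_cont v'_cont R_cont)
     (simp add: R_neq_0)

lemma v2_deriv: "(v2 has_real_derivative v2' t) (at t)"
proof -
  have "(v2 has_real_derivative q' t * v t + v' t * q t -
      (a t * v t * R t - v' t * (2 * (1 + a t) * (v t * v' t))) / (R t * R t)) (at t)"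
    unfolding v2_def
    by (rule derivative_eq_intros q_deriv v v' R_deriv R_neq_0 refl)+
  moreover have "q' t * v t - (a t * v t * R t - v' t * (2 * (1 + a t) * (v t * v' t))) / (R t * R t)
      = v t / R t"
  proof -
    have "(1 + a t) * ((v t)\<^sup>2 - (v' t)\<^sup>2) * v t - (a t * v t * R t - v' t * (2 * (1 + a t) * (v t * v' t)))
       = v t * R t"
      by (simp add: R_def power2_eq_square algebra_simps)
    then have "((1 + a t) * ((v t)\<^sup>2 - (v' t)\<^sup>2) * v t - (a t * v t * R t - v' t * (2 * (1 + a t) * (v t * v' t))))
        / (R t * R t) = v t / R t"
      using R_neq_0[of t] by simp
    then show ?thesis by (simp only: q'_def diff_divide_distrib power2_eq_square[of "R t"] times_divide_eq_left)
  qed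
  ultimately show ?thesis by (simp add: v2'_def algebra_simps)
qed

lemma v2'_deriv: "(v2' has_real_derivative a t * v2 t) (at t)"
proof -
  have "(v2' has_real_derivative q' t * v' t + a t * v t * q t +
      (v' t * R t - v t * (2 * (1 + a t) * (v t * v' t))) / (R t * R t)) (at t)"
    unfolding v2'_def
    by (rule derivative_eq_intros q_deriv v v' R_deriv R_neq_0 refl)+
  moreover have "q' t * v' t + (v' t * R t - v t * (2 * (1 + a t) * (v t * v' t))) / (R t * R t)
      = - (a t * v' t / R t)"
  proof -
    have "(1 + a t) * ((v t)\<^sup>2 - (v' t)\<^sup>2) * v' t + (v' t * R t - v t * (2 * (1 + a t) * (v t * v' t)))
       = - (a t * v' t * R t)"
      by (simp add: R_def power2_eq_square algebra_simps)
    then have "((1 + a t) * ((v t)\<^sup>2 - (v' t)\<^sup>2) * v' t + (v' t * R t - v t * (2 * (1 + a t) * (v t * v' t))))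
        / (R t * R t) = - (a t * v' t / R t)"
      using R_neq_0[of t] by simp
    then show ?thesis by (simp only: q'_def add_divide_distrib power2_eq_square[of "R t"] times_divide_eq_left)
  qed
  ultimately have "(v2' has_real_derivative a t * v t * q t - a t * v' t / R t) (at t)"
    by (elim DERIV_cong) linarith
  then show ?thesis by (simp add: v2_def algebra_simps)
qed

lemma wronskian: "v t * v2' t - v' t * v2 t = 1"
proof -
  have aux: "x * (z * x' + x / w) - x' * (z * x - x' / w) = (x\<^sup>2 + x'\<^sup>2) / w" for x x' z w :: real
    by (simp add: add_divide_distrib power2_eq_square algebra_simps)
  then have "v t * v2' t - v' t * v2 t = R t / R t" 
    using aux[of "v t" "q t" "v' t" "R t"] by (simp only: v2_def v2'_def R_def[symmetric])
  then show ?thesis using R_neq_0[of t] by simp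
qed

lemma q'_le: "\<bar>q' t\<bar> \<le> (1 + A) / R t"
proof -
  have "\<bar>1 + a t\<bar> \<le> 1 + A" using a_le[of t] by linarith
  moreover have "\<bar>(v t)\<^sup>2 - (v' t)\<^sup>2\<bar> \<le> R t" by (simp add: R_def abs_le_iff)
  ultimately have "\<bar>1 + a t\<bar> * \<bar>(v t)\<^sup>2 - (v' t)\<^sup>2\<bar> \<le> (1 + A) * R t"
    using A_nonneg by (intro mult_mono) auto
  then have "\<bar>q' t\<bar> \<le> (1 + A) * R t / (R t)\<^sup>2"
    by (simp add: q'_def abs_mult divide_right_mono)
  also have "\<dots> = (1 + A) / R t" using R_neq_0[of t] by (simp add: power2_eq_square)
  finally show ?thesis .
qed

text \<open>Since 1 / R grows exponentially away from 0, the integral \<open>q\<close> of a function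
  of this size is comparable with its last value 1 / R. Then \<open>q * v\<close> and
  \<open>v' / R\<close> are both of the order 1 / \<rho>.\<close>

lemma v2_le:
  obtains C where "0 < C" "\<And>t. \<bar>v2 t\<bar> \<le> C / \<rho> t" "\<And>t. \<bar>v2' t\<bar> \<le> C / \<rho> t"
proof -
  obtain C c where C: "1 \<le> C" "0 < c"
    "\<And>t s. 0 \<le> t \<Longrightarrow> t \<le> s \<Longrightarrow> \<rho> s \<le> C * \<rho> t * exp (- c * (s - t))"
    "\<And>t s. s \<le> t \<Longrightarrow> t \<le> 0 \<Longrightarrow> \<rho> s \<le> C * \<rho> t * exp (- c * (t - s))"
    by (rule \<rho>_decay) blast
  define K where "K = (1 + A) * C\<^sup>2"
  have K: "0 \<le> K" using A_nonneg by (simp add: K_def)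
  \<comment> \<open>The decay of \<rho> from s to t, read backwards: 1 / R at s is exponentially
    small compared with 1 / R at t.\<close>
  have inv: "\<bar>q' s\<bar> \<le> K / R t * exp (- (2 * c) * u)" if "\<rho> t \<le> C * \<rho> s * exp (- c * u)" for s t u
  proof -
    have "(\<rho> t)\<^sup>2 \<le> (C * \<rho> s * exp (- c * u))\<^sup>2"
      using that \<rho>_pos[of t] by (intro power_mono) auto
    also have "\<dots> = C\<^sup>2 * R s * exp (- (2 * c) * u)"
      by (simp add: power_mult_distrib \<rho>_sq exp_double[symmetric] algebra_simps)
    finally have "R t \<le> C\<^sup>2 * R s * exp (- (2 * c) * u)" by (simp add: \<rho>_sq)
    then have "1 / R s \<le> C\<^sup>2 / R t * exp (- (2 * c) * u)"
      using R_pos[of s] R_pos[of t] by (simp add: field_simps)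
    then have "(1 + A) * (1 / R s) \<le> (1 + A) * (C\<^sup>2 / R t * exp (- (2 * c) * u))"
      using A_nonneg by (intro mult_left_mono) auto
    then show ?thesis using q'_le[of s] by (simp add: K_def)
  qed
  have q: "\<bar>q t\<bar> \<le> K / (2 * c) / R t" for t
  proof -
    have "\<bar>q t - q 0\<bar> \<le> K / R t / (2 * c)"
    proof (rule abs_diff_le_of_exp_bound_to_0[OF _ _ q_deriv])
      show "\<bar>q' s\<bar> \<le> K / R t * exp (- (2 * c) * (t - s))" if "0 \<le> s" "s \<le> t" for s
        by (rule inv[OF C(3)[OF that]])
      show "\<bar>q' s\<bar> \<le> K / R t * exp (- (2 * c) * (s - t))" if "t \<le> s" "s \<le> 0" for s
        by (rule inv[OF C(4)[OF that]])
    qed (use C K R_pos[of t] in auto)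
    then show ?thesis by (simp add: q_def mult.commute)
  qed
  define D where "D = K / (2 * c) + 1"
  have D: "0 < D" using K C by (simp add: D_def add_nonneg_pos)
  have *: "\<bar>q t\<bar> * \<rho> t + \<rho> t / R t \<le> D / \<rho> t" for t
  proof -
    have "\<bar>q t\<bar> * \<rho> t \<le> K / (2 * c) / R t * \<rho> t" using q \<rho>_pos[of t] by (intro mult_right_mono) auto
    also have "\<dots> = K / (2 * c) / \<rho> t" using \<rho>_pos[of t] by (simp add: \<rho>_sq[symmetric] power2_eq_square)
    finally have "\<bar>q t\<bar> * \<rho> t \<le> K / (2 * c) / \<rho> t" .
    moreover have "\<rho> t / R t = 1 / \<rho> t" using \<rho>_pos[of t] by (simp add: \<rho>_sq[symmetric] power2_eq_square)
    ultimately show ?thesis by (simp add: D_def add_divide_distrib)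
  qed
  have "\<bar>v2 t\<bar> \<le> D / \<rho> t" "\<bar>v2' t\<bar> \<le> D / \<rho> t" for t
  proof -
    have 1: "\<bar>q t * v t\<bar> \<le> \<bar>q t\<bar> * \<rho> t" "\<bar>q t * v' t\<bar> \<le> \<bar>q t\<bar> * \<rho> t"
      using v_le[of t] v'_le[of t] by (auto simp: abs_mult intro: mult_left_mono)
    have 2: "\<bar>v t / R t\<bar> \<le> \<rho> t / R t" "\<bar>v' t / R t\<bar> \<le> \<rho> t / R t"
      using v_le[of t] v'_le[of t] R_pos[of t] by (auto intro: divide_right_mono)
    show "\<bar>v2 t\<bar> \<le> D / \<rho> t" "\<bar>v2' t\<bar> \<le> D / \<rho> t"
      using *[of t] 1 2 unfolding v2_def v2'_def by linarith+
  qed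
  then show ?thesis using that D by blast
qed

text \<open>Variation of constants with the decaying v and the growing \<open>v2\<close>. The
  coefficient of \<open>v2\<close> is an integral of \<open>v * r\<close>, normalized to vanish at
  both ends, and so it decays like \<rho>; the coefficient of v is an integral of
  \<open>v2 * r\<close> and grows like 1 / \<rho>. The products stay bounded.\<close>

theorem bounded_solution:
  obtains C where "0 < C" "\<And>r M. continuous_on UNIV r \<Longrightarrow> (\<And>t. \<bar>r t\<bar> \<le> M) \<Longrightarrow> (LBINT t. v t * r t) = 0 \<Longrightarrow>
    \<exists>y y'. (\<forall>t. (y has_real_derivative y' t) (at t) \<and> (y' has_real_derivative a t * y t + r t) (at t) \<and>
      \<bar>y t\<bar> \<le> C * M \<and> \<bar>y' t\<bar> \<le> C * M) \<and> (LBINT t. v t * y t) = 0"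
proof -
  obtain C c where C: "1 \<le> C" "0 < c"
    "\<And>t s. 0 \<le> t \<Longrightarrow> t \<le> s \<Longrightarrow> \<rho> s \<le> C * \<rho> t * exp (- c * (s - t))"
    "\<And>t s. s \<le> t \<Longrightarrow> t \<le> 0 \<Longrightarrow> \<rho> s \<le> C * \<rho> t * exp (- c * (t - s))"
    by (rule \<rho>_decay) blast
  obtain C2 where C2: "0 < C2" "\<And>t. \<bar>v2 t\<bar> \<le> C2 / \<rho> t" "\<And>t. \<bar>v2' t\<bar> \<le> C2 / \<rho> t"
    by (rule v2_le) blast
  obtain B where B: "0 < B" "\<And>t. \<bar>v t\<bar> \<le> B" "\<And>t. \<bar>v' t\<bar> \<le> B"
    by (rule v_bounded) blast
  \<comment> \<open>K counts the two terms of the formula, each at most \<open>C2 * C / c\<close>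
    times M. N bounds the coefficient of the projection on v relative to the sup norm, and E adds
    the cost of subtracting this projection.\<close>
  define K where "K = 2 * C2 * C / c"
  define N where "N = (LBINT t. \<bar>v t\<bar>) / (LBINT t. v t * v t)"
  have K: "0 < K" using C C2 by (simp add: K_def)
  have N: "0 \<le> N" using v_sq_pos by (simp add: N_def)
  define E where "E = K + N * K * B"
  have E: "0 < E" using K N B by (simp add: E_def add_pos_nonneg)
  show ?thesis
  proof (rule that[OF E])
    fix r :: "real \<Rightarrow> real" and M
    assume r: "continuous_on UNIV r" and rM: "\<And>t. \<bar>r t\<bar> \<le> M" and orth: "(LBINT t. v t * r t) = 0"
    have M: "0 \<le> M" using rM[of 0] by simp
    have vr: "continuous_on UNIV (\<lambda>t. v t * r t)" by (intro continuous_intros v_cont r)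
    have v2_cont: "continuous_on S v2" for S by (rule continuous_on_DERIV[OF v2_deriv])
    have v2r: "continuous_on UNIV (\<lambda>t. v2 t * r t)" by (intro continuous_intros v2_cont r)
    define P where "P = primitive (\<lambda>t. v t * r t)"
    define Q where "Q = primitive (\<lambda>t. v2 t * r t)"
    have P: "(P has_real_derivative v t * r t) (at t)" for t
      unfolding P_def by (rule primitive_has_real_derivative[OF vr])
    have Q: "(Q has_real_derivative v2 t * r t) (at t)" for t
      unfolding Q_def by (rule primitive_has_real_derivative[OF v2r])
    \<comment> \<open>Here the orthogonality enters: the two limits of P agree, and one constant L
      makes \<open>P - L\<close> decay at both ends.\<close>
    obtain L where L: "(P \<longlongrightarrow> L) at_bot" "(P \<longlongrightarrow> L) at_top"
      using integrable_primitive_limits[OF vr integrable_v_mult[OF r rM]] orth unfolding P_def by force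
    have vr_le: "\<bar>v s * r s\<bar> \<le> M * C * \<rho> t * exp (- c * u)" if "\<rho> s \<le> C * \<rho> t * exp (- c * u)" for s t u
    proof -
      have "\<bar>v s\<bar> * \<bar>r s\<bar> \<le> (C * \<rho> t * exp (- c * u)) * M"
        using v_le[of s] that rM[of s] \<rho>_pos[of s] by (intro mult_mono) auto
      then show ?thesis by (simp add: abs_mult algebra_simps)
    qed
    have PL: "\<bar>P t - L\<bar> \<le> M * C * \<rho> t / c" for t
    proof (cases "0 \<le> t")
      case True
      show ?thesis
      proof (rule abs_diff_le_of_exp_bound_right[OF _ _ P _ L(2)])
        show "\<bar>v s * r s\<bar> \<le> M * C * \<rho> t * exp (- c * (s - t))" if "t \<le> s" for s
          by (rule vr_le[OF C(3)[OF True that]])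
      qed (use C M \<rho>_pos[of t] in auto)
    next
      case False
      have "\<bar>(\<lambda>s. P (- s)) (- t) - L\<bar> \<le> M * C * \<rho> t / c"
      proof (rule abs_diff_le_of_exp_bound_right[where F = "\<lambda>s. P (- s)" and t = "- t"])
        show "((\<lambda>s. P (- s)) has_real_derivative - (v (- s) * r (- s))) (at s)" for s
          using P[of "- s"] by (simp add: DERIV_mirror)
        show "((\<lambda>s. P (- s)) \<longlongrightarrow> L) at_top"
          using L(1) by (simp add: at_bot_mirror filterlim_filtermap)
        show "\<bar>- (v (- s) * r (- s))\<bar> \<le> M * C * \<rho> t * exp (- c * (s - - t))" if "- t \<le> s" for s
          using vr_le[OF C(4)[of "- s" t]] that False by (simp add: algebra_simps)
      qed (use C M \<rho>_pos[of t] in auto)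
      then show ?thesis by simp
    qed
    have v2r_le: "\<bar>v2 s * r s\<bar> \<le> M * C2 * C / \<rho> t * exp (- c * u)" if "\<rho> t \<le> C * \<rho> s * exp (- c * u)" for s t u
    proof -
      have "1 / \<rho> s \<le> C / \<rho> t * exp (- c * u)"
        using that \<rho>_pos[of s] \<rho>_pos[of t] by (simp add: field_simps)
      then have "C2 * (1 / \<rho> s) \<le> C2 * (C / \<rho> t * exp (- c * u))"
        using C2 by (intro mult_left_mono) auto
      then have "\<bar>v2 s\<bar> \<le> C2 * (C / \<rho> t * exp (- c * u))"
        using C2(2)[of s] by simp
      then have "\<bar>v2 s\<bar> * \<bar>r s\<bar> \<le> C2 * (C / \<rho> t * exp (- c * u)) * M"
        using rM[of s] C2 C \<rho>_pos[of t] by (intro mult_mono) auto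
      then show ?thesis by (simp add: abs_mult algebra_simps)
    qed
    have Qle: "\<bar>Q t\<bar> \<le> M * C2 * C / \<rho> t / c" for t
    proof -
      have "\<bar>Q t - Q 0\<bar> \<le> M * C2 * C / \<rho> t / c"
      proof (rule abs_diff_le_of_exp_bound_to_0[OF _ _ Q])
        show "\<bar>v2 s * r s\<bar> \<le> M * C2 * C / \<rho> t * exp (- c * (t - s))" if "0 \<le> s" "s \<le> t" for s
          by (rule v2r_le[OF C(3)[OF that]])
        show "\<bar>v2 s * r s\<bar> \<le> M * C2 * C / \<rho> t * exp (- c * (s - t))" if "t \<le> s" "s \<le> 0" for s
          by (rule v2r_le[OF C(4)[OF that]])
      qed (use C C2 M \<rho>_pos[of t] in auto)
      then show ?thesis by (simp add: Q_def)
    qed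
    define y0 where "y0 t = v2 t * (P t - L) - v t * Q t" for t
    define y0' where "y0' t = v2' t * (P t - L) - v' t * Q t" for t
    have y0: "(y0 has_real_derivative y0' t) (at t)" for t
    proof -
      have "(y0 has_real_derivative v2' t * (P t - L) + (v t * r t) * v2 t
          - (v' t * Q t + (v2 t * r t) * v t)) (at t)"
        unfolding y0_def by (rule derivative_eq_intros v2_deriv v P Q refl)+ simp
      then show ?thesis by (simp add: y0'_def algebra_simps)
    qed
    have y0': "(y0' has_real_derivative a t * y0 t + r t) (at t)" for t
    proof -
      have "(y0' has_real_derivative a t * v2 t * (P t - L) + (v t * r t) * v2' t
          - (a t * v t * Q t + (v2 t * r t) * v' t)) (at t)"
        unfolding y0'_def by (rule derivative_eq_intros v2'_deriv v' P Q refl)+ simp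
      moreover have "(v t * r t) * v2' t - (v2 t * r t) * v' t = r t"
        using arg_cong[OF wronskian[of t], of "\<lambda>x. x * r t"] by (simp add: algebra_simps)
      ultimately show ?thesis by (simp add: y0_def algebra_simps)
    qed
    have prods: "x1 * x2 \<le> M * C2 * C / c"
      if "x1 \<le> C2 / \<rho> t" "0 \<le> x1" "x2 \<le> M * C * \<rho> t / c" "0 \<le> x2" for x1 x2 t
    proof -
      have "x1 * x2 \<le> C2 / \<rho> t * (M * C * \<rho> t / c)"
        using that C2 \<rho>_pos[of t] by (intro mult_mono) auto
      also have "\<dots> = M * C2 * C / c" using \<rho>_pos[of t] by simp
      finally show ?thesis .
    qed
    have prods': "x1 * x2 \<le> M * C2 * C / c"
      if "x1 \<le> \<rho> t" "0 \<le> x1" "x2 \<le> M * C2 * C / \<rho> t / c" "0 \<le> x2" for x1 x2 t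
    proof -
      have "x1 * x2 \<le> \<rho> t * (M * C2 * C / \<rho> t / c)"
        using that \<rho>_pos[of t] by (intro mult_mono) auto
      also have "\<dots> = M * C2 * C / c" using \<rho>_pos[of t] by simp
      finally show ?thesis .
    qed
    have bd0: "\<bar>y0 t\<bar> \<le> K * M" "\<bar>y0' t\<bar> \<le> K * M" for t
    proof -
      have sum: "\<bar>x1 * x2 - x3 * x4\<bar> \<le> K * M"
        if "\<bar>x1\<bar> * \<bar>x2\<bar> \<le> M * C2 * C / c" "\<bar>x3\<bar> * \<bar>x4\<bar> \<le> M * C2 * C / c" for x1 x2 x3 x4
      proof -
        have "\<bar>x1 * x2 - x3 * x4\<bar> \<le> \<bar>x1\<bar> * \<bar>x2\<bar> + \<bar>x3\<bar> * \<bar>x4\<bar>"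
          unfolding abs_mult[symmetric] by linarith
        moreover have "K * M = M * C2 * C / c + M * C2 * C / c" by (simp add: K_def)
        ultimately show ?thesis using that by linarith
      qed
      show "\<bar>y0 t\<bar> \<le> K * M" unfolding y0_def
        by (rule sum; (rule prods[OF C2(2) _ PL] | rule prods'[OF v_le _ Qle])) auto
      show "\<bar>y0' t\<bar> \<le> K * M" unfolding y0'_def
        by (rule sum; (rule prods[OF C2(3) _ PL] | rule prods'[OF v'_le _ Qle])) auto
    qed
    have y0_cont: "continuous_on UNIV y0" by (rule continuous_on_DERIV[OF y0])
    \<comment> \<open>Subtracting this multiple of v selects, among the bounded solutions, the one
      orthogonal to v.\<close>
    define \<beta> where "\<beta> = (LBINT t. v t * y0 t) / (LBINT t. v t * v t)"
    have "\<bar>LBINT t. v t * y0 t\<bar> \<le> (LBINT t. \<bar>v t\<bar>) * (K * M)"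
      by (rule abs_LBINT_v_mult_le[OF y0_cont bd0(1)])
    then have \<beta>: "\<bar>\<beta>\<bar> \<le> N * (K * M)"
      using v_sq_pos by (simp add: \<beta>_def N_def abs_divide divide_right_mono)
    define y where "y t = y0 t - \<beta> * v t" for t
    define y' where "y' t = y0' t - \<beta> * v' t" for t
    have "(y has_real_derivative y' t) (at t)" for t
      unfolding y_def y'_def by (rule derivative_eq_intros y0 v refl)+ simp
    moreover have "(y' has_real_derivative a t * y t + r t) (at t)" for t
      unfolding y_def y'_def by (rule derivative_eq_intros y0' v' refl)+ (simp add: algebra_simps)
    moreover have bv: "\<bar>\<beta> * x\<bar> \<le> N * (K * M) * B" if "\<bar>x\<bar> \<le> B" for x
      unfolding abs_mult using \<beta> that by (intro mult_mono) auto
    have "\<bar>y t\<bar> \<le> E * M" "\<bar>y' t\<bar> \<le> E * M" for t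
    proof -
      have EM: "E * M = K * M + N * (K * M) * B" by (simp add: E_def algebra_simps)
      show "\<bar>y t\<bar> \<le> E * M" "\<bar>y' t\<bar> \<le> E * M"
        unfolding y_def y'_def EM using bd0[of t] bv[OF B(2)[of t]] bv[OF B(3)[of t]] by linarith+
    qed
    moreover have "(LBINT t. v t * y t) = 0"
    proof -
      have "(LBINT t. v t * y t) = (LBINT t. v t * y0 t - \<beta> * (v t * v t))"
        by (simp add: y_def algebra_simps)
      also have "\<dots> = (LBINT t. v t * y0 t) - \<beta> * (LBINT t. v t * v t)"
        using integrable_v_mult[OF y0_cont bd0(1)] integrable_v_sq by simp
      also have "\<dots> = 0" using v_sq_pos by (simp add: \<beta>_def)
      finally show ?thesis .
    qed
    ultimately show "\<exists>y y'. (\<forall>t. (y has_real_derivative y' t) (at t) \<and> (y' has_real_derivative a t * y t + r t) (at t) \<and>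
      \<bar>y t\<bar> \<le> E * M \<and> \<bar>y' t\<bar> \<le> E * M) \<and> (LBINT t. v t * y t) = 0" by blast
  qed
qed

end

section \<open>Solution operators and parametrized contractions\<close>

text \<open>Uniqueness for the homogeneous problem makes the solution relation single-valued, and
  then its closure under sums and multiples is linearity of the resulting map.\<close>

lemma solution_operator:
  fixes Sol :: "'a::real_normed_vector \<Rightarrow> 'b::real_normed_vector \<Rightarrow> bool"
  assumes add: "\<And>r z r' z'. Sol r z \<Longrightarrow> Sol r' z' \<Longrightarrow> Sol (r + r') (z + z')"
    and scale: "\<And>c r z. Sol r z \<Longrightarrow> Sol (c *\<^sub>R r) (c *\<^sub>R z)"
    and ex: "\<And>r. \<exists>z. Sol r z \<and> norm z \<le> C * norm r"
    and uniq: "\<And>z. Sol 0 z \<Longrightarrow> z = 0"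
  obtains S where "bounded_linear S" "\<And>r z. Sol r z \<longleftrightarrow> z = S r"
proof -
  obtain S where S: "\<And>r. Sol r (S r) \<and> norm (S r) \<le> C * norm r" using ex by metis
  have eq: "z = z'" if "Sol r z" "Sol r z'" for r z z'
  proof -
    have "Sol (r + (-1) *\<^sub>R r) (z + (-1) *\<^sub>R z')" using that add scale by blast
    then have "z + (-1) *\<^sub>R z' = 0" by (intro uniq) simp
    then show ?thesis by simp
  qed
  have iff: "Sol r z \<longleftrightarrow> z = S r" for r z using S eq by blast
  have "bounded_linear S"
  proof (rule bounded_linear_intro)
    show "S (x + y) = S x + S y" for x y using add[of x "S x" y "S y"] iff by simp
    show "S (c *\<^sub>R x) = c *\<^sub>R S x" for c x using scale[of x "S x" c] iff by simp
    show "norm (S x) \<le> norm x * C" for x using S by (simp add: mult.commute)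
  qed
  then show ?thesis using that iff by blast
qed

section \<open>Bounded continuous functions and the equation with constant coefficients\<close>

lemma Bcontfun_apply:
  fixes f :: "real \<Rightarrow> real"
  assumes "continuous_on UNIV f" "\<And>t. \<bar>f t\<bar> \<le> M"
  shows "apply_bcontfun (Bcontfun f) = f"
  using assms by (intro Bcontfun_inverse bcontfun_normI) auto

lemma abs_apply_le_norm: "\<bar>apply_bcontfun (f :: real \<Rightarrow>\<^sub>C real) t\<bar> \<le> norm f"
  using norm_bounded[of f t] by simp

lemma norm_bcontfun_le:
  fixes f :: "real \<Rightarrow>\<^sub>C real"
  shows "(\<And>t. \<bar>f t\<bar> \<le> b) \<Longrightarrow> norm f \<le> b"
  by (rule norm_bound) simp

text \<open>The solution is the integral of \<open>exp (- k * (t - s)) * r s\<close> over all s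
  \<le> t; subtracting the limit L of the primitive at minus infinity moves the lower end of the
  integral there.\<close>

lemma bounded_solution_first_order:
  fixes r :: "real \<Rightarrow> real"
  assumes k: "0 < k" and r: "continuous_on UNIV r" "\<And>t. \<bar>r t\<bar> \<le> M"
  obtains y where "\<And>t. (y has_real_derivative - k * y t + r t) (at t)" "\<And>t. \<bar>y t\<bar> \<le> M / k"
proof -
  have M: "0 \<le> M" using r(2)[of 0] by simp
  \<comment> \<open>\<open>?w\<close> agrees with \<open>?p\<close> for s \<le> 0 and is integrable
    over the whole line, so its primitive shows that the primitive of \<open>?p\<close> has a limit
    at minus infinity.\<close>
  let ?w = "\<lambda>s. exp (- k * \<bar>s\<bar>) * r s" and ?p = "\<lambda>s. exp (k * s) * r s"
  have wc: "continuous_on UNIV ?w" and pc: "continuous_on UNIV ?p"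
    by (intro continuous_intros r)+
  have "integrable lborel ?w"
    using r(2) by (intro integrable_exp_decay[OF wc k, of M]) (simp add: abs_mult mult.commute mult_right_mono)
  then obtain L where L: "(primitive ?w \<longlongrightarrow> L) at_bot"
    using integrable_primitive_limits[OF wc] by metis
  define P where "P = primitive ?p"
  have P: "(P has_real_derivative ?p s) (at s)" for s
    unfolding P_def by (rule primitive_has_real_derivative[OF pc])
  have "\<exists>c. \<forall>s\<in>{..0}. P s - primitive ?w s = c"
  proof (rule has_field_derivative_zero_constant)
    fix s :: real assume s: "s \<in> {..0}"
    have "((\<lambda>s. P s - primitive ?w s) has_real_derivative ?p s - ?w s) (at s)"
      by (intro DERIV_diff P primitive_has_real_derivative[OF wc])
    moreover have "?p s - ?w s = 0" using s by simp
    ultimately have "((\<lambda>s. P s - primitive ?w s) has_real_derivative 0) (at s)" by (simp only:)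
    then show "((\<lambda>s. P s - primitive ?w s) has_real_derivative 0) (at s within {..0})"
      by (rule has_field_derivative_at_within)
  qed auto
  then have Pw: "P s = primitive ?w s" if "s \<le> 0" for s
  proof -
    obtain c where c: "\<And>s. s \<in> {..0} \<Longrightarrow> P s - primitive ?w s = c"
      using \<open>\<exists>c. \<forall>s\<in>{..0}. P s - primitive ?w s = c\<close> by blast
    show ?thesis using c[of 0] c[of s] that by (simp add: P_def)
  qed
  have PL: "(P \<longlongrightarrow> L) at_bot"
    by (rule Lim_transform_eventually[OF L])
       (use Pw in \<open>auto intro!: eventually_mono[OF eventually_le_at_bot[of 0]]\<close>)
  define y where "y t = exp (- k * t) * (P t - L)" for t
  have bd: "\<bar>P t - L\<bar> \<le> M * exp (k * t) / k" for t
  proof -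
    have "\<bar>(\<lambda>s. P (- s)) (- t) - L\<bar> \<le> M * exp (k * t) / k"
    proof (rule abs_diff_le_of_exp_bound_right[where F = "\<lambda>s. P (- s)" and t = "- t", OF k])
      show "((\<lambda>s. P (- s)) has_real_derivative - ?p (- s)) (at s)" for s
        using P[of "- s"] by (simp add: DERIV_mirror)
      show "((\<lambda>s. P (- s)) \<longlongrightarrow> L) at_top"
        using PL by (simp add: at_bot_mirror filterlim_filtermap)
      show "\<bar>- ?p (- s)\<bar> \<le> M * exp (k * t) * exp (- k * (s - - t))" for s
        using r(2)[of "- s"] by (simp add: abs_mult mult.assoc exp_add[symmetric] algebra_simps mult_left_mono)
    qed (use M in simp)
    then show ?thesis by simp
  qed
  show ?thesis
  proof (rule that)
    show "(y has_real_derivative - k * y t + r t) (at t)" for t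
    proof -
      have "(y has_real_derivative - k * exp (- k * t) * (P t - L) + exp (k * t) * r t * exp (- k * t)) (at t)"
        unfolding y_def by (auto intro!: derivative_eq_intros P)
      moreover have "exp (k * t) * r t * exp (- k * t) = r t"
        by (simp add: exp_minus)
      ultimately have "(y has_real_derivative - k * exp (- k * t) * (P t - L) + r t) (at t)"
        by (simp only:)
      then show ?thesis by (simp add: y_def mult.assoc)
    qed
    show "\<bar>y t\<bar> \<le> M / k" for t
    proof -
      have "\<bar>y t\<bar> \<le> exp (- k * t) * (M * exp (k * t) / k)"
        unfolding y_def abs_mult using bd[of t] by (simp add: mult_left_mono del: times_divide_eq_right)
      also have "\<dots> = M / k" by (simp add: exp_minus)
      finally show ?thesis .
    qed
  qed
qed

lemma bounded_solution_saddle: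
  fixes r :: "real \<Rightarrow> real"
  assumes k: "0 < k" and r: "continuous_on UNIV r" "\<And>t. \<bar>r t\<bar> \<le> M"
  obtains y y' where "\<And>t. (y has_real_derivative y' t) (at t)"
    "\<And>t. (y' has_real_derivative k\<^sup>2 * y t + r t) (at t)"
    "\<And>t. \<bar>y t\<bar> \<le> M / k\<^sup>2" "\<And>t. \<bar>y' t\<bar> \<le> 2 * M / k"
proof -
  have "continuous_on UNIV (\<lambda>t. r (- t))"
    by (auto intro!: continuous_intros continuous_on_compose2[OF r(1)])
  then obtain z where z: "\<And>t. (z has_real_derivative - k * z t + r (- t)) (at t)" "\<And>t. \<bar>z t\<bar> \<le> M / k"
    using bounded_solution_first_order[OF k, of "\<lambda>t. r (- t)" M] r(2) by metis
  define u where "u t = - z (- t)" for t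
  have u: "(u has_real_derivative k * u t + r t) (at t)" for t
  proof -
    have "((\<lambda>t. z (- t)) has_real_derivative - (- k * z (- t) + r t)) (at t)"
      using z(1)[of "- t"] by (simp add: DERIV_mirror)
    then show ?thesis unfolding u_def by (auto dest: DERIV_minus)
  qed
  have ub: "\<bar>u t\<bar> \<le> M / k" for t using z(2) by (simp add: u_def)
  obtain y where y: "\<And>t. (y has_real_derivative - k * y t + u t) (at t)" "\<And>t. \<bar>y t\<bar> \<le> M / k / k"
    using bounded_solution_first_order[OF k continuous_on_DERIV[OF u] ub] by metis
  show ?thesis
  proof (rule that[OF y(1)])
    show "((\<lambda>t. - k * y t + u t) has_real_derivative k\<^sup>2 * y t + r t) (at t)" for t
      by (auto intro!: derivative_eq_intros y u simp: power2_eq_square algebra_simps)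
    show "\<bar>y t\<bar> \<le> M / k\<^sup>2" for t using y(2)[of t] by (simp add: power2_eq_square)
    show "\<bar>- k * y t + u t\<bar> \<le> 2 * M / k" for t
    proof -
      have "k * \<bar>y t\<bar> \<le> k * (M / k / k)" using k y(2) by (intro mult_left_mono) auto
      then have "\<bar>k * y t\<bar> \<le> M / k" using k by (simp add: abs_mult)
      then show ?thesis using ub[of t] by simp
    qed
  qed
qed

text \<open>The derivative of the fixed point solves the linearized fixed point equation, which is
  again a contraction. Continuity of \<open>DF\<close> is assumed for each fixed argument \<zeta>,
  as the superposition operators provide it, and the derivatives are taken within D because D is a
  closed set with boundary.\<close>

lemma fixed_point_C1:
  fixes F :: "real \<Rightarrow> 'x::{real_normed_vector,complete_space} \<Rightarrow> 'x" and DF :: "real \<Rightarrow> 'x \<Rightarrow> real \<times> 'x \<Rightarrow> 'x"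
  assumes D: "closed D" "convex D" "D \<noteq> {}" and q: "0 \<le> q" "q < 1"
    and maps: "\<And>\<epsilon> x. \<bar>\<epsilon>\<bar> < e0 \<Longrightarrow> x \<in> D \<Longrightarrow> F \<epsilon> x \<in> D"
    and deriv: "\<And>\<epsilon> x. \<bar>\<epsilon>\<bar> < e0 \<Longrightarrow> x \<in> D \<Longrightarrow>
      ((\<lambda>z. F (fst z) (snd z)) has_derivative DF \<epsilon> x) (at (\<epsilon>, x) within {-e0<..<e0} \<times> D)"
    and cont: "\<And>\<zeta>. continuous_on ({-e0<..<e0} \<times> D) (\<lambda>z. DF (fst z) (snd z) \<zeta>)"
    and contr: "\<And>\<epsilon> x \<xi>. \<bar>\<epsilon>\<bar> < e0 \<Longrightarrow> x \<in> D \<Longrightarrow> norm (DF \<epsilon> x (0, \<xi>)) \<le> q * norm \<xi>"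
  obtains X X' where "\<And>\<epsilon>. \<bar>\<epsilon>\<bar> < e0 \<Longrightarrow> X \<epsilon> \<in> D \<and> F \<epsilon> (X \<epsilon>) = X \<epsilon>"
    "\<And>\<epsilon> x. \<bar>\<epsilon>\<bar> < e0 \<Longrightarrow> x \<in> D \<Longrightarrow> F \<epsilon> x = x \<Longrightarrow> x = X \<epsilon>"
    "\<And>\<epsilon>. \<bar>\<epsilon>\<bar> < e0 \<Longrightarrow> (X has_vector_derivative X' \<epsilon>) (at \<epsilon>)"
    "continuous_on {-e0<..<e0} X'"
proof -
  have bl: "bounded_linear (DF \<epsilon> x)" if "\<bar>\<epsilon>\<bar> < e0" "x \<in> D" for \<epsilon> x
    using deriv[OF that] by (rule has_derivative_bounded_linear)
  have lip: "norm (F \<epsilon> x - F \<epsilon> y) \<le> q * norm (x - y)" if \<epsilon>: "\<bar>\<epsilon>\<bar> < e0" and x: "x \<in> D" and y: "y \<in> D" for \<epsilon> x y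
  proof (rule differentiable_bound[OF D(2) _ _ x y])
    fix x assume x: "x \<in> D"
    have "((\<lambda>x. (\<lambda>z. F (fst z) (snd z)) (\<epsilon>, x)) has_derivative (\<lambda>\<xi>. DF \<epsilon> x (0, \<xi>))) (at x within D)"
    proof (rule has_derivative_in_compose2[where t = "{-e0<..<e0} \<times> D" and g' = "\<lambda>z. DF (fst z) (snd z)", THEN has_derivative_eq_rhs])
      show "((\<lambda>z. F (fst z) (snd z)) has_derivative DF (fst z) (snd z)) (at z within {-e0<..<e0} \<times> D)"
        if "z \<in> {-e0<..<e0} \<times> D" for z using deriv[of "fst z" "snd z"] that by auto
      show "(Pair \<epsilon> has_derivative (\<lambda>\<xi>. (0, \<xi>))) (at x within D)"
        by (auto intro!: derivative_eq_intros)
    qed (use x \<epsilon> in auto)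
    then show "(F \<epsilon> has_derivative (\<lambda>\<xi>. DF \<epsilon> x (0, \<xi>))) (at x within D)" by simp
    show "onorm (\<lambda>\<xi>. DF \<epsilon> x (0, \<xi>)) \<le> q"
      using contr[OF \<epsilon> x] q by (intro onorm_bound) auto
  qed
  have "\<exists>!x. x \<in> D \<and> F \<epsilon> x = x" if \<epsilon>: "\<bar>\<epsilon>\<bar> < e0" for \<epsilon>
    by (rule Banach_fix[OF _ D(3) q]) (use D maps[OF \<epsilon>] lip[OF \<epsilon>] in \<open>auto simp: complete_eq_closed dist_norm\<close>)
  then obtain X where X: "\<And>\<epsilon>. \<bar>\<epsilon>\<bar> < e0 \<Longrightarrow> X \<epsilon> \<in> D \<and> F \<epsilon> (X \<epsilon>) = X \<epsilon>"
    "\<And>\<epsilon> x. \<bar>\<epsilon>\<bar> < e0 \<Longrightarrow> x \<in> D \<Longrightarrow> F \<epsilon> x = x \<Longrightarrow> x = X \<epsilon>"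
    by metis
  have "\<exists>\<xi>. DF \<epsilon> (X \<epsilon>) (1, \<xi>) = \<xi>" if \<epsilon>: "\<bar>\<epsilon>\<bar> < e0" for \<epsilon>
  proof -
    have "\<exists>!\<xi>. DF \<epsilon> (X \<epsilon>) (1, \<xi>) = \<xi>"
    proof (rule banach_fix_type[OF q], safe)
      fix x y
      have "DF \<epsilon> (X \<epsilon>) (1, x) - DF \<epsilon> (X \<epsilon>) (1, y) = DF \<epsilon> (X \<epsilon>) (0, x - y)"
        using linear_diff[OF bounded_linear.linear[OF bl[OF \<epsilon> conjunct1[OF X(1)[OF \<epsilon>]]]], of "(1, x)" "(1, y)"] by simp
      then show "dist (DF \<epsilon> (X \<epsilon>) (1, x)) (DF \<epsilon> (X \<epsilon>) (1, y)) \<le> q * dist x y"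
        using contr[OF \<epsilon>, of "X \<epsilon>" "x - y"] X(1)[OF \<epsilon>] by (simp add: dist_norm)
    qed
    then show ?thesis by blast
  qed
  then obtain X' where X': "\<And>\<epsilon>. \<bar>\<epsilon>\<bar> < e0 \<Longrightarrow> DF \<epsilon> (X \<epsilon>) (1, X' \<epsilon>) = X' \<epsilon>" by metis
  have par: "norm (X \<epsilon> - X \<epsilon>0) \<le> norm (F \<epsilon> (X \<epsilon>0) - F \<epsilon>0 (X \<epsilon>0)) / (1 - q)"
    if "\<bar>\<epsilon>\<bar> < e0" "\<bar>\<epsilon>0\<bar> < e0" for \<epsilon> \<epsilon>0
  proof -
    have "X \<epsilon> - X \<epsilon>0 = (F \<epsilon> (X \<epsilon>) - F \<epsilon> (X \<epsilon>0)) + (F \<epsilon> (X \<epsilon>0) - F \<epsilon>0 (X \<epsilon>0))"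
      using X(1)[OF that(1)] X(1)[OF that(2)] by simp
    also have "norm \<dots> \<le> q * norm (X \<epsilon> - X \<epsilon>0) + norm (F \<epsilon> (X \<epsilon>0) - F \<epsilon>0 (X \<epsilon>0))"
      using X(1) that by (intro norm_triangle_le add_mono lip) auto
    finally show ?thesis using q by (simp add: field_simps)
  qed
  have rem: "\<exists>d>0. \<forall>z\<in>{-e0<..<e0} \<times> D. norm (z - (\<epsilon>0, x)) < d \<longrightarrow>
       norm (F (fst z) (snd z) - F \<epsilon>0 x - DF \<epsilon>0 x (z - (\<epsilon>0, x))) \<le> e * norm (z - (\<epsilon>0, x))"
    if "\<bar>\<epsilon>0\<bar> < e0" "x \<in> D" "0 < e" for \<epsilon>0 x e
    using conjunct2[OF deriv[OF that(1,2), unfolded has_derivative_within_alt]] that(3)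
    by (simp only: fst_conv snd_conv)
  \<comment> \<open>A Lipschitz bound at \<open>\<epsilon>0\<close> comes first: it turns a
    remainder that is small relative to the displacement of the pair (\<epsilon>, X \<epsilon>) into
    one that is small relative to that of \<epsilon>.\<close>
  have lipX: "\<exists>C\<ge>0. \<exists>d>0. \<forall>\<epsilon>. \<bar>\<epsilon>\<bar> < e0 \<longrightarrow> \<bar>\<epsilon> - \<epsilon>0\<bar> < d \<longrightarrow> norm (X \<epsilon> - X \<epsilon>0) \<le> C * \<bar>\<epsilon> - \<epsilon>0\<bar>"
    if \<epsilon>0: "\<bar>\<epsilon>0\<bar> < e0" for \<epsilon>0
  proof -
    let ?L = "DF \<epsilon>0 (X \<epsilon>0)"
    have xD: "X \<epsilon>0 \<in> D" using X(1)[OF \<epsilon>0] by simp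
    obtain B where B: "0 \<le> B" "\<And>z. norm (?L z) \<le> norm z * B"
      using bounded_linear.nonneg_bounded[OF bl[OF \<epsilon>0 xD]] by metis
    obtain d where d: "0 < d" "\<And>z. z \<in> {-e0<..<e0} \<times> D \<Longrightarrow> norm (z - (\<epsilon>0, X \<epsilon>0)) < d \<Longrightarrow>
       norm (F (fst z) (snd z) - F \<epsilon>0 (X \<epsilon>0) - ?L (z - (\<epsilon>0, X \<epsilon>0))) \<le> 1 * norm (z - (\<epsilon>0, X \<epsilon>0))"
      using rem[OF \<epsilon>0 xD zero_less_one] by blast
    show ?thesis
    proof (rule exI[of _ "(B + 1) / (1 - q)"], safe intro!: exI[of _ d])
      fix \<epsilon> assume \<epsilon>: "\<bar>\<epsilon>\<bar> < e0" "\<bar>\<epsilon> - \<epsilon>0\<bar> < d"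
      let ?z = "(\<epsilon>, X \<epsilon>0)"
      have n: "norm (?z - (\<epsilon>0, X \<epsilon>0)) = \<bar>\<epsilon> - \<epsilon>0\<bar>" by (simp add: norm_Pair)
      have "norm (F \<epsilon> (X \<epsilon>0) - F \<epsilon>0 (X \<epsilon>0)) \<le> norm (F \<epsilon> (X \<epsilon>0) - F \<epsilon>0 (X \<epsilon>0) - ?L (?z - (\<epsilon>0, X \<epsilon>0)))
          + norm (?L (?z - (\<epsilon>0, X \<epsilon>0)))"
        using norm_triangle_ineq[of "F \<epsilon> (X \<epsilon>0) - F \<epsilon>0 (X \<epsilon>0) - ?L (?z - (\<epsilon>0, X \<epsilon>0))" "?L (?z - (\<epsilon>0, X \<epsilon>0))"]
        by (simp only: diff_add_cancel)
      also have "\<dots> \<le> \<bar>\<epsilon> - \<epsilon>0\<bar> + \<bar>\<epsilon> - \<epsilon>0\<bar> * B"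
        using d(2)[of ?z] \<epsilon> xD B(2)[of "?z - (\<epsilon>0, X \<epsilon>0)"] n
        by (intro add_mono) (auto simp: abs_less_iff)
      finally have "norm (F \<epsilon> (X \<epsilon>0) - F \<epsilon>0 (X \<epsilon>0)) \<le> (B + 1) * \<bar>\<epsilon> - \<epsilon>0\<bar>" by (simp add: algebra_simps)
      then have "norm (F \<epsilon> (X \<epsilon>0) - F \<epsilon>0 (X \<epsilon>0)) / (1 - q) \<le> (B + 1) * \<bar>\<epsilon> - \<epsilon>0\<bar> / (1 - q)"
        using q by (intro divide_right_mono) auto
      then show "norm (X \<epsilon> - X \<epsilon>0) \<le> (B + 1) / (1 - q) * \<bar>\<epsilon> - \<epsilon>0\<bar>"
        using par[OF \<epsilon>(1) \<epsilon>0] by simp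
    qed (use B q d in auto)
  qed
  have Xc: "(X \<longlongrightarrow> X \<epsilon>0) (at \<epsilon>0 within {-e0<..<e0})" if \<epsilon>0: "\<bar>\<epsilon>0\<bar> < e0" for \<epsilon>0
  proof -
    obtain C d where C: "0 \<le> C" "0 < d" "\<And>\<epsilon>. \<bar>\<epsilon>\<bar> < e0 \<Longrightarrow> \<bar>\<epsilon> - \<epsilon>0\<bar> < d \<Longrightarrow> norm (X \<epsilon> - X \<epsilon>0) \<le> C * \<bar>\<epsilon> - \<epsilon>0\<bar>"
      using lipX[OF \<epsilon>0] by blast
    have "((\<lambda>\<epsilon>. X \<epsilon> - X \<epsilon>0) \<longlongrightarrow> 0) (at \<epsilon>0 within {-e0<..<e0})"
    proof (rule Lim_null_comparison)
      show "\<forall>\<^sub>F \<epsilon> in at \<epsilon>0 within {-e0<..<e0}. norm (X \<epsilon> - X \<epsilon>0) \<le> C * \<bar>\<epsilon> - \<epsilon>0\<bar>"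
        unfolding eventually_at using C by (intro exI[of _ d]) (auto simp: dist_real_def)
      have "((\<lambda>\<epsilon>. C * \<bar>\<epsilon> - \<epsilon>0\<bar>) \<longlongrightarrow> C * \<bar>\<epsilon>0 - \<epsilon>0\<bar>) (at \<epsilon>0 within {-e0<..<e0})"
        by (intro tendsto_intros)
      then show "((\<lambda>\<epsilon>. C * \<bar>\<epsilon> - \<epsilon>0\<bar>) \<longlongrightarrow> 0) (at \<epsilon>0 within {-e0<..<e0})" by simp
    qed
    then show ?thesis by (simp add: LIM_zero_iff)
  qed
  have dX: "(X has_vector_derivative X' \<epsilon>0) (at \<epsilon>0)" if \<epsilon>0: "\<bar>\<epsilon>0\<bar> < e0" for \<epsilon>0
    unfolding has_vector_derivative_def has_derivative_at_alt
  proof (intro conjI allI impI bounded_linear_scaleR_left)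
    fix e :: real assume e: "0 < e"
    let ?L = "DF \<epsilon>0 (X \<epsilon>0)"
    have xD: "X \<epsilon>0 \<in> D" using X(1)[OF \<epsilon>0] by simp
    obtain C d1 where C: "0 \<le> C" "0 < d1" "\<And>\<epsilon>. \<bar>\<epsilon>\<bar> < e0 \<Longrightarrow> \<bar>\<epsilon> - \<epsilon>0\<bar> < d1 \<Longrightarrow> norm (X \<epsilon> - X \<epsilon>0) \<le> C * \<bar>\<epsilon> - \<epsilon>0\<bar>"
      using lipX[OF \<epsilon>0] by blast
    \<comment> \<open>The factor 1 + C accounts for the displacement of the pair, the factor 1 - q
      for moving the contraction term to the other side.\<close>
    define e' where "e' = e * (1 - q) / (1 + C)"
    have e': "0 < e'" using e q C by (simp add: e'_def)
    obtain d where d: "0 < d" "\<And>z. z \<in> {-e0<..<e0} \<times> D \<Longrightarrow> norm (z - (\<epsilon>0, X \<epsilon>0)) < d \<Longrightarrow>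
       norm (F (fst z) (snd z) - F \<epsilon>0 (X \<epsilon>0) - ?L (z - (\<epsilon>0, X \<epsilon>0))) \<le> e' * norm (z - (\<epsilon>0, X \<epsilon>0))"
      using rem[OF \<epsilon>0 xD e'] by blast
    define d2 where "d2 = min (min d1 (e0 - \<bar>\<epsilon>0\<bar>)) (d / (1 + C))"
    have d2: "0 < d2" "d2 \<le> d1" "d2 \<le> e0 - \<bar>\<epsilon>0\<bar>" "d2 \<le> d / (1 + C)"
      using C d \<epsilon>0 by (auto simp: d2_def)
    show "\<exists>d>0. \<forall>y. norm (y - \<epsilon>0) < d \<longrightarrow> norm (X y - X \<epsilon>0 - (y - \<epsilon>0) *\<^sub>R X' \<epsilon>0) \<le> e * norm (y - \<epsilon>0)"
    proof (intro exI[of _ d2] conjI allI impI d2)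
      fix y assume y: "norm (y - \<epsilon>0) < d2"
      then have y0: "\<bar>y\<bar> < e0" using d2 by simp
      let ?z = "(y, X y)"
      have n: "norm (?z - (\<epsilon>0, X \<epsilon>0)) \<le> (1 + C) * \<bar>y - \<epsilon>0\<bar>"
      proof -
        have "norm (?z - (\<epsilon>0, X \<epsilon>0)) \<le> norm (y - \<epsilon>0) + norm (X y - X \<epsilon>0)"
          using norm_Pair_le[of "y - \<epsilon>0" "X y - X \<epsilon>0"] by simp
        also have "\<dots> \<le> \<bar>y - \<epsilon>0\<bar> + C * \<bar>y - \<epsilon>0\<bar>" using C(3)[OF y0] y d2 by simp
        finally show ?thesis by (simp add: algebra_simps)
      qed
      have "(1 + C) * \<bar>y - \<epsilon>0\<bar> < d"
      proof -
        have "\<bar>y - \<epsilon>0\<bar> < d / (1 + C)" using y d2(4) by simp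
        moreover have "0 < 1 + C" using C by simp
        ultimately show ?thesis by (simp add: pos_less_divide_eq mult.commute)
      qed
      then have small: "norm (X y - X \<epsilon>0 - ?L (?z - (\<epsilon>0, X \<epsilon>0))) \<le> e' * norm (?z - (\<epsilon>0, X \<epsilon>0))"
        using d(2)[of ?z] X(1)[OF y0] X(1)[OF \<epsilon>0] y0 n by (auto simp: abs_less_iff)
      \<comment> \<open>The error of the linear approximation reproduces itself: it equals the
        Taylor remainder of F plus \<open>?L (0, ?\<Delta>)\<close>, and the contraction absorbs the
        second term.\<close>
      let ?\<Delta> = "X y - X \<epsilon>0 - (y - \<epsilon>0) *\<^sub>R X' \<epsilon>0"
      note lin = bounded_linear.linear[OF bl[OF \<epsilon>0 xD]]
      have "?L (?z - (\<epsilon>0, X \<epsilon>0)) = ?L ((y - \<epsilon>0) *\<^sub>R (1, X' \<epsilon>0) + (0, ?\<Delta>))"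
        by (simp add: algebra_simps)
      also have "\<dots> = (y - \<epsilon>0) *\<^sub>R X' \<epsilon>0 + ?L (0, ?\<Delta>)"
        by (simp only: linear_add[OF lin] linear_scale[OF lin] X'[OF \<epsilon>0])
      finally have eq: "?\<Delta> = (X y - X \<epsilon>0 - ?L (?z - (\<epsilon>0, X \<epsilon>0))) + ?L (0, ?\<Delta>)" by simp
      have "norm ?\<Delta> \<le> norm (X y - X \<epsilon>0 - ?L (?z - (\<epsilon>0, X \<epsilon>0))) + norm (?L (0, ?\<Delta>))"
        using norm_triangle_ineq[of "X y - X \<epsilon>0 - ?L (?z - (\<epsilon>0, X \<epsilon>0))" "?L (0, ?\<Delta>)"]
        by (simp only: eq[symmetric])
      also have "\<dots> \<le> e' * ((1 + C) * \<bar>y - \<epsilon>0\<bar>) + q * norm ?\<Delta>"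
        using small n e' contr[OF \<epsilon>0 xD, of ?\<Delta>]
        by (intro add_mono order_trans[OF small] mult_left_mono) auto
      also have "e' * ((1 + C) * \<bar>y - \<epsilon>0\<bar>) = e * (1 - q) * \<bar>y - \<epsilon>0\<bar>"
        using C by (simp add: e'_def)
      finally have "(1 - q) * norm ?\<Delta> \<le> (1 - q) * (e * \<bar>y - \<epsilon>0\<bar>)" by (simp add: algebra_simps)
      then show "norm ?\<Delta> \<le> e * norm (y - \<epsilon>0)" using q by simp
    qed
  qed
  have "continuous_on {-e0<..<e0} X'"
    unfolding continuous_on_def
  proof
    fix \<epsilon>0 assume "\<epsilon>0 \<in> {-e0<..<e0}"
    then have \<epsilon>0: "\<bar>\<epsilon>0\<bar> < e0" by auto
    let ?F = "at \<epsilon>0 within {-e0<..<e0}"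
    let ?z = "(1, X' \<epsilon>0)"
    have zD: "(\<epsilon>0, X \<epsilon>0) \<in> {-e0<..<e0} \<times> D" using \<epsilon>0 X(1)[OF \<epsilon>0] by auto
    have "((\<lambda>\<epsilon>. (\<epsilon>, X \<epsilon>)) \<longlongrightarrow> (\<epsilon>0, X \<epsilon>0)) ?F"
      by (intro tendsto_intros Xc[OF \<epsilon>0])
    moreover have "\<forall>\<^sub>F \<epsilon> in ?F. (\<epsilon>, X \<epsilon>) \<in> {-e0<..<e0} \<times> D"
      using X(1) by (auto simp: eventually_at_filter abs_less_iff intro!: always_eventually)
    ultimately have "((\<lambda>\<epsilon>. DF \<epsilon> (X \<epsilon>) ?z) \<longlongrightarrow> DF \<epsilon>0 (X \<epsilon>0) ?z) ?F"
      using continuous_on_tendsto_compose[OF cont[of ?z] _ zD, of "\<lambda>\<epsilon>. (\<epsilon>, X \<epsilon>)" ?F] by simp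
    then have lim: "((\<lambda>\<epsilon>. norm (DF \<epsilon> (X \<epsilon>) ?z - DF \<epsilon>0 (X \<epsilon>0) ?z) / (1 - q)) \<longlongrightarrow> 0) ?F"
      using q by (auto intro!: tendsto_eq_intros LIM_zero tendsto_norm_zero)
    have "((\<lambda>\<epsilon>. X' \<epsilon> - X' \<epsilon>0) \<longlongrightarrow> 0) ?F"
    proof (rule Lim_null_comparison[OF _ lim])
      have "norm (X' \<epsilon> - X' \<epsilon>0) \<le> norm (DF \<epsilon> (X \<epsilon>) ?z - DF \<epsilon>0 (X \<epsilon>0) ?z) / (1 - q)" if \<epsilon>: "\<bar>\<epsilon>\<bar> < e0" for \<epsilon>
      proof -
        have XD: "X \<epsilon> \<in> D" using X(1)[OF \<epsilon>] by simp
        have "DF \<epsilon> (X \<epsilon>) (1, X' \<epsilon>) - DF \<epsilon> (X \<epsilon>) ?z = DF \<epsilon> (X \<epsilon>) (0, X' \<epsilon> - X' \<epsilon>0)"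
          using linear_diff[OF bounded_linear.linear[OF bl[OF \<epsilon> XD]], of "(1, X' \<epsilon>)" ?z] by simp
        \<comment> \<open>In the difference of the two linearized equations the varying operators
          meet only the fixed vector \<open>(1, X' \<epsilon>0)\<close>, so continuity for each
          fixed argument is enough.\<close>
        then have eq: "X' \<epsilon> - X' \<epsilon>0 = DF \<epsilon> (X \<epsilon>) (0, X' \<epsilon> - X' \<epsilon>0) + (DF \<epsilon> (X \<epsilon>) ?z - DF \<epsilon>0 (X \<epsilon>0) ?z)"
          using X'[OF \<epsilon>] X'[OF \<epsilon>0] by (simp add: algebra_simps)
        have "norm (X' \<epsilon> - X' \<epsilon>0) \<le> norm (DF \<epsilon> (X \<epsilon>) (0, X' \<epsilon> - X' \<epsilon>0))
            + norm (DF \<epsilon> (X \<epsilon>) ?z - DF \<epsilon>0 (X \<epsilon>0) ?z)"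
          using norm_triangle_ineq[of "DF \<epsilon> (X \<epsilon>) (0, X' \<epsilon> - X' \<epsilon>0)" "DF \<epsilon> (X \<epsilon>) ?z - DF \<epsilon>0 (X \<epsilon>0) ?z"]
          by (simp only: eq[symmetric])
        then have "norm (X' \<epsilon> - X' \<epsilon>0) \<le> q * norm (X' \<epsilon> - X' \<epsilon>0) + norm (DF \<epsilon> (X \<epsilon>) ?z - DF \<epsilon>0 (X \<epsilon>0) ?z)"
          using contr[OF \<epsilon> XD, of "X' \<epsilon> - X' \<epsilon>0"] by linarith
        then show ?thesis using q by (simp add: field_simps)
      qed
      then show "\<forall>\<^sub>F \<epsilon> in ?F. norm (X' \<epsilon> - X' \<epsilon>0) \<le> norm (DF \<epsilon> (X \<epsilon>) ?z - DF \<epsilon>0 (X \<epsilon>0) ?z) / (1 - q)"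
        by (auto simp: eventually_at_filter abs_less_iff intro!: always_eventually)
    qed
    then show "(X' \<longlongrightarrow> X' \<epsilon>0) ?F" by (simp add: LIM_zero_iff)
  qed
  then show ?thesis using that X dX by blast
qed

section \<open>Superposition operators\<close>

lemma uniform_equicontinuous:
  fixes g :: "'b::metric_space \<Rightarrow> 'c::metric_space \<Rightarrow> 'd::metric_space"
  assumes K: "compact K" and D: "compact D"
    and cont: "continuous_on (K \<times> D) (\<lambda>z. g (fst z) (snd z))" and e: "0 < e"
  obtains d where "0 < d"
    "\<And>\<tau> p p'. \<tau> \<in> K \<Longrightarrow> p \<in> D \<Longrightarrow> p' \<in> D \<Longrightarrow> dist p' p < d \<Longrightarrow> dist (g \<tau> p') (g \<tau> p) < e"
proof -
  have "uniformly_continuous_on (K \<times> D) (\<lambda>z. g (fst z) (snd z))"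
    by (rule compact_uniformly_continuous[OF cont compact_Times[OF K D]])
  then obtain d where d: "0 < d" "\<And>z z'. z \<in> K \<times> D \<Longrightarrow> z' \<in> K \<times> D \<Longrightarrow> dist z' z < d \<Longrightarrow>
      dist (g (fst z') (snd z')) (g (fst z) (snd z)) < e"
    unfolding uniformly_continuous_on_def using e by meson
  show ?thesis
  proof (rule that[OF d(1)])
    fix \<tau> p p' assume "\<tau> \<in> K" "p \<in> D" "p' \<in> D" "dist p' p < d"
    then show "dist (g \<tau> p') (g \<tau> p) < e"
      using d(2)[of "(\<tau>, p)" "(\<tau>, p')"] by (simp add: dist_Pair_Pair)
  qed
qed

text \<open>On the segment from p to p' the gradient stays e-close to its value at p, with a modulus
  that is uniform in \<tau> by compactness; the mean value inequality then bounds the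
  remainder.\<close>

lemma uniform_Taylor:
  fixes \<rho> :: "'b::metric_space \<Rightarrow> 'c::euclidean_space \<Rightarrow> real" and grad :: "'b \<Rightarrow> 'c \<Rightarrow> 'c"
  assumes K: "compact K" and D: "compact D" "convex D"
    and cont: "continuous_on (K \<times> D) (\<lambda>z. grad (fst z) (snd z))"
    and deriv: "\<And>\<tau> p. \<tau> \<in> K \<Longrightarrow> p \<in> D \<Longrightarrow> (\<rho> \<tau> has_derivative (\<lambda>h. grad \<tau> p \<bullet> h)) (at p within D)"
    and e: "0 < e"
  obtains d where "0 < d"
    "\<And>\<tau> p p'. \<tau> \<in> K \<Longrightarrow> p \<in> D \<Longrightarrow> p' \<in> D \<Longrightarrow> norm (p' - p) < d \<Longrightarrow>
      \<bar>\<rho> \<tau> p' - \<rho> \<tau> p - grad \<tau> p \<bullet> (p' - p)\<bar> \<le> e * norm (p' - p)"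
proof -
  obtain d where d: "0 < d"
    "\<And>\<tau> p p'. \<tau> \<in> K \<Longrightarrow> p \<in> D \<Longrightarrow> p' \<in> D \<Longrightarrow> dist p' p < d \<Longrightarrow> dist (grad \<tau> p') (grad \<tau> p) < e"
    using uniform_equicontinuous[OF K D(1) cont e] by metis
  show ?thesis
  proof (rule that[OF d(1)])
    fix \<tau> p p' assume *: "\<tau> \<in> K" "p \<in> D" "p' \<in> D" "norm (p' - p) < d"
    have seg: "closed_segment p p' \<subseteq> D"
      using *(2,3) D(2) by (simp add: closed_segment_subset)
    have "norm (\<rho> \<tau> p' - \<rho> \<tau> p - (\<lambda>h. grad \<tau> p \<bullet> h) (p' - p)) \<le> norm (p' - p) * e"
    proof (rule differentiable_bound_linearization[where S = "closed_segment p p'" and f' = "\<lambda>x h. grad \<tau> x \<bullet> h"])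
      show "p + t *\<^sub>R (p' - p) \<in> closed_segment p p'" if "t \<in> {0..1}" for t
        using that by (auto simp: closed_segment_def algebra_simps intro!: exI[of _ t])
      show "(\<rho> \<tau> has_derivative (\<lambda>h. grad \<tau> x \<bullet> h)) (at x within closed_segment p p')"
        if "x \<in> closed_segment p p'" for x
        using deriv[OF *(1), of x] that seg by (blast intro: has_derivative_subset)
      show "onorm ((\<lambda>h. grad \<tau> x \<bullet> h) - (\<lambda>h. grad \<tau> p \<bullet> h)) \<le> e" if x: "x \<in> closed_segment p p'" for x
      proof (rule onorm_bound)
        fix h :: 'c
        have "dist x p \<le> dist p' p"
          using segment_bound[OF x] by (simp add: dist_norm norm_minus_commute)
        then have "norm (grad \<tau> x - grad \<tau> p) \<le> e"
          using d(2)[OF *(1,2), of x] x seg *(4) by (force simp: dist_norm)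
        then have "norm (grad \<tau> x - grad \<tau> p) * norm h \<le> e * norm h"
          by (intro mult_right_mono) auto
        then show "norm (((\<lambda>h. grad \<tau> x \<bullet> h) - (\<lambda>h. grad \<tau> p \<bullet> h)) h) \<le> e * norm h"
          using Cauchy_Schwarz_ineq2[of "grad \<tau> x - grad \<tau> p" h]
          by (simp add: inner_diff_left)
      qed (use e in simp)
    qed auto
    then show "\<bar>\<rho> \<tau> p' - \<rho> \<tau> p - grad \<tau> p \<bullet> (p' - p)\<bar> \<le> e * norm (p' - p)"
      by (simp add: mult.commute)
  qed
qed

type_synonym real4 = "real \<times> real \<times> real \<times> real"
type_synonym state = "(real \<Rightarrow>\<^sub>C real) \<times> (real \<Rightarrow>\<^sub>C real) \<times> real"

text \<open>The value at time t of the unknowns (\<epsilon>, Y, Y', scaled phase). It is linear in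
  them, so the derivative of a superposition is the pointwise gradient applied to the curve of the
  increment.\<close>

definition curve :: "real \<Rightarrow> state \<Rightarrow> real \<Rightarrow> real4" where
  "curve \<epsilon> x t = (\<epsilon>, fst x t, fst (snd x) t, snd (snd x))"

lemma curve_diff: "curve \<epsilon>' x' t - curve \<epsilon> x t = curve (\<epsilon>' - \<epsilon>) (x' - x) t"
  by (simp add: curve_def)

lemma curve_add: "curve (fst (z + z')) (snd (z + z')) t = curve (fst z) (snd z) t + curve (fst z') (snd z') t"
  by (simp add: curve_def)

lemma curve_scale: "curve (fst (c *\<^sub>R z)) (snd (c *\<^sub>R z)) t = c *\<^sub>R curve (fst z) (snd z) t"
  by (simp add: curve_def)

lemma curve_cont: "continuous_on S (curve \<epsilon> x)"
  unfolding curve_def by (intro continuous_intros continuous_on_apply_bcontfun)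

lemma norm_curve_le: "norm (curve (fst z) (snd z) t) \<le> 4 * norm z"
proof -
  obtain e Y V a where z: "z = (e, Y, V, a)" by (metis prod.exhaust)
  have n: "\<bar>e\<bar> \<le> norm z" "norm (Y, V, a) \<le> norm z"
    using norm_fst_le[of e "(Y, V, a)"] norm_snd_le[of "(Y, V, a)" e] by (simp_all add: z)
  then have "norm Y \<le> norm z" "norm (V, a) \<le> norm z"
    using norm_fst_le[of Y "(V, a)"] norm_snd_le[of "(V, a)" Y] by simp_all
  then have "norm Y \<le> norm z" "norm V \<le> norm z" "\<bar>a\<bar> \<le> norm z"
    using norm_fst_le[of V a] norm_snd_le[of a V] by simp_all
  then have b: "\<bar>Y t\<bar> \<le> norm z" "\<bar>V t\<bar> \<le> norm z" "\<bar>a\<bar> \<le> norm z"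
    using abs_apply_le_norm[of Y t] abs_apply_le_norm[of V t] by linarith+
  have "norm (e, Y t, V t, a) \<le> \<bar>e\<bar> + norm (Y t, V t, a)"
    using norm_Pair_le[of e "(Y t, V t, a)"] by simp
  also have "norm (Y t, V t, a) \<le> \<bar>Y t\<bar> + norm (V t, a)"
    using norm_Pair_le[of "Y t" "(V t, a)"] by simp
  also have "norm (V t, a) \<le> \<bar>V t\<bar> + \<bar>a\<bar>"
    using norm_Pair_le[of "V t" a] by simp
  finally show ?thesis using n b by (simp add: curve_def z)
qed

text \<open>A superposition operator on bounded functions is differentiable in the sup norm only if
  the Taylor remainders are small uniformly in t. Continuity alone cannot give this on the whole
  line, so \<open>taylor\<close> and \<open>grad_equi\<close> state the uniformity.\<close>

locale superposition =
  fixes \<rho> :: "real \<Rightarrow> real4 \<Rightarrow> real" and grad :: "real \<Rightarrow> real4 \<Rightarrow> real4"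
    and D :: "real4 set" and W :: "state set" and e0 B :: real
  assumes curve_in: "\<And>\<epsilon> x t. \<bar>\<epsilon>\<bar> < e0 \<Longrightarrow> x \<in> W \<Longrightarrow> curve \<epsilon> x t \<in> D"
    and \<rho>_cont: "\<And>p. continuous_on UNIV p \<Longrightarrow> (\<And>t. p t \<in> D) \<Longrightarrow> continuous_on UNIV (\<lambda>t. \<rho> t (p t))"
    and grad_cont: "\<And>p. continuous_on UNIV p \<Longrightarrow> (\<And>t. p t \<in> D) \<Longrightarrow> continuous_on UNIV (\<lambda>t. grad t (p t))"
    and \<rho>_le: "\<And>t p. p \<in> D \<Longrightarrow> \<bar>\<rho> t p\<bar> \<le> B"
    and grad_le: "\<And>t p. p \<in> D \<Longrightarrow> norm (grad t p) \<le> B"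
    and taylor: "\<And>e. 0 < e \<Longrightarrow> \<exists>d>0. \<forall>t. \<forall>p\<in>D. \<forall>p'\<in>D. norm (p' - p) < d \<longrightarrow>
      \<bar>\<rho> t p' - \<rho> t p - grad t p \<bullet> (p' - p)\<bar> \<le> e * norm (p' - p)"
    and grad_equi: "\<And>e. 0 < e \<Longrightarrow> \<exists>d>0. \<forall>t. \<forall>p\<in>D. \<forall>p'\<in>D. norm (p' - p) < d \<longrightarrow>
      norm (grad t p' - grad t p) \<le> e"
begin

definition superpose :: "real \<Rightarrow> state \<Rightarrow> real \<Rightarrow>\<^sub>C real" where
  "superpose \<epsilon> x = Bcontfun (\<lambda>t. \<rho> t (curve \<epsilon> x t))"

definition dsuperpose :: "real \<Rightarrow> state \<Rightarrow> real \<times> state \<Rightarrow> real \<Rightarrow>\<^sub>C real" where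
  "dsuperpose \<epsilon> x z = Bcontfun (\<lambda>t. grad t (curve \<epsilon> x t) \<bullet> curve (fst z) (snd z) t)"

context
  fixes \<epsilon> x assumes \<epsilon>x: "\<bar>\<epsilon>\<bar> < e0" "x \<in> W"
begin

lemma superpose_apply: "superpose \<epsilon> x t = \<rho> t (curve \<epsilon> x t)"
  unfolding superpose_def using curve_in[OF \<epsilon>x]
  by (subst Bcontfun_apply[where M = B]) (auto intro!: \<rho>_cont curve_cont \<rho>_le)

lemma dsuperpose_bound: "\<bar>grad t (curve \<epsilon> x t) \<bullet> curve (fst z) (snd z) t\<bar> \<le> B * (4 * norm z)"
proof -
  have "\<bar>grad t (curve \<epsilon> x t) \<bullet> curve (fst z) (snd z) t\<bar> \<le>
      norm (grad t (curve \<epsilon> x t)) * norm (curve (fst z) (snd z) t)"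
    by (rule Cauchy_Schwarz_ineq2)
  also have "\<dots> \<le> B * (4 * norm z)"
    using norm_curve_le[of z t] grad_le[OF curve_in[OF \<epsilon>x], of t t] norm_ge_zero[of "grad t (curve \<epsilon> x t)"]
    by (intro mult_mono norm_ge_zero) linarith+
  finally show ?thesis .
qed

lemma dsuperpose_apply: "dsuperpose \<epsilon> x z t = grad t (curve \<epsilon> x t) \<bullet> curve (fst z) (snd z) t"
  unfolding dsuperpose_def using curve_in[OF \<epsilon>x]
  by (subst Bcontfun_apply[where M = "B * (4 * norm z)"])
     (auto intro!: continuous_intros grad_cont curve_cont dsuperpose_bound)

lemma dsuperpose_bounded_linear: "bounded_linear (dsuperpose \<epsilon> x)"
proof (rule bounded_linear_intro)
  show "dsuperpose \<epsilon> x (z + z') = dsuperpose \<epsilon> x z + dsuperpose \<epsilon> x z'" for z z'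
    by (rule bcontfun_eqI) (simp only: dsuperpose_apply curve_add plus_bcontfun.rep_eq inner_add_right)
  show "dsuperpose \<epsilon> x (c *\<^sub>R z) = c *\<^sub>R dsuperpose \<epsilon> x z" for c z
    by (rule bcontfun_eqI) (simp only: dsuperpose_apply curve_scale scaleR_bcontfun.rep_eq inner_scaleR_right real_scaleR_def)
  show "norm (dsuperpose \<epsilon> x z) \<le> norm z * (B * 4)" for z
    by (rule norm_bcontfun_le) (use dsuperpose_bound in \<open>simp add: dsuperpose_apply mult.commute mult.left_commute\<close>)
qed

end

lemma superpose_has_derivative:
  assumes \<epsilon>x: "\<bar>\<epsilon>\<bar> < e0" "x \<in> W"
  shows "((\<lambda>z. superpose (fst z) (snd z)) has_derivative dsuperpose \<epsilon> x) (at (\<epsilon>, x) within {-e0<..<e0} \<times> W)"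
  unfolding has_derivative_within_alt
proof (intro conjI dsuperpose_bounded_linear[OF \<epsilon>x] allI impI)
  fix e :: real assume e: "0 < e"
  \<comment> \<open>The quarter, here and in the radius below, pays for the factor 4 of
    \<open>norm_curve_le\<close>.\<close>
  then obtain d where d: "0 < d" "\<And>t p p'. p \<in> D \<Longrightarrow> p' \<in> D \<Longrightarrow> norm (p' - p) < d \<Longrightarrow>
      \<bar>\<rho> t p' - \<rho> t p - grad t p \<bullet> (p' - p)\<bar> \<le> e / 4 * norm (p' - p)"
    using taylor[of "e / 4"] by auto
  show "\<exists>d>0. \<forall>z\<in>{-e0<..<e0} \<times> W. norm (z - (\<epsilon>, x)) < d \<longrightarrow>
      norm (superpose (fst z) (snd z) - superpose (fst (\<epsilon>, x)) (snd (\<epsilon>, x)) - dsuperpose \<epsilon> x (z - (\<epsilon>, x))) \<le> e * norm (z - (\<epsilon>, x))"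
  proof (intro exI[of _ "d / 4"] conjI ballI impI)
    show "0 < d / 4" using d by simp
    fix z assume z: "z \<in> {-e0<..<e0} \<times> W" "norm (z - (\<epsilon>, x)) < d / 4"
    obtain \<epsilon>' x' where phase_point: "z = (\<epsilon>', x')" by (cases z)
    have \<epsilon>x': "\<bar>\<epsilon>'\<bar> < e0" "x' \<in> W" using z phase_point by auto
    have nz: "norm (curve \<epsilon>' x' t - curve \<epsilon> x t) \<le> 4 * norm (z - (\<epsilon>, x))" for t
      using norm_curve_le[of "z - (\<epsilon>, x)" t] by (simp add: phase_point curve_diff)
    show "norm (superpose (fst z) (snd z) - superpose (fst (\<epsilon>, x)) (snd (\<epsilon>, x)) - dsuperpose \<epsilon> x (z - (\<epsilon>, x))) \<le> e * norm (z - (\<epsilon>, x))"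
    proof (rule norm_bcontfun_le)
      fix t
      have "\<bar>\<rho> t (curve \<epsilon>' x' t) - \<rho> t (curve \<epsilon> x t) - grad t (curve \<epsilon> x t) \<bullet> (curve \<epsilon>' x' t - curve \<epsilon> x t)\<bar>
          \<le> e / 4 * norm (curve \<epsilon>' x' t - curve \<epsilon> x t)"
        using nz[of t] z by (intro d curve_in \<epsilon>x \<epsilon>x') auto
      also have "\<dots> \<le> e / 4 * (4 * norm (z - (\<epsilon>, x)))"
        using nz[of t] e by (intro mult_left_mono) auto
      finally show "\<bar>(superpose (fst z) (snd z) - superpose (fst (\<epsilon>, x)) (snd (\<epsilon>, x)) - dsuperpose \<epsilon> x (z - (\<epsilon>, x))) t\<bar> \<le> e * norm (z - (\<epsilon>, x))"
        by (simp add: superpose_apply[OF \<epsilon>x] superpose_apply[OF \<epsilon>x'] dsuperpose_apply[OF \<epsilon>x] phase_point curve_diff)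
    qed
  qed
qed

lemma dsuperpose_continuous: "continuous_on ({-e0<..<e0} \<times> W) (\<lambda>z. dsuperpose (fst z) (snd z) \<zeta>)"
  unfolding continuous_on_iff
proof (intro ballI allI impI)
  fix z and e :: real assume z: "z \<in> {-e0<..<e0} \<times> W" and e: "0 < e"
  obtain \<epsilon> x where phase_point: "z = (\<epsilon>, x)" by (cases z)
  have \<epsilon>x: "\<bar>\<epsilon>\<bar> < e0" "x \<in> W" using z phase_point by auto
  define M where "M = 4 * norm \<zeta> + 1"
  have M: "0 < M" by (simp add: M_def add_nonneg_pos)
  obtain d where d: "0 < d" "\<And>t p p'. p \<in> D \<Longrightarrow> p' \<in> D \<Longrightarrow> norm (p' - p) < d \<Longrightarrow>
      norm (grad t p' - grad t p) \<le> e / 2 / M"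
    using grad_equi[of "e / 2 / M"] e M by auto
  show "\<exists>d>0. \<forall>z'\<in>{-e0<..<e0} \<times> W. dist z' z < d \<longrightarrow>
      dist (dsuperpose (fst z') (snd z') \<zeta>) (dsuperpose (fst z) (snd z) \<zeta>) < e"
  proof (intro exI[of _ "d / 4"] conjI ballI impI)
    show "0 < d / 4" using d by simp
    fix z' assume z': "z' \<in> {-e0<..<e0} \<times> W" "dist z' z < d / 4"
    obtain \<epsilon>' x' where phase_point': "z' = (\<epsilon>', x')" by (cases z')
    have \<epsilon>x': "\<bar>\<epsilon>'\<bar> < e0" "x' \<in> W" using z' phase_point' by auto
    have nz: "norm (curve \<epsilon>' x' t - curve \<epsilon> x t) < d" for t
      using norm_curve_le[of "z' - z" t] z'(2) by (simp add: phase_point phase_point' curve_diff dist_norm)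
    have "norm (dsuperpose \<epsilon>' x' \<zeta> - dsuperpose \<epsilon> x \<zeta>) \<le> e / 2"
    proof (rule norm_bcontfun_le)
      fix t
      have "\<bar>(grad t (curve \<epsilon>' x' t) - grad t (curve \<epsilon> x t)) \<bullet> curve (fst \<zeta>) (snd \<zeta>) t\<bar>
          \<le> norm (grad t (curve \<epsilon>' x' t) - grad t (curve \<epsilon> x t)) * norm (curve (fst \<zeta>) (snd \<zeta>) t)"
        by (rule Cauchy_Schwarz_ineq2)
      also have "\<dots> \<le> (e / 2 / M) * M"
        using d(2)[OF curve_in[OF \<epsilon>x] curve_in[OF \<epsilon>x'] nz, of t t] norm_curve_le[of \<zeta> t] e M
        by (intro mult_mono) (auto simp: M_def)
      also have "\<dots> = e / 2" using M by simp
      finally show "\<bar>(dsuperpose \<epsilon>' x' \<zeta> - dsuperpose \<epsilon> x \<zeta>) t\<bar> \<le> e / 2"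
        by (simp add: dsuperpose_apply[OF \<epsilon>x] dsuperpose_apply[OF \<epsilon>x'] inner_diff_left)
    qed
    then show "dist (dsuperpose (fst z') (snd z') \<zeta>) (dsuperpose (fst z) (snd z) \<zeta>) < e"
      using e by (simp add: phase_point phase_point' dist_norm)
  qed
qed

end

section \<open>Solutions near a saddle\<close>

text \<open>With w = v' and z = v'' the right-hand side is the second derivative of the squared norm
  of v. The error costs at most \<open>3 * \<nu>\<close> times this square, half of the main term,
  and a multiple of the square of w that the term in w absorbs. The inner product form covers the
  complex Floquet solutions as well.\<close>

lemma saddle_convexity:
  fixes v w z :: "'a::real_inner"
  assumes \<nu>: "0 \<le> \<nu>" "\<nu> \<le> 2" "3 * \<nu> \<le> \<kappa>\<^sup>2"
    and z: "norm (z - \<kappa>\<^sup>2 *\<^sub>R v) \<le> \<nu> * (norm v + norm w)"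
  shows "\<kappa>\<^sup>2 * (v \<bullet> v) \<le> 2 * (w \<bullet> w) + 2 * (v \<bullet> z)"
proof -
  have "\<bar>v \<bullet> (z - \<kappa>\<^sup>2 *\<^sub>R v)\<bar> \<le> norm v * (\<nu> * (norm v + norm w))"
    using Cauchy_Schwarz_ineq2[of v "z - \<kappa>\<^sup>2 *\<^sub>R v"] mult_left_mono[OF z, of "norm v"] by simp
  then have 1: "- (norm v * (\<nu> * (norm v + norm w))) \<le> v \<bullet> z - \<kappa>\<^sup>2 * (v \<bullet> v)"
    by (simp add: inner_diff_right)
  have 2: "2 * (norm v * (\<nu> * (norm v + norm w))) \<le> 3 * \<nu> * (norm v)\<^sup>2 + \<nu> * (norm w)\<^sup>2"
  proof -
    have "\<nu> * (2 * norm v * norm w) \<le> \<nu> * ((norm v)\<^sup>2 + (norm w)\<^sup>2)"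
      using \<nu> by (intro mult_left_mono sum_squares_bound) auto
    then show ?thesis by (simp add: power2_eq_square algebra_simps)
  qed
  have 3: "3 * \<nu> * (norm v)\<^sup>2 \<le> \<kappa>\<^sup>2 * (norm v)\<^sup>2" "\<nu> * (norm w)\<^sup>2 \<le> 2 * (norm w)\<^sup>2"
    using \<nu> by (intro mult_right_mono; simp)+
  show ?thesis using 1 2 3 unfolding power2_norm_eq_inner by linarith
qed

lemma saddle_unique_bounded:
  fixes v w z :: "real \<Rightarrow> 'a::real_inner"
  assumes \<kappa>: "0 < \<kappa>" and \<nu>: "0 \<le> \<nu>" "\<nu> \<le> 2" "3 * \<nu> \<le> \<kappa>\<^sup>2"
    and v: "\<And>t. (v has_vector_derivative w t) (at t)"
    and w: "\<And>t. (w has_vector_derivative z t) (at t)"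
    and z: "\<And>t. norm (z t - \<kappa>\<^sup>2 *\<^sub>R v t) \<le> \<nu> * (norm (v t) + norm (w t))"
    and bd: "\<And>t. norm (v t) \<le> B"
  shows "v t = 0"
proof -
  have "v t \<bullet> v t = 0"
  proof (rule eq_0_of_bounded_convex[OF \<kappa>, where N = "\<lambda>t. v t \<bullet> v t" and N' = "\<lambda>t. 2 * (v t \<bullet> w t)"
        and N'' = "\<lambda>t. 2 * (w t \<bullet> w t) + 2 * (v t \<bullet> z t)" and B = "B\<^sup>2"])
    show "((\<lambda>t. v t \<bullet> v t) has_real_derivative 2 * (v t \<bullet> w t)) (at t)" for t
      using has_derivative_inner[OF v[unfolded has_vector_derivative_def] v[unfolded has_vector_derivative_def], of t]
      by (rule has_derivative_imp_has_field_derivative) (simp add: inner_commute algebra_simps)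
    show "((\<lambda>t. 2 * (v t \<bullet> w t)) has_real_derivative 2 * (w t \<bullet> w t) + 2 * (v t \<bullet> z t)) (at t)" for t
      using has_derivative_mult_right[OF has_derivative_inner[OF v[unfolded has_vector_derivative_def] w[unfolded has_vector_derivative_def], of t], of 2]
      by (rule has_derivative_imp_has_field_derivative) (simp add: inner_commute algebra_simps)
    show "\<kappa>\<^sup>2 * (v t \<bullet> v t) \<le> 2 * (w t \<bullet> w t) + 2 * (v t \<bullet> z t)" for t
      by (rule saddle_convexity[OF \<nu> z])
    show "v t \<bullet> v t \<le> B\<^sup>2" for t
      using power_mono[OF bd[of t], of 2] by (simp add: power2_norm_eq_inner)
  qed simp
  then show ?thesis by simp
qed

lemma saddle_asymptotic:
  fixes v w z :: "real \<Rightarrow> real"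
  assumes \<kappa>: "0 < \<kappa>" and \<nu>: "0 \<le> \<nu>" "\<nu> \<le> 2" "3 * \<nu> \<le> \<kappa>\<^sup>2"
    and v: "\<And>t. (v has_real_derivative w t) (at t)"
    and w: "\<And>t. (w has_real_derivative z t) (at t)"
    and z: "\<And>t. T \<le> t \<Longrightarrow> \<bar>z t - \<kappa>\<^sup>2 * v t\<bar> \<le> \<nu> * (\<bar>v t\<bar> + \<bar>w t\<bar>)"
    and bd: "\<And>t. T \<le> t \<Longrightarrow> \<bar>v t\<bar> \<le> B"
  shows "(v \<longlongrightarrow> 0) at_top"
proof -
  have "((\<lambda>t. (v t)\<^sup>2) \<longlongrightarrow> 0) at_top"
  proof (rule tendsto_0_of_bounded_convex[OF \<kappa>, where T = T and N = "\<lambda>t. (v t)\<^sup>2"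
        and N' = "\<lambda>t. 2 * (v t * w t)" and N'' = "\<lambda>t. 2 * (w t * w t) + 2 * (v t * z t)" and B = "B\<^sup>2"])
    show "((\<lambda>t. (v t)\<^sup>2) has_real_derivative 2 * (v t * w t)) (at t)" for t
      by (auto intro!: derivative_eq_intros v)
    show "((\<lambda>t. 2 * (v t * w t)) has_real_derivative 2 * (w t * w t) + 2 * (v t * z t)) (at t)" for t
      by (auto intro!: derivative_eq_intros v w simp: algebra_simps)
    show "\<kappa>\<^sup>2 * (v t)\<^sup>2 \<le> 2 * (w t * w t) + 2 * (v t * z t)" if "T \<le> t" for t
      using saddle_convexity[OF \<nu>, of "z t" "v t" "w t"] z[OF that] by (simp add: power2_eq_square)
    show "(v t)\<^sup>2 \<le> B\<^sup>2" if "T \<le> t" for t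
      using power_mono[OF bd[OF that], of 2] by simp
  qed simp
  then have "((\<lambda>t. sqrt ((v t)\<^sup>2)) \<longlongrightarrow> sqrt 0) at_top" by (rule tendsto_real_sqrt)
  then show ?thesis by (simp add: tendsto_rabs_zero_iff)
qed

lemma periodic_of_int:
  fixes g :: "real \<Rightarrow> 'a"
  assumes "\<And>t. g (t + 1) = g t"
  shows "g (t + of_int n) = g t"
proof -
  have nat: "g (t + of_nat m) = g t" for t m
  proof (induction m)
    case (Suc m)
    then show ?case using assms[of "t + of_nat m"] by (simp add: algebra_simps)
  qed simp
  show ?thesis
  proof (cases "0 \<le> n")
    case True
    then show ?thesis using nat[of t "nat n"] by simp
  next
    case False
    then show ?thesis using nat[of "t + of_int n" "nat (- n)"] by simp
  qed
qed

lemma periodic_frac: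
  fixes g :: "real \<Rightarrow> 'a"
  assumes "\<And>t. g (t + 1) = g t"
  shows "g (frac t - s) = g (t - s)"
  using periodic_of_int[where g = g, OF assms, of "frac t - s" "\<lfloor>t\<rfloor>"] by (simp add: frac_def algebra_simps)

lemma periodic_bounded:
  fixes g :: "real \<Rightarrow> real"
  assumes "\<And>t. g (t + 1) = g t" "continuous_on UNIV g"
  obtains G where "0 < G" "\<And>t. \<bar>g t\<bar> \<le> G"
proof -
  have "compact (g ` {0..1})"
    by (intro compact_continuous_image continuous_on_subset[OF assms(2)]) auto
  then obtain G where G: "0 < G" "\<And>t. t \<in> {0..1} \<Longrightarrow> norm (g t) \<le> G"
    using compact_imp_bounded bounded_pos by (metis imageI)
  have "\<bar>g t\<bar> \<le> G" for t
    using G(2)[of "frac t"] periodic_frac[of g t 0, OF assms(1)]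
    by (simp add: frac_ge_0 frac_lt_1 less_imp_le)
  then show ?thesis using that G by blast
qed

text \<open>\<Omega> is the set of states whose energy minus d lies in J. Only there k is the
  intended composition with the inverse of H, so membership in \<Omega> becomes part of being a
  solution.\<close>

locale perturbed_oscillator =
  fixes f f1 f2 \<gamma> \<gamma>1 :: "real \<Rightarrow> real" and k k1 k2 :: "real \<times> real \<Rightarrow> real" and \<Omega> :: "(real \<times> real) set"
  assumes f: "\<And>x. (f has_real_derivative f1 x) (at x)"
    and f1: "\<And>x. (f1 has_real_derivative f2 x) (at x)"
    and f2_cont: "continuous_on UNIV f2"
    and \<gamma>: "\<And>t. (\<gamma> has_real_derivative \<gamma>1 t) (at t)"
    and \<gamma>1_cont: "continuous_on UNIV \<gamma>1"
    and \<gamma>_per: "\<And>t. \<gamma> (t + 1) = \<gamma> t"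
    and \<Omega>: "open \<Omega>"
    and k: "\<And>z. z \<in> \<Omega> \<Longrightarrow> (k has_derivative (\<lambda>h. k1 z * fst h + k2 z * snd h)) (at z)"
    and k1_cont: "continuous_on \<Omega> k1" and k2_cont: "continuous_on \<Omega> k2"
begin

definition sol :: "real \<Rightarrow> (real \<Rightarrow> real) \<Rightarrow> (real \<Rightarrow> real) \<Rightarrow> bool" where
  "sol \<epsilon> \<psi> \<psi>' \<longleftrightarrow> (\<forall>t. (\<psi> has_real_derivative \<psi>' t) (at t) \<and>
     (\<psi>' has_real_derivative f (\<psi> t) + \<epsilon> * \<gamma> t * k (\<psi> t, \<psi>' t)) (at t) \<and> (\<psi> t, \<psi>' t) \<in> \<Omega>)"

lemma f_cont: "continuous_on S f" and f1_cont: "continuous_on S f1" and \<gamma>_cont: "continuous_on S \<gamma>"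
  by (rule continuous_on_DERIV[OF f] continuous_on_DERIV[OF f1] continuous_on_DERIV[OF \<gamma>])+

lemma k_cont: "continuous_on \<Omega> k"
  using k by (meson continuous_at_imp_continuous_on has_derivative_continuous)

lemma \<gamma>_bounded: obtains G where "0 < G" "\<And>t. \<bar>\<gamma> t\<bar> \<le> G"
  using periodic_bounded[OF \<gamma>_per \<gamma>_cont] by blast

lemma sol_shift: "sol \<epsilon> \<psi> \<psi>' \<Longrightarrow> sol \<epsilon> (\<lambda>t. \<psi> (t + 1)) (\<lambda>t. \<psi>' (t + 1))"
  unfolding sol_def using \<gamma>_per DERIV_shift by metis

text \<open>Near (p, 0) the right-hand side differs from the linear one by a function with the small
  Lipschitz constant \<nu>. One half of \<nu> is spent on the variation of f' and the other half on
  the forcing.\<close>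

lemma saddle_estimates:
  assumes p: "(p, 0) \<in> \<Omega>" and \<kappa>: "f1 p = \<kappa>\<^sup>2" and \<nu>: "0 < \<nu>"
  obtains r e1 C where "0 < r" "0 < e1" "0 \<le> C"
    "\<And>x y. \<bar>x - p\<bar> \<le> r \<Longrightarrow> \<bar>y\<bar> \<le> r \<Longrightarrow> (x, y) \<in> \<Omega>"
    "\<And>\<epsilon> t x y. \<bar>x - p\<bar> \<le> r \<Longrightarrow> \<bar>y\<bar> \<le> r \<Longrightarrow> \<bar>\<epsilon> * \<gamma> t * k (x, y)\<bar> \<le> C * \<bar>\<epsilon>\<bar>"
    "\<And>\<epsilon> t x y x' y'. \<bar>\<epsilon>\<bar> < e1 \<Longrightarrow> \<bar>x - p\<bar> \<le> r \<Longrightarrow> \<bar>y\<bar> \<le> r \<Longrightarrow> \<bar>x' - p\<bar> \<le> r \<Longrightarrow> \<bar>y'\<bar> \<le> r \<Longrightarrow>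
      \<bar>(f x + \<epsilon> * \<gamma> t * k (x, y)) - (f x' + \<epsilon> * \<gamma> t * k (x', y')) - \<kappa>\<^sup>2 * (x - x')\<bar>
        \<le> \<nu> * (\<bar>x - x'\<bar> + \<bar>y - y'\<bar>)"
    "\<And>\<epsilon> t x y. \<bar>\<epsilon>\<bar> < e1 \<Longrightarrow> \<bar>x - p\<bar> \<le> r \<Longrightarrow> \<bar>y\<bar> \<le> r \<Longrightarrow>
      \<bar>f1 x + \<epsilon> * \<gamma> t * k1 (x, y) - \<kappa>\<^sup>2\<bar> \<le> \<nu> \<and> \<bar>\<epsilon> * \<gamma> t * k2 (x, y)\<bar> \<le> \<nu>"
proof -
  obtain G where G: "0 < G" "\<And>t. \<bar>\<gamma> t\<bar> \<le> G" by (rule \<gamma>_bounded) blast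
  obtain d where d: "0 < d" "cball (p, 0) d \<subseteq> \<Omega>" using \<Omega> p open_contains_cball by blast
  have "isCont f1 p" using f1_cont[of UNIV] by (simp add: continuous_on_eq_continuous_at)
  then obtain d1 where d1: "0 < d1" "\<And>x. \<bar>x - p\<bar> < d1 \<Longrightarrow> \<bar>f1 x - f1 p\<bar> < \<nu> / 2"
    unfolding continuous_at_eps_delta using \<nu> by (metis dist_real_def half_gt_zero)
  \<comment> \<open>A square of half side d / 2 fits into the ball of radius d inside
    \<Omega>.\<close>
  define r where "r = min (d / 2) (d1 / 2)"
  have r: "0 < r" "r \<le> d / 2" "r < d1" using d d1 by (auto simp: r_def)
  define Q where "Q = {p - r..p + r} \<times> {- r..r}"
  have Qiff: "(x, y) \<in> Q \<longleftrightarrow> \<bar>x - p\<bar> \<le> r \<and> \<bar>y\<bar> \<le> r" for x y by (auto simp: Q_def)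
  have Q\<Omega>: "Q \<subseteq> \<Omega>"
  proof
    fix z assume z: "z \<in> Q"
    obtain x y where phase_point: "z = (x, y)" by (cases z)
    have "norm (p - x, - y) \<le> \<bar>p - x\<bar> + \<bar>y\<bar>" using norm_Pair_le[of "p - x" "- y"] by simp
    then have "dist (p, 0) z \<le> d"
      using z r by (simp add: phase_point Qiff dist_norm abs_minus_commute)
    then show "z \<in> \<Omega>" using d by auto
  qed
  have Qc: "compact Q" "convex Q" unfolding Q_def by (auto intro!: compact_Times convex_Times)
  have bnd: "\<exists>B>0. \<forall>z\<in>Q. \<bar>g z\<bar> \<le> B" if "continuous_on \<Omega> g" for g :: "real \<times> real \<Rightarrow> real"
  proof -
    have "compact (g ` Q)" using that Q\<Omega> Qc by (blast intro: compact_continuous_image continuous_on_subset)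
    then show ?thesis using compact_imp_bounded[of "g ` Q"] unfolding bounded_pos by auto
  qed
  obtain B0 B1 B2 where B: "0 < B0" "0 < B1" "0 < B2"
    "\<And>z. z \<in> Q \<Longrightarrow> \<bar>k z\<bar> \<le> B0" "\<And>z. z \<in> Q \<Longrightarrow> \<bar>k1 z\<bar> \<le> B1" "\<And>z. z \<in> Q \<Longrightarrow> \<bar>k2 z\<bar> \<le> B2"
    using bnd[OF k_cont] bnd[OF k1_cont] bnd[OF k2_cont] by metis
  \<comment> \<open>\<open>B1 + B2\<close> is a Lipschitz constant of k on Q and G bounds \<gamma>,
    so the forcing gets Lipschitz constant at most \<nu> / 2.\<close>
  define e1 where "e1 = \<nu> / (2 * (G * (B1 + B2)))"
  have e1: "0 < e1" using G B \<nu> by (simp add: e1_def)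
  have small: "\<bar>\<epsilon>\<bar> * (G * (B1 + B2)) \<le> \<nu> / 2" if "\<bar>\<epsilon>\<bar> < e1" for \<epsilon>
  proof -
    have "\<bar>\<epsilon>\<bar> * (G * (B1 + B2)) \<le> e1 * (G * (B1 + B2))" using that G B by (intro mult_right_mono) auto
    also have "\<dots> = \<nu> / 2" using G B by (simp add: e1_def)
    finally show ?thesis .
  qed
  have kl: "\<bar>k z - k z'\<bar> \<le> (B1 + B2) * norm (z - z')" if "z \<in> Q" "z' \<in> Q" for z z'
  proof -
    have "norm (k z - k z') \<le> (B1 + B2) * norm (z - z')"
    proof (rule differentiable_bound[OF Qc(2) _ _ that])
      show "(k has_derivative (\<lambda>h. k1 z * fst h + k2 z * snd h)) (at z within Q)" if "z \<in> Q" for z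
        using k[of z] that Q\<Omega> by (blast intro: has_derivative_at_withinI)
      show "onorm (\<lambda>h. k1 z * fst h + k2 z * snd h) \<le> B1 + B2" if z: "z \<in> Q" for z
      proof (rule onorm_bound)
        fix h :: "real \<times> real"
        have "\<bar>fst h\<bar> \<le> norm h" "\<bar>snd h\<bar> \<le> norm h"
          using norm_fst_le[of "fst h" "snd h"] norm_snd_le[of "snd h" "fst h"] by simp_all
        then have "\<bar>k1 z\<bar> * \<bar>fst h\<bar> \<le> B1 * norm h" "\<bar>k2 z\<bar> * \<bar>snd h\<bar> \<le> B2 * norm h"
          using B(2,3) B(5)[OF z] B(6)[OF z] by (auto intro!: mult_mono)
        then show "norm (k1 z * fst h + k2 z * snd h) \<le> (B1 + B2) * norm h"
          unfolding abs_mult[symmetric] by (simp add: algebra_simps)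
      qed (use B in simp)
    qed
    then show ?thesis by simp
  qed
  have fl: "\<bar>f x - f x' - \<kappa>\<^sup>2 * (x - x')\<bar> \<le> \<nu> / 2 * \<bar>x - x'\<bar>" if "\<bar>x - p\<bar> \<le> r" "\<bar>x' - p\<bar> \<le> r" for x x'
  proof -
    have "norm ((\<lambda>x. f x - \<kappa>\<^sup>2 * x) x - (\<lambda>x. f x - \<kappa>\<^sup>2 * x) x') \<le> \<nu> / 2 * norm (x - x')"
    proof (rule field_differentiable_bound)
      show "convex {p - r..p + r}" by simp
      show "((\<lambda>x. f x - \<kappa>\<^sup>2 * x) has_real_derivative f1 x - \<kappa>\<^sup>2) (at x within {p - r..p + r})" for x
        using f by (auto intro!: derivative_eq_intros has_field_derivative_at_within[OF f])
      show "norm (f1 x - \<kappa>\<^sup>2) \<le> \<nu> / 2" if "x \<in> {p - r..p + r}" for x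
        using d1(2)[of x] that r by (simp add: \<kappa> less_imp_le abs_less_iff)
    qed (use that in auto)
    then show ?thesis by (simp add: algebra_simps)
  qed
  show ?thesis
  proof (rule that[of r e1 "G * B0"])
    show "(x, y) \<in> \<Omega>" if "\<bar>x - p\<bar> \<le> r" "\<bar>y\<bar> \<le> r" for x y using that Q\<Omega> Qiff by blast
    show "\<bar>\<epsilon> * \<gamma> t * k (x, y)\<bar> \<le> G * B0 * \<bar>\<epsilon>\<bar>" if "\<bar>x - p\<bar> \<le> r" "\<bar>y\<bar> \<le> r" for \<epsilon> t x y
    proof -
      have "\<bar>\<gamma> t\<bar> * \<bar>k (x, y)\<bar> \<le> G * B0" using G B that Qiff by (intro mult_mono) auto
      then have "\<bar>\<epsilon>\<bar> * (\<bar>\<gamma> t\<bar> * \<bar>k (x, y)\<bar>) \<le> \<bar>\<epsilon>\<bar> * (G * B0)" by (intro mult_left_mono) auto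
      then show ?thesis by (simp add: abs_mult algebra_simps)
    qed
    show "\<bar>(f x + \<epsilon> * \<gamma> t * k (x, y)) - (f x' + \<epsilon> * \<gamma> t * k (x', y')) - \<kappa>\<^sup>2 * (x - x')\<bar>
        \<le> \<nu> * (\<bar>x - x'\<bar> + \<bar>y - y'\<bar>)"
      if \<epsilon>: "\<bar>\<epsilon>\<bar> < e1" and Q: "\<bar>x - p\<bar> \<le> r" "\<bar>y\<bar> \<le> r" "\<bar>x' - p\<bar> \<le> r" "\<bar>y'\<bar> \<le> r" for \<epsilon> t x y x' y'
    proof -
      let ?s = "\<bar>x - x'\<bar> + \<bar>y - y'\<bar>"
      have n: "norm ((x, y) - (x', y')) \<le> ?s" using norm_Pair_le[of "x - x'" "y - y'"] by simp
      have "\<bar>k (x, y) - k (x', y')\<bar> \<le> (B1 + B2) * norm ((x, y) - (x', y'))"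
        by (rule kl) (use Q Qiff in auto)
      also have "\<dots> \<le> (B1 + B2) * ?s" using B by (intro mult_left_mono n) auto
      finally have "\<bar>\<gamma> t\<bar> * \<bar>k (x, y) - k (x', y')\<bar> \<le> G * ((B1 + B2) * ?s)"
        using G by (intro mult_mono) auto
      then have "\<bar>\<epsilon>\<bar> * (\<bar>\<gamma> t\<bar> * \<bar>k (x, y) - k (x', y')\<bar>) \<le> \<bar>\<epsilon>\<bar> * (G * ((B1 + B2) * ?s))"
        by (intro mult_left_mono) auto
      also have "\<dots> = (\<bar>\<epsilon>\<bar> * (G * (B1 + B2))) * ?s" by (simp only: mult.assoc)
      also have "\<dots> \<le> \<nu> / 2 * ?s" using small[OF \<epsilon>] by (intro mult_right_mono) auto
      finally have "\<bar>\<epsilon> * \<gamma> t * (k (x, y) - k (x', y'))\<bar> \<le> \<nu> / 2 * ?s"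
        by (simp only: abs_mult mult.assoc)
      moreover have "\<bar>f x - f x' - \<kappa>\<^sup>2 * (x - x')\<bar> \<le> \<nu> / 2 * ?s"
        using fl[OF Q(1,3)] \<nu> mult_left_mono[of "\<bar>x - x'\<bar>" ?s "\<nu> / 2"] by linarith
      moreover have "(f x + \<epsilon> * \<gamma> t * k (x, y)) - (f x' + \<epsilon> * \<gamma> t * k (x', y')) - \<kappa>\<^sup>2 * (x - x')
          = (f x - f x' - \<kappa>\<^sup>2 * (x - x')) + \<epsilon> * \<gamma> t * (k (x, y) - k (x', y'))"
        by (simp add: algebra_simps)
      ultimately show ?thesis by linarith
    qed
    show "\<bar>f1 x + \<epsilon> * \<gamma> t * k1 (x, y) - \<kappa>\<^sup>2\<bar> \<le> \<nu> \<and> \<bar>\<epsilon> * \<gamma> t * k2 (x, y)\<bar> \<le> \<nu>"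
      if \<epsilon>: "\<bar>\<epsilon>\<bar> < e1" and Q: "\<bar>x - p\<bar> \<le> r" "\<bar>y\<bar> \<le> r" for \<epsilon> t x y
    proof -
      have kk: "\<bar>k1 (x, y)\<bar> \<le> B1 + B2" "\<bar>k2 (x, y)\<bar> \<le> B1 + B2"
        using B(2,3) B(5,6)[of "(x, y)"] Q Qiff[of x y] by auto
      have "\<bar>\<epsilon> * \<gamma> t * c\<bar> \<le> \<nu> / 2" if "\<bar>c\<bar> \<le> B1 + B2" for c
      proof -
        have "\<bar>\<gamma> t\<bar> * \<bar>c\<bar> \<le> G * (B1 + B2)" using G that by (intro mult_mono) auto
        then have "\<bar>\<epsilon>\<bar> * (\<bar>\<gamma> t\<bar> * \<bar>c\<bar>) \<le> \<bar>\<epsilon>\<bar> * (G * (B1 + B2))" by (intro mult_left_mono) auto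
        then show ?thesis using small[OF \<epsilon>] by (simp only: abs_mult mult.assoc)
      qed
      note a = this[OF kk(1)] this[OF kk(2)]
      have "\<bar>f1 x - \<kappa>\<^sup>2\<bar> < \<nu> / 2" using d1(2)[of x] Q r by (simp add: \<kappa>)
      then show ?thesis using a \<nu> by linarith
    qed
  qed (use r e1 G B in auto)
qed

end

text \<open>The inverse of the linear part at a saddle on bounded functions. It records y' as a
  second component, because the nonlinearity depends on it.\<close>

lemma saddle_operator:
  assumes \<kappa>: "0 < \<kappa>"
  obtains S :: "(real \<Rightarrow>\<^sub>C real) \<Rightarrow> (real \<Rightarrow>\<^sub>C real) \<times> (real \<Rightarrow>\<^sub>C real)" where "bounded_linear S"
    "\<And>r t. (fst (S r) has_real_derivative snd (S r) t) (at t)"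
    "\<And>r t. (snd (S r) has_real_derivative \<kappa>\<^sup>2 * fst (S r) t + r t) (at t)"
proof -
  define Sol :: "(real \<Rightarrow>\<^sub>C real) \<Rightarrow> (real \<Rightarrow>\<^sub>C real) \<times> (real \<Rightarrow>\<^sub>C real) \<Rightarrow> bool" where
    "Sol r z \<longleftrightarrow> (\<forall>t. (fst z has_real_derivative snd z t) (at t) \<and>
       (snd z has_real_derivative \<kappa>\<^sup>2 * fst z t + r t) (at t))" for r z
  obtain S where S: "bounded_linear S" "\<And>r z. Sol r z \<longleftrightarrow> z = S r"
  proof (rule solution_operator[of Sol "1 / \<kappa>\<^sup>2 + 2 / \<kappa>"])
    show "Sol (r + r') (z + z')" if "Sol r z" "Sol r' z'" for r z r' z'
      unfolding Sol_def
    proof (intro allI conjI)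
      fix t
      have "((\<lambda>t. fst z t + fst z' t) has_real_derivative snd z t + snd z' t) (at t)"
        using that unfolding Sol_def by (intro DERIV_add) auto
      then show "(fst (z + z') has_real_derivative snd (z + z') t) (at t)"
        by (simp add: plus_bcontfun.rep_eq[abs_def])
      have "((\<lambda>t. snd z t + snd z' t) has_real_derivative (\<kappa>\<^sup>2 * fst z t + r t) + (\<kappa>\<^sup>2 * fst z' t + r' t)) (at t)"
        using that unfolding Sol_def by (intro DERIV_add) auto
      then show "(snd (z + z') has_real_derivative \<kappa>\<^sup>2 * fst (z + z') t + (r + r') t) (at t)"
        by (simp add: plus_bcontfun.rep_eq[abs_def] algebra_simps)
    qed
    show "Sol (c *\<^sub>R r) (c *\<^sub>R z)" if "Sol r z" for c r z
      unfolding Sol_def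
    proof (intro allI conjI)
      fix t
      have "((\<lambda>t. c * fst z t) has_real_derivative c * snd z t) (at t)"
        using that unfolding Sol_def by (intro DERIV_cmult) auto
      then show "(fst (c *\<^sub>R z) has_real_derivative snd (c *\<^sub>R z) t) (at t)"
        by (simp add: scaleR_bcontfun.rep_eq[abs_def])
      have "((\<lambda>t. c * snd z t) has_real_derivative c * (\<kappa>\<^sup>2 * fst z t + r t)) (at t)"
        using that unfolding Sol_def by (intro DERIV_cmult) auto
      then show "(snd (c *\<^sub>R z) has_real_derivative \<kappa>\<^sup>2 * fst (c *\<^sub>R z) t + (c *\<^sub>R r) t) (at t)"
        by (simp add: scaleR_bcontfun.rep_eq[abs_def] algebra_simps)
    qed
    show "\<exists>z. Sol r z \<and> norm z \<le> (1 / \<kappa>\<^sup>2 + 2 / \<kappa>) * norm r" for r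
    proof -
      obtain y y' where y: "\<And>t. (y has_real_derivative y' t) (at t)"
        "\<And>t. (y' has_real_derivative \<kappa>\<^sup>2 * y t + r t) (at t)"
        "\<And>t. \<bar>y t\<bar> \<le> norm r / \<kappa>\<^sup>2" "\<And>t. \<bar>y' t\<bar> \<le> 2 * norm r / \<kappa>"
        by (rule bounded_solution_saddle[OF \<kappa> continuous_on_apply_bcontfun abs_apply_le_norm, of r]) blast
      have ap: "apply_bcontfun (Bcontfun y) = y" "apply_bcontfun (Bcontfun y') = y'"
        by (rule Bcontfun_apply[OF continuous_on_DERIV[OF y(1)] y(3)]
              Bcontfun_apply[OF continuous_on_DERIV[OF y(2)] y(4)])+
      have "norm (Bcontfun y, Bcontfun y') \<le> norm (Bcontfun y) + norm (Bcontfun y')"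
        by (rule norm_Pair_le)
      also have "\<dots> \<le> norm r / \<kappa>\<^sup>2 + 2 * norm r / \<kappa>"
        using y(3,4) by (intro add_mono norm_bcontfun_le) (simp_all only: ap)
      also have "\<dots> = (1 / \<kappa>\<^sup>2 + 2 / \<kappa>) * norm r" by (simp add: distrib_right)
      finally show ?thesis
        by (intro exI[of _ "(Bcontfun y, Bcontfun y')"]) (simp add: Sol_def ap y)
    qed
    show "z = 0" if "Sol 0 z" for z
    proof -
      have d: "(fst z has_vector_derivative snd z t) (at t)" "(snd z has_vector_derivative \<kappa>\<^sup>2 * fst z t) (at t)" for t
        using that unfolding Sol_def by (simp_all flip: has_real_derivative_iff_has_vector_derivative)
      have "fst z t = 0" for t
        by (rule saddle_unique_bounded[OF \<kappa> _ _ _ d, of 0 "norm (fst z)"]) (simp_all add: abs_apply_le_norm)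
      then have f0: "fst z = 0" by (intro bcontfun_eqI) simp
      have "snd z t = 0" for t
        using d(1)[of t] f0 vector_derivative_unique_at[of "\<lambda>_. 0" "snd z t" t 0] by simp
      then show ?thesis using f0 by (simp add: prod_eq_iff bcontfun_eqI)
    qed
  qed (blast intro: that)
  show ?thesis using that[OF S(1)] S(2) unfolding Sol_def by blast
qed

lemma norm_fst_le_norm: "norm (fst z) \<le> norm z" and norm_snd_le_norm: "norm (snd z) \<le> norm z"
  by (cases z, simp add: norm_fst_le norm_snd_le)+

lemma floquet_hyperbolic:
  assumes \<kappa>: "0 < \<kappa>" and \<nu>: "0 \<le> \<nu>" "\<nu> \<le> 2" "3 * \<nu> \<le> \<kappa>\<^sup>2"
    and a: "\<And>t. \<bar>a t - \<kappa>\<^sup>2\<bar> \<le> \<nu>" and b: "\<And>t. \<bar>b t\<bar> \<le> \<nu>"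
    and \<mu>: "floquet_multiplier a b 1 \<mu>"
  shows "cmod \<mu> \<noteq> 1"
proof
  assume 1: "cmod \<mu> = 1"
  obtain v w where v0: "\<exists>t. v t \<noteq> 0" and v: "\<And>t. (v has_vector_derivative w t) (at t)"
    and w: "\<And>t. (w has_vector_derivative of_real (a t) * v t + of_real (b t) * w t) (at t)"
    and per: "\<And>t. v (t + 1) = \<mu> * v t"
    using \<mu> unfolding floquet_multiplier_def by blast
  have vc: "continuous_on UNIV v"
    using v by (meson continuous_at_imp_continuous_on has_vector_derivative_continuous)
  \<comment> \<open>A multiplier on the unit circle makes the modulus of v periodic, although v
    itself need not be; this already bounds v on the line.\<close>
  have "cmod (v (t + 1)) = cmod (v t)" for t using per[of t] 1 by (simp add: norm_mult)
  then obtain B where B: "\<And>t. \<bar>cmod (v t)\<bar> \<le> B"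
    using periodic_bounded[of "\<lambda>t. cmod (v t)"] vc by (metis continuous_on_norm)
  have "v t = 0" for t
  proof (rule saddle_unique_bounded[OF \<kappa> \<nu> v w])
    fix t
    have "of_real (a t) * v t + of_real (b t) * w t - \<kappa>\<^sup>2 *\<^sub>R v t = (a t - \<kappa>\<^sup>2) *\<^sub>R v t + b t *\<^sub>R w t"
      by (simp add: scaleR_conv_of_real algebra_simps)
    also have "norm \<dots> \<le> \<bar>a t - \<kappa>\<^sup>2\<bar> * norm (v t) + \<bar>b t\<bar> * norm (w t)"
      by (rule norm_triangle_le) simp
    also have "\<dots> \<le> \<nu> * norm (v t) + \<nu> * norm (w t)"
      using a b by (intro add_mono mult_right_mono) auto
    finally show "norm (of_real (a t) * v t + of_real (b t) * w t - \<kappa>\<^sup>2 *\<^sub>R v t) \<le> \<nu> * (norm (v t) + norm (w t))"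
      by (simp add: distrib_left)
    show "norm (v t) \<le> B" using B[of t] by simp
  qed
  then show False using v0 by blast
qed

section \<open>Periodic solutions near a saddle and the solutions asymptotic to them\<close>

context perturbed_oscillator
begin

text \<open>Two radii occur: \<rho> locates the solution and may be shrunk later, while r is a fixed
  radius of uniqueness. The last clause ranges over all solutions that stay in the square of size r,
  whether periodic or not, which covers solutions of every period.\<close>

definition periodic_near :: "real \<Rightarrow> real \<Rightarrow> real \<Rightarrow> real \<Rightarrow> (real \<Rightarrow> real) \<Rightarrow> (real \<Rightarrow> real) \<Rightarrow> bool" where
  "periodic_near p r \<rho> \<epsilon> u u' \<longleftrightarrow> sol \<epsilon> u u' \<and>
    (\<forall>t. \<bar>u t - p\<bar> \<le> \<rho> \<and> \<bar>u' t\<bar> \<le> \<rho> \<and> \<bar>f (u t) + \<epsilon> * \<gamma> t * k (u t, u' t)\<bar> \<le> \<rho>) \<and>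
    (\<forall>t. u (t + 1) = u t) \<and>
    (\<forall>\<mu>. floquet_multiplier (\<lambda>t. f1 (u t) + \<epsilon> * \<gamma> t * k1 (u t, u' t)) (\<lambda>t. \<epsilon> * \<gamma> t * k2 (u t, u' t)) 1 \<mu>
        \<longrightarrow> cmod \<mu> \<noteq> 1) \<and>
    (\<forall>w w'. sol \<epsilon> w w' \<and> (\<forall>t. \<bar>w t - p\<bar> \<le> r \<and> \<bar>w' t\<bar> \<le> r) \<longrightarrow> w = u)"

lemma saddle_solutions:
  assumes p: "(p, 0) \<in> \<Omega>" "f p = 0" and \<kappa>: "f1 p = \<kappa>\<^sup>2" "0 < \<kappa>"
  obtains r e1 where "0 < r" "0 < e1"
    "\<And>\<rho>. 0 < \<rho> \<Longrightarrow> \<rho> \<le> r \<Longrightarrow> \<exists>e>0. \<forall>\<epsilon>. \<bar>\<epsilon>\<bar> < e \<longrightarrow> (\<exists>u u'. periodic_near p r \<rho> \<epsilon> u u')"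
    "\<And>\<epsilon> T w w' u u'. \<bar>\<epsilon>\<bar> < e1 \<Longrightarrow> sol \<epsilon> w w' \<Longrightarrow> sol \<epsilon> u u' \<Longrightarrow>
      (\<And>t. T \<le> t \<Longrightarrow> \<bar>w t - p\<bar> \<le> r \<and> \<bar>w' t\<bar> \<le> r \<and> \<bar>u t - p\<bar> \<le> r \<and> \<bar>u' t\<bar> \<le> r) \<Longrightarrow>
      ((\<lambda>t. w t - u t) \<longlongrightarrow> 0) at_top"
    "\<And>\<epsilon> T w w' u u'. \<bar>\<epsilon>\<bar> < e1 \<Longrightarrow> sol \<epsilon> w w' \<Longrightarrow> sol \<epsilon> u u' \<Longrightarrow>
      (\<And>t. t \<le> T \<Longrightarrow> \<bar>w t - p\<bar> \<le> r \<and> \<bar>w' t\<bar> \<le> r \<and> \<bar>u t - p\<bar> \<le> r \<and> \<bar>u' t\<bar> \<le> r) \<Longrightarrow>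
      ((\<lambda>t. w t - u t) \<longlongrightarrow> 0) at_bot"
proof -
  obtain S :: "(real \<Rightarrow>\<^sub>C real) \<Rightarrow> (real \<Rightarrow>\<^sub>C real) \<times> (real \<Rightarrow>\<^sub>C real)" where S: "bounded_linear S"
    "\<And>r t. (fst (S r) has_real_derivative snd (S r) t) (at t)"
    "\<And>r t. (snd (S r) has_real_derivative \<kappa>\<^sup>2 * fst (S r) t + r t) (at t)"
    by (rule saddle_operator[OF \<kappa>(2)]) blast
  obtain M where M: "0 < M" "\<And>r. norm (S r) \<le> norm r * M"
    using bounded_linear.pos_bounded[OF S(1)] by blast
  \<comment> \<open>The first two bounds are those of \<open>saddle_convexity\<close>. The third
    makes the fixed point map a contraction with the factor \<open>2 * \<nu> * M\<close>, at most 1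
    / 2.\<close>
  define \<nu> where "\<nu> = min (min 2 (\<kappa>\<^sup>2 / 3)) (1 / (4 * M))"
  have \<nu>: "0 < \<nu>" "\<nu> \<le> 2" "\<nu> \<le> \<kappa>\<^sup>2 / 3" "\<nu> \<le> 1 / (4 * M)"
    using M \<kappa> unfolding \<nu>_def by auto
  have \<nu>3: "0 \<le> \<nu>" "\<nu> \<le> 2" "3 * \<nu> \<le> \<kappa>\<^sup>2" using \<nu> by auto
  have \<nu>M: "4 * (\<nu> * M) \<le> 1" using \<nu>(4) M by (simp add: field_simps)
  obtain r e1 C where r: "0 < r" "0 < e1" "0 \<le> C"
    and in\<Omega>: "\<And>x y. \<bar>x - p\<bar> \<le> r \<Longrightarrow> \<bar>y\<bar> \<le> r \<Longrightarrow> (x, y) \<in> \<Omega>"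
    and kC: "\<And>\<epsilon> t x y. \<bar>x - p\<bar> \<le> r \<Longrightarrow> \<bar>y\<bar> \<le> r \<Longrightarrow> \<bar>\<epsilon> * \<gamma> t * k (x, y)\<bar> \<le> C * \<bar>\<epsilon>\<bar>"
    and lip: "\<And>\<epsilon> t x y x' y'. \<bar>\<epsilon>\<bar> < e1 \<Longrightarrow> \<bar>x - p\<bar> \<le> r \<Longrightarrow> \<bar>y\<bar> \<le> r \<Longrightarrow> \<bar>x' - p\<bar> \<le> r \<Longrightarrow> \<bar>y'\<bar> \<le> r \<Longrightarrow>
      \<bar>(f x + \<epsilon> * \<gamma> t * k (x, y)) - (f x' + \<epsilon> * \<gamma> t * k (x', y')) - \<kappa>\<^sup>2 * (x - x')\<bar>
        \<le> \<nu> * (\<bar>x - x'\<bar> + \<bar>y - y'\<bar>)"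
    and lin: "\<And>\<epsilon> t x y. \<bar>\<epsilon>\<bar> < e1 \<Longrightarrow> \<bar>x - p\<bar> \<le> r \<Longrightarrow> \<bar>y\<bar> \<le> r \<Longrightarrow>
      \<bar>f1 x + \<epsilon> * \<gamma> t * k1 (x, y) - \<kappa>\<^sup>2\<bar> \<le> \<nu> \<and> \<bar>\<epsilon> * \<gamma> t * k2 (x, y)\<bar> \<le> \<nu>"
    by (rule saddle_estimates[OF p(1) \<kappa>(1) \<nu>(1)]) blast
  have unique: "w = u" if \<epsilon>: "\<bar>\<epsilon>\<bar> < e1" and s: "sol \<epsilon> w w'" "sol \<epsilon> u u'"
    and bd: "\<And>t. \<bar>w t - p\<bar> \<le> r \<and> \<bar>w' t\<bar> \<le> r" "\<And>t. \<bar>u t - p\<bar> \<le> r \<and> \<bar>u' t\<bar> \<le> r" for \<epsilon> w w' u u'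
  proof
    fix t
    have "w t - u t = 0"
    proof (rule saddle_unique_bounded[OF \<kappa>(2) \<nu>3, where v = "\<lambda>t. w t - u t" and w = "\<lambda>t. w' t - u' t"])
      show "((\<lambda>t. w t - u t) has_vector_derivative w' t - u' t) (at t)" for t
        using s unfolding sol_def has_real_derivative_iff_has_vector_derivative[symmetric] by (intro DERIV_diff) auto
      show "((\<lambda>t. w' t - u' t) has_vector_derivative (f (w t) + \<epsilon> * \<gamma> t * k (w t, w' t)) - (f (u t) + \<epsilon> * \<gamma> t * k (u t, u' t))) (at t)" for t
        using s unfolding sol_def has_real_derivative_iff_has_vector_derivative[symmetric] by (intro DERIV_diff) auto
      show "norm (f (w t) + \<epsilon> * \<gamma> t * k (w t, w' t) - (f (u t) + \<epsilon> * \<gamma> t * k (u t, u' t)) - \<kappa>\<^sup>2 *\<^sub>R (w t - u t))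
          \<le> \<nu> * (norm (w t - u t) + norm (w' t - u' t))" for t
        using lip[OF \<epsilon>, of "w t" "w' t" "u t" "u' t" t] bd by simp
      show "norm (w t - u t) \<le> 2 * r" for t
        using bd(1)[of t] bd(2)[of t] unfolding real_norm_def by linarith
    qed
    then show "w t = u t" by simp
  qed
  have top: "((\<lambda>t. w t - u t) \<longlongrightarrow> 0) at_top" if \<epsilon>: "\<bar>\<epsilon>\<bar> < e1" and s: "sol \<epsilon> w w'" "sol \<epsilon> u u'"
    and bd: "\<And>t. T \<le> t \<Longrightarrow> \<bar>w t - p\<bar> \<le> r \<and> \<bar>w' t\<bar> \<le> r \<and> \<bar>u t - p\<bar> \<le> r \<and> \<bar>u' t\<bar> \<le> r" for \<epsilon> T w w' u u'
  proof (rule saddle_asymptotic[OF \<kappa>(2) \<nu>3, where T = T])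
    show "((\<lambda>t. w t - u t) has_real_derivative w' t - u' t) (at t)" for t
      using s unfolding sol_def by (intro DERIV_diff) auto
    show "((\<lambda>t. w' t - u' t) has_real_derivative (f (w t) + \<epsilon> * \<gamma> t * k (w t, w' t)) - (f (u t) + \<epsilon> * \<gamma> t * k (u t, u' t))) (at t)" for t
      using s unfolding sol_def by (intro DERIV_diff) auto
    show "\<bar>f (w t) + \<epsilon> * \<gamma> t * k (w t, w' t) - (f (u t) + \<epsilon> * \<gamma> t * k (u t, u' t)) - \<kappa>\<^sup>2 * (w t - u t)\<bar>
        \<le> \<nu> * (\<bar>w t - u t\<bar> + \<bar>w' t - u' t\<bar>)" if "T \<le> t" for t
      using lip[OF \<epsilon>, of "w t" "w' t" "u t" "u' t" t] bd[OF that] by simp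
    show "\<bar>w t - u t\<bar> \<le> 2 * r" if "T \<le> t" for t
      using bd[OF that] by linarith
  qed
  have bot: "((\<lambda>t. w t - u t) \<longlongrightarrow> 0) at_bot" if \<epsilon>: "\<bar>\<epsilon>\<bar> < e1" and s: "sol \<epsilon> w w'" "sol \<epsilon> u u'"
    and bd: "\<And>t. t \<le> T \<Longrightarrow> \<bar>w t - p\<bar> \<le> r \<and> \<bar>w' t\<bar> \<le> r \<and> \<bar>u t - p\<bar> \<le> r \<and> \<bar>u' t\<bar> \<le> r" for \<epsilon> T w w' u u'
  proof -
    let ?z = "\<lambda>t. f (w t) + \<epsilon> * \<gamma> t * k (w t, w' t) - (f (u t) + \<epsilon> * \<gamma> t * k (u t, u' t))"
    have d: "((\<lambda>t. w t - u t) has_real_derivative w' t - u' t) (at t)"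
      "((\<lambda>t. w' t - u' t) has_real_derivative ?z t) (at t)" for t
      using s unfolding sol_def by (intro DERIV_diff; auto)+
    \<comment> \<open>Only the inequality for the difference is reflected in time; the reflected
      functions need not solve an equation of the same form.\<close>
    have "((\<lambda>t. w (- t) - u (- t)) \<longlongrightarrow> 0) at_top"
    proof (rule saddle_asymptotic[OF \<kappa>(2) \<nu>3, where v = "\<lambda>t. w (- t) - u (- t)"
          and w = "\<lambda>t. - (w' (- t) - u' (- t))" and z = "\<lambda>t. ?z (- t)" and T = "- T" and B = "2 * r"])
      show "((\<lambda>t. w (- t) - u (- t)) has_real_derivative - (w' (- t) - u' (- t))) (at t)" for t
        using d(1)[of "- t"] by (simp only: DERIV_mirror)
      show "((\<lambda>t. - (w' (- t) - u' (- t))) has_real_derivative ?z (- t)) (at t)" for t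
        using DERIV_minus[OF d(2)[of "- t", unfolded DERIV_mirror]] by (simp only: minus_minus)
      show "\<bar>?z (- t) - \<kappa>\<^sup>2 * (w (- t) - u (- t))\<bar>
          \<le> \<nu> * (\<bar>w (- t) - u (- t)\<bar> + \<bar>- (w' (- t) - u' (- t))\<bar>)" if "- T \<le> t" for t
        using lip[OF \<epsilon>, of "w (- t)" "w' (- t)" "u (- t)" "u' (- t)" "- t"] bd[of "- t"] that
        by (simp add: abs_minus_commute)
      show "\<bar>w (- t) - u (- t)\<bar> \<le> 2 * r" if "- T \<le> t" for t
        using bd[of "- t"] that by linarith
    qed
    then show ?thesis by (simp add: at_bot_mirror filterlim_filtermap)
  qed
  have existence: "\<exists>e>0. \<forall>\<epsilon>. \<bar>\<epsilon>\<bar> < e \<longrightarrow> (\<exists>u u'. periodic_near p r \<rho> \<epsilon> u u')" if \<rho>: "0 < \<rho>" "\<rho> \<le> r" for \<rho>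
  proof -
    \<comment> \<open>The fixed point is sought in the ball of radius s. The second derivative of
      the solution is then at most \<open>q * s\<close>, which is \<rho> / 2, plus the
      forcing.\<close>
    define q where "q = \<kappa>\<^sup>2 + 4"
    define s where "s = \<rho> / (2 * q)"
    have K: "4 \<le> q" by (simp add: q_def)
    have s: "0 < s" using \<rho> K by (simp add: s_def)
    have s2: "q * s = \<rho> / 2" using K by (simp add: s_def)
    have "4 * s \<le> q * s" using K s by (intro mult_right_mono) auto
    then have s\<rho>: "s \<le> \<rho>" using s2 s by linarith
    \<comment> \<open>The forcing contributes at most \<rho> / 2 to the second derivative and, after
      the solution operator with bound M, at most s / 2 to the fixed point.\<close>
    define e where "e = min e1 (min (\<rho> / 2) (s / (2 * M)) / (C + 1))"
    have e: "0 < e" "e \<le> e1" using r \<rho> s M by (auto simp: e_def)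
    have eC: "C * \<bar>\<epsilon>\<bar> \<le> \<rho> / 2 \<and> C * \<bar>\<epsilon>\<bar> \<le> s / (2 * M)" if "\<bar>\<epsilon>\<bar> < e" for \<epsilon>
    proof -
      have "\<bar>\<epsilon>\<bar> \<le> min (\<rho> / 2) (s / (2 * M)) / (C + 1)" using that by (simp add: e_def)
      then have "(C + 1) * \<bar>\<epsilon>\<bar> \<le> min (\<rho> / 2) (s / (2 * M))"
        using r(3) by (simp add: pos_le_divide_eq mult.commute)
      moreover have "C * \<bar>\<epsilon>\<bar> \<le> (C + 1) * \<bar>\<epsilon>\<bar>" by (intro mult_right_mono) auto
      ultimately show ?thesis by simp
    qed
    show ?thesis
    proof (intro exI[of _ e] conjI allI impI e)
      fix \<epsilon> assume \<epsilon>: "\<bar>\<epsilon>\<bar> < e"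
      then have \<epsilon>1: "\<bar>\<epsilon>\<bar> < e1" using e by simp
      define D :: "((real \<Rightarrow>\<^sub>C real) \<times> (real \<Rightarrow>\<^sub>C real)) set" where "D = {z. norm (fst z) \<le> s \<and> norm (snd z) \<le> s}"
      \<comment> \<open>The right-hand side minus its linear part at the saddle, in coordinates
        centred at p; fixed points of S after N are the solutions.\<close>
      define h where "h z t = f (p + fst z t) + \<epsilon> * \<gamma> t * k (p + fst z t, snd z t) - \<kappa>\<^sup>2 * fst z t"
        for z :: "(real \<Rightarrow>\<^sub>C real) \<times> (real \<Rightarrow>\<^sub>C real)" and t
      have pt: "\<bar>fst z t\<bar> \<le> s" "\<bar>snd z t\<bar> \<le> s" "\<bar>p + fst z t - p\<bar> \<le> r" "\<bar>snd z t\<bar> \<le> r" if "z \<in> D" for z t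
        using that abs_apply_le_norm[of "fst z" t] abs_apply_le_norm[of "snd z" t] s\<rho> \<rho> by (auto simp: D_def)
      have h_le: "\<bar>h z t\<bar> \<le> 2 * \<nu> * s + C * \<bar>\<epsilon>\<bar>" if z: "z \<in> D" for z t
      proof -
        have "\<bar>h z t - \<epsilon> * \<gamma> t * k (p, 0)\<bar> \<le> \<nu> * (\<bar>fst z t\<bar> + \<bar>snd z t\<bar>)"
          using lip[OF \<epsilon>1 pt(3,4)[OF z], of p 0 t] r p(2) by (simp add: h_def algebra_simps)
        also have "\<dots> \<le> \<nu> * (s + s)" using pt(1,2)[OF z, of t] \<nu> by (intro mult_left_mono add_mono) auto
        finally show ?thesis using kC[of p 0 \<epsilon> t] r by simp
      qed
      have h_cont: "continuous_on UNIV (h z)" if z: "z \<in> D" for z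
      proof -
        have "continuous_on UNIV (\<lambda>t. k (p + fst z t, snd z t))"
          by (rule continuous_on_compose2[OF k_cont])
             (use pt[OF z] in\<Omega> in \<open>auto intro!: continuous_intros\<close>)
        moreover have "continuous_on UNIV (\<lambda>t. f (p + fst z t))"
          by (rule continuous_on_compose2[OF f_cont]) (auto intro!: continuous_intros)
        ultimately show ?thesis unfolding h_def by (intro continuous_intros \<gamma>_cont) auto
      qed
      define N where "N z = Bcontfun (h z)" for z
      have N: "N z t = h z t" if "z \<in> D" for z t
        unfolding N_def by (simp add: Bcontfun_apply[OF h_cont[OF that] h_le[OF that]])
      have SN: "norm (S (N z) - S (N z')) \<le> 1 / 2 * norm (z - z')" if z: "z \<in> D" "z' \<in> D" for z z'
      proof -
        have "norm (N z - N z') \<le> 2 * \<nu> * norm (z - z')"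
        proof (rule norm_bcontfun_le)
          fix t
          have "\<bar>h z t - h z' t\<bar> \<le> \<nu> * (\<bar>fst z t - fst z' t\<bar> + \<bar>snd z t - snd z' t\<bar>)"
            using lip[OF \<epsilon>1 pt(3,4)[OF z(1)] pt(3,4)[OF z(2)], of t] by (simp add: h_def algebra_simps)
          also have "\<dots> \<le> \<nu> * (norm (z - z') + norm (z - z'))"
          proof (intro mult_left_mono add_mono)
            show "\<bar>fst z t - fst z' t\<bar> \<le> norm (z - z')"
              using abs_apply_le_norm[of "fst (z - z')" t] norm_fst_le_norm[of "z - z'"] by simp
            show "\<bar>snd z t - snd z' t\<bar> \<le> norm (z - z')"
              using abs_apply_le_norm[of "snd (z - z')" t] norm_snd_le_norm[of "z - z'"] by simp
          qed (use \<nu> in simp)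
          finally show "\<bar>(N z - N z') t\<bar> \<le> 2 * \<nu> * norm (z - z')" by (simp add: N z)
        qed
        then have "norm (N z - N z') * M \<le> 2 * \<nu> * norm (z - z') * M" using M by (intro mult_right_mono) auto
        also have "\<dots> = 1 / 2 * (4 * (\<nu> * M)) * norm (z - z')" by simp
        also have "\<dots> \<le> 1 / 2 * 1 * norm (z - z')" using \<nu>M by (intro mult_right_mono mult_left_mono) auto
        finally show ?thesis
          using M(2)[of "N z - N z'"] linear_diff[OF bounded_linear.linear[OF S(1)], of "N z" "N z'"] by simp
      qed
      have maps: "S (N z) \<in> D" if z: "z \<in> D" for z
      proof -
        have "norm (N z) \<le> 2 * \<nu> * s + C * \<bar>\<epsilon>\<bar>" using h_le[OF z] by (intro norm_bcontfun_le) (simp add: N z)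
        also have "\<dots> \<le> 2 * \<nu> * s + s / (2 * M)" using eC[OF \<epsilon>] by simp
        finally have "norm (N z) * M \<le> (2 * \<nu> * s + s / (2 * M)) * M" using M by (intro mult_right_mono) auto
        also have "\<dots> = 1 / 2 * (4 * (\<nu> * M)) * s + s / 2" using M by (simp add: field_simps)
        also have "\<dots> \<le> 1 / 2 * 1 * s + s / 2" using \<nu>M s by (intro add_mono mult_right_mono mult_left_mono) auto
        finally have "norm (S (N z)) \<le> s" using M(2)[of "N z"] by simp
        then show ?thesis
          using norm_fst_le_norm[of "S (N z)"] norm_snd_le_norm[of "S (N z)"]
          by (simp add: D_def)
      qed
      have Dc: "closed D"
        unfolding D_def by (intro closed_Collect_conj closed_Collect_le continuous_intros)
      have D0: "D \<noteq> {}" using s by (auto simp: D_def intro!: exI[of _ 0])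
      have "\<exists>!z. z \<in> D \<and> S (N z) = z"
        by (rule Banach_fix[OF _ D0, of "1 / 2"])
           (use Dc SN maps in \<open>auto simp: complete_eq_closed dist_norm\<close>)
      then obtain z where z: "z \<in> D" "S (N z) = z" by blast
      define u where "u t = p + fst z t" for t
      define u' where "u' t = snd z t" for t
      have zd: "(fst z has_real_derivative snd z t) (at t)" "(snd z has_real_derivative \<kappa>\<^sup>2 * fst z t + h z t) (at t)" for t
        using S(2)[of "N z" t] S(3)[of "N z" t] N[OF z(1), of t] by (simp_all add: z(2))
      have su: "sol \<epsilon> u u'"
        unfolding sol_def
      proof (intro allI conjI)
        fix t
        show "(u has_real_derivative u' t) (at t)"
          unfolding u_def u'_def using DERIV_add[OF DERIV_const zd(1)[of t], of p] by simp
        have "(u' has_real_derivative \<kappa>\<^sup>2 * fst z t + h z t) (at t)" unfolding u'_def by (rule zd(2))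
        then show "(u' has_real_derivative f (u t) + \<epsilon> * \<gamma> t * k (u t, u' t)) (at t)"
          by (simp add: h_def u_def u'_def)
        show "(u t, u' t) \<in> \<Omega>" using pt(3,4)[OF z(1)] in\<Omega> by (simp add: u_def u'_def)
      qed
      have us: "\<bar>u t - p\<bar> \<le> s" "\<bar>u' t\<bar> \<le> s" for t using pt[OF z(1)] by (simp_all add: u_def u'_def)
      have ur: "\<bar>u t - p\<bar> \<le> r" "\<bar>u' t\<bar> \<le> r" for t using us[of t] s\<rho> \<rho> by simp_all
      have rhs: "\<bar>f (u t) + \<epsilon> * \<gamma> t * k (u t, u' t)\<bar> \<le> \<rho>" for t
      proof -
        have "f (u t) + \<epsilon> * \<gamma> t * k (u t, u' t) = \<kappa>\<^sup>2 * fst z t + h z t"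
          by (simp add: h_def u_def u'_def)
        moreover have "\<bar>\<kappa>\<^sup>2 * fst z t\<bar> \<le> \<kappa>\<^sup>2 * s"
          unfolding abs_mult using pt(1)[OF z(1), of t] by (simp add: mult_left_mono)
        moreover have "2 * \<nu> * s \<le> 4 * s" using \<nu> s by (intro mult_right_mono) auto
        moreover have "\<kappa>\<^sup>2 * s + 4 * s = \<rho> / 2" using s2 by (simp add: q_def distrib_right)
        moreover have "C * \<bar>\<epsilon>\<bar> \<le> \<rho> / 2" using eC[OF \<epsilon>] by simp
        ultimately show ?thesis using h_le[OF z(1), of t] by linarith
      qed
      have "periodic_near p r \<rho> \<epsilon> u u'"
        unfolding periodic_near_def
      proof (intro conjI allI impI su rhs)
        fix t
        show "\<bar>u t - p\<bar> \<le> \<rho>" "\<bar>u' t\<bar> \<le> \<rho>" using us[of t] s\<rho> by simp_all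
        \<comment> \<open>The translate by the period of the forcing is a solution in the same
          square, so uniqueness gives periodicity.\<close>
        have "(\<lambda>t. u (t + 1)) = u"
          by (rule unique[OF \<epsilon>1 sol_shift[OF su] su]) (use ur in auto)
        then show "u (t + 1) = u t" by metis
      next
        fix \<mu> assume "floquet_multiplier (\<lambda>t. f1 (u t) + \<epsilon> * \<gamma> t * k1 (u t, u' t)) (\<lambda>t. \<epsilon> * \<gamma> t * k2 (u t, u' t)) 1 \<mu>"
        then show "cmod \<mu> \<noteq> 1"
          by (rule floquet_hyperbolic[OF \<kappa>(2) \<nu>3, rotated 2]) (use lin[OF \<epsilon>1 ur] in auto)
      next
        fix w w' assume "sol \<epsilon> w w' \<and> (\<forall>t. \<bar>w t - p\<bar> \<le> r \<and> \<bar>w' t\<bar> \<le> r)"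
        then show "w = u" using unique[OF \<epsilon>1 _ su] ur by blast
      qed
      then show "\<exists>u u'. periodic_near p r \<rho> \<epsilon> u u'" by blast
    qed
  qed
  show ?thesis by (rule that[OF r(1,2) existence top bot])
qed

end

section \<open>The scaled equation along a heteroclinic orbit\<close>

context perturbed_oscillator
begin

text \<open>\<open>f (x + u) - f x - f1 x u = u * remainder x u\<close>. After the scaling \<open>u = \<epsilon> y\<close> and division by
  \<open>\<epsilon>\<close>, the quadratic remainder is \<open>y * remainder x (\<epsilon> y)\<close>, which is still \<open>C\<^sup>1\<close> in \<open>\<epsilon>\<close>.\<close>

definition remainder :: "real \<Rightarrow> real \<Rightarrow> real" where
  "remainder x u = integral {0..1} (\<lambda>s. f1 (x + s * u) - f1 x)"

definition remainder' :: "real \<Rightarrow> real \<Rightarrow> real" where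
  "remainder' x u = integral {0..1} (\<lambda>s. s * f2 (x + s * u))"

lemma remainder_0 [simp]: "remainder x 0 = 0"
  by (simp add: remainder_def)

lemma remainder_mult: "u * remainder x u = f (x + u) - f x - f1 x * u"
proof -
  have "((\<lambda>s. u * (f1 (x + s * u) - f1 x)) has_integral
      (f (x + 1 * u) - 1 * (f1 x * u)) - (f (x + 0 * u) - 0 * (f1 x * u))) {0..1}"
  proof (rule fundamental_theorem_of_calculus)
    fix s :: real assume "s \<in> {0..1}"
    have "((\<lambda>s. f (x + s * u)) has_real_derivative f1 (x + s * u) * u) (at s)"
      by (rule DERIV_chain2[where f = f, OF f]) (auto intro!: derivative_eq_intros)
    then have "((\<lambda>s. f (x + s * u) - s * (f1 x * u)) has_real_derivative u * (f1 (x + s * u) - f1 x)) (at s)"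
      by (auto intro!: derivative_eq_intros simp: algebra_simps)
    then show "((\<lambda>s. f (x + s * u) - s * (f1 x * u)) has_vector_derivative u * (f1 (x + s * u) - f1 x)) (at s within {0..1})"
      by (simp add: has_real_derivative_iff_has_vector_derivative has_vector_derivative_at_within)
  qed simp
  from integral_unique[OF this] show ?thesis by (simp add: remainder_def)
qed

lemma remainder_deriv: "((remainder x) has_real_derivative remainder' x u) (at u)"
proof -
  have "((\<lambda>u. integral (cbox 0 1) (\<lambda>s. f1 (x + s * u) - f1 x)) has_field_derivative
      integral (cbox 0 1) (\<lambda>s. s * f2 (x + s * u))) (at u within UNIV)"
  proof (rule leibniz_rule_field_derivative)
    show "((\<lambda>u. f1 (x + s * u) - f1 x) has_field_derivative s * f2 (x + s * u)) (at u within UNIV)" for s u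
    proof -
      have "((\<lambda>u. f1 (x + s * u)) has_real_derivative f2 (x + s * u) * s) (at u)"
        by (rule DERIV_chain2[where f = f1, OF f1]) (auto intro!: derivative_eq_intros)
      then show ?thesis by (auto intro!: derivative_eq_intros)
    qed
    show "(\<lambda>s. f1 (x + s * u) - f1 x) integrable_on cbox 0 1" for u
      by (intro integrable_continuous continuous_intros continuous_on_compose2[OF f1_cont]) auto
    show "continuous_on (UNIV \<times> cbox 0 1) (\<lambda>(u, s). s * f2 (x + s * u))"
      unfolding split_beta
      by (intro continuous_intros continuous_on_compose2[OF f2_cont]) auto
  qed auto
  then show ?thesis unfolding remainder_def[abs_def] remainder'_def by simp
qed

lemma remainder_cont: "continuous_on S (\<lambda>z. remainder (fst z) (snd z))"
  and remainder_deriv_cont: "continuous_on S (\<lambda>z. remainder' (fst z) (snd z))"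
proof -
  have "continuous_on UNIV (\<lambda>z. integral (cbox 0 1) (\<lambda>s. f1 (fst z + s * snd z) - f1 (fst z)))"
    by (rule integral_continuous_on_param)
       (auto simp: split_beta intro!: continuous_intros continuous_on_compose2[OF f1_cont])
  moreover have "continuous_on UNIV (\<lambda>z. integral (cbox 0 1) (\<lambda>s. s * f2 (fst z + s * snd z)))"
    by (rule integral_continuous_on_param)
       (auto simp: split_beta intro!: continuous_intros continuous_on_compose2[OF f2_cont])
  ultimately show "continuous_on S (\<lambda>z. remainder (fst z) (snd z))" "continuous_on S (\<lambda>z. remainder' (fst z) (snd z))"
    unfolding remainder_def remainder'_def by (auto intro: continuous_on_subset)
qed

text \<open>The equation in the time of the unperturbed orbit. The phase moves into the forcing, so
  the linearization and its inverse do not depend on it.\<close>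

definition shifted_sol :: "real \<Rightarrow> real \<Rightarrow> (real \<Rightarrow> real) \<Rightarrow> (real \<Rightarrow> real) \<Rightarrow> bool" where
  "shifted_sol \<epsilon> \<beta> \<xi> \<xi>' \<longleftrightarrow> (\<forall>t. (\<xi> has_real_derivative \<xi>' t) (at t) \<and>
     (\<xi>' has_real_derivative f (\<xi> t) + \<epsilon> * \<gamma> (t - \<beta>) * k (\<xi> t, \<xi>' t)) (at t) \<and> (\<xi> t, \<xi>' t) \<in> \<Omega>)"

lemma sol_iff_shifted_sol: "sol \<epsilon> \<psi> \<psi>' \<longleftrightarrow> shifted_sol \<epsilon> \<beta> (\<lambda>t. \<psi> (t - \<beta>)) (\<lambda>t. \<psi>' (t - \<beta>))"
proof -
  have s: "((\<lambda>t. g (t - \<beta>)) has_real_derivative d) (at t) \<longleftrightarrow> (g has_real_derivative d) (at (t - \<beta>))" for g d t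
    using DERIV_shift[of g d t "- \<beta>"] by simp
  have all: "(\<forall>t. P t) \<longleftrightarrow> (\<forall>t. P (t - \<beta>))" for P :: "real \<Rightarrow> bool"
  proof (intro iffI allI)
    fix t assume "\<forall>t. P (t - \<beta>)"
    then have "P ((t + \<beta>) - \<beta>)" by blast
    then show "P t" by simp
  qed blast
  show ?thesis unfolding sol_def shifted_sol_def s by (subst all) simp
qed

end

text \<open>Closed balls about the two limit points catch both ends of the orbit. The resulting
  compact set has a positive distance to the complement of \<Omega>, which gives a tube of uniform
  width.\<close>

lemma orbit_in_compact:
  fixes c :: "real \<Rightarrow> 'a::euclidean_space"
  assumes c: "continuous_on UNIV c" and \<Omega>: "open \<Omega>" and in\<Omega>: "\<And>t. c t \<in> \<Omega>" "P \<in> \<Omega>" "Q \<in> \<Omega>"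
    and lim: "(c \<longlongrightarrow> P) at_bot" "(c \<longlongrightarrow> Q) at_top"
  obtains K \<eta> where "compact K" "\<And>t. c t \<in> K" "0 < \<eta>" "\<And>z h. z \<in> K \<Longrightarrow> norm h \<le> \<eta> \<Longrightarrow> z + h \<in> \<Omega>"
proof -
  obtain d where d: "0 < d" "cball P d \<subseteq> \<Omega>" "cball Q d \<subseteq> \<Omega>"
  proof -
    obtain d1 d2 where "0 < d1" "cball P d1 \<subseteq> \<Omega>" "0 < d2" "cball Q d2 \<subseteq> \<Omega>"
      using \<Omega> in\<Omega> open_contains_cball by metis
    then show ?thesis using that[of "min d1 d2"] by (auto simp: subset_iff)
  qed
  have "\<forall>\<^sub>F t in at_bot. dist (c t) P < d" "\<forall>\<^sub>F t in at_top. dist (c t) Q < d"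
    using lim d(1) by (auto dest: tendstoD)
  then obtain T1 T2 where T: "\<And>t. t \<le> T1 \<Longrightarrow> dist (c t) P < d" "\<And>t. T2 \<le> t \<Longrightarrow> dist (c t) Q < d"
    unfolding eventually_at_bot_linorder eventually_at_top_linorder by blast
  define K where "K = c ` {T1..T2} \<union> cball P d \<union> cball Q d"
  have K: "compact K" unfolding K_def
    by (intro compact_Un compact_continuous_image continuous_on_subset[OF c]) auto
  have cK: "c t \<in> K" for t
    using T[of t] by (cases "t \<le> T1"; cases "T2 \<le> t") (auto simp: K_def dist_commute less_imp_le)
  have K\<Omega>: "K \<subseteq> \<Omega>" using d in\<Omega> by (auto simp: K_def)
  obtain \<eta> where \<eta>: "0 < \<eta>" "{x. infdist x K \<le> \<eta>} \<subseteq> \<Omega>"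
    using compact_in_open_separated[OF _ K \<Omega> K\<Omega>] cK by blast
  have "z + h \<in> \<Omega>" if "z \<in> K" "norm h \<le> \<eta>" for z h
  proof -
    have "infdist (z + h) K \<le> dist (z + h) z" by (rule infdist_le[OF that(1)])
    then show ?thesis using \<eta> that by (auto simp: dist_norm)
  qed
  then show ?thesis using that K cK \<eta>(1) by blast
qed

context decaying_solution
begin

text \<open>Removing the component along v first makes the operator total. For right-hand sides
  orthogonal to v this correction is 0, so the operator solves the actual equation for them.\<close>

lemma bounded_solution_operator:
  obtains S :: "(real \<Rightarrow>\<^sub>C real) \<Rightarrow> (real \<Rightarrow>\<^sub>C real) \<times> (real \<Rightarrow>\<^sub>C real)" where "bounded_linear S"
    "\<And>r z. (LBINT t. v t * apply_bcontfun r t) = 0 \<Longrightarrow> z = S r \<longleftrightarrow> (\<forall>t. (fst z has_real_derivative snd z t) (at t) \<and>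
       (snd z has_real_derivative a t * fst z t + r t) (at t)) \<and> (LBINT t. v t * fst z t) = 0"
proof -
  let ?vv = "LBINT t. v t * v t"
  define P where "P r = (LBINT t. v t * r t) / ?vv" for r :: "real \<Rightarrow>\<^sub>C real"
  define Sol :: "(real \<Rightarrow>\<^sub>C real) \<Rightarrow> (real \<Rightarrow>\<^sub>C real) \<times> (real \<Rightarrow>\<^sub>C real) \<Rightarrow> bool" where
    "Sol r z \<longleftrightarrow> (\<forall>t. (fst z has_real_derivative snd z t) (at t) \<and>
       (snd z has_real_derivative a t * fst z t + (r t - P r * v t)) (at t)) \<and> (LBINT t. v t * fst z t) = 0" for r z
  have int: "integrable lborel (\<lambda>t. v t * g t)" for g :: "real \<Rightarrow>\<^sub>C real"
    by (rule integrable_v_mult[OF continuous_on_apply_bcontfun abs_apply_le_norm])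
  have lin_add: "(LBINT t. v t * (g + h) t) = (LBINT t. v t * g t) + (LBINT t. v t * h t)" for g h :: "real \<Rightarrow>\<^sub>C real"
    using Bochner_Integration.integral_add[OF int[of g] int[of h]] by (simp add: distrib_left)
  have lin_scale: "(LBINT t. v t * (c *\<^sub>R g) t) = c * (LBINT t. v t * g t)" for c and g :: "real \<Rightarrow>\<^sub>C real"
    by (simp add: mult.left_commute)
  obtain B where B: "0 < B" "\<And>t. \<bar>v t\<bar> \<le> B" by (rule v_bounded) blast
  obtain C where C: "0 < C" "\<And>r M. continuous_on UNIV r \<Longrightarrow> (\<And>t. \<bar>r t\<bar> \<le> M) \<Longrightarrow> (LBINT t. v t * r t) = 0 \<Longrightarrow>
    \<exists>y y'. (\<forall>t. (y has_real_derivative y' t) (at t) \<and> (y' has_real_derivative a t * y t + r t) (at t) \<and>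
      \<bar>y t\<bar> \<le> C * M \<and> \<bar>y' t\<bar> \<le> C * M) \<and> (LBINT t. v t * y t) = 0"
    by (rule bounded_solution) blast
  define N where "N = (LBINT t. \<bar>v t\<bar>) / ?vv"
  have N: "0 \<le> N" using v_sq_pos by (simp add: N_def)
  have PN: "\<bar>P r\<bar> \<le> N * norm r" for r
  proof -
    have "\<bar>LBINT t. v t * r t\<bar> \<le> (LBINT t. \<bar>v t\<bar>) * norm r"
      by (rule abs_LBINT_v_mult_le[OF continuous_on_apply_bcontfun abs_apply_le_norm])
    then have "\<bar>LBINT t. v t * r t\<bar> / ?vv \<le> (LBINT t. \<bar>v t\<bar>) * norm r / ?vv"
      using v_sq_pos by (intro divide_right_mono) auto
    then show ?thesis using v_sq_pos by (simp add: P_def N_def abs_divide)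
  qed
  obtain S where S: "bounded_linear S" "\<And>r z. Sol r z \<longleftrightarrow> z = S r"
  proof (rule solution_operator[of Sol "2 * (C * (1 + N * B))"])
    show "Sol (r + r') (z + z')" if s: "Sol r z" "Sol r' z'" for r z r' z'
      unfolding Sol_def
    proof (intro allI conjI)
      fix t
      have "((\<lambda>t. fst z t + fst z' t) has_real_derivative snd z t + snd z' t) (at t)"
        using s unfolding Sol_def by (intro DERIV_add) auto
      then show "(fst (z + z') has_real_derivative snd (z + z') t) (at t)"
        by (simp add: plus_bcontfun.rep_eq[abs_def])
      have "((\<lambda>t. snd z t + snd z' t) has_real_derivative
          (a t * fst z t + (r t - P r * v t)) + (a t * fst z' t + (r' t - P r' * v t))) (at t)"
        using s unfolding Sol_def by (intro DERIV_add) auto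
      moreover have "P (r + r') = P r + P r'" unfolding P_def lin_add by (rule add_divide_distrib)
      ultimately show "(snd (z + z') has_real_derivative a t * fst (z + z') t + ((r + r') t - P (r + r') * v t)) (at t)"
        by (simp add: plus_bcontfun.rep_eq[abs_def] algebra_simps)
      show "(LBINT t. v t * fst (z + z') t) = 0"
        using s unfolding Sol_def fst_add lin_add by simp
    qed
    show "Sol (c *\<^sub>R r) (c *\<^sub>R z)" if s: "Sol r z" for c r z
      unfolding Sol_def
    proof (intro allI conjI)
      fix t
      have "((\<lambda>t. c * fst z t) has_real_derivative c * snd z t) (at t)"
        using s unfolding Sol_def by (intro DERIV_cmult) auto
      then show "(fst (c *\<^sub>R z) has_real_derivative snd (c *\<^sub>R z) t) (at t)"
        by (simp add: scaleR_bcontfun.rep_eq[abs_def])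
      have "((\<lambda>t. c * snd z t) has_real_derivative c * (a t * fst z t + (r t - P r * v t))) (at t)"
        using s unfolding Sol_def by (intro DERIV_cmult) auto
      moreover have "P (c *\<^sub>R r) = c * P r" unfolding P_def lin_scale by simp
      ultimately show "(snd (c *\<^sub>R z) has_real_derivative a t * fst (c *\<^sub>R z) t + ((c *\<^sub>R r) t - P (c *\<^sub>R r) * v t)) (at t)"
        by (simp add: scaleR_bcontfun.rep_eq[abs_def] algebra_simps)
      show "(LBINT t. v t * fst (c *\<^sub>R z) t) = 0"
        using s unfolding Sol_def fst_scaleR lin_scale by simp
    qed
    show "\<exists>z. Sol r z \<and> norm z \<le> 2 * (C * (1 + N * B)) * norm r" for r
    proof -
      let ?r = "\<lambda>t. r t - P r * v t"
      have rc: "continuous_on UNIV ?r" by (intro continuous_intros v_cont continuous_on_apply_bcontfun)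
      have rM: "\<bar>?r t\<bar> \<le> (1 + N * B) * norm r" for t
      proof -
        have "\<bar>P r * v t\<bar> \<le> N * norm r * B"
          unfolding abs_mult using PN[of r] B by (intro mult_mono) auto
        then show ?thesis using abs_apply_le_norm[of r t] by (simp add: algebra_simps)
      qed
      have "(LBINT t. v t * ?r t) = (LBINT t. v t * r t) - P r * ?vv"
        using int[of r] integrable_v_sq by (simp add: right_diff_distrib mult.left_commute)
      then have orth: "(LBINT t. v t * ?r t) = 0" using v_sq_pos by (simp add: P_def)
      obtain y y' where y: "\<And>t. (y has_real_derivative y' t) (at t)" "\<And>t. (y' has_real_derivative a t * y t + ?r t) (at t)"
        "\<And>t. \<bar>y t\<bar> \<le> C * ((1 + N * B) * norm r)" "\<And>t. \<bar>y' t\<bar> \<le> C * ((1 + N * B) * norm r)" "(LBINT t. v t * y t) = 0"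
        using C(2)[OF rc rM orth] by blast
      have ap: "apply_bcontfun (Bcontfun y) = y" "apply_bcontfun (Bcontfun y') = y'"
        by (rule Bcontfun_apply[OF continuous_on_DERIV[OF y(1)] y(3)]
              Bcontfun_apply[OF continuous_on_DERIV[OF y(2)] y(4)])+
      have "norm (Bcontfun y, Bcontfun y') \<le> norm (Bcontfun y) + norm (Bcontfun y')"
        by (rule norm_Pair_le)
      also have "\<dots> \<le> C * ((1 + N * B) * norm r) + C * ((1 + N * B) * norm r)"
        using y(3,4) by (intro add_mono norm_bcontfun_le) (simp_all only: ap)
      also have "\<dots> = 2 * (C * (1 + N * B)) * norm r" by (simp add: mult.assoc)
      finally have bd: "norm (Bcontfun y, Bcontfun y') \<le> 2 * (C * (1 + N * B)) * norm r" .
      have "Sol r (Bcontfun y, Bcontfun y')" by (simp add: Sol_def ap y)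
      then show ?thesis using bd by blast
    qed
    show "z = 0" if s: "Sol 0 z" for z
    proof -
      have d: "(fst z has_real_derivative snd z t) (at t)" "(snd z has_real_derivative a t * fst z t) (at t)" for t
        using s unfolding Sol_def by (simp_all add: P_def)
      have f0: "fst z t = 0" for t
      proof (rule uniqueness[OF d])
        show "\<bar>fst z t\<bar> \<le> norm (fst z) + norm (snd z)" "\<bar>snd z t\<bar> \<le> norm (fst z) + norm (snd z)" for t
          using abs_apply_le_norm[of "fst z" t] abs_apply_le_norm[of "snd z" t]
            norm_ge_zero[of "fst z"] norm_ge_zero[of "snd z"] by linarith+
        show "(LBINT t. v t * fst z t) = 0" using s unfolding Sol_def by simp
      qed
      then have "apply_bcontfun (fst z) = (\<lambda>_. 0)" by auto
      then have "snd z t = 0" for t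
        using d(1)[of t] DERIV_unique[OF _ DERIV_const[of 0 "at t"], of "snd z t"] by simp
      then show ?thesis using f0 by (simp add: prod_eq_iff bcontfun_eqI)
    qed
  qed (blast intro: that)
  show ?thesis
  proof (rule that[OF S(1)])
    fix r z assume "(LBINT t. v t * apply_bcontfun r t) = 0"
    then have "P r = 0" by (simp add: P_def)
    then show "z = S r \<longleftrightarrow> (\<forall>t. (fst z has_real_derivative snd z t) (at t) \<and>
       (snd z has_real_derivative a t * fst z t + r t) (at t)) \<and> (LBINT t. v t * fst z t) = 0"
      using S(2)[of r z] by (simp add: Sol_def)
  qed
qed

end

lemma periodic_uniformly_continuous:
  fixes g :: "real \<Rightarrow> real"
  assumes per: "\<And>t. g (t + 1) = g t" and cont: "continuous_on UNIV g" and e: "0 < e"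
  obtains d where "0 < d" "\<And>t h. \<bar>h\<bar> < d \<Longrightarrow> \<bar>g (t - h) - g t\<bar> < e"
proof -
  \<comment> \<open>The interval contains every \<open>frac t - h\<close> with \<bar>h\<bar> <
    1.\<close>
  have "uniformly_continuous_on {-1..2} g"
    by (intro compact_uniformly_continuous continuous_on_subset[OF cont]) auto
  then obtain d where d: "0 < d" "\<And>s t. s \<in> {-1..2} \<Longrightarrow> t \<in> {-1..2} \<Longrightarrow> dist s t < d \<Longrightarrow> dist (g s) (g t) < e"
    unfolding uniformly_continuous_on_def using e by metis
  show ?thesis
  proof (rule that[of "min d 1"])
    fix t h :: real assume h: "\<bar>h\<bar> < min d 1"
    have t: "0 \<le> frac t" "frac t < 1" by (simp_all add: frac_lt_1)
    have "dist (g (frac t - h)) (g (frac t - 0)) < e"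
    proof (intro d(2))
      have "\<bar>h\<bar> < d" "\<bar>h\<bar> < 1" using h by simp_all
      then show "frac t - h \<in> {-1..2}" "frac t - 0 \<in> {-1..2}" "dist (frac t - h) (frac t - 0) < d"
        unfolding atLeastAtMost_iff dist_real_def using t by linarith+
    qed
    then show "\<bar>g (t - h) - g t\<bar> < e"
      unfolding periodic_frac[of g, OF per] by (simp add: dist_real_def)
  qed (use d in simp)
qed

locale heteroclinic = perturbed_oscillator +
  fixes \<phi> \<phi>' :: "real \<Rightarrow> real" and pm pp g0 A \<kappa> T :: real
  assumes \<phi>: "\<And>t. (\<phi> has_real_derivative \<phi>' t) (at t)"
    and \<phi>': "\<And>t. (\<phi>' has_real_derivative f (\<phi> t)) (at t)"
    and \<phi>_lim: "(\<phi> \<longlongrightarrow> pm) at_bot" "(\<phi> \<longlongrightarrow> pp) at_top"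
    and \<phi>'_lim: "(\<phi>' \<longlongrightarrow> 0) at_bot" "(\<phi>' \<longlongrightarrow> 0) at_top"
    and f_pq: "f pm = 0" "f pp = 0"
    and \<phi>_nonconst: "\<exists>t. \<phi>' t \<noteq> 0"
    and orbit_\<Omega>: "\<And>t. (\<phi> t, \<phi>' t) \<in> \<Omega>" "(pm, 0) \<in> \<Omega>" "(pp, 0) \<in> \<Omega>"
    and k_orbit: "\<And>t. k (\<phi> t, \<phi>' t) = g0" and g0: "g0 \<noteq> 0"
    and f1_orbit_le: "\<And>t. \<bar>f1 (\<phi> t)\<bar> \<le> A"
    and \<kappa>_pos: "0 < \<kappa>" and f1_orbit_ge: "\<And>t. T \<le> \<bar>t\<bar> \<Longrightarrow> \<kappa> \<le> f1 (\<phi> t)"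
begin

lemma \<phi>_cont: "continuous_on S \<phi>"
  by (rule continuous_on_DERIV[OF \<phi>])

sublocale decaying_solution "\<lambda>t. f1 (\<phi> t)" \<phi>' "\<lambda>t. f (\<phi> t)" A \<kappa> T
proof
  show "continuous_on UNIV (\<lambda>t. f1 (\<phi> t))"
    by (rule continuous_on_compose2[OF f1_cont \<phi>_cont]) auto
  show "((\<lambda>t. f (\<phi> t)) has_real_derivative f1 (\<phi> t) * \<phi>' t) (at t)" for t
    by (rule DERIV_chain2[OF f \<phi>])
  have "isCont f x" for x using f_cont[of UNIV] by (simp add: continuous_on_eq_continuous_at)
  then show "((\<lambda>t. f (\<phi> t)) \<longlongrightarrow> 0) at_top" "((\<lambda>t. f (\<phi> t)) \<longlongrightarrow> 0) at_bot"
    using isCont_tendsto_compose[of pm f, OF _ \<phi>_lim(1)] isCont_tendsto_compose[of pp f, OF _ \<phi>_lim(2)]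
    by (simp_all add: f_pq)
qed (use f1_orbit_le \<kappa>_pos f1_orbit_ge \<phi>' \<phi>'_lim \<phi>_nonconst in auto)

lemma orbit_tube:
  obtains K \<eta> where "compact K" "\<And>t. (\<phi> t, \<phi>' t) \<in> K" "0 < \<eta>" "\<And>z h. z \<in> K \<Longrightarrow> norm h \<le> \<eta> \<Longrightarrow> z + h \<in> \<Omega>"
proof (rule orbit_in_compact[of "\<lambda>t. (\<phi> t, \<phi>' t)" \<Omega> "(pm, 0)" "(pp, 0)"])
  show "((\<lambda>t. (\<phi> t, \<phi>' t)) \<longlongrightarrow> (pm, 0)) at_bot" "((\<lambda>t. (\<phi> t, \<phi>' t)) \<longlongrightarrow> (pp, 0)) at_top"
    by (intro tendsto_intros \<phi>_lim \<phi>'_lim)+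
qed (use \<Omega> orbit_\<Omega> that in \<open>auto intro!: continuous_intros \<phi>_cont v_cont\<close>)

lemma \<gamma>1_per: "\<gamma>1 (t + 1) = \<gamma>1 t"
proof -
  have "((\<lambda>t. \<gamma> (t + 1)) has_real_derivative \<gamma>1 (t + 1)) (at t)"
    using \<gamma>[of "t + 1"] by (simp add: DERIV_shift)
  then show ?thesis using \<gamma>_per DERIV_unique[OF _ \<gamma>[of t]] by simp
qed

lemma \<gamma>1_bounded: obtains G where "0 < G" "\<And>t. \<bar>\<gamma>1 t\<bar> \<le> G"
  using periodic_bounded[OF \<gamma>1_per \<gamma>1_cont] by blast

lemma shift_cont: "continuous_on S (\<lambda>t. \<gamma> (t - \<alpha>))" "continuous_on S (\<lambda>t. \<gamma>1 (t - \<alpha>))"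
  by (rule continuous_on_compose2[OF \<gamma>_cont[of UNIV]] continuous_on_compose2[OF \<gamma>1_cont]; auto intro!: continuous_intros)+

text \<open>The Melnikov integral after a translation of time. The parameter now sits in \<gamma>,
  so differentiation in it falls on \<gamma> and leaves the integrable weight \<phi>' fixed.\<close>

definition Mel :: "real \<Rightarrow> real" where "Mel \<alpha> = (LBINT t. \<phi>' t * \<gamma> (t - \<alpha>))"
definition Mel' :: "real \<Rightarrow> real" where "Mel' \<alpha> = - (LBINT t. \<phi>' t * \<gamma>1 (t - \<alpha>))"

abbreviation "V1 \<equiv> LBINT t. \<bar>\<phi>' t\<bar>"

lemma V1_nonneg: "0 \<le> V1" by (rule Bochner_Integration.integral_nonneg) simp

lemma LBINT_v_diff:
  assumes "continuous_on UNIV r" "\<And>t. \<bar>r t\<bar> \<le> M" "continuous_on UNIV s" "\<And>t. \<bar>s t\<bar> \<le> N"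
  shows "(LBINT t. \<phi>' t * r t) - (LBINT t. \<phi>' t * s t) = (LBINT t. \<phi>' t * (r t - s t))"
  using integrable_v_mult[OF assms(1,2)] integrable_v_mult[OF assms(3,4)] by (simp add: right_diff_distrib)

lemma Mel'_uniform:
  assumes "0 < e"
  obtains d where "0 < d" "\<And>\<alpha> \<beta>. \<bar>\<alpha> - \<beta>\<bar> < d \<Longrightarrow> \<bar>Mel' \<alpha> - Mel' \<beta>\<bar> \<le> V1 * e"
proof -
  obtain G where G: "0 < G" "\<And>t. \<bar>\<gamma>1 t\<bar> \<le> G" by (rule \<gamma>1_bounded) blast
  obtain d where d: "0 < d" "\<And>t h. \<bar>h\<bar> < d \<Longrightarrow> \<bar>\<gamma>1 (t - h) - \<gamma>1 t\<bar> < e"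
    using periodic_uniformly_continuous[OF \<gamma>1_per \<gamma>1_cont assms] by blast
  show ?thesis
  proof (rule that[OF d(1)])
    fix \<alpha> \<beta> :: real assume "\<bar>\<alpha> - \<beta>\<bar> < d"
    then have le: "\<bar>\<gamma>1 (t - \<beta>) - \<gamma>1 (t - \<alpha>)\<bar> \<le> e" for t
      using d(2)[of "\<alpha> - \<beta>" "t - \<beta>"] by (simp add: abs_minus_commute less_imp_le)
    have "Mel' \<alpha> - Mel' \<beta> = (LBINT t. \<phi>' t * (\<gamma>1 (t - \<beta>) - \<gamma>1 (t - \<alpha>)))"
      using LBINT_v_diff[OF shift_cont(2) G(2) shift_cont(2) G(2), of \<beta> \<alpha>] by (simp add: Mel'_def)
    also have "\<bar>\<dots>\<bar> \<le> V1 * e"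
      by (rule abs_LBINT_v_mult_le) (auto intro!: continuous_intros shift_cont le)
    finally show "\<bar>Mel' \<alpha> - Mel' \<beta>\<bar> \<le> V1 * e" .
  qed
qed

text \<open>Differentiation under the integral: the linearization error of \<gamma> is small
  uniformly in t, as its periodic derivative is uniformly continuous, and the weight \<phi>' is
  integrable.\<close>

lemma Mel_deriv: "(Mel has_real_derivative Mel' \<alpha>) (at \<alpha>)"
  unfolding has_field_derivative_def has_derivative_at_alt
proof (intro conjI allI impI bounded_linear_mult_right)
  fix e :: real assume e: "0 < e"
  \<comment> \<open>\<open>V1\<close> is the integral of \<bar>\<phi>'\<bar>; adding 1 permits the
    division when only \<open>V1_nonneg\<close> is at hand.\<close>
  define e' where "e' = e / (V1 + 1)"
  have V: "0 < V1 + 1" using V1_nonneg by linarith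
  have e': "0 < e'" using e V by (simp add: e'_def)
  have "V1 * e' \<le> (V1 + 1) * e'" using e' by (intro mult_right_mono) auto
  also have "\<dots> = e" using V by (simp add: e'_def)
  finally have e'V: "V1 * e' \<le> e" .
  obtain G0 where G0: "0 < G0" "\<And>t. \<bar>\<gamma> t\<bar> \<le> G0" by (rule \<gamma>_bounded) blast
  obtain G where G: "0 < G" "\<And>t. \<bar>\<gamma>1 t\<bar> \<le> G" by (rule \<gamma>1_bounded) blast
  obtain d where d: "0 < d" "\<And>t h. \<bar>h\<bar> < d \<Longrightarrow> \<bar>\<gamma>1 (t - h) - \<gamma>1 t\<bar> < e'"
    using periodic_uniformly_continuous[OF \<gamma>1_per \<gamma>1_cont e'] by blast
  show "\<exists>d>0. \<forall>\<beta>. norm (\<beta> - \<alpha>) < d \<longrightarrow> norm (Mel \<beta> - Mel \<alpha> - Mel' \<alpha> * (\<beta> - \<alpha>)) \<le> e * norm (\<beta> - \<alpha>)"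
  proof (intro exI[of _ d] conjI allI impI d)
    fix \<beta> assume \<beta>: "norm (\<beta> - \<alpha>) < d"
    have le: "\<bar>(\<gamma> (t - \<beta>) - \<gamma> (t - \<alpha>)) - (- (\<beta> - \<alpha>) * \<gamma>1 (t - \<alpha>))\<bar> \<le> e' * \<bar>\<beta> - \<alpha>\<bar>" for t
    proof -
      let ?F = "\<lambda>u. \<gamma> (t - u) + u * \<gamma>1 (t - \<alpha>)"
      have "norm (?F \<beta> - ?F \<alpha>) \<le> e' * norm (\<beta> - \<alpha>)"
      proof (rule field_differentiable_bound[OF convex_closed_segment])
        fix u assume u: "u \<in> closed_segment \<alpha> \<beta>"
        have "((\<lambda>u. \<gamma> (t - u)) has_real_derivative \<gamma>1 (t - u) * (- 1)) (at u)"
          by (rule DERIV_chain2[where f = \<gamma>, OF \<gamma>]) (auto intro!: derivative_eq_intros)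
        then have "(?F has_real_derivative \<gamma>1 (t - \<alpha>) - \<gamma>1 (t - u)) (at u)"
          by (auto intro!: derivative_eq_intros)
        then show "(?F has_real_derivative \<gamma>1 (t - \<alpha>) - \<gamma>1 (t - u)) (at u within closed_segment \<alpha> \<beta>)"
          by (rule has_field_derivative_at_within)
        have "\<bar>u - \<alpha>\<bar> < d"
          using segment_bound(1)[OF u] \<beta> by (simp add: abs_minus_commute)
        then show "norm (\<gamma>1 (t - \<alpha>) - \<gamma>1 (t - u)) \<le> e'"
          using d(2)[of "u - \<alpha>" "t - \<alpha>"] by (simp add: abs_minus_commute less_imp_le)
      qed auto
      then show ?thesis by (simp add: algebra_simps)
    qed
    have "(LBINT t. \<phi>' t * (c * \<gamma>1 (t - \<alpha>))) = c * (LBINT t. \<phi>' t * \<gamma>1 (t - \<alpha>))" for c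
      by (simp add: mult.left_commute)
    note c = this[of "- (\<beta> - \<alpha>)"]
    have "Mel \<beta> - Mel \<alpha> - Mel' \<alpha> * (\<beta> - \<alpha>) =
        (LBINT t. \<phi>' t * (\<gamma> (t - \<beta>) - \<gamma> (t - \<alpha>))) - (LBINT t. \<phi>' t * (- (\<beta> - \<alpha>) * \<gamma>1 (t - \<alpha>)))"
      using LBINT_v_diff[OF shift_cont(1) G0(2) shift_cont(1) G0(2), of \<beta> \<alpha>]
      unfolding c Mel_def Mel'_def by (simp only: mult_minus_left mult.commute)
    also have "\<dots> = (LBINT t. \<phi>' t * ((\<gamma> (t - \<beta>) - \<gamma> (t - \<alpha>)) - (- (\<beta> - \<alpha>) * \<gamma>1 (t - \<alpha>))))"
    proof (rule LBINT_v_diff[of _ "2 * G0" _ "\<bar>\<beta> - \<alpha>\<bar> * G"])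
      show "\<bar>\<gamma> (t - \<beta>) - \<gamma> (t - \<alpha>)\<bar> \<le> 2 * G0" for t
        using G0(2)[of "t - \<beta>"] G0(2)[of "t - \<alpha>"] by linarith
      show "\<bar>- (\<beta> - \<alpha>) * \<gamma>1 (t - \<alpha>)\<bar> \<le> \<bar>\<beta> - \<alpha>\<bar> * G" for t
        using G(2)[of "t - \<alpha>"] by (simp add: abs_mult mult_left_mono abs_minus_commute)
    qed (auto intro!: continuous_intros shift_cont)
    also have "\<bar>\<dots>\<bar> \<le> V1 * (e' * \<bar>\<beta> - \<alpha>\<bar>)"
      by (rule abs_LBINT_v_mult_le[OF _ le]) (auto intro!: continuous_intros shift_cont)
    also have "\<dots> \<le> e * \<bar>\<beta> - \<alpha>\<bar>"
      using mult_right_mono[OF e'V, of "\<bar>\<beta> - \<alpha>\<bar>"] by (simp add: mult.assoc)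
    finally show "norm (Mel \<beta> - Mel \<alpha> - Mel' \<alpha> * (\<beta> - \<alpha>)) \<le> e * norm (\<beta> - \<alpha>)" by simp
  qed
qed

text \<open>The scaled right-hand side as a function of \<open>p = (\<epsilon>, y, w, b)\<close>, where \<open>\<alpha>\<^sub>0 + \<theta> b\<close> is the phase,
  at the point \<open>\<tau> = (z, s)\<close>, where \<open>z\<close> is a point of the phase space and \<open>s\<close> is the time.\<close>

definition phase_point :: "(real \<times> real) \<times> real \<Rightarrow> real4 \<Rightarrow> real \<times> real" where
  "phase_point \<tau> p = (fst (fst \<tau>) + fst p * fst (snd p), snd (fst \<tau>) + fst p * fst (snd (snd p)))"

definition forcing_time :: "real \<Rightarrow> real \<Rightarrow> (real \<times> real) \<times> real \<Rightarrow> real4 \<Rightarrow> real" where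
  "forcing_time \<alpha>0 \<theta> \<tau> p = snd \<tau> - (\<alpha>0 + \<theta> * snd (snd (snd p)))"

definition scaled_rhs :: "real \<Rightarrow> real \<Rightarrow> (real \<times> real) \<times> real \<Rightarrow> real4 \<Rightarrow> real" where
  "scaled_rhs \<alpha>0 \<theta> \<tau> p = fst (snd p) * remainder (fst (fst \<tau>)) (fst p * fst (snd p)) + \<gamma> (forcing_time \<alpha>0 \<theta> \<tau> p) * k (phase_point \<tau> p)"

definition scaled_grad :: "real \<Rightarrow> real \<Rightarrow> (real \<times> real) \<times> real \<Rightarrow> real4 \<Rightarrow> real4" where
  "scaled_grad \<alpha>0 \<theta> \<tau> p =
    (let \<epsilon> = fst p; y = fst (snd p); w = fst (snd (snd p)); x = fst (fst \<tau>); z = phase_point \<tau> p; t = forcing_time \<alpha>0 \<theta> \<tau> p in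
    (y * (remainder' x (\<epsilon> * y) * y) + \<gamma> t * (k1 z * y + k2 z * w),
     remainder x (\<epsilon> * y) + y * (remainder' x (\<epsilon> * y) * \<epsilon>) + \<gamma> t * (k1 z * \<epsilon>),
     \<gamma> t * (k2 z * \<epsilon>),
     - \<theta> * \<gamma>1 t * k z))"

lemma scaled_rhs_has_derivative:
  assumes z: "phase_point \<tau> p \<in> \<Omega>"
  shows "(scaled_rhs \<alpha>0 \<theta> \<tau> has_derivative (\<lambda>h. scaled_grad \<alpha>0 \<theta> \<tau> p \<bullet> h)) (at p within D)"
proof -
  have kp: "((\<lambda>p. remainder (fst (fst \<tau>)) (fst p * fst (snd p))) has_derivative
      (\<lambda>h. (fst p * fst (snd h) + fst h * fst (snd p)) * remainder' (fst (fst \<tau>)) (fst p * fst (snd p)))) (at p within D)"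
    by (rule DERIV_compose_FDERIV[OF remainder_deriv]) (auto intro!: derivative_eq_intros)
  have gp: "((\<lambda>p. \<gamma> (forcing_time \<alpha>0 \<theta> \<tau> p)) has_derivative (\<lambda>h. - \<theta> * snd (snd (snd h)) * \<gamma>1 (forcing_time \<alpha>0 \<theta> \<tau> p))) (at p within D)"
    unfolding forcing_time_def by (rule DERIV_compose_FDERIV[OF \<gamma>]) (auto intro!: derivative_eq_intros)
  have zp: "((\<lambda>p. phase_point \<tau> p) has_derivative (\<lambda>h. (fst p * fst (snd h) + fst h * fst (snd p),
      fst p * fst (snd (snd h)) + fst h * fst (snd (snd p))))) (at p within D)"
    unfolding phase_point_def by (auto intro!: derivative_eq_intros)
  note kz = has_derivative_compose[OF zp k[OF z]]
  show ?thesis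
    unfolding scaled_rhs_def scaled_grad_def Let_def
    by (rule has_derivative_eq_rhs, rule derivative_intros, rule derivative_intros)
       (auto intro!: derivative_eq_intros kp gp kz simp: fun_eq_iff inner_prod_def algebra_simps)
qed

lemma scaled_rhs_grad_cont:
  assumes "continuous_on S \<tau>" "continuous_on S P" "\<And>s. s \<in> S \<Longrightarrow> phase_point (\<tau> s) (P s) \<in> \<Omega>"
  shows "continuous_on S (\<lambda>s. scaled_rhs \<alpha>0 \<theta> (\<tau> s) (P s))" "continuous_on S (\<lambda>s. scaled_grad \<alpha>0 \<theta> (\<tau> s) (P s))"
proof -
  have z: "continuous_on S (\<lambda>s. phase_point (\<tau> s) (P s))"
    unfolding phase_point_def by (intro continuous_intros assms)
  have kz: "continuous_on S (\<lambda>s. k (phase_point (\<tau> s) (P s)))" "continuous_on S (\<lambda>s. k1 (phase_point (\<tau> s) (P s)))"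
    "continuous_on S (\<lambda>s. k2 (phase_point (\<tau> s) (P s)))"
    by (rule continuous_on_compose2[OF k_cont z] continuous_on_compose2[OF k1_cont z]
         continuous_on_compose2[OF k2_cont z]; use assms(3) in blast)+
  have t: "continuous_on S (\<lambda>s. forcing_time \<alpha>0 \<theta> (\<tau> s) (P s))"
    unfolding forcing_time_def by (intro continuous_intros assms)
  have gt: "continuous_on S (\<lambda>s. \<gamma> (forcing_time \<alpha>0 \<theta> (\<tau> s) (P s)))" "continuous_on S (\<lambda>s. \<gamma>1 (forcing_time \<alpha>0 \<theta> (\<tau> s) (P s)))"
    by (rule continuous_on_compose2[OF \<gamma>_cont[of UNIV] t] continuous_on_compose2[OF \<gamma>1_cont t]; simp)+
  have pr: "continuous_on S (\<lambda>s. (fst (fst (\<tau> s)), fst (P s) * fst (snd (P s))))"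
    by (intro continuous_intros assms)
  have kp: "continuous_on S (\<lambda>s. remainder (fst (fst (\<tau> s))) (fst (P s) * fst (snd (P s))))"
    "continuous_on S (\<lambda>s. remainder' (fst (fst (\<tau> s))) (fst (P s) * fst (snd (P s))))"
    using continuous_on_compose2[OF remainder_cont[of UNIV] pr] continuous_on_compose2[OF remainder_deriv_cont[of UNIV] pr] by simp_all
  show "continuous_on S (\<lambda>s. scaled_rhs \<alpha>0 \<theta> (\<tau> s) (P s))" "continuous_on S (\<lambda>s. scaled_grad \<alpha>0 \<theta> (\<tau> s) (P s))"
    unfolding scaled_rhs_def scaled_grad_def Let_def by (intro continuous_intros assms kz gt kp)+
qed

text \<open>Time enters only through \<gamma> and its derivative. Replacing t by its fractional part
  confines the parameter \<tau> to a compact set, on which the moduli become uniform.\<close>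

lemma scaled_rhs_periodic: "scaled_rhs \<alpha>0 \<theta> (z, frac s) P = scaled_rhs \<alpha>0 \<theta> (z, s) P"
  and scaled_grad_periodic: "scaled_grad \<alpha>0 \<theta> (z, frac s) P = scaled_grad \<alpha>0 \<theta> (z, s) P"
proof -
  have t: "\<gamma> (forcing_time \<alpha>0 \<theta> (z, frac s) P) = \<gamma> (forcing_time \<alpha>0 \<theta> (z, s) P)" "\<gamma>1 (forcing_time \<alpha>0 \<theta> (z, frac s) P) = \<gamma>1 (forcing_time \<alpha>0 \<theta> (z, s) P)"
    unfolding forcing_time_def snd_conv by (rule periodic_frac[where g = \<gamma>, OF \<gamma>_per] periodic_frac[where g = \<gamma>1, OF \<gamma>1_per])+
  have "phase_point (z, frac s) P = phase_point (z, s) P" by (simp add: phase_point_def)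
  then show "scaled_rhs \<alpha>0 \<theta> (z, frac s) P = scaled_rhs \<alpha>0 \<theta> (z, s) P" "scaled_grad \<alpha>0 \<theta> (z, frac s) P = scaled_grad \<alpha>0 \<theta> (z, s) P"
    by (simp_all add: scaled_rhs_def scaled_grad_def Let_def t)
qed

end

section \<open>The bifurcation equation\<close>

text \<open>The constants of the contraction. \<open>C1\<close> is the radius for Y and Y', twice
  the operator bound \<open>Ms\<close> times a bound of the scaled forcing. The phase scale \<theta>
  is so small that \<open>Mel'\<close> is nearly m and the direct effect of the phase on Y is weak.
  The distance of the scaled equation from its explicit limit at \<epsilon> = 0 is at most
  \<nu>.\<close>

locale melnikov_reduction = heteroclinic +
  fixes \<alpha>0 m \<theta> e0 C1 Ms \<Gamma> \<nu> B :: real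
    and S :: "(real \<Rightarrow>\<^sub>C real) \<Rightarrow> (real \<Rightarrow>\<^sub>C real) \<times> (real \<Rightarrow>\<^sub>C real)" and K :: "(real \<times> real) set"
  assumes m: "m \<noteq> 0" and \<theta>: "0 < \<theta>" and e0: "0 < e0" and Ms: "0 < Ms" and \<Gamma>: "0 < \<Gamma>" "\<And>t. \<bar>\<gamma> t\<bar> \<le> \<Gamma>"
    and Mel0: "Mel \<alpha>0 = 0"
    and S_lin: "bounded_linear S" and S_le: "\<And>r. norm (S r) \<le> Ms * norm r"
    and S_iff: "\<And>r z. (LBINT t. \<phi>' t * apply_bcontfun r t) = 0 \<Longrightarrow> z = S r \<longleftrightarrow>
      (\<forall>t. (fst z has_real_derivative snd z t) (at t) \<and>
       (snd z has_real_derivative f1 (\<phi> t) * fst z t + r t) (at t)) \<and> (LBINT t. \<phi>' t * fst z t) = 0"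
    and K: "compact K" and orbit_K: "\<And>t. (\<phi> t, \<phi>' t) \<in> K"
    and tube: "\<And>z h1 h2. z \<in> K \<Longrightarrow> \<bar>h1\<bar> \<le> e0 * C1 \<Longrightarrow> \<bar>h2\<bar> \<le> e0 * C1 \<Longrightarrow> z + (h1, h2) \<in> \<Omega>"
    and C1: "C1 = 2 * Ms * (\<Gamma> * (\<bar>g0\<bar> + 1) + 1)"
    and \<theta>1: "\<And>\<alpha>. \<bar>\<alpha> - \<alpha>0\<bar> \<le> \<theta> \<Longrightarrow> \<bar>m - Mel' \<alpha>\<bar> \<le> \<bar>m\<bar> / 8"
    and \<theta>2: "\<And>t. 2 * Ms * (\<theta> * \<bar>\<gamma>1 t\<bar> * \<bar>g0\<bar>) \<le> 1 / 8"
    and \<nu>: "0 < \<nu>" "\<nu> \<le> 1" "64 * Ms * \<nu> \<le> 1" "32 * (V1 * \<nu>) \<le> \<bar>m * \<theta> * g0\<bar>"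
    and B: "\<And>t p. p \<in> {-e0..e0} \<times> {-C1..C1} \<times> {-C1..C1} \<times> {-1..1} \<Longrightarrow> \<bar>scaled_rhs \<alpha>0 \<theta> ((\<phi> t, \<phi>' t), t) p\<bar> \<le> B"
      "\<And>t p. p \<in> {-e0..e0} \<times> {-C1..C1} \<times> {-C1..C1} \<times> {-1..1} \<Longrightarrow> norm (scaled_grad \<alpha>0 \<theta> ((\<phi> t, \<phi>' t), t) p) \<le> B"
    and small: "\<And>t \<epsilon> y. \<bar>\<epsilon>\<bar> < e0 \<Longrightarrow> y \<in> {-C1..C1} \<times> {-C1..C1} \<times> {-1..1} \<Longrightarrow>
        \<bar>scaled_rhs \<alpha>0 \<theta> ((\<phi> t, \<phi>' t), t) (\<epsilon>, y) - scaled_rhs \<alpha>0 \<theta> ((\<phi> t, \<phi>' t), t) (0, y)\<bar> \<le> \<nu>"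
      "\<And>t \<epsilon> y. \<bar>\<epsilon>\<bar> < e0 \<Longrightarrow> y \<in> {-C1..C1} \<times> {-C1..C1} \<times> {-1..1} \<Longrightarrow>
        norm (scaled_grad \<alpha>0 \<theta> ((\<phi> t, \<phi>' t), t) (\<epsilon>, y) - scaled_grad \<alpha>0 \<theta> ((\<phi> t, \<phi>' t), t) (0, y)) \<le> \<nu>"
begin

definition D :: "real4 set" where "D = {-e0..e0} \<times> {-C1..C1} \<times> {-C1..C1} \<times> {-1..1}"

definition W :: "state set" where
  "W = {x. norm (fst x) \<le> C1 \<and> norm (fst (snd x)) \<le> C1 \<and> \<bar>snd (snd x)\<bar> \<le> 1}"

lemma C1_pos: "0 < C1"
  unfolding C1 using Ms \<Gamma>(1) by (intro mult_pos_pos add_nonneg_pos) auto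

lemma D_compact: "compact D" and D_convex: "convex D"
  unfolding D_def by (intro compact_Times compact_Icc convex_Times convex_real_interval)+

lemma phase_point_in_\<Omega>: "fst \<tau> \<in> K \<Longrightarrow> P \<in> D \<Longrightarrow> phase_point \<tau> P \<in> \<Omega>"
proof -
  assume \<tau>: "fst \<tau> \<in> K" and P: "P \<in> D"
  obtain \<epsilon> y w b where PP: "P = (\<epsilon>, y, w, b)" by (metis prod.exhaust)
  have "\<bar>\<epsilon> * y\<bar> \<le> e0 * C1" "\<bar>\<epsilon> * w\<bar> \<le> e0 * C1"
    unfolding abs_mult using P C1_pos e0 by (auto simp: PP D_def abs_le_iff intro!: mult_mono)
  then have "fst \<tau> + (\<epsilon> * y, \<epsilon> * w) \<in> \<Omega>" by (intro tube \<tau>)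
  then show ?thesis by (simp add: phase_point_def PP plus_prod_def)
qed

lemma curve_in_D: "\<bar>\<epsilon>\<bar> < e0 \<Longrightarrow> x \<in> W \<Longrightarrow> curve \<epsilon> x t \<in> D"
  using abs_apply_le_norm[of "fst x" t] abs_apply_le_norm[of "fst (snd x)" t]
  by (auto simp: curve_def D_def W_def abs_le_iff)

sublocale superposition "\<lambda>t. scaled_rhs \<alpha>0 \<theta> ((\<phi> t, \<phi>' t), t)" "\<lambda>t. scaled_grad \<alpha>0 \<theta> ((\<phi> t, \<phi>' t), t)" D W e0 B
proof
  have orb: "phase_point ((\<phi> t, \<phi>' t), t) P \<in> \<Omega>" if "P \<in> D" for t P
    using that orbit_K by (intro phase_point_in_\<Omega>) auto
  show "continuous_on UNIV (\<lambda>t. scaled_rhs \<alpha>0 \<theta> ((\<phi> t, \<phi>' t), t) (P t))"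
    "continuous_on UNIV (\<lambda>t. scaled_grad \<alpha>0 \<theta> ((\<phi> t, \<phi>' t), t) (P t))"
    if "continuous_on UNIV P" "\<And>t. P t \<in> D" for P
    using that by (intro scaled_rhs_grad_cont continuous_intros \<phi>_cont v_cont orb; simp)+
  let ?K = "K \<times> {0..1::real}"
  have Kc: "compact ?K" by (intro compact_Times K compact_Icc)
  have grc: "continuous_on (?K \<times> D) (\<lambda>z. scaled_grad \<alpha>0 \<theta> (fst z) (snd z))"
    by (intro scaled_rhs_grad_cont continuous_intros phase_point_in_\<Omega>) auto
  have der: "(scaled_rhs \<alpha>0 \<theta> \<tau> has_derivative (\<lambda>h. scaled_grad \<alpha>0 \<theta> \<tau> P \<bullet> h)) (at P within D)" if "\<tau> \<in> ?K" "P \<in> D" for \<tau> P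
    using that by (intro scaled_rhs_has_derivative phase_point_in_\<Omega>) auto
  have fr: "((\<phi> t, \<phi>' t), frac t) \<in> ?K" for t
    using orbit_K by (auto simp: frac_lt_1 less_imp_le)
  show "\<exists>d>0. \<forall>t. \<forall>P\<in>D. \<forall>P'\<in>D. norm (P' - P) < d \<longrightarrow>
      \<bar>scaled_rhs \<alpha>0 \<theta> ((\<phi> t, \<phi>' t), t) P' - scaled_rhs \<alpha>0 \<theta> ((\<phi> t, \<phi>' t), t) P - scaled_grad \<alpha>0 \<theta> ((\<phi> t, \<phi>' t), t) P \<bullet> (P' - P)\<bar>
        \<le> e * norm (P' - P)" if e: "0 < e" for e
  proof -
    obtain d where d: "0 < d" "\<And>\<tau> P P'. \<tau> \<in> ?K \<Longrightarrow> P \<in> D \<Longrightarrow> P' \<in> D \<Longrightarrow> norm (P' - P) < d \<Longrightarrow>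
      \<bar>scaled_rhs \<alpha>0 \<theta> \<tau> P' - scaled_rhs \<alpha>0 \<theta> \<tau> P - scaled_grad \<alpha>0 \<theta> \<tau> P \<bullet> (P' - P)\<bar> \<le> e * norm (P' - P)"
      using uniform_Taylor[OF Kc D_compact D_convex grc der e] by blast
    show ?thesis
      using d(2)[OF fr] by (intro exI[of _ d] conjI d(1) allI ballI impI) (simp add: scaled_rhs_periodic scaled_grad_periodic)
  qed
  show "\<exists>d>0. \<forall>t. \<forall>P\<in>D. \<forall>P'\<in>D. norm (P' - P) < d \<longrightarrow>
      norm (scaled_grad \<alpha>0 \<theta> ((\<phi> t, \<phi>' t), t) P' - scaled_grad \<alpha>0 \<theta> ((\<phi> t, \<phi>' t), t) P) \<le> e" if e: "0 < e" for e
  proof -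
    obtain d where d: "0 < d" "\<And>\<tau> P P'. \<tau> \<in> ?K \<Longrightarrow> P \<in> D \<Longrightarrow> P' \<in> D \<Longrightarrow> dist P' P < d \<Longrightarrow>
      dist (scaled_grad \<alpha>0 \<theta> \<tau> P') (scaled_grad \<alpha>0 \<theta> \<tau> P) < e"
      using uniform_equicontinuous[OF Kc D_compact grc e] by blast
    show ?thesis
      using d(2)[OF fr] by (intro exI[of _ d] conjI d(1) allI ballI impI)
        (simp add: scaled_grad_periodic dist_norm less_imp_le)
  qed
qed (use curve_in_D B in \<open>auto simp: D_def\<close>)

definition pairing :: "(real \<Rightarrow>\<^sub>C real) \<Rightarrow> real" where "pairing r = (LBINT t. \<phi>' t * apply_bcontfun r t)"

lemma pairing_int: "integrable lborel (\<lambda>t. \<phi>' t * apply_bcontfun r t)"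
  by (rule integrable_v_mult[OF continuous_on_apply_bcontfun abs_apply_le_norm])

lemma pairing_linear: "bounded_linear pairing"
proof (rule bounded_linear_intro)
  show "pairing (r + s) = pairing r + pairing s" for r s
    using Bochner_Integration.integral_add[OF pairing_int[of r] pairing_int[of s]] by (simp add: pairing_def distrib_left)
  show "pairing (c *\<^sub>R r) = c *\<^sub>R pairing r" for c r
    by (simp add: pairing_def mult.left_commute)
  show "norm (pairing r) \<le> norm r * V1" for r
    using abs_LBINT_v_mult_le[OF continuous_on_apply_bcontfun abs_apply_le_norm, of r]
    by (simp add: pairing_def mult.commute)
qed

lemma pairing_approx:
  assumes "continuous_on UNIV s" "\<And>t. \<bar>s t\<bar> \<le> M" "\<And>t. \<bar>apply_bcontfun r t - s t\<bar> \<le> e"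
  shows "\<bar>pairing r - (LBINT t. \<phi>' t * s t)\<bar> \<le> V1 * e"
proof -
  have "pairing r - (LBINT t. \<phi>' t * s t) = (LBINT t. \<phi>' t * (r t - s t))"
    unfolding pairing_def by (rule LBINT_v_diff[OF continuous_on_apply_bcontfun abs_apply_le_norm assms(1,2)])
  also have "\<bar>\<dots>\<bar> \<le> V1 * e"
    by (rule abs_LBINT_v_mult_le) (use assms in \<open>auto intro!: continuous_intros continuous_on_apply_bcontfun\<close>)
  finally show ?thesis .
qed

text \<open>The last component is the Newton correction of the scaled phase b. At \<epsilon> = 0 the
  pairing is \<open>g0 * Mel (\<alpha>0 + \<theta> * b)\<close>, whose derivative in b is close to
  \<open>m * \<theta> * g0\<close>; this constant is divided out, so that adding b in
  \<open>F\<close> nearly cancels the dependence on b.\<close>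

definition \<Lambda> :: "(real \<Rightarrow>\<^sub>C real) \<Rightarrow> state" where
  "\<Lambda> r = (fst (S r), snd (S r), - (1 / (m * \<theta> * g0)) * pairing r)"

definition F :: "real \<Rightarrow> state \<Rightarrow> state" where
  "F \<epsilon> x = \<Lambda> (superpose \<epsilon> x) + (0, 0, snd (snd x))"

definition DF :: "real \<Rightarrow> state \<Rightarrow> real \<times> state \<Rightarrow> state" where
  "DF \<epsilon> x z = \<Lambda> (dsuperpose \<epsilon> x z) + (0, 0, snd (snd (snd z)))"

lemma \<Lambda>_linear: "bounded_linear \<Lambda>"
  unfolding \<Lambda>_def
  by (intro bounded_linear_Pair bounded_linear_compose[OF bounded_linear_fst S_lin]
      bounded_linear_compose[OF bounded_linear_snd S_lin] bounded_linear_compose[OF bounded_linear_mult_right pairing_linear])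

definition \<alpha>of :: "state \<Rightarrow> real" where "\<alpha>of x = \<alpha>0 + \<theta> * snd (snd x)"

lemma \<alpha>of_near: "x \<in> W \<Longrightarrow> \<bar>\<alpha>of x - \<alpha>0\<bar> \<le> \<theta>"
  using \<theta> by (auto simp: \<alpha>of_def W_def abs_mult mult_left_le)

lemma curve_tail: "x \<in> W \<Longrightarrow> snd (curve \<epsilon> x t) \<in> {-C1..C1} \<times> {-C1..C1} \<times> {-1..1}"
  using curve_in_D[of 0 x t] e0 by (auto simp: curve_def D_def)

lemma curve_split: "curve \<epsilon> x t = (\<epsilon>, snd (curve \<epsilon>' x t))"
  by (simp add: curve_def)

lemma scaled_rhs_0: "scaled_rhs \<alpha>0 \<theta> ((\<phi> t, \<phi>' t), t) (curve 0 x t) = \<gamma> (t - \<alpha>of x) * g0"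
  by (simp add: scaled_rhs_def curve_def phase_point_def forcing_time_def \<alpha>of_def k_orbit)

lemma scaled_grad_0: "scaled_grad \<alpha>0 \<theta> ((\<phi> t, \<phi>' t), t) (curve 0 x t) \<bullet> curve 0 \<xi> t = - \<theta> * \<gamma>1 (t - \<alpha>of x) * g0 * snd (snd \<xi>)"
  by (simp add: scaled_grad_def Let_def curve_def phase_point_def forcing_time_def \<alpha>of_def k_orbit inner_prod_def)

lemma superpose_approx:
  assumes "\<bar>\<epsilon>\<bar> < e0" "x \<in> W"
  shows "\<bar>superpose \<epsilon> x t - \<gamma> (t - \<alpha>of x) * g0\<bar> \<le> \<nu>"
  using small(1)[OF assms(1) curve_tail[OF assms(2)], of t 0 t] superpose_apply[OF assms, of t] scaled_rhs_0[of t x]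
    curve_split[of \<epsilon> x t 0] curve_split[of 0 x t 0] by simp

lemma dsuperpose_approx:
  assumes "\<bar>\<epsilon>\<bar> < e0" "x \<in> W"
  shows "\<bar>dsuperpose \<epsilon> x (0, \<xi>) t - (- \<theta> * \<gamma>1 (t - \<alpha>of x) * g0 * snd (snd \<xi>))\<bar> \<le> 4 * \<nu> * norm \<xi>"
proof -
  have "\<bar>(scaled_grad \<alpha>0 \<theta> ((\<phi> t, \<phi>' t), t) (curve \<epsilon> x t) - scaled_grad \<alpha>0 \<theta> ((\<phi> t, \<phi>' t), t) (curve 0 x t)) \<bullet> curve 0 \<xi> t\<bar>
     \<le> norm (scaled_grad \<alpha>0 \<theta> ((\<phi> t, \<phi>' t), t) (curve \<epsilon> x t) - scaled_grad \<alpha>0 \<theta> ((\<phi> t, \<phi>' t), t) (curve 0 x t)) * norm (curve 0 \<xi> t)"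
    by (rule Cauchy_Schwarz_ineq2)
  also have "\<dots> \<le> \<nu> * (4 * norm \<xi>)"
  proof (rule mult_mono)
    show "norm (scaled_grad \<alpha>0 \<theta> ((\<phi> t, \<phi>' t), t) (curve \<epsilon> x t) - scaled_grad \<alpha>0 \<theta> ((\<phi> t, \<phi>' t), t) (curve 0 x t)) \<le> \<nu>"
      using small(2)[OF assms(1) curve_tail[OF assms(2)], of t 0 t] curve_split[of \<epsilon> x t 0] curve_split[of 0 x t 0] by simp
    show "norm (curve 0 \<xi> t) \<le> 4 * norm \<xi>"
      using norm_curve_le[of "(0, \<xi>)" t] by (simp add: norm_Pair)
  qed (use \<nu> in auto)
  finally show ?thesis
    using dsuperpose_apply[OF assms, of "(0, \<xi>)" t] scaled_grad_0[of t x \<xi>] by (simp add: inner_diff_left)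
qed

lemma mtg: "m * \<theta> * g0 \<noteq> 0" using m \<theta> g0 by simp

lemma S_superpose_le:
  assumes "\<bar>\<epsilon>\<bar> < e0" "x \<in> W"
  shows "norm (superpose \<epsilon> x) \<le> \<Gamma> * (\<bar>g0\<bar> + 1) + 1" "norm (S (superpose \<epsilon> x)) \<le> C1"
proof -
  show 1: "norm (superpose \<epsilon> x) \<le> \<Gamma> * (\<bar>g0\<bar> + 1) + 1"
  proof (rule norm_bcontfun_le)
    fix t
    have "\<bar>\<gamma> (t - \<alpha>of x) * g0\<bar> \<le> \<Gamma> * \<bar>g0\<bar>"
      unfolding abs_mult using \<Gamma>(2) by (intro mult_right_mono) auto
    then show "\<bar>superpose \<epsilon> x t\<bar> \<le> \<Gamma> * (\<bar>g0\<bar> + 1) + 1"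
      using superpose_approx[OF assms, of t] \<nu>(2) \<Gamma>(1) unfolding distrib_left by linarith
  qed
  have "norm (S (superpose \<epsilon> x)) \<le> Ms * (\<Gamma> * (\<bar>g0\<bar> + 1) + 1)"
    using S_le[of "superpose \<epsilon> x"] mult_left_mono[OF 1, of Ms] Ms by linarith
  also have "\<dots> \<le> C1" using C1_pos by (simp add: C1)
  finally show "norm (S (superpose \<epsilon> x)) \<le> C1" .
qed

text \<open>The critical component is the phase. In units of
  \<open>\<bar>m * \<theta> * g0\<bar>\<close> the nonlinearity of \<open>Mel\<close> costs at most
  1/8 and the passage from \<epsilon> = 0 at most 1/32, so the new phase stays in [-1, 1].\<close>

lemma F_maps:
  assumes \<epsilon>: "\<bar>\<epsilon>\<bar> < e0" and x: "x \<in> W"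
  shows "F \<epsilon> x \<in> W"
proof -
  let ?r = "superpose \<epsilon> x" and ?\<alpha> = "\<alpha>of x" and ?a = "snd (snd x)"
  note b = norm_fst_le_norm[of "S ?r"] norm_snd_le_norm[of "S ?r"] S_superpose_le(2)[OF \<epsilon> x]
  have a: "\<bar>?a\<bar> \<le> 1" using x by (simp add: W_def)
  \<comment> \<open>On the interval of radius \<theta> the function \<open>Mel u - m * u\<close> has
    a derivative of size at most \<open>\<bar>m\<bar> / 8\<close>.\<close>
  have "\<bar>(Mel ?\<alpha> - m * ?\<alpha>) - (Mel \<alpha>0 - m * \<alpha>0)\<bar> \<le> \<bar>m\<bar> / 8 * \<bar>?\<alpha> - \<alpha>0\<bar>"
  proof -
    have "norm ((\<lambda>u. Mel u - m * u) ?\<alpha> - (\<lambda>u. Mel u - m * u) \<alpha>0) \<le> \<bar>m\<bar> / 8 * norm (?\<alpha> - \<alpha>0)"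
    proof (rule field_differentiable_bound[of "{\<alpha>0 - \<theta>..\<alpha>0 + \<theta>}"])
      show "((\<lambda>u. Mel u - m * u) has_real_derivative Mel' u - m) (at u within {\<alpha>0 - \<theta>..\<alpha>0 + \<theta>})" for u
        by (auto intro!: derivative_eq_intros has_field_derivative_at_within[OF Mel_deriv])
      show "norm (Mel' u - m) \<le> \<bar>m\<bar> / 8" if "u \<in> {\<alpha>0 - \<theta>..\<alpha>0 + \<theta>}" for u
        using \<theta>1[of u] that by (simp add: abs_minus_commute abs_le_iff)
    qed (use \<alpha>of_near[OF x] \<theta> in \<open>auto simp: abs_le_iff\<close>)
    then show ?thesis by simp
  qed
  also have "\<dots> \<le> \<bar>m\<bar> / 8 * \<theta>" using \<alpha>of_near[OF x] by (intro mult_left_mono) auto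
  finally have "\<bar>Mel ?\<alpha> - m * (\<theta> * ?a)\<bar> \<le> \<bar>m\<bar> / 8 * \<theta>" by (simp add: Mel0 \<alpha>of_def algebra_simps)
  then have "\<bar>g0\<bar> * \<bar>Mel ?\<alpha> - m * (\<theta> * ?a)\<bar> \<le> \<bar>g0\<bar> * (\<bar>m\<bar> / 8 * \<theta>)" by (intro mult_left_mono) auto
  then have 1: "\<bar>g0 * Mel ?\<alpha> - m * \<theta> * g0 * ?a\<bar> \<le> \<bar>m * \<theta> * g0\<bar> / 8"
    using \<theta> by (simp add: abs_mult[symmetric] right_diff_distrib) (simp add: abs_mult algebra_simps)
  have "\<bar>pairing ?r - (LBINT t. \<phi>' t * (\<gamma> (t - ?\<alpha>) * g0))\<bar> \<le> V1 * \<nu>"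
  proof (rule pairing_approx[of _ "\<Gamma> * \<bar>g0\<bar>"])
    show "\<bar>\<gamma> (t - ?\<alpha>) * g0\<bar> \<le> \<Gamma> * \<bar>g0\<bar>" for t
      unfolding abs_mult using \<Gamma>(2) by (intro mult_right_mono) auto
  qed (auto intro!: continuous_intros shift_cont superpose_approx[OF \<epsilon> x])
  moreover have "(LBINT t. \<phi>' t * (\<gamma> (t - ?\<alpha>) * g0)) = g0 * Mel ?\<alpha>"
  proof -
    have "(LBINT t. \<phi>' t * (\<gamma> (t - ?\<alpha>) * g0)) = (LBINT t. g0 * (\<phi>' t * \<gamma> (t - ?\<alpha>)))"
      by (intro Bochner_Integration.integral_cong) simp_all
    also have "\<dots> = g0 * (LBINT t. \<phi>' t * \<gamma> (t - ?\<alpha>))" by (rule integral_mult_right_zero)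
    finally show ?thesis by (simp only: Mel_def)
  qed
  ultimately have 2: "\<bar>pairing ?r - g0 * Mel ?\<alpha>\<bar> \<le> V1 * \<nu>" by simp
  have "\<bar>pairing ?r - m * \<theta> * g0 * ?a\<bar> \<le> \<bar>m * \<theta> * g0\<bar>"
    using 1 2 \<nu>(4) by linarith
  then have "\<bar>(pairing ?r - m * \<theta> * g0 * ?a) / (m * \<theta> * g0)\<bar> \<le> 1"
    using mtg by (simp add: abs_divide divide_le_eq_1)
  moreover have "(pairing ?r - m * \<theta> * g0 * ?a) / (m * \<theta> * g0) = - (- (1 / (m * \<theta> * g0)) * pairing ?r + ?a)"
    using mtg by (simp add: diff_divide_distrib)
  ultimately have "\<bar>- (1 / (m * \<theta> * g0)) * pairing ?r + ?a\<bar> \<le> 1" by (simp only: abs_minus_cancel)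
  then show ?thesis using b by (simp add: F_def \<Lambda>_def W_def)
qed

text \<open>Four contributions of 1/8: for Y and Y' together the explicit dependence on the phase,
  controlled by \<theta>, and the deviation \<nu> from \<epsilon> = 0; for the phase the deviation
  of \<open>Mel'\<close> from m and again \<nu>.\<close>

lemma DF_contraction:
  assumes \<epsilon>: "\<bar>\<epsilon>\<bar> < e0" and x: "x \<in> W"
  shows "norm (DF \<epsilon> x (0, \<xi>)) \<le> 1 / 2 * norm \<xi>"
proof -
  let ?r = "dsuperpose \<epsilon> x (0, \<xi>)" and ?\<alpha> = "\<alpha>of x" and ?b = "snd (snd \<xi>)"
  let ?s = "\<lambda>t. - \<theta> * \<gamma>1 (t - ?\<alpha>) * g0 * ?b"
  have b: "\<bar>?b\<bar> \<le> norm \<xi>"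
    using norm_snd_le_norm[of "snd \<xi>"] norm_snd_le_norm[of \<xi>] by simp
  have r: "2 * Ms * \<bar>?r t\<bar> \<le> 1 / 4 * norm \<xi>" for t
  proof -
    have "2 * Ms * \<bar>?s t\<bar> = 2 * Ms * (\<theta> * \<bar>\<gamma>1 (t - ?\<alpha>)\<bar> * \<bar>g0\<bar>) * \<bar>?b\<bar>"
      using \<theta> by (simp add: abs_mult)
    also have "\<dots> \<le> 1 / 8 * norm \<xi>"
      using \<theta>2[of "t - ?\<alpha>"] b by (intro mult_mono) auto
    finally have 1: "2 * Ms * \<bar>?s t\<bar> \<le> 1 / 8 * norm \<xi>" .
    have "2 * Ms * \<bar>?r t - ?s t\<bar> \<le> 2 * Ms * (4 * \<nu> * norm \<xi>)"
      using dsuperpose_approx[OF \<epsilon> x, of \<xi> t] Ms by (intro mult_left_mono) auto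
    also have "\<dots> = 1 / 8 * (64 * Ms * \<nu>) * norm \<xi>" by simp
    also have "\<dots> \<le> 1 / 8 * 1 * norm \<xi>"
      using \<nu>(3) by (intro mult_right_mono mult_left_mono) auto
    finally have 2: "2 * Ms * \<bar>?r t - ?s t\<bar> \<le> 1 / 8 * norm \<xi>" by simp
    have "2 * Ms * \<bar>?r t\<bar> \<le> 2 * Ms * (\<bar>?s t\<bar> + \<bar>?r t - ?s t\<bar>)"
      using Ms by (intro mult_left_mono) auto
    then show ?thesis using 1 2 unfolding distrib_left by linarith
  qed
  have "\<bar>?r t\<bar> \<le> 1 / 4 * norm \<xi> / (2 * Ms)" for t
    using r[of t] Ms by (simp add: field_simps)
  then have "norm ?r \<le> 1 / 4 * norm \<xi> / (2 * Ms)" by (rule norm_bcontfun_le)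
  then have "2 * (Ms * norm ?r) \<le> 1 / 4 * norm \<xi>" using Ms by (simp add: field_simps)
  then have Sr: "norm (fst (S ?r)) + norm (snd (S ?r)) \<le> 1 / 4 * norm \<xi>"
    using norm_fst_le_norm[of "S ?r"] norm_snd_le_norm[of "S ?r"] S_le[of ?r] by linarith
  have "\<bar>pairing ?r - (LBINT t. \<phi>' t * ?s t)\<bar> \<le> V1 * (4 * \<nu> * norm \<xi>)"
  proof -
    obtain G where G: "0 < G" "\<And>t. \<bar>\<gamma>1 t\<bar> \<le> G" by (rule \<gamma>1_bounded) blast
    have "\<bar>?s t\<bar> \<le> \<theta> * G * \<bar>g0\<bar> * \<bar>?b\<bar>" for t
      unfolding abs_mult using G(2) \<theta> by (intro mult_right_mono mult_mono) auto
    then show ?thesis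
      by (intro pairing_approx dsuperpose_approx[OF \<epsilon> x] continuous_intros shift_cont)
  qed
  moreover have "(LBINT t. \<phi>' t * ?s t) = \<theta> * g0 * ?b * Mel' ?\<alpha>"
  proof -
    have "(LBINT t. \<phi>' t * ?s t) = (LBINT t. (- \<theta> * g0 * ?b) * (\<phi>' t * \<gamma>1 (t - ?\<alpha>)))"
      by (intro Bochner_Integration.integral_cong) simp_all
    also have "\<dots> = (- \<theta> * g0 * ?b) * (LBINT t. \<phi>' t * \<gamma>1 (t - ?\<alpha>))"
      by (rule integral_mult_right_zero)
    finally show ?thesis by (simp add: Mel'_def)
  qed
  ultimately have 1: "\<bar>pairing ?r - \<theta> * g0 * ?b * Mel' ?\<alpha>\<bar> \<le> V1 * (4 * \<nu> * norm \<xi>)" by simp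
  also have "\<dots> = 1 / 8 * (32 * (V1 * \<nu>)) * norm \<xi>" by simp
  also have "\<dots> \<le> 1 / 8 * \<bar>m * \<theta> * g0\<bar> * norm \<xi>"
    using \<nu>(4) by (intro mult_right_mono mult_left_mono) auto
  finally have 2: "\<bar>pairing ?r - \<theta> * g0 * ?b * Mel' ?\<alpha>\<bar> \<le> 1 / 8 * \<bar>m * \<theta> * g0\<bar> * norm \<xi>" .
  have "\<bar>\<theta> * g0 * ?b * (m - Mel' ?\<alpha>)\<bar> = \<bar>\<theta> * g0\<bar> * \<bar>?b\<bar> * \<bar>m - Mel' ?\<alpha>\<bar>"
    by (simp add: abs_mult)
  also have "\<dots> \<le> \<bar>\<theta> * g0\<bar> * norm \<xi> * (\<bar>m\<bar> / 8)"
    using \<theta>1[OF \<alpha>of_near[OF x]] b by (intro mult_mono) auto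
  also have "\<dots> = 1 / 8 * \<bar>m * \<theta> * g0\<bar> * norm \<xi>" by (simp add: abs_mult)
  finally have 3: "\<bar>\<theta> * g0 * ?b * (m - Mel' ?\<alpha>)\<bar> \<le> 1 / 8 * \<bar>m * \<theta> * g0\<bar> * norm \<xi>" .
  have "\<bar>m * \<theta> * g0 * ?b - pairing ?r\<bar> \<le> \<bar>m * \<theta> * g0\<bar> * (1 / 4 * norm \<xi>)"
  proof -
    have "m * \<theta> * g0 * ?b - pairing ?r = \<theta> * g0 * ?b * (m - Mel' ?\<alpha>) - (pairing ?r - \<theta> * g0 * ?b * Mel' ?\<alpha>)"
      by (simp add: algebra_simps)
    then show ?thesis using 2 3 by linarith
  qed
  then have "\<bar>(m * \<theta> * g0 * ?b - pairing ?r) / (m * \<theta> * g0)\<bar> \<le> 1 / 4 * norm \<xi>"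
    using mtg by (simp add: abs_divide pos_divide_le_eq mult.commute)
  moreover have "(m * \<theta> * g0 * ?b - pairing ?r) / (m * \<theta> * g0) = - (1 / (m * \<theta> * g0)) * pairing ?r + ?b"
    using mtg by (simp add: diff_divide_distrib)
  ultimately have third: "\<bar>- (1 / (m * \<theta> * g0)) * pairing ?r + ?b\<bar> \<le> 1 / 4 * norm \<xi>" by simp
  have DF: "DF \<epsilon> x (0, \<xi>) = (fst (S ?r), snd (S ?r), - (1 / (m * \<theta> * g0)) * pairing ?r + ?b)"
    by (simp add: DF_def \<Lambda>_def)
  have tri: "norm (y, w, c) \<le> norm y + norm w + \<bar>c\<bar>" for y w :: "real \<Rightarrow>\<^sub>C real" and c :: real
    using norm_Pair_le[of y "(w, c)"] norm_Pair_le[of w c] by simp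
  show ?thesis
    unfolding DF using tri[of "fst (S ?r)" "snd (S ?r)" "- (1 / (m * \<theta> * g0)) * pairing ?r + ?b"] Sr third by linarith
qed

theorem fixed_points:
  obtains X X' where "\<And>\<epsilon>. \<bar>\<epsilon>\<bar> < e0 \<Longrightarrow> X \<epsilon> \<in> W \<and> F \<epsilon> (X \<epsilon>) = X \<epsilon>"
    "\<And>\<epsilon> x. \<bar>\<epsilon>\<bar> < e0 \<Longrightarrow> x \<in> W \<Longrightarrow> F \<epsilon> x = x \<Longrightarrow> x = X \<epsilon>"
    "\<And>\<epsilon>. \<bar>\<epsilon>\<bar> < e0 \<Longrightarrow> (X has_vector_derivative X' \<epsilon>) (at \<epsilon>)"
    "continuous_on {-e0<..<e0} X'"
proof (rule fixed_point_C1[of W "1 / 2" e0 F DF])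
  show "closed W" unfolding W_def
    by (intro closed_Collect_conj closed_Collect_le continuous_intros)
  have "W = (cball 0 C1) \<times> (cball 0 C1) \<times> (cball 0 1)"
    by (auto simp: W_def)
  then show "convex W" by (simp only: convex_Times convex_cball)
  show "W \<noteq> {}" using C1_pos by (auto simp: W_def intro!: exI[of _ 0])
  show "((\<lambda>z. F (fst z) (snd z)) has_derivative DF \<epsilon> x) (at (\<epsilon>, x) within {-e0<..<e0} \<times> W)"
    if "\<bar>\<epsilon>\<bar> < e0" "x \<in> W" for \<epsilon> x
    unfolding F_def DF_def[abs_def]
    by (intro has_derivative_add bounded_linear.has_derivative[OF \<Lambda>_linear] superpose_has_derivative that
        has_derivative_Pair has_derivative_const has_derivative_snd has_derivative_ident)
  show "continuous_on ({-e0<..<e0} \<times> W) (\<lambda>z. DF (fst z) (snd z) \<zeta>)" for \<zeta>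
    unfolding DF_def
    by (intro continuous_intros bounded_linear.continuous_on[OF \<Lambda>_linear] dsuperpose_continuous)
qed (use F_maps DF_contraction that in auto)

end

section \<open>Correspondence between fixed points and solutions\<close>

context melnikov_reduction
begin

lemma fixed_iff:
  "F \<epsilon> x = x \<longleftrightarrow> pairing (superpose \<epsilon> x) = 0 \<and> S (superpose \<epsilon> x) = (fst x, fst (snd x))"
  using mtg by (auto simp: F_def \<Lambda>_def prod_eq_iff)

lemma superpose_explicit:
  assumes "\<bar>\<epsilon>\<bar> < e0" "x \<in> W"
  shows "superpose \<epsilon> x t = fst x t * remainder (\<phi> t) (\<epsilon> * fst x t)
    + \<gamma> (t - \<alpha>of x) * k (\<phi> t + \<epsilon> * fst x t, \<phi>' t + \<epsilon> * fst (snd x) t)"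
  by (simp add: superpose_apply[OF assms] scaled_rhs_def curve_def phase_point_def forcing_time_def \<alpha>of_def)

lemma fixed_imp_solution:
  assumes \<epsilon>: "\<bar>\<epsilon>\<bar> < e0" and x: "x \<in> W" and fx: "F \<epsilon> x = x"
  shows "shifted_sol \<epsilon> (\<alpha>of x) (\<lambda>t. \<phi> t + \<epsilon> * fst x t) (\<lambda>t. \<phi>' t + \<epsilon> * fst (snd x) t)"
    "(LBINT t. \<phi>' t * fst x t) = 0"
    "\<bar>f (\<phi> t + \<epsilon> * fst x t) + \<epsilon> * \<gamma> (t - \<alpha>of x) * k (\<phi> t + \<epsilon> * fst x t, \<phi>' t + \<epsilon> * fst (snd x) t) - f (\<phi> t)\<bar>
      \<le> (A * C1 + (\<Gamma> * (\<bar>g0\<bar> + 1) + 1)) * \<bar>\<epsilon>\<bar>"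
proof -
  have "pairing (superpose \<epsilon> x) = 0" "(fst x, fst (snd x)) = S (superpose \<epsilon> x)" using fx by (simp_all add: fixed_iff)
  then have *: "(fst x has_real_derivative fst (snd x) t) (at t)"
    "(fst (snd x) has_real_derivative f1 (\<phi> t) * fst x t + superpose \<epsilon> x t) (at t)"
    "(LBINT t. \<phi>' t * fst x t) = 0" for t
    using S_iff[of "superpose \<epsilon> x" "(fst x, fst (snd x))"] by (simp_all add: pairing_def)
  \<comment> \<open>This undoes the division by \<epsilon>: \<open>remainder_mult\<close> is applied
    to the increment \<open>\<epsilon> * fst x t\<close>.\<close>
  have rhs: "f (\<phi> t + \<epsilon> * fst x t) + \<epsilon> * \<gamma> (t - \<alpha>of x) * k (\<phi> t + \<epsilon> * fst x t, \<phi>' t + \<epsilon> * fst (snd x) t)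
      = f (\<phi> t) + \<epsilon> * (f1 (\<phi> t) * fst x t + superpose \<epsilon> x t)" for t
    using remainder_mult[of "\<epsilon> * fst x t" "\<phi> t"] by (simp add: superpose_explicit[OF \<epsilon> x] algebra_simps)
  show "(LBINT t. \<phi>' t * fst x t) = 0" by (rule *(3))
  show "shifted_sol \<epsilon> (\<alpha>of x) (\<lambda>t. \<phi> t + \<epsilon> * fst x t) (\<lambda>t. \<phi>' t + \<epsilon> * fst (snd x) t)"
    unfolding shifted_sol_def rhs
  proof (intro allI conjI)
    fix t
    show "((\<lambda>t. \<phi> t + \<epsilon> * fst x t) has_real_derivative \<phi>' t + \<epsilon> * fst (snd x) t) (at t)"
      by (intro DERIV_add DERIV_cmult \<phi> *)
    show "((\<lambda>t. \<phi>' t + \<epsilon> * fst (snd x) t) has_real_derivative f (\<phi> t) + \<epsilon> * (f1 (\<phi> t) * fst x t + superpose \<epsilon> x t)) (at t)"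
      by (intro DERIV_add DERIV_cmult \<phi>' *)
    show "(\<phi> t + \<epsilon> * fst x t, \<phi>' t + \<epsilon> * fst (snd x) t) \<in> \<Omega>"
      using phase_point_in_\<Omega>[OF _ curve_in_D[OF \<epsilon> x, of t], of "((\<phi> t, \<phi>' t), t)"] orbit_K[of t]
      by (simp add: phase_point_def curve_def)
  qed
  have "\<bar>f1 (\<phi> t) * fst x t\<bar> \<le> A * C1"
    unfolding abs_mult using f1_orbit_le[of t] abs_apply_le_norm[of "fst x" t] x A_nonneg
    by (intro mult_mono) (auto simp: W_def)
  then have "\<bar>f1 (\<phi> t) * fst x t + superpose \<epsilon> x t\<bar> \<le> A * C1 + (\<Gamma> * (\<bar>g0\<bar> + 1) + 1)"
    using S_superpose_le(1)[OF \<epsilon> x] abs_apply_le_norm[of "superpose \<epsilon> x" t] by linarith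
  then have "\<bar>\<epsilon> * (f1 (\<phi> t) * fst x t + superpose \<epsilon> x t)\<bar> \<le> \<bar>\<epsilon>\<bar> * (A * C1 + (\<Gamma> * (\<bar>g0\<bar> + 1) + 1))"
    unfolding abs_mult by (intro mult_left_mono) auto
  then show "\<bar>f (\<phi> t + \<epsilon> * fst x t) + \<epsilon> * \<gamma> (t - \<alpha>of x) * k (\<phi> t + \<epsilon> * fst x t, \<phi>' t + \<epsilon> * fst (snd x) t) - f (\<phi> t)\<bar>
      \<le> (A * C1 + (\<Gamma> * (\<bar>g0\<bar> + 1) + 1)) * \<bar>\<epsilon>\<bar>"
    unfolding rhs by (simp add: mult.commute)
qed

text \<open>The way back from solutions, before any scaling. The difference to the orbit solves the
  linear equation with its own nonlinear part r as inhomogeneity. Being bounded, it forces r to be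
  orthogonal to \<phi>'; being orthogonal itself, it is the solution selected by S.\<close>

lemma solution_difference:
  assumes s: "shifted_sol \<epsilon> \<beta> \<xi> \<xi>'" and bd: "\<And>t. \<bar>\<xi> t - \<phi> t\<bar> \<le> b" "\<And>t. \<bar>\<xi>' t - \<phi>' t\<bar> \<le> b"
    and orth: "(LBINT t. \<phi>' t * (\<xi> t - \<phi> t)) = 0"
    and r: "\<And>t. \<bar>(\<xi> t - \<phi> t) * remainder (\<phi> t) (\<xi> t - \<phi> t) + \<epsilon> * \<gamma> (t - \<beta>) * k (\<xi> t, \<xi>' t)\<bar> \<le> M"
  defines "r \<equiv> Bcontfun (\<lambda>t. (\<xi> t - \<phi> t) * remainder (\<phi> t) (\<xi> t - \<phi> t) + \<epsilon> * \<gamma> (t - \<beta>) * k (\<xi> t, \<xi>' t))"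
  shows "apply_bcontfun r t = (\<xi> t - \<phi> t) * remainder (\<phi> t) (\<xi> t - \<phi> t) + \<epsilon> * \<gamma> (t - \<beta>) * k (\<xi> t, \<xi>' t)"
    "pairing r = 0" "S r = (Bcontfun (\<lambda>t. \<xi> t - \<phi> t), Bcontfun (\<lambda>t. \<xi>' t - \<phi>' t))"
    "apply_bcontfun (Bcontfun (\<lambda>t. \<xi> t - \<phi> t)) = (\<lambda>t. \<xi> t - \<phi> t)"
    "apply_bcontfun (Bcontfun (\<lambda>t. \<xi>' t - \<phi>' t)) = (\<lambda>t. \<xi>' t - \<phi>' t)"
proof -
  let ?r = "\<lambda>t. (\<xi> t - \<phi> t) * remainder (\<phi> t) (\<xi> t - \<phi> t) + \<epsilon> * \<gamma> (t - \<beta>) * k (\<xi> t, \<xi>' t)"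
  have \<xi>: "\<And>t. (\<xi> has_real_derivative \<xi>' t) (at t)"
    "\<And>t. (\<xi>' has_real_derivative f (\<xi> t) + \<epsilon> * \<gamma> (t - \<beta>) * k (\<xi> t, \<xi>' t)) (at t)" "\<And>t. (\<xi> t, \<xi>' t) \<in> \<Omega>"
    using s by (simp_all add: shifted_sol_def)
  have c: "continuous_on UNIV \<xi>" "continuous_on UNIV \<xi>'"
    by (rule continuous_on_DERIV[OF \<xi>(1)] continuous_on_DERIV[OF \<xi>(2)])+
  have pr: "continuous_on UNIV (\<lambda>t. (\<phi> t, \<xi> t - \<phi> t))" "continuous_on UNIV (\<lambda>t. (\<xi> t, \<xi>' t))"
    by (intro continuous_intros c \<phi>_cont)+
  have kp: "continuous_on UNIV (\<lambda>t. remainder (\<phi> t) (\<xi> t - \<phi> t))"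
    using continuous_on_compose2[OF remainder_cont[of UNIV] pr(1)] by simp
  have kc: "continuous_on UNIV (\<lambda>t. k (\<xi> t, \<xi>' t))"
    by (rule continuous_on_compose2[OF k_cont pr(2)]) (use \<xi>(3) in auto)
  have rc: "continuous_on UNIV ?r"
    by (intro continuous_intros c \<phi>_cont kp kc shift_cont)
  have ra: "apply_bcontfun (Bcontfun ?r) = ?r" by (rule Bcontfun_apply[OF rc r])
  have d: "((\<lambda>t. \<xi> t - \<phi> t) has_real_derivative \<xi>' t - \<phi>' t) (at t)"
    "((\<lambda>t. \<xi>' t - \<phi>' t) has_real_derivative f1 (\<phi> t) * (\<xi> t - \<phi> t) + ?r t) (at t)" for t
  proof -
    show "((\<lambda>t. \<xi> t - \<phi> t) has_real_derivative \<xi>' t - \<phi>' t) (at t)"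
      by (intro DERIV_diff \<xi> \<phi>)
    have "((\<lambda>t. \<xi>' t - \<phi>' t) has_real_derivative f (\<xi> t) + \<epsilon> * \<gamma> (t - \<beta>) * k (\<xi> t, \<xi>' t) - f (\<phi> t)) (at t)"
      by (intro DERIV_diff \<xi> \<phi>')
    then show "((\<lambda>t. \<xi>' t - \<phi>' t) has_real_derivative f1 (\<phi> t) * (\<xi> t - \<phi> t) + ?r t) (at t)"
      by (rule DERIV_cong) (simp add: remainder_mult)
  qed
  show ya: "apply_bcontfun (Bcontfun (\<lambda>t. \<xi> t - \<phi> t)) = (\<lambda>t. \<xi> t - \<phi> t)"
    by (rule Bcontfun_apply[OF continuous_on_DERIV[OF d(1)] bd(1)])
  show ya': "apply_bcontfun (Bcontfun (\<lambda>t. \<xi>' t - \<phi>' t)) = (\<lambda>t. \<xi>' t - \<phi>' t)"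
    by (rule Bcontfun_apply[OF continuous_on_DERIV[OF d(2)] bd(2)])
  show "apply_bcontfun r t = ?r t" unfolding r_def by (simp add: ra)
  have l0: "(LBINT t. \<phi>' t * ?r t) = 0"
    by (rule solvability[OF d rc r bd])
  then show "pairing r = 0" unfolding pairing_def r_def ra .
  have "(Bcontfun (\<lambda>t. \<xi> t - \<phi> t), Bcontfun (\<lambda>t. \<xi>' t - \<phi>' t)) = S (Bcontfun ?r)"
    by (subst S_iff) (simp_all add: ra ya ya' d orth l0)
  then show "S r = (Bcontfun (\<lambda>t. \<xi> t - \<phi> t), Bcontfun (\<lambda>t. \<xi>' t - \<phi>' t))" by (simp add: r_def)
qed

text \<open>The quadratic part of r is at most the difference divided by \<open>2 * Ms\<close>, so
  after applying S it is absorbed by half of the left side. What remains is the forcing, and mere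
  closeness b improves to order \<epsilon>.\<close>

lemma a_priori_bound:
  assumes s: "shifted_sol \<epsilon> \<beta> \<xi> \<xi>'" and bd: "\<And>t. \<bar>\<xi> t - \<phi> t\<bar> \<le> b" "\<And>t. \<bar>\<xi>' t - \<phi>' t\<bar> \<le> b"
    and orth: "(LBINT t. \<phi>' t * (\<xi> t - \<phi> t)) = 0"
    and remainder_small: "\<And>t u. \<bar>u\<bar> \<le> b \<Longrightarrow> 2 * Ms * \<bar>remainder (\<phi> t) u\<bar> \<le> 1"
    and k_small: "\<And>t h1 h2. \<bar>h1\<bar> \<le> b \<Longrightarrow> \<bar>h2\<bar> \<le> b \<Longrightarrow> \<bar>k (\<phi> t + h1, \<phi>' t + h2)\<bar> \<le> \<bar>g0\<bar> + 1"
  shows "\<bar>\<xi> t - \<phi> t\<bar> \<le> C1 * \<bar>\<epsilon>\<bar>" "\<bar>\<xi>' t - \<phi>' t\<bar> \<le> C1 * \<bar>\<epsilon>\<bar>"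
proof -
  let ?y = "Bcontfun (\<lambda>t. \<xi> t - \<phi> t)" and ?y' = "Bcontfun (\<lambda>t. \<xi>' t - \<phi>' t)"
  let ?r = "\<lambda>t. (\<xi> t - \<phi> t) * remainder (\<phi> t) (\<xi> t - \<phi> t) + \<epsilon> * \<gamma> (t - \<beta>) * k (\<xi> t, \<xi>' t)"
  let ?G = "\<bar>\<epsilon>\<bar> * (\<Gamma> * (\<bar>g0\<bar> + 1))"
  have r: "\<bar>?r t\<bar> \<le> c / (2 * Ms) + ?G" if "\<bar>\<xi> t - \<phi> t\<bar> \<le> c" for t c
  proof -
    have "\<bar>remainder (\<phi> t) (\<xi> t - \<phi> t)\<bar> \<le> 1 / (2 * Ms)"
      using remainder_small[OF bd(1)[of t], of t] Ms by (simp add: field_simps)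
    then have "\<bar>(\<xi> t - \<phi> t) * remainder (\<phi> t) (\<xi> t - \<phi> t)\<bar> \<le> c * (1 / (2 * Ms))"
      unfolding abs_mult using that by (intro mult_mono) auto
    moreover have "\<bar>\<gamma> (t - \<beta>)\<bar> * \<bar>k (\<xi> t, \<xi>' t)\<bar> \<le> \<Gamma> * (\<bar>g0\<bar> + 1)"
      using k_small[OF bd(1)[of t] bd(2)[of t], of t] \<Gamma> by (intro mult_mono) auto
    then have "\<bar>\<epsilon> * \<gamma> (t - \<beta>) * k (\<xi> t, \<xi>' t)\<bar> \<le> ?G"
      unfolding abs_mult mult.assoc by (intro mult_left_mono) auto
    ultimately show ?thesis by simp
  qed
  note * = solution_difference[OF s bd orth r[OF bd(1)]]
  have yn: "norm ?y \<le> Ms * norm (Bcontfun ?r)" "norm ?y' \<le> Ms * norm (Bcontfun ?r)"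
    using norm_fst_le_norm[of "S (Bcontfun ?r)"] norm_snd_le_norm[of "S (Bcontfun ?r)"] S_le[of "Bcontfun ?r"]
    unfolding *(3) by simp_all
  have "norm (Bcontfun ?r) \<le> norm ?y / (2 * Ms) + ?G"
    using abs_apply_le_norm[of ?y] unfolding *(4) by (intro norm_bcontfun_le) (simp only: *(1), rule r)
  then have "Ms * norm (Bcontfun ?r) \<le> Ms * (norm ?y / (2 * Ms) + ?G)" using Ms by (intro mult_left_mono) auto
  also have "\<dots> = norm ?y / 2 + Ms * ?G" using Ms by (simp add: distrib_left)
  finally have n: "Ms * norm (Bcontfun ?r) \<le> norm ?y / 2 + Ms * ?G" .
  have C: "2 * (Ms * ?G) \<le> C1 * \<bar>\<epsilon>\<bar>"
    unfolding C1 using Ms by (simp add: algebra_simps)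
  have "norm ?y \<le> C1 * \<bar>\<epsilon>\<bar>" "norm ?y' \<le> C1 * \<bar>\<epsilon>\<bar>" using yn n C by linarith+
  then show "\<bar>\<xi> t - \<phi> t\<bar> \<le> C1 * \<bar>\<epsilon>\<bar>" "\<bar>\<xi>' t - \<phi>' t\<bar> \<le> C1 * \<bar>\<epsilon>\<bar>"
    using abs_apply_le_norm[of ?y t] abs_apply_le_norm[of ?y' t] unfolding *(4,5) by linarith+
qed

lemma solution_imp_fixed:
  assumes \<epsilon>: "\<bar>\<epsilon>\<bar> < e0" "\<epsilon> \<noteq> 0" and \<beta>: "\<bar>\<beta> - \<alpha>0\<bar> \<le> \<theta>" and s: "shifted_sol \<epsilon> \<beta> \<xi> \<xi>'"
    and bd: "\<And>t. \<bar>\<xi> t - \<phi> t\<bar> \<le> C1 * \<bar>\<epsilon>\<bar>" "\<And>t. \<bar>\<xi>' t - \<phi>' t\<bar> \<le> C1 * \<bar>\<epsilon>\<bar>"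
    and orth: "(LBINT t. \<phi>' t * (\<xi> t - \<phi> t)) = 0"
  obtains x where "x \<in> W" "F \<epsilon> x = x" "\<alpha>of x = \<beta>" "\<And>t. \<xi> t = \<phi> t + \<epsilon> * fst x t"
proof -
  let ?y = "Bcontfun (\<lambda>t. \<xi> t - \<phi> t)" and ?y' = "Bcontfun (\<lambda>t. \<xi>' t - \<phi>' t)"
  let ?r = "\<lambda>t. (\<xi> t - \<phi> t) * remainder (\<phi> t) (\<xi> t - \<phi> t) + \<epsilon> * \<gamma> (t - \<beta>) * k (\<xi> t, \<xi>' t)"
  \<comment> \<open>The bound \<open>C1 * \<bar>\<epsilon>\<bar>\<close> is exactly what places the
    difference quotient in \<open>W\<close>.\<close>
  define x :: state where "x = ((1 / \<epsilon>) *\<^sub>R ?y, (1 / \<epsilon>) *\<^sub>R ?y', (\<beta> - \<alpha>0) / \<theta>)"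
  have d: "(\<xi> has_real_derivative \<xi>' t) (at t)"
    "(\<xi>' has_real_derivative f (\<xi> t) + \<epsilon> * \<gamma> (t - \<beta>) * k (\<xi> t, \<xi>' t)) (at t)" for t
    using s by (simp_all add: shifted_sol_def)
  have ya: "apply_bcontfun ?y = (\<lambda>t. \<xi> t - \<phi> t)"
    by (rule Bcontfun_apply[OF continuous_on_DERIV[OF DERIV_diff[OF d(1) \<phi>]] bd(1)])
  have ya': "apply_bcontfun ?y' = (\<lambda>t. \<xi>' t - \<phi>' t)"
    by (rule Bcontfun_apply[OF continuous_on_DERIV[OF DERIV_diff[OF d(2) \<phi>']] bd(2)])
  have yn: "norm ?y \<le> C1 * \<bar>\<epsilon>\<bar>" "norm ?y' \<le> C1 * \<bar>\<epsilon>\<bar>"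
    using bd by (auto intro!: norm_bcontfun_le simp: ya ya')
  have x: "x \<in> W"
  proof -
    have "norm ((1 / \<epsilon>) *\<^sub>R ?y) \<le> C1" "norm ((1 / \<epsilon>) *\<^sub>R ?y') \<le> C1"
      using yn \<epsilon>(2) by (simp_all add: pos_divide_le_eq)
    moreover have "\<bar>(\<beta> - \<alpha>0) / \<theta>\<bar> \<le> 1" using \<beta> \<theta> by (simp add: abs_divide pos_divide_le_eq)
    ultimately show ?thesis by (simp add: x_def W_def)
  qed
  have \<alpha>: "\<alpha>of x = \<beta>" using \<theta> by (simp add: \<alpha>of_def x_def)
  have xa: "\<epsilon> * fst x t = \<xi> t - \<phi> t" "\<epsilon> * fst (snd x) t = \<xi>' t - \<phi>' t" for t
    using \<epsilon>(2) by (simp_all add: x_def ya ya')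
  have superpose: "\<epsilon> * superpose \<epsilon> x t = ?r t" for t
    by (simp add: superpose_explicit[OF \<epsilon>(1) x] xa \<alpha> distrib_left mult.assoc[symmetric])
  have rM: "\<bar>?r t\<bar> \<le> \<bar>\<epsilon>\<bar> * norm (superpose \<epsilon> x)" for t
    unfolding superpose[symmetric] abs_mult by (intro mult_left_mono abs_apply_le_norm) auto
  note * = solution_difference[OF s bd orth rM]
  have r: "Bcontfun ?r = \<epsilon> *\<^sub>R superpose \<epsilon> x"
    by (rule bcontfun_eqI) (simp add: *(1) superpose)
  have "\<epsilon> * pairing (superpose \<epsilon> x) = 0"
    using *(2) linear_scale[OF bounded_linear.linear[OF pairing_linear], of \<epsilon> "superpose \<epsilon> x"] unfolding r by simp
  then have 1: "pairing (superpose \<epsilon> x) = 0" using \<epsilon>(2) by simp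
  have "\<epsilon> *\<^sub>R S (superpose \<epsilon> x) = (?y, ?y')"
    using *(3) linear_scale[OF bounded_linear.linear[OF S_lin], of \<epsilon> "superpose \<epsilon> x"] unfolding r by simp
  then have "(1 / \<epsilon>) *\<^sub>R (\<epsilon> *\<^sub>R S (superpose \<epsilon> x)) = (1 / \<epsilon>) *\<^sub>R (?y, ?y')" by simp
  then have 2: "S (superpose \<epsilon> x) = (fst x, fst (snd x))" using \<epsilon>(2) by (simp add: x_def)
  show ?thesis
    using that[OF x _ \<alpha>] 1 2 xa by (simp add: fixed_iff)
qed

text \<open>At \<epsilon> = 0 the superposition depends on x only through its phase, and the phase
  \<open>\<alpha>0\<close> is already right, so one application of F to 0 reaches the fixed point.
  This identifies the start of the branch, which the correspondence with solutions for \<epsilon>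
  \<noteq> 0 does not see.\<close>

lemma fixed_point_at_0:
  obtains x where "x \<in> W" "F 0 x = x" "\<alpha>of x = \<alpha>0"
proof -
  have W0: "(0 :: state) \<in> W" using C1_pos by (simp add: W_def)
  have e: "\<bar>0::real\<bar> < e0" using e0 by simp
  have op0: "superpose 0 x t = \<gamma> (t - \<alpha>of x) * g0" if "x \<in> W" for x t
    by (simp add: superpose_explicit[OF e that] k_orbit)
  have \<alpha>0: "\<alpha>of 0 = \<alpha>0" by (simp add: \<alpha>of_def)
  have l0: "pairing (superpose 0 0) = 0"
  proof -
    have "pairing (superpose 0 0) = (LBINT t. g0 * (\<phi>' t * \<gamma> (t - \<alpha>0)))"
      unfolding pairing_def by (intro Bochner_Integration.integral_cong) (simp_all add: op0[OF W0] \<alpha>0)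
    also have "\<dots> = g0 * (LBINT t. \<phi>' t * \<gamma> (t - \<alpha>0))" by (rule integral_mult_right_zero)
    finally show ?thesis using Mel0 by (simp add: Mel_def)
  qed
  have FW: "F 0 0 \<in> W" by (rule F_maps[OF e W0])
  have third: "snd (snd (F 0 0)) = 0" by (simp add: F_def \<Lambda>_def l0)
  then have \<alpha>: "\<alpha>of (F 0 0) = \<alpha>0" by (simp add: \<alpha>of_def)
  have "superpose 0 (F 0 0) = superpose 0 0"
    by (rule bcontfun_eqI) (simp add: op0[OF FW] op0[OF W0] \<alpha> \<alpha>0)
  then have "F 0 (F 0 0) = F 0 0" unfolding F_def[of 0 "F 0 0"] third by (simp add: F_def)
  then show ?thesis using that FW \<alpha> by blast
qed

end

section \<open>Choice of the constants and the branch of phases\<close>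

context heteroclinic
begin

theorem melnikov_persistence:
  assumes Mel0: "Mel \<alpha>0 = 0" and md: "(Mel has_real_derivative m) (at \<alpha>0)" and m: "m \<noteq> 0"
  obtains \<theta> b e0 C :: real and \<alpha> \<alpha>' :: "real \<Rightarrow> real" and Y V :: "real \<Rightarrow> real \<Rightarrow> real" where
    "0 < \<theta>" "0 < b" "0 < e0" "0 < C" "\<alpha> 0 = \<alpha>0"
    "\<And>\<epsilon>. \<bar>\<epsilon>\<bar> < e0 \<Longrightarrow> (\<alpha> has_real_derivative \<alpha>' \<epsilon>) (at \<epsilon>)" "continuous_on {-e0<..<e0} \<alpha>'"
    "\<And>\<epsilon>. \<bar>\<epsilon>\<bar> < e0 \<Longrightarrow> shifted_sol \<epsilon> (\<alpha> \<epsilon>) (\<lambda>t. \<phi> t + \<epsilon> * Y \<epsilon> t) (\<lambda>t. \<phi>' t + \<epsilon> * V \<epsilon> t)"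
    "\<And>\<epsilon> t. \<bar>\<epsilon>\<bar> < e0 \<Longrightarrow> \<bar>Y \<epsilon> t\<bar> \<le> C \<and> \<bar>V \<epsilon> t\<bar> \<le> C \<and>
       \<bar>f (\<phi> t + \<epsilon> * Y \<epsilon> t) + \<epsilon> * \<gamma> (t - \<alpha> \<epsilon>) * k (\<phi> t + \<epsilon> * Y \<epsilon> t, \<phi>' t + \<epsilon> * V \<epsilon> t) - f (\<phi> t)\<bar> \<le> C * \<bar>\<epsilon>\<bar>"
    "\<And>\<epsilon>. \<bar>\<epsilon>\<bar> < e0 \<Longrightarrow> (LBINT t. \<phi>' t * Y \<epsilon> t) = 0"
    "\<And>\<epsilon> \<beta> \<xi> \<xi>'. \<bar>\<epsilon>\<bar> < e0 \<Longrightarrow> \<epsilon> \<noteq> 0 \<Longrightarrow> \<bar>\<beta> - \<alpha>0\<bar> \<le> \<theta> \<Longrightarrow> shifted_sol \<epsilon> \<beta> \<xi> \<xi>' \<Longrightarrow>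
       (\<And>t. \<bar>\<xi> t - \<phi> t\<bar> \<le> b) \<Longrightarrow> (\<And>t. \<bar>\<xi>' t - \<phi>' t\<bar> \<le> b) \<Longrightarrow> (LBINT t. \<phi>' t * (\<xi> t - \<phi> t)) = 0 \<Longrightarrow>
       \<beta> = \<alpha> \<epsilon> \<and> (\<forall>t. \<xi> t = \<phi> t + \<epsilon> * Y \<epsilon> t)"
proof -
  have Mel': "Mel' \<alpha>0 = m" using DERIV_unique[OF Mel_deriv md] .
  obtain \<Gamma> where \<Gamma>: "0 < \<Gamma>" "\<And>t. \<bar>\<gamma> t\<bar> \<le> \<Gamma>" by (rule \<gamma>_bounded) blast
  obtain G where G: "0 < G" "\<And>t. \<bar>\<gamma>1 t\<bar> \<le> G" by (rule \<gamma>1_bounded) blast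
  obtain S :: "(real \<Rightarrow>\<^sub>C real) \<Rightarrow> (real \<Rightarrow>\<^sub>C real) \<times> (real \<Rightarrow>\<^sub>C real)" where S: "bounded_linear S"
    and S_iff: "\<And>r z. (LBINT t. \<phi>' t * apply_bcontfun r t) = 0 \<Longrightarrow> z = S r \<longleftrightarrow>
      (\<forall>t. (fst z has_real_derivative snd z t) (at t) \<and>
       (snd z has_real_derivative f1 (\<phi> t) * fst z t + r t) (at t)) \<and> (LBINT t. \<phi>' t * fst z t) = 0"
    by (rule bounded_solution_operator) blast
  obtain Ms where Ms: "0 < Ms" "\<And>r. norm (S r) \<le> Ms * norm r"
    using bounded_linear.pos_bounded[OF S] by (metis mult.commute)
  define N where "N = V1 + 1"
  have V: "0 < N" "V1 \<le> N" unfolding N_def using V1_nonneg by linarith+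
  define em where "em = \<bar>m\<bar> / 8 / N"
  have em: "0 < em" using m V by (simp add: em_def)
  have emV: "V1 * em \<le> \<bar>m\<bar> / 8"
  proof -
    have "V1 * em \<le> N * em" using em V by (intro mult_right_mono) auto
    also have "\<dots> = \<bar>m\<bar> / 8" using V by (simp add: em_def)
    finally show ?thesis .
  qed
  obtain dm where dm: "0 < dm" "\<And>\<alpha> \<beta>. \<bar>\<alpha> - \<beta>\<bar> < dm \<Longrightarrow> \<bar>Mel' \<alpha> - Mel' \<beta>\<bar> \<le> V1 * em"
    using Mel'_uniform[OF em] by blast
  \<comment> \<open>The first bound keeps \<open>Mel'\<close> within \<bar>m\<bar> / 8 of m. By the
    second, the effect of the phase on Y, at most
    \<open>2 * Ms * \<theta> * G * \<bar>g0\<bar>\<close>, is at most 1 / 8.\<close>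
  define \<theta> where "\<theta> = min (dm / 2) (1 / (16 * Ms * G * \<bar>g0\<bar>))"
  have "0 < 1 / (16 * Ms * G * \<bar>g0\<bar>)" using Ms G g0 by simp
  moreover have "\<theta> \<le> dm / 2" "\<theta> \<le> 1 / (16 * Ms * G * \<bar>g0\<bar>)"
    unfolding \<theta>_def by (rule min.cobounded1 min.cobounded2)+
  ultimately have \<theta>: "0 < \<theta>" "\<theta> < dm" "\<theta> \<le> 1 / (16 * Ms * G * \<bar>g0\<bar>)"
    using dm by (simp_all add: \<theta>_def)
  have \<theta>1: "\<bar>m - Mel' \<alpha>\<bar> \<le> \<bar>m\<bar> / 8" if "\<bar>\<alpha> - \<alpha>0\<bar> \<le> \<theta>" for \<alpha>
    using dm(2)[of \<alpha> \<alpha>0] that \<theta>(2) emV unfolding Mel' by linarith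
  have \<theta>2: "2 * Ms * (\<theta> * \<bar>\<gamma>1 t\<bar> * \<bar>g0\<bar>) \<le> 1 / 8" for t
  proof -
    have "\<theta> * (16 * Ms * G * \<bar>g0\<bar>) \<le> 1" using \<theta>(3) Ms G g0 by (simp add: pos_le_divide_eq)
    moreover have "2 * Ms * (\<theta> * \<bar>\<gamma>1 t\<bar> * \<bar>g0\<bar>) \<le> 2 * Ms * (\<theta> * G * \<bar>g0\<bar>)"
      using G(2)[of t] Ms \<theta> by (intro mult_left_mono mult_right_mono) auto
    ultimately show ?thesis by (simp add: mult.commute mult.left_commute)
  qed
  define C1 where "C1 = 2 * Ms * (\<Gamma> * (\<bar>g0\<bar> + 1) + 1)"
  have C1: "0 < C1" unfolding C1_def using Ms \<Gamma>(1) by (intro mult_pos_pos add_nonneg_pos) auto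
  \<comment> \<open>The three bounds are the requirements on the deviation from \<epsilon> = 0 in
    the size of the forcing, in the contraction of Y and Y', and in the phase equation, where it is
    integrated against \<phi>'.\<close>
  define \<nu> where "\<nu> = min 1 (min (1 / (64 * Ms)) (\<bar>m * \<theta> * g0\<bar> / (32 * N)))"
  have \<nu>: "0 < \<nu>" "\<nu> \<le> 1" "\<nu> \<le> 1 / (64 * Ms)" "\<nu> \<le> \<bar>m * \<theta> * g0\<bar> / (32 * N)"
    using Ms m \<theta> g0 V by (auto simp: \<nu>_def)
  have \<nu>3: "64 * Ms * \<nu> \<le> 1" using \<nu>(3) Ms by (simp add: pos_le_divide_eq mult.commute)
  have \<nu>4: "32 * (V1 * \<nu>) \<le> \<bar>m * \<theta> * g0\<bar>"
  proof -
    have "\<nu> * (32 * N) \<le> \<bar>m * \<theta> * g0\<bar>" using \<nu>(4) V by (simp add: pos_le_divide_eq del: mult_numeral_left)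
    moreover have "V1 * \<nu> \<le> N * \<nu>" using \<nu> V by (intro mult_right_mono) auto
    ultimately show ?thesis by (simp add: algebra_simps)
  qed
  obtain K \<eta> where K: "compact K" "\<And>t. (\<phi> t, \<phi>' t) \<in> K" "0 < \<eta>" "\<And>z h. z \<in> K \<Longrightarrow> norm h \<le> \<eta> \<Longrightarrow> z + h \<in> \<Omega>"
    by (rule orbit_tube) blast
  \<comment> \<open>The scaled unknowns are at most \<open>C1\<close>, so both increments together
    have norm at most \<eta> and stay in the tube.\<close>
  define e' where "e' = \<eta> / (2 * C1)"
  have e': "0 < e'" "2 * (e' * C1) = \<eta>" using K C1 by (simp_all add: e'_def)
  have tube: "z + (h1, h2) \<in> \<Omega>" if "z \<in> K" "\<bar>h1\<bar> \<le> e' * C1" "\<bar>h2\<bar> \<le> e' * C1" for z h1 h2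
  proof (rule K(4)[OF that(1)])
    have "norm (h1, h2) \<le> \<bar>h1\<bar> + \<bar>h2\<bar>" using norm_Pair_le[of h1 h2] by simp
    then show "norm (h1, h2) \<le> \<eta>" using that e' by linarith
  qed
  define D where "D = {-e'..e'} \<times> {-C1..C1} \<times> {-C1..C1} \<times> {-1..1::real}"
  have Dc: "compact D" unfolding D_def by (intro compact_Times compact_Icc)
  let ?K = "K \<times> {0..1::real}"
  have Kc: "compact ?K" by (intro compact_Times K compact_Icc)
  have zzD: "phase_point \<tau> P \<in> \<Omega>" if "fst \<tau> \<in> K" "P \<in> D" for \<tau> P
  proof -
    obtain \<epsilon> y w c where PP: "P = (\<epsilon>, y, w, c)" by (metis prod.exhaust)
    have "\<bar>\<epsilon> * y\<bar> \<le> e' * C1" "\<bar>\<epsilon> * w\<bar> \<le> e' * C1"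
      unfolding abs_mult using that C1 e' by (auto simp: PP D_def abs_le_iff intro!: mult_mono)
    then have "fst \<tau> + (\<epsilon> * y, \<epsilon> * w) \<in> \<Omega>" by (intro tube that)
    then show ?thesis by (simp add: phase_point_def PP plus_prod_def)
  qed
  have cont: "continuous_on (?K \<times> D) (\<lambda>z. scaled_rhs \<alpha>0 \<theta> (fst z) (snd z))"
    "continuous_on (?K \<times> D) (\<lambda>z. scaled_grad \<alpha>0 \<theta> (fst z) (snd z))"
    by (intro scaled_rhs_grad_cont continuous_intros zzD; auto)+
  have fr: "((\<phi> t, \<phi>' t), frac t) \<in> ?K" for t
    using K(2) by (auto simp: frac_lt_1 less_imp_le)
  have bnd: "\<exists>B. \<forall>z\<in>?K \<times> D. norm (g z) \<le> B" if "continuous_on (?K \<times> D) g"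
    for g :: "((real \<times> real) \<times> real) \<times> real4 \<Rightarrow> 'b::real_normed_vector"
  proof -
    have "bounded (g ` (?K \<times> D))"
      by (intro compact_imp_bounded compact_continuous_image that compact_Times[OF Kc Dc])
    then show ?thesis unfolding bounded_iff by blast
  qed
  obtain B1 where B1: "\<And>z. z \<in> ?K \<times> D \<Longrightarrow> norm (scaled_rhs \<alpha>0 \<theta> (fst z) (snd z)) \<le> B1"
    using bnd[OF cont(1)] by blast
  obtain B2 where B2: "\<And>z. z \<in> ?K \<times> D \<Longrightarrow> norm (scaled_grad \<alpha>0 \<theta> (fst z) (snd z)) \<le> B2"
    using bnd[OF cont(2)] by blast
  have B: "\<bar>scaled_rhs \<alpha>0 \<theta> ((\<phi> t, \<phi>' t), t) P\<bar> \<le> max B1 B2" "norm (scaled_grad \<alpha>0 \<theta> ((\<phi> t, \<phi>' t), t) P) \<le> max B1 B2" if "P \<in> D" for t P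
    using B1[of "(((\<phi> t, \<phi>' t), frac t), P)"] B2[of "(((\<phi> t, \<phi>' t), frac t), P)"] fr[of t] that
    by (auto simp: scaled_rhs_periodic scaled_grad_periodic)
  obtain d1 where d1: "0 < d1" "\<And>\<tau> P P'. \<tau> \<in> ?K \<Longrightarrow> P \<in> D \<Longrightarrow> P' \<in> D \<Longrightarrow> dist P' P < d1 \<Longrightarrow>
      dist (scaled_rhs \<alpha>0 \<theta> \<tau> P') (scaled_rhs \<alpha>0 \<theta> \<tau> P) < \<nu>"
    using uniform_equicontinuous[OF Kc Dc cont(1) \<nu>(1)] by blast
  obtain d2 where d2: "0 < d2" "\<And>\<tau> P P'. \<tau> \<in> ?K \<Longrightarrow> P \<in> D \<Longrightarrow> P' \<in> D \<Longrightarrow> dist P' P < d2 \<Longrightarrow>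
      dist (scaled_grad \<alpha>0 \<theta> \<tau> P') (scaled_grad \<alpha>0 \<theta> \<tau> P) < \<nu>"
    using uniform_equicontinuous[OF Kc Dc cont(2) \<nu>(1)] by blast
  \<comment> \<open>\<open>C1\<close> and \<nu> depend on \<theta> at most, so \<epsilon> can be
    restricted last, by the moduli of continuity for \<nu>.\<close>
  define e0 where "e0 = min e' (min d1 d2)"
  have e0: "0 < e0" "e0 \<le> e'" "e0 \<le> d1" "e0 \<le> d2" using e' d1 d2 by (auto simp: e0_def)
  have e0C: "e0 * C1 \<le> e' * C1" using e0 C1 by (intro mult_right_mono) auto
  interpret M: melnikov_reduction f f1 f2 \<gamma> \<gamma>1 k k1 k2 \<Omega> \<phi> \<phi>' pm pp g0 A \<kappa> T \<alpha>0 m \<theta> e0 C1 Ms \<Gamma> \<nu> "max B1 B2" S K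
  proof (intro melnikov_reduction.intro[OF heteroclinic_axioms] melnikov_reduction_axioms.intro)
    show "z + (h1, h2) \<in> \<Omega>" if "z \<in> K" "\<bar>h1\<bar> \<le> e0 * C1" "\<bar>h2\<bar> \<le> e0 * C1" for z h1 h2
      using that e0C by (intro tube) auto
    show "\<bar>scaled_rhs \<alpha>0 \<theta> ((\<phi> t, \<phi>' t), t) P\<bar> \<le> max B1 B2" "norm (scaled_grad \<alpha>0 \<theta> ((\<phi> t, \<phi>' t), t) P) \<le> max B1 B2"
      if "P \<in> {-e0..e0} \<times> {-C1..C1} \<times> {-C1..C1} \<times> {-1..1}" for t P
      using that e0(2) by (intro B; auto simp: D_def)+
    have D2: "(\<epsilon>, y) \<in> D" "(0, y) \<in> D" "dist (\<epsilon>, y) (0, y) = \<bar>\<epsilon>\<bar>"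
      if "\<bar>\<epsilon>\<bar> < e0" "y \<in> {-C1..C1} \<times> {-C1..C1} \<times> {-1..1}" for \<epsilon> y
      using that e0 e' by (auto simp: D_def dist_Pair_Pair)
    show "\<bar>scaled_rhs \<alpha>0 \<theta> ((\<phi> t, \<phi>' t), t) (\<epsilon>, y) - scaled_rhs \<alpha>0 \<theta> ((\<phi> t, \<phi>' t), t) (0, y)\<bar> \<le> \<nu>"
      if "\<bar>\<epsilon>\<bar> < e0" "y \<in> {-C1..C1} \<times> {-C1..C1} \<times> {-1..1}" for t \<epsilon> y
      using d1(2)[OF fr D2(2,1)[OF that], of t] D2(3)[OF that] that e0
      by (simp add: scaled_rhs_periodic dist_real_def)
    show "norm (scaled_grad \<alpha>0 \<theta> ((\<phi> t, \<phi>' t), t) (\<epsilon>, y) - scaled_grad \<alpha>0 \<theta> ((\<phi> t, \<phi>' t), t) (0, y)) \<le> \<nu>"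
      if "\<bar>\<epsilon>\<bar> < e0" "y \<in> {-C1..C1} \<times> {-C1..C1} \<times> {-1..1}" for t \<epsilon> y
      using d2(2)[OF fr D2(2,1)[OF that], of t] D2(3)[OF that] that e0
      by (simp add: scaled_grad_periodic dist_norm)
  qed (fact m \<theta> e0 Ms \<Gamma> Mel0 S S_iff K C1_def \<theta>1 \<theta>2 \<nu> \<nu>3 \<nu>4)+
  obtain X X' where X: "\<And>\<epsilon>. \<bar>\<epsilon>\<bar> < e0 \<Longrightarrow> X \<epsilon> \<in> M.W \<and> M.F \<epsilon> (X \<epsilon>) = X \<epsilon>"
    "\<And>\<epsilon> x. \<bar>\<epsilon>\<bar> < e0 \<Longrightarrow> x \<in> M.W \<Longrightarrow> M.F \<epsilon> x = x \<Longrightarrow> x = X \<epsilon>"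
    "\<And>\<epsilon>. \<bar>\<epsilon>\<bar> < e0 \<Longrightarrow> (X has_vector_derivative X' \<epsilon>) (at \<epsilon>)"
    "continuous_on {-e0<..<e0} X'"
    using M.fixed_points by blast
  have "continuous_on (fst ` K \<times> {-1..1}) (\<lambda>z. remainder (fst z) (snd z))" by (rule remainder_cont)
  moreover have "compact (fst ` K)" by (intro compact_continuous_image K continuous_intros)
  ultimately obtain b1 where b1: "0 < b1" "\<And>x u u'. x \<in> fst ` K \<Longrightarrow> u \<in> {-1..1} \<Longrightarrow> u' \<in> {-1..1} \<Longrightarrow> dist u' u < b1 \<Longrightarrow>
      dist (remainder x u') (remainder x u) < 1 / (2 * Ms)"
    using uniform_equicontinuous[of "fst ` K" "{-1..1::real}" remainder "1 / (2 * Ms)"] Ms by auto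
  have "continuous_on (K \<times> cball 0 \<eta>) (\<lambda>z. k (fst z + snd z))"
    by (rule continuous_on_compose2[OF k_cont]) (use K in \<open>auto intro!: continuous_intros\<close>)
  then obtain b2 where b2: "0 < b2" "\<And>z h h'. z \<in> K \<Longrightarrow> h \<in> cball 0 \<eta> \<Longrightarrow> h' \<in> cball 0 \<eta> \<Longrightarrow> dist h' h < b2 \<Longrightarrow>
      dist (k (z + h')) (k (z + h)) < 1"
    using uniform_equicontinuous[of K "cball 0 \<eta>" "\<lambda>z h. k (z + h)" 1] K by auto
  \<comment> \<open>The radius for \<open>a_priori_bound\<close>: the remainder is close to its
    value 0 at no increment and k is within 1 of \<open>g0\<close>. The bounds on
    \<open>2 * b\<close> come from the norm of a pair with entries up to b.\<close>
  define b where "b = min (min 1 (b1 / 2)) (min (\<eta> / 2) (b2 / 4))"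
  have b: "0 < b" "b \<le> 1" "b < b1" "2 * b \<le> \<eta>" "2 * b < b2"
    using b1 b2 K by (auto simp: b_def min_def)
  have remainder_small: "2 * Ms * \<bar>remainder (\<phi> t) u\<bar> \<le> 1" if "\<bar>u\<bar> \<le> b" for t u
  proof -
    have "\<phi> t \<in> fst ` K" using K(2)[of t] by force
    then have "dist (remainder (\<phi> t) u) (remainder (\<phi> t) 0) < 1 / (2 * Ms)"
      using that b by (intro b1(2)) (auto simp: abs_le_iff)
    then show ?thesis using Ms by (simp add: field_simps)
  qed
  have k_small: "\<bar>k (\<phi> t + h1, \<phi>' t + h2)\<bar> \<le> \<bar>g0\<bar> + 1" if "\<bar>h1\<bar> \<le> b" "\<bar>h2\<bar> \<le> b" for t h1 h2
  proof -
    have "norm (h1, h2) \<le> \<bar>h1\<bar> + \<bar>h2\<bar>" using norm_Pair_le[of h1 h2] by simp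
    then have n: "norm (h1, h2) \<le> 2 * b" using that by linarith
    have "dist (k ((\<phi> t, \<phi>' t) + (h1, h2))) (k ((\<phi> t, \<phi>' t) + 0)) < 1"
      using n b K by (intro b2(2)) auto
    then show ?thesis by (simp add: k_orbit dist_real_def)
  qed
  define C where "C = max C1 (A * C1 + (\<Gamma> * (\<bar>g0\<bar> + 1) + 1))"
  obtain x0 where x0: "x0 \<in> M.W" "M.F 0 x0 = x0" "M.\<alpha>of x0 = \<alpha>0" by (rule M.fixed_point_at_0) blast
  show ?thesis
  proof (rule that[of \<theta> b e0 C "\<lambda>\<epsilon>. M.\<alpha>of (X \<epsilon>)" "\<lambda>\<epsilon>. \<theta> * snd (snd (X' \<epsilon>))" "\<lambda>\<epsilon>. fst (X \<epsilon>)" "\<lambda>\<epsilon>. fst (snd (X \<epsilon>))"])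
    show "0 < C" using C1 by (simp add: C_def)
    show "M.\<alpha>of (X 0) = \<alpha>0" using X(2)[of 0 x0] x0 e0 by simp
    show "((\<lambda>\<epsilon>. M.\<alpha>of (X \<epsilon>)) has_real_derivative \<theta> * snd (snd (X' \<epsilon>))) (at \<epsilon>)" if "\<bar>\<epsilon>\<bar> < e0" for \<epsilon>
    proof -
      have "((\<lambda>\<epsilon>. snd (snd (X \<epsilon>))) has_vector_derivative snd (snd (X' \<epsilon>))) (at \<epsilon>)"
        by (intro bounded_linear.has_vector_derivative[OF bounded_linear_snd] X that)
      then have "((\<lambda>\<epsilon>. snd (snd (X \<epsilon>))) has_real_derivative snd (snd (X' \<epsilon>))) (at \<epsilon>)"
        by (simp only: has_real_derivative_iff_has_vector_derivative)
      then show ?thesis unfolding M.\<alpha>of_def by (auto intro!: derivative_eq_intros)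
    qed
    show "continuous_on {-e0<..<e0} (\<lambda>\<epsilon>. \<theta> * snd (snd (X' \<epsilon>)))"
      by (intro continuous_intros X)
    fix \<epsilon> assume \<epsilon>: "\<bar>\<epsilon>\<bar> < e0"
    note x = X(1)[OF \<epsilon>, THEN conjunct1] X(1)[OF \<epsilon>, THEN conjunct2]
    note sol = M.fixed_imp_solution[OF \<epsilon> x]
    show "shifted_sol \<epsilon> (M.\<alpha>of (X \<epsilon>)) (\<lambda>t. \<phi> t + \<epsilon> * fst (X \<epsilon>) t) (\<lambda>t. \<phi>' t + \<epsilon> * fst (snd (X \<epsilon>)) t)"
      "(LBINT t. \<phi>' t * fst (X \<epsilon>) t) = 0" by (rule sol)+
    show "\<bar>fst (X \<epsilon>) t\<bar> \<le> C \<and> \<bar>fst (snd (X \<epsilon>)) t\<bar> \<le> C \<and>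
       \<bar>f (\<phi> t + \<epsilon> * fst (X \<epsilon>) t) + \<epsilon> * \<gamma> (t - M.\<alpha>of (X \<epsilon>)) * k (\<phi> t + \<epsilon> * fst (X \<epsilon>) t, \<phi>' t + \<epsilon> * fst (snd (X \<epsilon>)) t) - f (\<phi> t)\<bar>
        \<le> C * \<bar>\<epsilon>\<bar>" for t
    proof -
      have "\<bar>fst (X \<epsilon>) t\<bar> \<le> C1" "\<bar>fst (snd (X \<epsilon>)) t\<bar> \<le> C1"
        using x(1) abs_apply_le_norm[of "fst (X \<epsilon>)" t] abs_apply_le_norm[of "fst (snd (X \<epsilon>))" t]
        by (auto simp: M.W_def)
      moreover have "C1 \<le> C" "(A * C1 + (\<Gamma> * (\<bar>g0\<bar> + 1) + 1)) * \<bar>\<epsilon>\<bar> \<le> C * \<bar>\<epsilon>\<bar>"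
        by (auto simp: C_def intro!: mult_right_mono)
      ultimately show ?thesis using sol(3)[of t] by linarith
    qed
    fix \<beta> \<xi> \<xi>' assume *: "\<epsilon> \<noteq> 0" "\<bar>\<beta> - \<alpha>0\<bar> \<le> \<theta>" "shifted_sol \<epsilon> \<beta> \<xi> \<xi>'" "\<And>t. \<bar>\<xi> t - \<phi> t\<bar> \<le> b"
      "\<And>t. \<bar>\<xi>' t - \<phi>' t\<bar> \<le> b" "(LBINT t. \<phi>' t * (\<xi> t - \<phi> t)) = 0"
    obtain x where x: "x \<in> M.W" "M.F \<epsilon> x = x" "M.\<alpha>of x = \<beta>" "\<And>t. \<xi> t = \<phi> t + \<epsilon> * fst x t"
      using M.solution_imp_fixed[OF \<epsilon> *(1,2,3) M.a_priori_bound[OF *(3-6) remainder_small k_small] *(6)] by blast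
    then show "\<beta> = M.\<alpha>of (X \<epsilon>) \<and> (\<forall>t. \<xi> t = \<phi> t + \<epsilon> * fst (X \<epsilon>) t)"
      using X(2)[OF \<epsilon> x(1,2)] by auto
  qed (use \<theta> b e0 in auto)
qed

end

section \<open>Heteroclinic solutions\<close>

lemma lipschitz_of_derivative:
  fixes g :: "real \<Rightarrow> real"
  assumes "\<And>t. (g has_real_derivative g' t) (at t)" "\<And>t. \<bar>g' t\<bar> \<le> L"
  shows "\<bar>g s - g t\<bar> \<le> L * \<bar>s - t\<bar>"
  using field_differentiable_bound[of UNIV g g' L s t] assms by simp

lemma LBINT_shift:
  fixes g :: "real \<Rightarrow> real"
  shows "(LBINT t. g t) = (LBINT t. g (t - \<beta>))"
  using lborel_integral_real_affine[of 1 g "- \<beta>"] by simp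

lemma DERIV_shift_minus:
  "((\<lambda>t. g (t - \<beta>)) has_real_derivative D) (at t) \<longleftrightarrow> (g has_real_derivative D) (at (t - \<beta>))"
  using DERIV_shift[of g D t "- \<beta>"] by simp

context heteroclinic
begin

text \<open>The phase of a function close to the orbit is found by the intermediate value theorem: up to
  small errors, the phase function is \<open>- \<tau>\<close> times the squared \<open>L\<^sup>2\<close> norm of \<open>\<phi>'\<close>.\<close>

lemma phase_exists:
  assumes b: "0 < b" and \<theta>: "0 < \<theta>"
  obtains \<rho>0 where "0 < \<rho>0"
    "\<And>\<xi> \<xi>'. (\<And>t. (\<xi> has_real_derivative \<xi>' t) (at t)) \<Longrightarrow> (\<And>t. \<bar>\<xi> t - \<phi> t\<bar> \<le> \<rho>0) \<Longrightarrow> (\<And>t. \<bar>\<xi>' t - \<phi>' t\<bar> \<le> \<rho>0) \<Longrightarrow>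
      \<exists>\<tau>. \<bar>\<tau>\<bar> \<le> \<theta> \<and> (LBINT t. \<phi>' t * (\<xi> (t - \<tau>) - \<phi> t)) = 0 \<and>
        (\<forall>t. \<bar>\<xi> (t - \<tau>) - \<phi> t\<bar> \<le> b) \<and> (\<forall>t. \<bar>\<xi>' (t - \<tau>) - \<phi>' t\<bar> \<le> b)"
proof -
  obtain B where B: "0 < B" "\<And>t. \<bar>\<phi>' t\<bar> \<le> B" "\<And>t. \<bar>f (\<phi> t)\<bar> \<le> B" by (rule v_bounded) blast
  define n where "n = (LBINT t. \<phi>' t * \<phi>' t)"
  have n: "0 < n" unfolding n_def by (rule v_sq_pos)
  define V where "V = V1 + 1"
  have V: "0 < V" "V1 \<le> V" unfolding V_def using V1_nonneg by linarith+
  \<comment> \<open>At \<tau> = \<plusminus> \<tau>0 the Taylor error of the shifted orbit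
    contributes at most \<open>\<tau>0 * n / 4\<close>, and with \<rho>0 below the distance of \<xi>
    from \<phi> contributes at most \<open>\<tau>0 * n / 8\<close>. The main term
    \<open>- \<tau> * n\<close> thus decides the sign. The last bound keeps the shifted function
    within b.\<close>
  define \<tau>0 where "\<tau>0 = min \<theta> (min (n / (4 * (V * B))) (b / (2 * B)))"
  have "0 < \<tau>0" "\<tau>0 \<le> \<theta>" "\<tau>0 \<le> n / (4 * (V * B))" "\<tau>0 \<le> b / (2 * B)"
    using \<theta> n V B b by (auto simp: \<tau>0_def)
  then have \<tau>0: "0 < \<tau>0" "\<tau>0 \<le> \<theta>" "4 * (V * (B * \<tau>0)) \<le> n" "B * \<tau>0 \<le> b / 2"
    using V B by (simp_all add: field_simps)
  define \<rho>0 where "\<rho>0 = min (\<tau>0 * n / (8 * V)) (b / 2)"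
  have "0 < \<rho>0" "\<rho>0 \<le> \<tau>0 * n / (8 * V)" "\<rho>0 \<le> b / 2"
    using \<tau>0 n V b by (auto simp: \<rho>0_def)
  then have \<rho>0: "0 < \<rho>0" "8 * (V * \<rho>0) \<le> \<tau>0 * n" "\<rho>0 \<le> b / 2"
    using V by (simp_all add: field_simps)
  show ?thesis
  proof (rule that[OF \<rho>0(1)])
    fix \<xi> \<xi>' assume \<xi>: "\<And>t. (\<xi> has_real_derivative \<xi>' t) (at t)"
      and c0: "\<And>t. \<bar>\<xi> t - \<phi> t\<bar> \<le> \<rho>0" and c1: "\<And>t. \<bar>\<xi>' t - \<phi>' t\<bar> \<le> \<rho>0"
    have \<xi>c: "continuous_on UNIV (\<lambda>t. \<xi> (t - \<tau>))" for \<tau>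
      by (rule continuous_on_compose2[OF continuous_on_DERIV[OF \<xi>]]) (auto intro!: continuous_intros)
    have \<phi>lip: "\<bar>\<phi> s - \<phi> t\<bar> \<le> B * \<bar>s - t\<bar>" for s t by (rule lipschitz_of_derivative[OF \<phi> B(2)])
    have \<phi>'lip: "\<bar>\<phi>' s - \<phi>' t\<bar> \<le> B * \<bar>s - t\<bar>" for s t by (rule lipschitz_of_derivative[OF \<phi>' B(3)])
    have "\<bar>\<xi>' t\<bar> \<le> B + \<rho>0" for t using B(2)[of t] c1[of t] by linarith
    then have \<xi>lip: "\<bar>\<xi> s - \<xi> t\<bar> \<le> (B + \<rho>0) * \<bar>s - t\<bar>" for s t by (rule lipschitz_of_derivative[OF \<xi>])
    define P where "P \<tau> = (LBINT t. \<phi>' t * (\<xi> (t - \<tau>) - \<phi> t))" for \<tau>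
    have dist: "\<bar>\<xi> (t - \<tau>) - \<phi> t\<bar> \<le> \<rho>0 + B * \<bar>\<tau>\<bar>" for t \<tau>
      using c0[of "t - \<tau>"] \<phi>lip[of "t - \<tau>" t] by simp
    have cc: "continuous_on UNIV (\<lambda>t. \<xi> (t - \<tau>) - \<phi> t)" for \<tau>
      by (intro continuous_intros \<xi>c \<phi>_cont)
    have Plip: "\<bar>P \<tau> - P \<sigma>\<bar> \<le> V1 * ((B + \<rho>0) * \<bar>\<tau> - \<sigma>\<bar>)" for \<tau> \<sigma>
    proof -
      have "P \<tau> - P \<sigma> = (LBINT t. \<phi>' t * ((\<xi> (t - \<tau>) - \<phi> t) - (\<xi> (t - \<sigma>) - \<phi> t)))"
        unfolding P_def by (rule LBINT_v_diff[OF cc dist cc dist])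
      also have "\<bar>\<dots>\<bar> \<le> V1 * ((B + \<rho>0) * \<bar>\<tau> - \<sigma>\<bar>)"
      proof (rule abs_LBINT_v_mult_le)
        show "\<bar>\<xi> (t - \<tau>) - \<phi> t - (\<xi> (t - \<sigma>) - \<phi> t)\<bar> \<le> (B + \<rho>0) * \<bar>\<tau> - \<sigma>\<bar>" for t
          using \<xi>lip[of "t - \<tau>" "t - \<sigma>"] by (simp add: abs_minus_commute)
      qed (intro continuous_intros \<xi>c \<phi>_cont)
      finally show ?thesis .
    qed
    have Pc: "continuous_on S P" for S
    proof (rule continuous_on_subset[of UNIV])
      have L: "0 \<le> V1 * (B + \<rho>0)" using V1_nonneg B(1) \<rho>0(1) by (intro mult_nonneg_nonneg) linarith+
      have "(V1 * (B + \<rho>0))-lipschitz_on UNIV P"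
        by (rule lipschitz_onI[OF _ L]) (use Plip in \<open>simp add: dist_real_def mult.assoc\<close>)
      then show "continuous_on UNIV P" by (rule lipschitz_on_continuous_on)
    qed simp
    \<comment> \<open>A shift by \<tau> changes \<phi> by \<open>- \<tau> * \<phi>'\<close> to first
      order, and pairing this with \<phi>' gives \<open>- \<tau> * n\<close>.\<close>
    have main: "\<bar>P \<tau> + \<tau> * n\<bar> \<le> V1 * (\<rho>0 + B * \<bar>\<tau>\<bar> * \<bar>\<tau>\<bar>)" for \<tau>
    proof -
      have "P \<tau> + \<tau> * n = (LBINT t. \<phi>' t * (\<xi> (t - \<tau>) - \<phi> t)) - (LBINT t. \<phi>' t * (- \<tau> * \<phi>' t))"
      proof -
        have "(LBINT t. \<phi>' t * (- \<tau> * \<phi>' t)) = (LBINT t. - \<tau> * (\<phi>' t * \<phi>' t))"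
          by (intro Bochner_Integration.integral_cong) simp_all
        also have "\<dots> = - \<tau> * n" unfolding n_def by (rule integral_mult_right_zero)
        finally show ?thesis by (simp add: P_def)
      qed
      also have "\<dots> = (LBINT t. \<phi>' t * ((\<xi> (t - \<tau>) - \<phi> t) - (- \<tau> * \<phi>' t)))"
      proof (rule LBINT_v_diff[OF cc dist])
        show "\<bar>- \<tau> * \<phi>' t\<bar> \<le> \<bar>\<tau>\<bar> * B" for t
          unfolding abs_mult using B(2)[of t] by (intro mult_mono) auto
      qed (intro continuous_intros v_cont)
      also have "\<bar>\<dots>\<bar> \<le> V1 * (\<rho>0 + B * \<bar>\<tau>\<bar> * \<bar>\<tau>\<bar>)"
      proof (rule abs_LBINT_v_mult_le)
        show "continuous_on UNIV (\<lambda>t. \<xi> (t - \<tau>) - \<phi> t - - \<tau> * \<phi>' t)"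
          by (intro continuous_intros \<xi>c \<phi>_cont v_cont)
        fix t
        have "norm ((\<lambda>u. \<phi> (t - u) + u * \<phi>' t) \<tau> - (\<lambda>u. \<phi> (t - u) + u * \<phi>' t) 0) \<le> B * \<bar>\<tau>\<bar> * norm (\<tau> - 0)"
        proof (rule field_differentiable_bound[OF convex_closed_segment[of 0 \<tau>]])
          fix u assume u: "u \<in> closed_segment 0 \<tau>"
          have "((\<lambda>u. \<phi> (t - u)) has_real_derivative \<phi>' (t - u) * (- 1)) (at u)"
            by (rule DERIV_chain2[where f = \<phi>, OF \<phi>]) (auto intro!: derivative_eq_intros)
          then have "((\<lambda>u. \<phi> (t - u) + u * \<phi>' t) has_real_derivative \<phi>' t - \<phi>' (t - u)) (at u)"
            by (auto intro!: derivative_eq_intros)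
          then show "((\<lambda>u. \<phi> (t - u) + u * \<phi>' t) has_real_derivative \<phi>' t - \<phi>' (t - u)) (at u within closed_segment 0 \<tau>)"
            by (rule has_field_derivative_at_within)
          have "\<bar>u\<bar> \<le> \<bar>\<tau>\<bar>" using segment_bound(1)[OF u] by simp
          then have "B * \<bar>u\<bar> \<le> B * \<bar>\<tau>\<bar>" using B(1) by (intro mult_left_mono) auto
          then show "norm (\<phi>' t - \<phi>' (t - u)) \<le> B * \<bar>\<tau>\<bar>"
            using \<phi>'lip[of t "t - u"] by simp
        qed auto
        then have "\<bar>\<phi> (t - \<tau>) + \<tau> * \<phi>' t - \<phi> t\<bar> \<le> B * \<bar>\<tau>\<bar> * \<bar>\<tau>\<bar>" by simp
        then show "\<bar>\<xi> (t - \<tau>) - \<phi> t - - \<tau> * \<phi>' t\<bar> \<le> \<rho>0 + B * \<bar>\<tau>\<bar> * \<bar>\<tau>\<bar>"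
          using c0[of "t - \<tau>"] by simp
      qed
      finally show ?thesis .
    qed
    have small: "\<bar>P \<tau> + \<tau> * n\<bar> \<le> \<tau>0 * n / 2" if "\<bar>\<tau>\<bar> = \<tau>0" for \<tau>
    proof -
      have "\<tau>0 * (4 * (V * (B * \<tau>0))) \<le> \<tau>0 * n" using \<tau>0 by (intro mult_left_mono) auto
      moreover have "\<tau>0 * (4 * (V * (B * \<tau>0))) = 4 * (V * (B * \<tau>0 * \<tau>0))" by simp
      moreover have "0 < \<tau>0 * n" using \<tau>0 n by simp
      ultimately have "V * (\<rho>0 + B * \<tau>0 * \<tau>0) \<le> \<tau>0 * n / 2"
        using \<rho>0(2) unfolding distrib_left by linarith
      moreover have "V1 * (\<rho>0 + B * \<tau>0 * \<tau>0) \<le> V * (\<rho>0 + B * \<tau>0 * \<tau>0)"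
        using V \<rho>0(1) B(1) \<tau>0(1) by (intro mult_right_mono add_nonneg_nonneg) auto
      ultimately show ?thesis using main[of \<tau>] unfolding that by linarith
    qed
    have pos: "0 < \<tau>0 * n" using \<tau>0 n by simp
    have ab: "\<bar>\<tau>0\<bar> = \<tau>0" "\<bar>- \<tau>0\<bar> = \<tau>0" using \<tau>0 by simp_all
    have "P \<tau>0 \<le> 0" using small[OF ab(1)] pos by linarith
    moreover have "0 \<le> P (- \<tau>0)" using small[OF ab(2)] pos by linarith
    ultimately obtain \<tau> where \<tau>: "- \<tau>0 \<le> \<tau>" "\<tau> \<le> \<tau>0" "P \<tau> = 0"
      using IVT2'[of P \<tau>0 0 "- \<tau>0", OF _ _ _ Pc] \<tau>0 by auto
    then have \<tau>a: "\<bar>\<tau>\<bar> \<le> \<tau>0" by (simp add: abs_le_iff)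
    then have "B * \<bar>\<tau>\<bar> \<le> B * \<tau>0" using B(1) by (intro mult_left_mono) auto
    then have sh: "B * \<bar>\<tau>\<bar> \<le> b / 2" using \<tau>0(4) by linarith
    have "\<bar>\<xi> (t - \<tau>) - \<phi> t\<bar> \<le> b" "\<bar>\<xi>' (t - \<tau>) - \<phi>' t\<bar> \<le> b" for t
    proof -
      show "\<bar>\<xi> (t - \<tau>) - \<phi> t\<bar> \<le> b" using dist[of t \<tau>] sh \<rho>0(3) by linarith
      have "\<bar>\<phi>' (t - \<tau>) - \<phi>' t\<bar> \<le> B * \<bar>\<tau>\<bar>" using \<phi>'lip[of "t - \<tau>" t] by simp
      then show "\<bar>\<xi>' (t - \<tau>) - \<phi>' t\<bar> \<le> b" using c1[of "t - \<tau>"] sh \<rho>0(3) by linarith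
    qed
    then show "\<exists>\<tau>. \<bar>\<tau>\<bar> \<le> \<theta> \<and> (LBINT t. \<phi>' t * (\<xi> (t - \<tau>) - \<phi> t)) = 0 \<and>
        (\<forall>t. \<bar>\<xi> (t - \<tau>) - \<phi> t\<bar> \<le> b) \<and> (\<forall>t. \<bar>\<xi>' (t - \<tau>) - \<phi>' t\<bar> \<le> b)"
      using \<tau>a \<tau>0(2) \<tau>(3) unfolding P_def by (intro exI[of _ \<tau>]) simp
  qed
qed

end

section \<open>From the notions of the statement to explicit derivatives\<close>

lemma C2_derivatives:
  assumes "C2 g"
  shows "(g has_real_derivative deriv g x) (at x)"
    "(deriv g has_real_derivative deriv (deriv g) x) (at x)"
    "continuous_on UNIV (deriv (deriv g))"
proof -
  show "(g has_real_derivative deriv g x) (at x)"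
    using assms unfolding C2_def by (simp add: DERIV_deriv_iff_real_differentiable)
  obtain D where D: "\<And>x. (deriv g has_vector_derivative D x) (at x)" "continuous_on UNIV D"
    using assms unfolding C2_def C1_differentiable_on_def by blast
  have "(deriv g has_real_derivative D x) (at x)" for x
    using D(1) by (simp add: has_real_derivative_iff_has_vector_derivative)
  moreover from this have "deriv (deriv g) = D" by (intro ext DERIV_imp_deriv)
  ultimately show "(deriv g has_real_derivative deriv (deriv g) x) (at x)" "continuous_on UNIV (deriv (deriv g))"
    using D(2) by simp_all
qed

lemma C2_I:
  assumes g: "\<And>x. (g has_real_derivative g' x) (at x)" and g': "\<And>x. (g' has_real_derivative g'' x) (at x)"
    and c: "continuous_on UNIV g''"
  shows "C2 g" "deriv g = g'" "deriv (deriv g) = g''"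
proof -
  show 1: "deriv g = g'" using g by (intro ext DERIV_imp_deriv)
  show "deriv (deriv g) = g''" unfolding 1 using g' by (intro ext DERIV_imp_deriv)
  show "C2 g"
    unfolding C2_def C1_differentiable_on_def 1
    using g g' c real_differentiable_def by (auto simp: has_real_derivative_iff_has_vector_derivative[symmetric])
qed

lemma C2_near_bounds:
  assumes "C2_near r u w"
  shows "\<bar>u t - w t\<bar> \<le> r" "\<bar>deriv (\<lambda>t. u t - w t) t\<bar> \<le> r"
proof -
  let ?y = "\<lambda>t. u t - w t"
  have b: "bounded (range ?y)" "bounded (range (deriv ?y))"
    and n: "(SUP t. \<bar>?y t\<bar>) \<le> r" "(SUP t. \<bar>deriv ?y t\<bar>) \<le> r"
    using assms unfolding C2_near_def C2_bounded_def C2_norm_def by auto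
  have le: "\<bar>g t\<bar> \<le> (SUP t. \<bar>g t\<bar>)" if "bounded (range g)" for g :: "real \<Rightarrow> real"
  proof (rule cSUP_upper[OF UNIV_I])
    obtain c where "\<And>t. \<bar>g t\<bar> \<le> c" using \<open>bounded (range g)\<close> unfolding bounded_iff by auto
    then show "bdd_above (range (\<lambda>t. \<bar>g t\<bar>))" by (auto intro!: bdd_aboveI)
  qed
  show "\<bar>u t - w t\<bar> \<le> r" "\<bar>deriv ?y t\<bar> \<le> r" using le[OF b(1)] le[OF b(2)] n by force+
qed

lemma C2_nearI:
  assumes y: "\<And>t. ((\<lambda>t. u t - w t) has_real_derivative y' t) (at t)" and y': "\<And>t. (y' has_real_derivative y'' t) (at t)"
    and c: "continuous_on UNIV y''"
    and bd: "\<And>t. \<bar>u t - w t\<bar> \<le> r" "\<And>t. \<bar>y' t\<bar> \<le> r" "\<And>t. \<bar>y'' t\<bar> \<le> r"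
  shows "C2_near r u w" "0 \<le> C2_norm (\<lambda>t. u t - w t)" "C2_norm (\<lambda>t. u t - w t) \<le> r"
proof -
  note C2 = C2_I[OF y y' c]
  have "deriv y' = y''" by (intro ext DERIV_imp_deriv y')
  note C = C2(2) this
  have bb: "bounded (range g)" if "\<And>t. \<bar>g t\<bar> \<le> r" for g :: "real \<Rightarrow> real"
    using that by (auto intro!: boundedI)
  show n: "C2_norm (\<lambda>t. u t - w t) \<le> r"
    unfolding C2_norm_def C using bd by (intro max.boundedI cSUP_least) auto
  show "C2_near r u w"
    unfolding C2_near_def C2_bounded_def C using C2(1) n by (intro conjI bb bd) simp_all
  have "bdd_above (range (\<lambda>t. \<bar>u t - w t\<bar>))" using bd(1) by (auto intro!: bdd_aboveI)
  then have "\<bar>u 0 - w 0\<bar> \<le> (SUP t. \<bar>u t - w t\<bar>)" by (rule cSUP_upper[OF UNIV_I])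
  then show "0 \<le> C2_norm (\<lambda>t. u t - w t)" unfolding C2_norm_def by (simp add: le_max_iff_disj)
     (meson abs_ge_zero order_trans)
qed

text \<open>Energy conservation supplies a limit of the squared derivative. At mean value points of
  unit intervals the derivative equals an increment of \<phi>, which tends to 0, so that limit is 0.
  The assumption on shifts by at most 1 treats both ends of the line at once.\<close>

lemma derivative_tendsto_0:
  fixes \<phi> \<phi>' :: "real \<Rightarrow> real"
  assumes \<phi>: "\<And>t. (\<phi> has_real_derivative \<phi>' t) (at t)"
    and F: "F \<noteq> bot" and sh: "\<And>\<xi>. (\<And>t. t \<le> \<xi> t \<and> \<xi> t \<le> t + 1) \<Longrightarrow> filterlim \<xi> F F"
    and lim: "(\<phi> \<longlongrightarrow> q) F" "((\<lambda>t. (\<phi>' t)\<^sup>2) \<longlongrightarrow> L) F"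
  shows "(\<phi>' \<longlongrightarrow> 0) F"
proof -
  have "\<exists>s. t < s \<and> s < t + 1 \<and> \<phi> (t + 1) - \<phi> t = \<phi>' s" for t
    using MVT2[of t "t + 1" \<phi> \<phi>'] \<phi> by auto
  then obtain \<xi> where \<xi>: "\<And>t. t < \<xi> t" "\<And>t. \<xi> t < t + 1" "\<And>t. \<phi> (t + 1) - \<phi> t = \<phi>' (\<xi> t)" by metis
  have 1: "((\<lambda>t. (\<phi>' (\<xi> t))\<^sup>2) \<longlongrightarrow> L) F"
    by (rule filterlim_compose[OF lim(2) sh]) (use \<xi> in \<open>auto simp: less_imp_le\<close>)
  have "((\<lambda>t. \<phi> (t + 1)) \<longlongrightarrow> q) F"
    by (rule filterlim_compose[OF lim(1) sh]) auto
  then have "((\<lambda>t. (\<phi> (t + 1) - \<phi> t)\<^sup>2) \<longlongrightarrow> (q - q)\<^sup>2) F" by (intro tendsto_intros lim)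
  then have "((\<lambda>t. (\<phi>' (\<xi> t))\<^sup>2) \<longlongrightarrow> 0) F" by (simp add: \<xi>(3))
  then have "L = 0" using tendsto_unique[OF F 1] by simp
  then have "((\<lambda>t. sqrt ((\<phi>' t)\<^sup>2)) \<longlongrightarrow> sqrt 0) F" using lim(2) by (intro tendsto_real_sqrt) simp
  then show ?thesis by (simp add: tendsto_rabs_zero_iff)
qed

lemma bounded_of_limits:
  fixes g :: "real \<Rightarrow> real"
  assumes g: "continuous_on UNIV g" and "(g \<longlongrightarrow> l) at_bot" "(g \<longlongrightarrow> l') at_top"
  obtains B where "\<And>t. \<bar>g t\<bar> \<le> B"
proof -
  have "\<forall>\<^sub>F t in at_bot. dist (g t) l < 1" "\<forall>\<^sub>F t in at_top. dist (g t) l' < 1"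
    by (rule tendstoD[OF assms(2) zero_less_one] tendstoD[OF assms(3) zero_less_one])+
  then obtain T1 T2 where T: "\<And>t. t \<le> T1 \<Longrightarrow> dist (g t) l < 1" "\<And>t. T2 \<le> t \<Longrightarrow> dist (g t) l' < 1"
    unfolding eventually_at_bot_linorder eventually_at_top_linorder by blast
  have "bounded (g ` {T1..T2})"
    by (intro compact_imp_bounded compact_continuous_image continuous_on_subset[OF g]) auto
  then obtain c where "\<forall>x\<in>g ` {T1..T2}. norm x \<le> c"
    unfolding bounded_iff by blast
  then have c: "\<bar>g t\<bar> \<le> c" if "t \<in> {T1..T2}" for t using that by simp
  have "\<bar>g t\<bar> \<le> \<bar>c\<bar> + \<bar>l\<bar> + \<bar>l'\<bar> + 1" for t
  proof -
    consider "t \<le> T1" | "T2 \<le> t" | "t \<in> {T1..T2}" by fastforce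
    then show ?thesis
    proof cases
      case 1 then show ?thesis using T(1)[of t] by (simp add: dist_real_def)
    next
      case 2 then show ?thesis using T(2)[of t] by (simp add: dist_real_def)
    next
      case 3 then show ?thesis using c[of t] by simp
    qed
  qed
  then show ?thesis using that by blast
qed

lemma diffeo_inverse:
  assumes h: "C2 h" and C1: "diffeo_cond h I J" and z: "z \<in> J"
  defines "Hi \<equiv> the_inv_into I (primitive h)"
  shows "Hi z \<in> I" "h (Hi z) \<noteq> 0" "(Hi has_real_derivative 1 / h (Hi z)) (at z)"
proof -
  have I: "open I" and bij: "bij_betw (primitive h) I J" and nz: "\<And>z. z \<in> I \<Longrightarrow> h z \<noteq> 0"
    using C1 unfolding diffeo_cond_def by auto
  have inj: "inj_on (primitive h) I" and im: "primitive h ` I = J"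
    using bij unfolding bij_betw_def by auto
  show x: "Hi z \<in> I" unfolding Hi_def using the_inv_into_into[OF inj, of z I] z im by auto
  show nx: "h (Hi z) \<noteq> 0" by (rule nz[OF x])
  have hc: "continuous_on UNIV h" by (rule continuous_on_DERIV[OF C2_derivatives(1)[OF h]])
  have "(Hi has_derivative (\<lambda>y. y / h (Hi z))) (at (primitive h (Hi z)))"
  proof (rule has_derivative_inverse_strong[OF I x])
    show "continuous_on I (primitive h)"
      by (rule continuous_on_DERIV[OF primitive_has_real_derivative[OF hc]])
    show "Hi (primitive h x) = x" if "x \<in> I" for x
      unfolding Hi_def by (rule the_inv_into_f_f[OF inj that])
    show "(primitive h has_derivative (*) (h (Hi z))) (at (Hi z))"
      using primitive_has_real_derivative[OF hc] by (simp add: has_field_derivative_def)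
    show "(*) (h (Hi z)) \<circ> (\<lambda>y. y / h (Hi z)) = id" using nx by auto
  qed
  moreover have "primitive h (Hi z) = z"
    unfolding Hi_def using f_the_inv_into_f[OF inj, of z] z im by auto
  ultimately show "(Hi has_real_derivative 1 / h (Hi z)) (at z)"
    by (intro has_derivative_imp_has_field_derivative) auto
qed

definition rel_energy :: "(real \<Rightarrow> real) \<Rightarrow> real \<Rightarrow> real \<times> real \<Rightarrow> real" where
  "rel_energy f d z = (snd z)\<^sup>2 / 2 - primitive f (fst z) - d"

definition h_of_H :: "(real \<Rightarrow> real) \<Rightarrow> real set \<Rightarrow> real \<Rightarrow> real" where
  "h_of_H h I z = h (the_inv_into I (primitive h) z)"

text \<open>The derivative of \<open>h_of_H\<close>: since H' = h, the inverse of H contributes the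
  division by h.\<close>

definition h_of_H' :: "(real \<Rightarrow> real) \<Rightarrow> real set \<Rightarrow> real \<Rightarrow> real" where
  "h_of_H' h I z = deriv h (the_inv_into I (primitive h) z) / h (the_inv_into I (primitive h) z)"

lemma h_of_H_deriv:
  assumes "C2 h" "diffeo_cond h I J"
  shows "z \<in> J \<Longrightarrow> (h_of_H h I has_real_derivative h_of_H' h I z) (at z)"
    "continuous_on J (h_of_H' h I)"
proof -
  note inv = diffeo_inverse[OF assms]
  show "(h_of_H h I has_real_derivative h_of_H' h I z) (at z)" if "z \<in> J" for z
    using DERIV_chain2[OF C2_derivatives(1)[OF assms(1)] inv(3)[OF that]]
    unfolding h_of_H_def[abs_def] h_of_H'_def by simp
  have c: "continuous_on J (the_inv_into I (primitive h))"
    using inv(3) by (intro continuous_at_imp_continuous_on ballI DERIV_isCont)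
  have "continuous_on UNIV (deriv h)" "continuous_on UNIV h"
    by (rule continuous_on_DERIV[OF C2_derivatives(1)[OF assms(1)]] continuous_on_DERIV[OF C2_derivatives(2)[OF assms(1)]])+
  then show "continuous_on J (h_of_H' h I)"
    unfolding h_of_H'_def using inv(2)
    by (intro continuous_intros continuous_on_compose2[OF _ c]) auto
qed

lemma perturbed_oscillatorI:
  assumes f: "C2 f" and h: "C2 h" and \<gamma>: "C2 \<gamma>" and per: "\<forall>t. \<gamma> (t + 1) = \<gamma> t" and C1: "diffeo_cond h I J"
  shows "perturbed_oscillator f (deriv f) (deriv (deriv f)) \<gamma> (deriv \<gamma>)
    (\<lambda>z. h_of_H h I (rel_energy f d z)) (\<lambda>z. - (h_of_H' h I (rel_energy f d z) * f (fst z)))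
    (\<lambda>z. h_of_H' h I (rel_energy f d z) * snd z) {z. rel_energy f d z \<in> J}"
proof
  have fc: "continuous_on UNIV f" by (rule continuous_on_DERIV[OF C2_derivatives(1)[OF f]])
  note F = primitive_has_real_derivative[OF fc]
  have e: "(rel_energy f d has_derivative (\<lambda>v. - (f (fst z) * fst v) + snd z * snd v)) (at z)" for z
  proof -
    have "((\<lambda>z. primitive f (fst z)) has_derivative (\<lambda>v. fst v * f (fst z))) (at z)"
      by (rule DERIV_compose_FDERIV[OF F]) (auto intro!: derivative_eq_intros)
    then show ?thesis
      unfolding rel_energy_def[abs_def]
      by (auto intro!: derivative_eq_intros simp: fun_eq_iff algebra_simps)
  qed
  have ec: "continuous_on UNIV (rel_energy f d)"
    using e by (intro continuous_at_imp_continuous_on ballI has_derivative_continuous)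
  have J: "open J" using C1 by (simp add: diffeo_cond_def)
  show "open {z. rel_energy f d z \<in> J}"
    using open_vimage[OF J ec] by (simp add: vimage_def)
  show "((\<lambda>z. h_of_H h I (rel_energy f d z)) has_derivative
      (\<lambda>v. - (h_of_H' h I (rel_energy f d z) * f (fst z)) * fst v + h_of_H' h I (rel_energy f d z) * snd z * snd v)) (at z)"
    if "z \<in> {z. rel_energy f d z \<in> J}" for z
    using DERIV_compose_FDERIV[OF h_of_H_deriv(1)[OF h C1] e, of z] that
    by (auto elim!: has_derivative_eq_rhs simp: fun_eq_iff algebra_simps)
  have gc: "continuous_on {z. rel_energy f d z \<in> J} (\<lambda>z. h_of_H' h I (rel_energy f d z))"
    by (rule continuous_on_compose2[OF h_of_H_deriv(2)[OF h C1] continuous_on_subset[OF ec]]) auto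
  show "continuous_on {z. rel_energy f d z \<in> J} (\<lambda>z. - (h_of_H' h I (rel_energy f d z) * f (fst z)))"
    "continuous_on {z. rel_energy f d z \<in> J} (\<lambda>z. h_of_H' h I (rel_energy f d z) * snd z)"
    by (intro continuous_intros gc continuous_on_compose2[OF fc]; simp)+
  show "continuous_on UNIV (deriv \<gamma>)" by (rule continuous_on_DERIV[OF C2_derivatives(2)[OF \<gamma>]])
qed (use C2_derivatives[OF f] C2_derivatives(1)[OF \<gamma>] per in auto)

text \<open>The linearization maps (x, y) to (y, D x), so its eigenvalues satisfy D = k * k; a
  single positive real eigenvalue decides the sign of D.\<close>

lemma hyperbolic_saddleD:
  assumes "hyperbolic_saddle f p" "(f has_real_derivative D) (at p)"
  shows "f p = 0" "0 < D"
proof -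
  let ?X = "\<lambda>z :: real \<times> real. (snd z, f (fst z))"
  have sad: "planar_saddle ?X (p, 0)" using assms(1) by (simp add: hyperbolic_saddle_def case_prod_beta')
  then show "f p = 0" by (simp add: planar_saddle_def zero_prod_def)
  obtain L k v where L: "(?X has_derivative L) (at (p, 0))" and k: "0 < k" "v \<noteq> 0" "L v = k *\<^sub>R v"
    using sad unfolding planar_saddle_def by blast
  have "((\<lambda>z :: real \<times> real. f (fst z)) has_derivative (\<lambda>v. fst v * D)) (at (p, 0))"
    by (rule DERIV_compose_FDERIV) (use assms(2) in \<open>auto intro!: derivative_eq_intros\<close>)
  then have "(?X has_derivative (\<lambda>v. (snd v, fst v * D))) (at (p, 0))"
    by (intro has_derivative_Pair has_derivative_snd has_derivative_ident)
  then have "L = (\<lambda>v. (snd v, fst v * D))" by (rule has_derivative_unique[OF L])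
  then have e: "snd v = k * fst v" "fst v * D = k * snd v" using k(3) by (auto simp: prod_eq_iff)
  have "fst v \<noteq> 0" using e(1) k(2) by (auto simp: prod_eq_iff)
  moreover have "fst v * D = fst v * (k * k)" using e by simp
  ultimately have "D = k * k" by simp
  then show "0 < D" using k(1) by simp
qed

context perturbed_oscillator
begin

lemma sol_rhs_cont:
  assumes "sol \<epsilon> \<psi> \<psi>'"
  shows "continuous_on UNIV (\<lambda>t. f (\<psi> t) + \<epsilon> * \<gamma> t * k (\<psi> t, \<psi>' t))"
proof -
  have d: "\<And>t. (\<psi> has_real_derivative \<psi>' t) (at t)"
    "\<And>t. (\<psi>' has_real_derivative f (\<psi> t) + \<epsilon> * \<gamma> t * k (\<psi> t, \<psi>' t)) (at t)" "\<And>t. (\<psi> t, \<psi>' t) \<in> \<Omega>"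
    using assms by (simp_all add: sol_def)
  have c: "continuous_on UNIV \<psi>" "continuous_on UNIV \<psi>'"
    by (rule continuous_on_DERIV[OF d(1)] continuous_on_DERIV[OF d(2)])+
  have "continuous_on UNIV (\<lambda>t. k (\<psi> t, \<psi>' t))"
    by (rule continuous_on_compose2[OF k_cont]) (use c d(3) in \<open>auto intro!: continuous_intros\<close>)
  then show ?thesis
    by (intro continuous_intros \<gamma>_cont continuous_on_compose2[OF f_cont[of UNIV] c(1)]) auto
qed

end

context heteroclinic
begin

text \<open>The solution is the translate by \<open>\<alpha> \<epsilon>\<close> of the one in the
  time of the orbit. The radius \<rho> and the bound e1 stay free below the threshold, because they
  have to be matched afterwards with the uniqueness radius and the parameter range of the periodic
  solutions; the tail bounds r prepare the asymptotics there.\<close>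

theorem heteroclinic_persistence:
  assumes Mel0: "Mel \<alpha>0 = 0" and md: "(Mel has_real_derivative m) (at \<alpha>0)" and m: "m \<noteq> 0" and r: "0 < r"
  shows "\<exists>\<rho>1>0. \<forall>\<rho> e1. 0 < \<rho> \<and> \<rho> \<le> \<rho>1 \<and> 0 < e1 \<longrightarrow> (\<exists>e0>0. e0 \<le> e1 \<and> (\<exists>\<delta>>0. \<exists>C \<alpha> \<psi> \<psi>'.
     \<alpha> C1_differentiable_on {-e0<..<e0} \<and> \<alpha> 0 = \<alpha>0 \<and> ((\<lambda>\<epsilon>. \<bar>\<alpha> \<epsilon> - \<alpha>0\<bar>) \<longlongrightarrow> 0) (at 0) \<and>
     (\<forall>\<epsilon>. 0 < \<bar>\<epsilon>\<bar> \<and> \<bar>\<epsilon>\<bar> < e0 \<longrightarrow>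
        sol \<epsilon> (\<psi> \<epsilon>) (\<psi>' \<epsilon>) \<and> C2_near \<rho> (\<psi> \<epsilon>) (\<lambda>t. \<phi> (t + \<alpha> \<epsilon>)) \<and>
        0 \<le> C2_norm (\<lambda>t. \<psi> \<epsilon> t - \<phi> (t + \<alpha> \<epsilon>)) \<and> C2_norm (\<lambda>t. \<psi> \<epsilon> t - \<phi> (t + \<alpha> \<epsilon>)) \<le> C * \<bar>\<epsilon>\<bar> \<and>
        (\<forall>w w'. sol \<epsilon> w w' \<and> C2_near \<rho> w (\<lambda>t. \<phi> (t + \<alpha> \<epsilon>)) \<longrightarrow> w = \<psi> \<epsilon>) \<and>
        (\<exists>T. \<forall>t\<le>T. \<bar>\<psi> \<epsilon> t - pm\<bar> \<le> r \<and> \<bar>\<psi>' \<epsilon> t\<bar> \<le> r) \<and>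
        (\<exists>T. \<forall>t\<ge>T. \<bar>\<psi> \<epsilon> t - pp\<bar> \<le> r \<and> \<bar>\<psi>' \<epsilon> t\<bar> \<le> r) \<and>
        \<bar>\<alpha> \<epsilon> - \<alpha>0\<bar> < \<delta> \<and> phase_condition \<phi> (\<alpha> \<epsilon>) (\<psi> \<epsilon>) \<and>
        (\<forall>\<beta>. \<bar>\<beta> - \<alpha>0\<bar> < \<delta> \<and> (\<exists>w w'. sol \<epsilon> w w' \<and> C2_near \<rho> w (\<lambda>t. \<phi> (t + \<beta>)) \<and> phase_condition \<phi> \<beta> w)
            \<longrightarrow> \<beta> = \<alpha> \<epsilon>))))"
proof -
  obtain \<theta> b e0 C :: real and \<alpha> \<alpha>' :: "real \<Rightarrow> real" and Y V :: "real \<Rightarrow> real \<Rightarrow> real" where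
    pos: "0 < \<theta>" "0 < b" "0 < e0" "0 < C" and \<alpha>0: "\<alpha> 0 = \<alpha>0"
    and \<alpha>: "\<And>\<epsilon>. \<bar>\<epsilon>\<bar> < e0 \<Longrightarrow> (\<alpha> has_real_derivative \<alpha>' \<epsilon>) (at \<epsilon>)" "continuous_on {-e0<..<e0} \<alpha>'"
    and ss: "\<And>\<epsilon>. \<bar>\<epsilon>\<bar> < e0 \<Longrightarrow> shifted_sol \<epsilon> (\<alpha> \<epsilon>) (\<lambda>t. \<phi> t + \<epsilon> * Y \<epsilon> t) (\<lambda>t. \<phi>' t + \<epsilon> * V \<epsilon> t)"
    and bd: "\<And>\<epsilon> t. \<bar>\<epsilon>\<bar> < e0 \<Longrightarrow> \<bar>Y \<epsilon> t\<bar> \<le> C \<and> \<bar>V \<epsilon> t\<bar> \<le> C \<and>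
       \<bar>f (\<phi> t + \<epsilon> * Y \<epsilon> t) + \<epsilon> * \<gamma> (t - \<alpha> \<epsilon>) * k (\<phi> t + \<epsilon> * Y \<epsilon> t, \<phi>' t + \<epsilon> * V \<epsilon> t) - f (\<phi> t)\<bar> \<le> C * \<bar>\<epsilon>\<bar>"
    and orth: "\<And>\<epsilon>. \<bar>\<epsilon>\<bar> < e0 \<Longrightarrow> (LBINT t. \<phi>' t * Y \<epsilon> t) = 0"
    and uniq: "\<And>\<epsilon> \<beta> \<xi> \<xi>'. \<bar>\<epsilon>\<bar> < e0 \<Longrightarrow> \<epsilon> \<noteq> 0 \<Longrightarrow> \<bar>\<beta> - \<alpha>0\<bar> \<le> \<theta> \<Longrightarrow> shifted_sol \<epsilon> \<beta> \<xi> \<xi>' \<Longrightarrow>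
       (\<And>t. \<bar>\<xi> t - \<phi> t\<bar> \<le> b) \<Longrightarrow> (\<And>t. \<bar>\<xi>' t - \<phi>' t\<bar> \<le> b) \<Longrightarrow> (LBINT t. \<phi>' t * (\<xi> t - \<phi> t)) = 0 \<Longrightarrow>
       \<beta> = \<alpha> \<epsilon> \<and> (\<forall>t. \<xi> t = \<phi> t + \<epsilon> * Y \<epsilon> t)"
    by (rule melnikov_persistence[OF Mel0 md m]) blast
  \<comment> \<open>Half of \<theta> is left for the shift \<tau> and half for the distance of
    \<open>\<alpha> \<epsilon>\<close> from \<open>\<alpha>0\<close>, so that their sum remains in
    the range where phases are unique.\<close>
  obtain \<rho>0 where \<rho>0: "0 < \<rho>0"
    "\<And>\<xi> \<xi>'. (\<And>t. (\<xi> has_real_derivative \<xi>' t) (at t)) \<Longrightarrow> (\<And>t. \<bar>\<xi> t - \<phi> t\<bar> \<le> \<rho>0) \<Longrightarrow> (\<And>t. \<bar>\<xi>' t - \<phi>' t\<bar> \<le> \<rho>0) \<Longrightarrow>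
      \<exists>\<tau>. \<bar>\<tau>\<bar> \<le> \<theta> / 2 \<and> (LBINT t. \<phi>' t * (\<xi> (t - \<tau>) - \<phi> t)) = 0 \<and>
        (\<forall>t. \<bar>\<xi> (t - \<tau>) - \<phi> t\<bar> \<le> b) \<and> (\<forall>t. \<bar>\<xi>' (t - \<tau>) - \<phi>' t\<bar> \<le> b)"
    by (rule phase_exists[OF pos(2) half_gt_zero[OF pos(1)]]) blast
  have \<alpha>c: "isCont \<alpha> 0" using \<alpha>(1)[of 0] pos by (intro DERIV_isCont) auto
  then have "\<forall>e>0. \<exists>d>0. \<forall>\<epsilon>. \<bar>\<epsilon>\<bar> < d \<longrightarrow> \<bar>\<alpha> \<epsilon> - \<alpha>0\<bar> < e"
    unfolding continuous_at_eps_delta by (simp add: dist_real_def \<alpha>0)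
  then obtain d where d: "0 < d" "\<And>\<epsilon>. \<bar>\<epsilon>\<bar> < d \<Longrightarrow> \<bar>\<alpha> \<epsilon> - \<alpha>0\<bar> < \<theta> / 2"
    using half_gt_zero[OF pos(1)] by blast
  have d\<phi>: "deriv \<phi> = \<phi>'" by (intro ext DERIV_imp_deriv \<phi>)
  have \<phi>s: "((\<lambda>t. \<phi> (t + \<beta>)) has_real_derivative \<phi>' (t + \<beta>)) (at t)"
    "((\<lambda>t. \<phi>' (t + \<beta>)) has_real_derivative f (\<phi> (t + \<beta>))) (at t)" for t \<beta>
    using \<phi>[of "t + \<beta>"] \<phi>'[of "t + \<beta>"] by (simp_all add: DERIV_shift)
  show ?thesis
  proof (rule exI[of _ "min \<rho>0 b"], intro conjI allI impI)
    show "0 < min \<rho>0 b" using \<rho>0 pos by simp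
    fix \<rho> e1 :: real assume "0 < \<rho> \<and> \<rho> \<le> min \<rho>0 b \<and> 0 < e1"
    then have \<rho>: "0 < \<rho>" "\<rho> \<le> \<rho>0" "\<rho> \<le> b" and e1: "0 < e1" by auto
    \<comment> \<open>Closeness \<rho> in the norm requires \<rho> / C. For the tails r / 2 goes to
      the perturbation and r / 2 to the convergence of the orbit to the saddles.\<close>
    define e where "e = min (min e0 e1) (min d (min (\<rho> / C) (r / (2 * C))))"
    have e: "0 < e" "e \<le> e0" "e \<le> e1" "e \<le> d" "e \<le> \<rho> / C" "e \<le> r / (2 * C)"
      using pos e1 d \<rho> r by (auto simp: e_def)
    have eC: "C * \<bar>\<epsilon>\<bar> \<le> \<rho>" "C * \<bar>\<epsilon>\<bar> \<le> r / 2" if "\<bar>\<epsilon>\<bar> < e" for \<epsilon>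
    proof -
      have "\<bar>\<epsilon>\<bar> \<le> \<rho> / C" "\<bar>\<epsilon>\<bar> \<le> r / 2 / C" using that e(5,6) by simp_all
      then show "C * \<bar>\<epsilon>\<bar> \<le> \<rho>" "C * \<bar>\<epsilon>\<bar> \<le> r / 2"
        using pos(4) by (simp_all only: pos_le_divide_eq mult.commute)
    qed
    define \<psi> where "\<psi> \<epsilon> t = \<phi> (t + \<alpha> \<epsilon>) + \<epsilon> * Y \<epsilon> (t + \<alpha> \<epsilon>)" for \<epsilon> t
    define \<psi>' where "\<psi>' \<epsilon> t = \<phi>' (t + \<alpha> \<epsilon>) + \<epsilon> * V \<epsilon> (t + \<alpha> \<epsilon>)" for \<epsilon> t
    show "\<exists>e0>0. e0 \<le> e1 \<and> (\<exists>\<delta>>0. \<exists>C \<alpha> \<psi> \<psi>'.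
     \<alpha> C1_differentiable_on {-e0<..<e0} \<and> \<alpha> 0 = \<alpha>0 \<and> ((\<lambda>\<epsilon>. \<bar>\<alpha> \<epsilon> - \<alpha>0\<bar>) \<longlongrightarrow> 0) (at 0) \<and>
     (\<forall>\<epsilon>. 0 < \<bar>\<epsilon>\<bar> \<and> \<bar>\<epsilon>\<bar> < e0 \<longrightarrow>
        sol \<epsilon> (\<psi> \<epsilon>) (\<psi>' \<epsilon>) \<and> C2_near \<rho> (\<psi> \<epsilon>) (\<lambda>t. \<phi> (t + \<alpha> \<epsilon>)) \<and>
        0 \<le> C2_norm (\<lambda>t. \<psi> \<epsilon> t - \<phi> (t + \<alpha> \<epsilon>)) \<and> C2_norm (\<lambda>t. \<psi> \<epsilon> t - \<phi> (t + \<alpha> \<epsilon>)) \<le> C * \<bar>\<epsilon>\<bar> \<and>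
        (\<forall>w w'. sol \<epsilon> w w' \<and> C2_near \<rho> w (\<lambda>t. \<phi> (t + \<alpha> \<epsilon>)) \<longrightarrow> w = \<psi> \<epsilon>) \<and>
        (\<exists>T. \<forall>t\<le>T. \<bar>\<psi> \<epsilon> t - pm\<bar> \<le> r \<and> \<bar>\<psi>' \<epsilon> t\<bar> \<le> r) \<and>
        (\<exists>T. \<forall>t\<ge>T. \<bar>\<psi> \<epsilon> t - pp\<bar> \<le> r \<and> \<bar>\<psi>' \<epsilon> t\<bar> \<le> r) \<and>
        \<bar>\<alpha> \<epsilon> - \<alpha>0\<bar> < \<delta> \<and> phase_condition \<phi> (\<alpha> \<epsilon>) (\<psi> \<epsilon>) \<and>
        (\<forall>\<beta>. \<bar>\<beta> - \<alpha>0\<bar> < \<delta> \<and> (\<exists>w w'. sol \<epsilon> w w' \<and> C2_near \<rho> w (\<lambda>t. \<phi> (t + \<beta>)) \<and> phase_condition \<phi> \<beta> w)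
            \<longrightarrow> \<beta> = \<alpha> \<epsilon>)))"
    proof (rule exI[of _ e], rule conjI[OF e(1) conjI[OF e(3)]], rule exI[of _ \<theta>], rule conjI[OF pos(1)],
        rule exI[of _ C], rule exI[of _ \<alpha>], rule exI[of _ \<psi>], rule exI[of _ \<psi>'], intro conjI \<alpha>0)
      show "\<alpha> C1_differentiable_on {-e<..<e}"
        unfolding C1_differentiable_on_def
      proof (intro exI[of _ \<alpha>'] conjI ballI)
        show "(\<alpha> has_vector_derivative \<alpha>' \<epsilon>) (at \<epsilon>)" if "\<epsilon> \<in> {-e<..<e}" for \<epsilon>
          using \<alpha>(1)[of \<epsilon>] that e by (simp add: has_real_derivative_iff_has_vector_derivative abs_less_iff)
        show "continuous_on {-e<..<e} \<alpha>'"
          by (rule continuous_on_subset[OF \<alpha>(2)]) (use e in auto)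
      qed
      show "((\<lambda>\<epsilon>. \<bar>\<alpha> \<epsilon> - \<alpha>0\<bar>) \<longlongrightarrow> 0) (at 0)"
        using \<alpha>c \<alpha>0 unfolding isCont_def by (auto intro!: tendsto_eq_intros)
    next
      show "\<forall>\<epsilon>. 0 < \<bar>\<epsilon>\<bar> \<and> \<bar>\<epsilon>\<bar> < e \<longrightarrow>
        sol \<epsilon> (\<psi> \<epsilon>) (\<psi>' \<epsilon>) \<and> C2_near \<rho> (\<psi> \<epsilon>) (\<lambda>t. \<phi> (t + \<alpha> \<epsilon>)) \<and>
        0 \<le> C2_norm (\<lambda>t. \<psi> \<epsilon> t - \<phi> (t + \<alpha> \<epsilon>)) \<and> C2_norm (\<lambda>t. \<psi> \<epsilon> t - \<phi> (t + \<alpha> \<epsilon>)) \<le> C * \<bar>\<epsilon>\<bar> \<and>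
        (\<forall>w w'. sol \<epsilon> w w' \<and> C2_near \<rho> w (\<lambda>t. \<phi> (t + \<alpha> \<epsilon>)) \<longrightarrow> w = \<psi> \<epsilon>) \<and>
        (\<exists>T. \<forall>t\<le>T. \<bar>\<psi> \<epsilon> t - pm\<bar> \<le> r \<and> \<bar>\<psi>' \<epsilon> t\<bar> \<le> r) \<and>
        (\<exists>T. \<forall>t\<ge>T. \<bar>\<psi> \<epsilon> t - pp\<bar> \<le> r \<and> \<bar>\<psi>' \<epsilon> t\<bar> \<le> r) \<and>
        \<bar>\<alpha> \<epsilon> - \<alpha>0\<bar> < \<theta> \<and> phase_condition \<phi> (\<alpha> \<epsilon>) (\<psi> \<epsilon>) \<and>
        (\<forall>\<beta>. \<bar>\<beta> - \<alpha>0\<bar> < \<theta> \<and> (\<exists>w w'. sol \<epsilon> w w' \<and> C2_near \<rho> w (\<lambda>t. \<phi> (t + \<beta>)) \<and> phase_condition \<phi> \<beta> w)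
            \<longrightarrow> \<beta> = \<alpha> \<epsilon>)"
      proof (rule allI, rule impI)
        fix \<epsilon> :: real assume "0 < \<bar>\<epsilon>\<bar> \<and> \<bar>\<epsilon>\<bar> < e"
        then have \<epsilon>: "\<epsilon> \<noteq> 0" "\<bar>\<epsilon>\<bar> < e" "\<bar>\<epsilon>\<bar> < e0" "\<bar>\<epsilon>\<bar> < d" using e by auto
        have \<alpha>\<theta>: "\<bar>\<alpha> \<epsilon> - \<alpha>0\<bar> < \<theta> / 2" by (rule d(2)[OF \<epsilon>(4)])
        have s: "sol \<epsilon> (\<psi> \<epsilon>) (\<psi>' \<epsilon>)"
          unfolding sol_iff_shifted_sol[of \<epsilon> _ _ "\<alpha> \<epsilon>"] using ss[OF \<epsilon>(3)] by (simp add: \<psi>_def \<psi>'_def)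
        let ?y2 = "\<lambda>t. f (\<psi> \<epsilon> t) + \<epsilon> * \<gamma> t * k (\<psi> \<epsilon> t, \<psi>' \<epsilon> t) - f (\<phi> (t + \<alpha> \<epsilon>))"
        have y: "((\<lambda>t. \<psi> \<epsilon> t - \<phi> (t + \<alpha> \<epsilon>)) has_real_derivative \<psi>' \<epsilon> t - \<phi>' (t + \<alpha> \<epsilon>)) (at t)"
          "((\<lambda>t. \<psi>' \<epsilon> t - \<phi>' (t + \<alpha> \<epsilon>)) has_real_derivative ?y2 t) (at t)" for t
          using s unfolding sol_def by (intro DERIV_diff \<phi>s; simp)+
        have y2c: "continuous_on UNIV ?y2"
          by (intro continuous_on_diff sol_rhs_cont[OF s] continuous_on_compose2[OF f_cont[of UNIV]])
             (auto intro!: continuous_intros continuous_on_compose2[OF \<phi>_cont[of UNIV]])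
        have \<epsilon>C: "\<bar>\<epsilon> * c\<bar> \<le> C * \<bar>\<epsilon>\<bar>" if "\<bar>c\<bar> \<le> C" for c
          unfolding abs_mult using mult_left_mono[OF that, of "\<bar>\<epsilon>\<bar>"] by (simp add: mult.commute)
        have yb: "\<bar>\<psi> \<epsilon> t - \<phi> (t + \<alpha> \<epsilon>)\<bar> \<le> C * \<bar>\<epsilon>\<bar>" "\<bar>\<psi>' \<epsilon> t - \<phi>' (t + \<alpha> \<epsilon>)\<bar> \<le> C * \<bar>\<epsilon>\<bar>"
          "\<bar>?y2 t\<bar> \<le> C * \<bar>\<epsilon>\<bar>" for t
          using bd[OF \<epsilon>(3), of "t + \<alpha> \<epsilon>"] by (simp_all add: \<psi>_def \<psi>'_def \<epsilon>C)
        have yr: "\<bar>\<psi> \<epsilon> t - \<phi> (t + \<alpha> \<epsilon>)\<bar> \<le> \<rho>" "\<bar>\<psi>' \<epsilon> t - \<phi>' (t + \<alpha> \<epsilon>)\<bar> \<le> \<rho>" "\<bar>?y2 t\<bar> \<le> \<rho>" for t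
          using yb[of t] eC(1)[OF \<epsilon>(2)] by linarith+
        have near: "C2_near \<rho> (\<psi> \<epsilon>) (\<lambda>t. \<phi> (t + \<alpha> \<epsilon>))" by (rule C2_nearI(1)[OF y y2c yr])
        have norm: "0 \<le> C2_norm (\<lambda>t. \<psi> \<epsilon> t - \<phi> (t + \<alpha> \<epsilon>))" "C2_norm (\<lambda>t. \<psi> \<epsilon> t - \<phi> (t + \<alpha> \<epsilon>)) \<le> C * \<bar>\<epsilon>\<bar>"
          by (rule C2_nearI(2,3)[OF y y2c yb])+
        have nearD: "\<bar>w (t - \<beta>) - \<phi> t\<bar> \<le> \<rho>" "\<bar>w' (t - \<beta>) - \<phi>' t\<bar> \<le> \<rho>"
          if "sol \<epsilon> w w'" "C2_near \<rho> w (\<lambda>t. \<phi> (t + \<beta>))" for w w' \<beta> t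
        proof -
          have "((\<lambda>t. w t - \<phi> (t + \<beta>)) has_real_derivative w' t - \<phi>' (t + \<beta>)) (at t)" for t
            using that(1) unfolding sol_def by (intro DERIV_diff \<phi>s) auto
          then have "deriv (\<lambda>t. w t - \<phi> (t + \<beta>)) t = w' t - \<phi>' (t + \<beta>)" for t by (rule DERIV_imp_deriv)
          then show "\<bar>w (t - \<beta>) - \<phi> t\<bar> \<le> \<rho>" "\<bar>w' (t - \<beta>) - \<phi>' t\<bar> \<le> \<rho>"
            using C2_near_bounds[OF that(2), of "t - \<beta>"] by simp_all
        qed
        \<comment> \<open>Here w satisfies no phase condition. A shift \<tau> establishes it, at the
          price of the phase \<open>\<alpha> \<epsilon> + \<tau>\<close>; uniqueness among
          normalized solutions then returns \<tau> = 0 together with w.\<close>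
        have U: "w = \<psi> \<epsilon>" if w: "sol \<epsilon> w w'" "C2_near \<rho> w (\<lambda>t. \<phi> (t + \<alpha> \<epsilon>))" for w w'
        proof -
          let ?\<xi> = "\<lambda>t. w (t - \<alpha> \<epsilon>)" and ?\<xi>' = "\<lambda>t. w' (t - \<alpha> \<epsilon>)"
          have "(?\<xi> has_real_derivative ?\<xi>' t) (at t)" for t
            using w(1) unfolding sol_def by (simp add: DERIV_shift_minus)
          moreover have "\<bar>?\<xi> t - \<phi> t\<bar> \<le> \<rho>0" "\<bar>?\<xi>' t - \<phi>' t\<bar> \<le> \<rho>0" for t
            using nearD[OF w, of t] \<rho> by simp_all
          ultimately obtain \<tau> where \<tau>: "\<bar>\<tau>\<bar> \<le> \<theta> / 2" "(LBINT t. \<phi>' t * (?\<xi> (t - \<tau>) - \<phi> t)) = 0"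
            "\<And>t. \<bar>?\<xi> (t - \<tau>) - \<phi> t\<bar> \<le> b" "\<And>t. \<bar>?\<xi>' (t - \<tau>) - \<phi>' t\<bar> \<le> b"
            using \<rho>0(2)[of ?\<xi> ?\<xi>'] by blast
          have "shifted_sol \<epsilon> (\<alpha> \<epsilon> + \<tau>) (\<lambda>t. ?\<xi> (t - \<tau>)) (\<lambda>t. ?\<xi>' (t - \<tau>))"
            using w(1) unfolding sol_iff_shifted_sol[of \<epsilon> w w' "\<alpha> \<epsilon> + \<tau>"] by (simp add: algebra_simps)
          moreover have "\<bar>\<alpha> \<epsilon> + \<tau> - \<alpha>0\<bar> \<le> \<theta>" using \<alpha>\<theta> \<tau>(1) by linarith
          ultimately have *: "\<alpha> \<epsilon> + \<tau> = \<alpha> \<epsilon>" "\<And>t. ?\<xi> (t - \<tau>) = \<phi> t + \<epsilon> * Y \<epsilon> t"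
            using uniq[OF \<epsilon>(3,1) _ _ \<tau>(3,4,2)] by blast+
          show "w = \<psi> \<epsilon>"
          proof
            fix t show "w t = \<psi> \<epsilon> t" using *(1) *(2)[of "t + \<alpha> \<epsilon>"] by (simp add: \<psi>_def)
          qed
        qed
        have pc: "phase_condition \<phi> \<beta> w \<longleftrightarrow> (LBINT t. \<phi>' t * (w (t - \<beta>) - \<phi> t)) = 0" for \<beta> w
          unfolding phase_condition_def d\<phi>
          by (subst LBINT_shift[where \<beta> = \<beta>]) (simp add: mult.commute)
        have ph: "phase_condition \<phi> (\<alpha> \<epsilon>) (\<psi> \<epsilon>)"
        proof -
          have "(LBINT t. \<phi>' t * (\<psi> \<epsilon> (t - \<alpha> \<epsilon>) - \<phi> t)) = (LBINT t. \<epsilon> * (\<phi>' t * Y \<epsilon> t))"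
            by (intro Bochner_Integration.integral_cong) (simp_all add: \<psi>_def)
          also have "\<dots> = \<epsilon> * (LBINT t. \<phi>' t * Y \<epsilon> t)" by (rule integral_mult_right_zero)
          finally show ?thesis unfolding pc using orth[OF \<epsilon>(3)] by simp
        qed
        have UB: "\<beta> = \<alpha> \<epsilon>" if \<beta>: "\<bar>\<beta> - \<alpha>0\<bar> < \<theta>" and w: "sol \<epsilon> w w'" "C2_near \<rho> w (\<lambda>t. \<phi> (t + \<beta>))"
          and p: "phase_condition \<phi> \<beta> w" for \<beta> w w'
        proof -
          have "shifted_sol \<epsilon> \<beta> (\<lambda>t. w (t - \<beta>)) (\<lambda>t. w' (t - \<beta>))" using w(1) unfolding sol_iff_shifted_sol[of \<epsilon> w w' \<beta>] .
          moreover have "\<bar>w (t - \<beta>) - \<phi> t\<bar> \<le> b" "\<bar>w' (t - \<beta>) - \<phi>' t\<bar> \<le> b" for t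
            using nearD[OF w, of t] \<rho> by simp_all
          ultimately show ?thesis using uniq[OF \<epsilon>(3,1)] \<beta> p unfolding pc by (meson less_imp_le)
        qed
        have tail: "\<forall>\<^sub>F t in F. \<bar>\<psi> \<epsilon> t - q\<bar> \<le> r \<and> \<bar>\<psi>' \<epsilon> t\<bar> \<le> r"
          if l: "(\<phi> \<longlongrightarrow> q) F" "(\<phi>' \<longlongrightarrow> 0) F" and sh: "filterlim (\<lambda>t. t + \<alpha> \<epsilon>) F F" for F q
        proof -
          have "\<forall>\<^sub>F t in F. dist (\<phi> (t + \<alpha> \<epsilon>)) q < r / 2" "\<forall>\<^sub>F t in F. dist (\<phi>' (t + \<alpha> \<epsilon>)) 0 < r / 2"
            using r by (intro tendstoD[OF filterlim_compose[OF l(1) sh]] tendstoD[OF filterlim_compose[OF l(2) sh]]; simp)+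
          then show ?thesis
          proof eventually_elim
            case (elim t)
            then show ?case using yb(1,2)[of t] eC(2)[OF \<epsilon>(2)] unfolding dist_real_def by linarith
          qed
        qed
        have "filterlim (\<lambda>t. t + \<alpha> \<epsilon>) at_bot at_bot" "filterlim (\<lambda>t. t + \<alpha> \<epsilon>) at_top at_top"
          by real_asymp+
        then have tails: "\<exists>T. \<forall>t\<le>T. \<bar>\<psi> \<epsilon> t - pm\<bar> \<le> r \<and> \<bar>\<psi>' \<epsilon> t\<bar> \<le> r"
          "\<exists>T. \<forall>t\<ge>T. \<bar>\<psi> \<epsilon> t - pp\<bar> \<le> r \<and> \<bar>\<psi>' \<epsilon> t\<bar> \<le> r"
          using tail[OF \<phi>_lim(1) \<phi>'_lim(1)] tail[OF \<phi>_lim(2) \<phi>'_lim(2)]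
          unfolding eventually_at_bot_linorder eventually_at_top_linorder by blast+
        have "\<bar>\<alpha> \<epsilon> - \<alpha>0\<bar> < \<theta>" using \<alpha>\<theta> pos(1) by linarith
        then show "sol \<epsilon> (\<psi> \<epsilon>) (\<psi>' \<epsilon>) \<and> C2_near \<rho> (\<psi> \<epsilon>) (\<lambda>t. \<phi> (t + \<alpha> \<epsilon>)) \<and>
        0 \<le> C2_norm (\<lambda>t. \<psi> \<epsilon> t - \<phi> (t + \<alpha> \<epsilon>)) \<and> C2_norm (\<lambda>t. \<psi> \<epsilon> t - \<phi> (t + \<alpha> \<epsilon>)) \<le> C * \<bar>\<epsilon>\<bar> \<and>
        (\<forall>w w'. sol \<epsilon> w w' \<and> C2_near \<rho> w (\<lambda>t. \<phi> (t + \<alpha> \<epsilon>)) \<longrightarrow> w = \<psi> \<epsilon>) \<and>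
        (\<exists>T. \<forall>t\<le>T. \<bar>\<psi> \<epsilon> t - pm\<bar> \<le> r \<and> \<bar>\<psi>' \<epsilon> t\<bar> \<le> r) \<and>
        (\<exists>T. \<forall>t\<ge>T. \<bar>\<psi> \<epsilon> t - pp\<bar> \<le> r \<and> \<bar>\<psi>' \<epsilon> t\<bar> \<le> r) \<and>
        \<bar>\<alpha> \<epsilon> - \<alpha>0\<bar> < \<theta> \<and> phase_condition \<phi> (\<alpha> \<epsilon>) (\<psi> \<epsilon>) \<and>
        (\<forall>\<beta>. \<bar>\<beta> - \<alpha>0\<bar> < \<theta> \<and> (\<exists>w w'. sol \<epsilon> w w' \<and> C2_near \<rho> w (\<lambda>t. \<phi> (t + \<beta>)) \<and> phase_condition \<phi> \<beta> w)
            \<longrightarrow> \<beta> = \<alpha> \<epsilon>)"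
          using s near norm U tails ph UB by blast
      qed
    qed
  qed
qed

end

section \<open>Verification of the abstract hypotheses and matching of the radii\<close>

theorem theorem3:
  fixes f h \<gamma> \<psi>inf :: "real \<Rightarrow> real" and d c \<psi>m \<psi>p \<alpha>0 :: real and I J :: "real set"
  assumes "C2 f" and "C2 h" and "C2 \<gamma>" and "\<forall>t. \<gamma> (t + 1) = \<gamma> t"
    and C1: "diffeo_cond h I J"
    and H4: "heteroclinic_orbit f \<psi>inf \<psi>m \<psi>p"
    and c: "\<forall>t. energy f \<psi>inf t = c"
    and H5: "c - d \<in> J"
  shows "\<exists>\<rho>>0. \<exists>\<epsilon>1>0. \<exists>um up :: real \<Rightarrow> real \<Rightarrow> real.
    (\<forall>\<epsilon>. \<bar>\<epsilon>\<bar> < \<epsilon>1 \<longrightarrow>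
       unique_hyperbolic_periodic_near f h \<gamma> d I J \<epsilon> \<rho> \<psi>m (um \<epsilon>) \<and>
       unique_hyperbolic_periodic_near f h \<gamma> d I J \<epsilon> \<rho> \<psi>p (up \<epsilon>)) \<and>
    (simple_zero (melnikov \<psi>inf \<gamma>) \<alpha>0 \<longrightarrow>
      (\<exists>\<epsilon>0>0. \<epsilon>0 \<le> \<epsilon>1 \<and> (\<exists>\<delta>>0. \<exists>(\<alpha> :: real \<Rightarrow> real) (\<psi> :: real \<Rightarrow> real \<Rightarrow> real).
        \<alpha> C1_differentiable_on {-\<epsilon>0<..<\<epsilon>0} \<and>
        \<alpha> 0 = \<alpha>0 \<and> ((\<lambda>\<epsilon>. \<bar>\<alpha> \<epsilon> - \<alpha>0\<bar>) \<longlongrightarrow> 0) (at 0) \<and>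
        (\<forall>\<epsilon>. 0 < \<bar>\<epsilon>\<bar> \<and> \<bar>\<epsilon>\<bar> < \<epsilon>0 \<longrightarrow>
           perturbed_solution f h \<gamma> d I J \<epsilon> (\<psi> \<epsilon>) \<and>
           C2_near \<rho> (\<psi> \<epsilon>) (\<lambda>t. \<psi>inf (t + \<alpha> \<epsilon>)) \<and>
           (\<forall>w. perturbed_solution f h \<gamma> d I J \<epsilon> w \<and>
                C2_near \<rho> w (\<lambda>t. \<psi>inf (t + \<alpha> \<epsilon>)) \<longrightarrow> w = \<psi> \<epsilon>) \<and>
           ((\<lambda>t. \<bar>\<psi> \<epsilon> t - um \<epsilon> t\<bar>) \<longlongrightarrow> 0) at_bot \<and>
           ((\<lambda>t. \<bar>\<psi> \<epsilon> t - up \<epsilon> t\<bar>) \<longlongrightarrow> 0) at_top \<and>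
           \<bar>\<alpha> \<epsilon> - \<alpha>0\<bar> < \<delta> \<and> phase_condition \<psi>inf (\<alpha> \<epsilon>) (\<psi> \<epsilon>) \<and>
           (\<forall>\<beta>. \<bar>\<beta> - \<alpha>0\<bar> < \<delta> \<and>
                (\<exists>w. perturbed_solution f h \<gamma> d I J \<epsilon> w \<and>
                     C2_near \<rho> w (\<lambda>t. \<psi>inf (t + \<beta>)) \<and> phase_condition \<psi>inf \<beta> w)
                \<longrightarrow> \<beta> = \<alpha> \<epsilon>)) \<and>
        ((\<lambda>\<epsilon>. C2_norm (\<lambda>t. \<psi> \<epsilon> t - \<psi>inf (t + \<alpha> \<epsilon>))) \<longlongrightarrow> 0) (at 0))))"
proof -
  let ?f1 = "deriv f" and ?\<phi>' = "deriv \<psi>inf"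
  define k where "k = (\<lambda>z. h_of_H h I (rel_energy f d z))"
  define k1 where "k1 = (\<lambda>z. - (h_of_H' h I (rel_energy f d z) * f (fst z)))"
  define k2 where "k2 = (\<lambda>z. h_of_H' h I (rel_energy f d z) * snd z)"
  define \<Omega> where "\<Omega> = {z. rel_energy f d z \<in> J}"
  interpret P: perturbed_oscillator f ?f1 "deriv ?f1" \<gamma> "deriv \<gamma>" k k1 k2 \<Omega>
    unfolding k_def k1_def k2_def \<Omega>_def by (rule perturbed_oscillatorI[OF assms(1-5)])
  have rhs: "perturbed_rhs f h \<gamma> d I \<epsilon> t x y = f x + \<epsilon> * \<gamma> t * k (x, y)" for \<epsilon> t x y
    by (simp add: perturbed_rhs_def k_def h_of_H_def rel_energy_def)
  have \<Omega>_iff: "z \<in> \<Omega> \<longleftrightarrow> (snd z)\<^sup>2 / 2 - primitive f (fst z) - d \<in> J" for z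
    by (simp add: \<Omega>_def rel_energy_def)
  have sol_iff: "perturbed_solution f h \<gamma> d I J \<epsilon> \<psi> \<longleftrightarrow> P.sol \<epsilon> \<psi> (deriv \<psi>)" for \<epsilon> \<psi>
    by (auto simp: perturbed_solution_def solves2_def P.sol_def rhs energy_def \<Omega>_iff
        DERIV_deriv_iff_real_differentiable)
  have sol_deriv: "\<psi>' = deriv \<psi>" if "P.sol \<epsilon> \<psi> \<psi>'" for \<epsilon> \<psi> \<psi>'
    using that unfolding P.sol_def by (intro ext DERIV_imp_deriv[symmetric]) auto
  have solD: "perturbed_solution f h \<gamma> d I J \<epsilon> \<psi>" if "P.sol \<epsilon> \<psi> \<psi>'" for \<epsilon> \<psi> \<psi>'
    using that sol_deriv[OF that] by (simp add: sol_iff)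

  have sad: "hyperbolic_saddle f \<psi>m" "hyperbolic_saddle f \<psi>p"
    and lim: "(\<psi>inf \<longlongrightarrow> \<psi>m) at_bot" "(\<psi>inf \<longlongrightarrow> \<psi>p) at_top"
    and so: "solves2 (\<lambda>t x y. f x) \<psi>inf" and nc: "\<not> \<psi>inf constant_on UNIV"
    using H4 by (simp_all add: heteroclinic_orbit_def)
  note sm = hyperbolic_saddleD[OF sad(1) P.f] and sp = hyperbolic_saddleD[OF sad(2) P.f]
  have \<phi>: "(\<psi>inf has_real_derivative ?\<phi>' t) (at t)" "(?\<phi>' has_real_derivative f (\<psi>inf t)) (at t)" for t
    using so by (auto simp: solves2_def DERIV_deriv_iff_real_differentiable)
  define G where "G = primitive f"
  have Gc: "isCont G x" for x
    unfolding G_def by (rule DERIV_isCont[OF primitive_has_real_derivative[OF P.f_cont]])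
  \<comment> \<open>Constancy of the energy expresses the squared derivative through the position,
    so it converges at both ends.\<close>
  have en: "(?\<phi>' t)\<^sup>2 = 2 * (c + G (\<psi>inf t))" for t
    using c[rule_format, of t] by (simp add: energy_def G_def field_simps)
  have sq: "((\<lambda>t. (?\<phi>' t)\<^sup>2) \<longlongrightarrow> 2 * (c + G q)) F" if "(\<psi>inf \<longlongrightarrow> q) F" for q F
    unfolding en by (intro tendsto_intros isCont_tendsto_compose[OF Gc that])
  have \<phi>'lim: "(?\<phi>' \<longlongrightarrow> 0) at_bot" "(?\<phi>' \<longlongrightarrow> 0) at_top"
  proof -
    show "(?\<phi>' \<longlongrightarrow> 0) at_bot"
    proof (rule derivative_tendsto_0[OF \<phi>(1) _ _ lim(1) sq[OF lim(1)]])
      fix \<xi> :: "real \<Rightarrow> real" assume \<xi>: "\<And>t. t \<le> \<xi> t \<and> \<xi> t \<le> t + 1"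
      have "filterlim (\<lambda>t::real. t + 1) at_bot at_bot" by real_asymp
      then show "filterlim \<xi> at_bot at_bot"
        by (rule filterlim_at_bot_mono) (use \<xi> in auto)
    qed simp
    show "(?\<phi>' \<longlongrightarrow> 0) at_top"
    proof (rule derivative_tendsto_0[OF \<phi>(1) _ _ lim(2) sq[OF lim(2)]])
      fix \<xi> :: "real \<Rightarrow> real" assume \<xi>: "\<And>t. t \<le> \<xi> t \<and> \<xi> t \<le> t + 1"
      show "filterlim \<xi> at_top at_top"
        by (rule filterlim_at_top_mono[OF filterlim_ident]) (use \<xi> in auto)
    qed simp
  qed
  have cG: "c + G q = 0" if "(\<psi>inf \<longlongrightarrow> q) F" "(?\<phi>' \<longlongrightarrow> 0) F" "F \<noteq> bot" for q F
  proof -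
    have "((\<lambda>t. (?\<phi>' t)\<^sup>2) \<longlongrightarrow> 0\<^sup>2) F" by (intro tendsto_intros that)
    from tendsto_unique[OF that(3) sq[OF that(1)] this] show ?thesis by simp
  qed
  \<comment> \<open>In the limit both saddles have the energy c of the orbit, so the energy
    assumption places them in \<Omega> as well.\<close>
  have Gm: "c + G \<psi>m = 0" and Gp: "c + G \<psi>p = 0"
    by (rule cG[OF lim(1) \<phi>'lim(1)] cG[OF lim(2) \<phi>'lim(2)]; simp)+
  have re: "rel_energy f d (\<psi>inf t, ?\<phi>' t) = c - d" for t
    using c[rule_format, of t] by (simp add: rel_energy_def energy_def)
  have re0: "rel_energy f d (\<psi>m, 0) = c - d" "rel_energy f d (\<psi>p, 0) = c - d"
    using Gm Gp by (simp_all add: rel_energy_def G_def)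
  define g0 where "g0 = h_of_H h I (c - d)"
  have g0: "g0 \<noteq> 0" unfolding g0_def h_of_H_def by (rule diffeo_inverse(2)[OF assms(2) C1 H5])
  have f1c: "isCont ?f1 x" for x using P.f1_cont[of UNIV] by (simp add: continuous_on_eq_continuous_at)
  have f1lim: "((\<lambda>t. ?f1 (\<psi>inf t)) \<longlongrightarrow> ?f1 \<psi>m) at_bot" "((\<lambda>t. ?f1 (\<psi>inf t)) \<longlongrightarrow> ?f1 \<psi>p) at_top"
    by (rule isCont_tendsto_compose[OF f1c lim(1)] isCont_tendsto_compose[OF f1c lim(2)])+
  obtain A where A: "\<And>t. \<bar>?f1 (\<psi>inf t)\<bar> \<le> A"
    by (rule bounded_of_limits[OF _ f1lim])
       (auto intro!: continuous_on_compose2[OF P.f1_cont[of UNIV] continuous_on_DERIV[OF \<phi>(1)]])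
  \<comment> \<open>Half of the smaller derivative of f at the saddles: along the orbit the
    derivative eventually exceeds it on both sides.\<close>
  define \<kappa> where "\<kappa> = min (?f1 \<psi>m) (?f1 \<psi>p) / 2"
  have \<kappa>: "0 < \<kappa>" "\<kappa> < ?f1 \<psi>m" "\<kappa> < ?f1 \<psi>p"
    using sm(2) sp(2) by (auto simp: \<kappa>_def min_def)
  obtain T1 T2 where T12: "\<And>t. t \<le> T1 \<Longrightarrow> \<kappa> < ?f1 (\<psi>inf t)" "\<And>t. T2 \<le> t \<Longrightarrow> \<kappa> < ?f1 (\<psi>inf t)"
    using order_tendstoD(1)[OF f1lim(1) \<kappa>(2)] order_tendstoD(1)[OF f1lim(2) \<kappa>(3)]
    unfolding eventually_at_bot_linorder eventually_at_top_linorder by blast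
  define T where "T = max \<bar>T1\<bar> \<bar>T2\<bar>"
  have T: "\<kappa> \<le> ?f1 (\<psi>inf t)" if "T \<le> \<bar>t\<bar>" for t
  proof -
    have "t \<le> T1 \<or> T2 \<le> t" using that unfolding T_def by linarith
    then show ?thesis using T12[of t] by (auto simp: less_imp_le)
  qed
  have nonconst: "\<exists>t. ?\<phi>' t \<noteq> 0"
  proof (rule ccontr)
    assume "\<not> (\<exists>t. ?\<phi>' t \<noteq> 0)"
    then have "(\<psi>inf has_real_derivative 0) (at t)" for t using \<phi>(1)[of t] by simp
    then have "\<psi>inf t = \<psi>inf 0" for t by (intro DERIV_isconst_all) auto
    then show False using nc unfolding constant_on_def by blast
  qed
  interpret Q: heteroclinic f ?f1 "deriv ?f1" \<gamma> "deriv \<gamma>" k k1 k2 \<Omega> \<psi>inf ?\<phi>' \<psi>m \<psi>p g0 A \<kappa> T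
    by unfold_locales
       (use \<phi> lim \<phi>'lim sm sp nonconst re re0 H5 g0 A \<kappa>(1) T in \<open>auto simp: \<Omega>_def k_def g0_def\<close>)
  have Mel: "melnikov \<psi>inf \<gamma> = Q.Mel"
  proof
    fix \<alpha>
    show "melnikov \<psi>inf \<gamma> \<alpha> = Q.Mel \<alpha>"
      unfolding melnikov_def Q.Mel_def by (subst LBINT_shift[where \<beta> = \<alpha>]) simp
  qed

  have "0 < sqrt (?f1 \<psi>m)" "?f1 \<psi>m = (sqrt (?f1 \<psi>m))\<^sup>2" "0 < sqrt (?f1 \<psi>p)" "?f1 \<psi>p = (sqrt (?f1 \<psi>p))\<^sup>2"
    using sm(2) sp(2) by simp_all
  note sq = this
  have in\<Omega>: "(\<psi>m, 0) \<in> \<Omega>" "(\<psi>p, 0) \<in> \<Omega>" using re0 H5 by (simp_all add: \<Omega>_def)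
  obtain rm em where m: "0 < rm" "0 < em"
    "\<And>\<rho>. 0 < \<rho> \<Longrightarrow> \<rho> \<le> rm \<Longrightarrow> \<exists>e>0. \<forall>\<epsilon>. \<bar>\<epsilon>\<bar> < e \<longrightarrow> (\<exists>u u'. P.periodic_near \<psi>m rm \<rho> \<epsilon> u u')"
    "\<And>\<epsilon> T w w' u u'. \<bar>\<epsilon>\<bar> < em \<Longrightarrow> P.sol \<epsilon> w w' \<Longrightarrow> P.sol \<epsilon> u u' \<Longrightarrow>
      (\<And>t. t \<le> T \<Longrightarrow> \<bar>w t - \<psi>m\<bar> \<le> rm \<and> \<bar>w' t\<bar> \<le> rm \<and> \<bar>u t - \<psi>m\<bar> \<le> rm \<and> \<bar>u' t\<bar> \<le> rm) \<Longrightarrow>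
      ((\<lambda>t. w t - u t) \<longlongrightarrow> 0) at_bot"
    by (rule P.saddle_solutions[OF in\<Omega>(1) sm(1) sq(2,1)]) blast
  obtain rp ep where p: "0 < rp" "0 < ep"
    "\<And>\<rho>. 0 < \<rho> \<Longrightarrow> \<rho> \<le> rp \<Longrightarrow> \<exists>e>0. \<forall>\<epsilon>. \<bar>\<epsilon>\<bar> < e \<longrightarrow> (\<exists>u u'. P.periodic_near \<psi>p rp \<rho> \<epsilon> u u')"
    "\<And>\<epsilon> T w w' u u'. \<bar>\<epsilon>\<bar> < ep \<Longrightarrow> P.sol \<epsilon> w w' \<Longrightarrow> P.sol \<epsilon> u u' \<Longrightarrow>
      (\<And>t. T \<le> t \<Longrightarrow> \<bar>w t - \<psi>p\<bar> \<le> rp \<and> \<bar>w' t\<bar> \<le> rp \<and> \<bar>u t - \<psi>p\<bar> \<le> rp \<and> \<bar>u' t\<bar> \<le> rp) \<Longrightarrow>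
      ((\<lambda>t. w t - u t) \<longlongrightarrow> 0) at_top"
    by (rule P.saddle_solutions[OF in\<Omega>(2) sp(1) sq(4,3)]) blast

  \<comment> \<open>The uniqueness clause of \<open>periodic_near\<close> bounds only u and its
    first derivative, within r; a function in the C2 ball of radius \<rho> \<le> r satisfies it. The
    Floquet coefficients are identified with the partial derivatives of the right-hand side.\<close>
  have uhp: "unique_hyperbolic_periodic_near f h \<gamma> d I J \<epsilon> \<rho> q u"
    if pn: "P.periodic_near q r \<rho> \<epsilon> u u'" and \<rho>: "\<rho> \<le> r" for q r \<rho> \<epsilon> u u'
  proof -
    have s: "P.sol \<epsilon> u u'"
      and b: "\<And>t. \<bar>u t - q\<bar> \<le> \<rho>" "\<And>t. \<bar>u' t\<bar> \<le> \<rho>" "\<And>t. \<bar>f (u t) + \<epsilon> * \<gamma> t * k (u t, u' t)\<bar> \<le> \<rho>"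
      and per: "\<And>t. u (t + 1) = u t"
      and fl: "\<And>\<mu>. floquet_multiplier (\<lambda>t. ?f1 (u t) + \<epsilon> * \<gamma> t * k1 (u t, u' t)) (\<lambda>t. \<epsilon> * \<gamma> t * k2 (u t, u' t)) 1 \<mu>
        \<Longrightarrow> cmod \<mu> \<noteq> 1"
      and un: "\<And>w w'. P.sol \<epsilon> w w' \<Longrightarrow> (\<And>t. \<bar>w t - q\<bar> \<le> r \<and> \<bar>w' t\<bar> \<le> r) \<Longrightarrow> w = u"
      using pn unfolding P.periodic_near_def by blast+
    have u': "u' = deriv u" by (rule sol_deriv[OF s])
    have d: "((\<lambda>t. u t - q) has_real_derivative u' t) (at t)"
      "(u' has_real_derivative f (u t) + \<epsilon> * \<gamma> t * k (u t, u' t)) (at t)" "(u t, u' t) \<in> \<Omega>" for t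
      using s unfolding P.sol_def by (auto intro!: derivative_eq_intros)
    have near: "C2_near \<rho> u (\<lambda>t. q)"
      by (rule C2_nearI(1)[OF d(1,2) P.sol_rhs_cont[OF s] b])
    have dx: "deriv (\<lambda>x. perturbed_rhs f h \<gamma> d I \<epsilon> t x (u' t)) (u t) = ?f1 (u t) + \<epsilon> * \<gamma> t * k1 (u t, u' t)" for t
    proof (rule DERIV_imp_deriv)
      have px: "((\<lambda>x. (x, u' t)) has_derivative (\<lambda>v. (v, 0))) (at (u t))"
        by (auto intro!: derivative_eq_intros)
      have "((\<lambda>x. k (x, u' t)) has_derivative (\<lambda>v. k1 (u t, u' t) * fst (v, 0) + k2 (u t, u' t) * snd (v, 0))) (at (u t))"
        using has_derivative_compose[OF px, where g = k and g' = "\<lambda>h. k1 (u t, u' t) * fst h + k2 (u t, u' t) * snd h"]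
          P.k[OF d(3)[of t]] by simp
      then have "((\<lambda>x. k (x, u' t)) has_real_derivative k1 (u t, u' t)) (at (u t))"
        by (rule has_derivative_imp_has_field_derivative) simp
      then show "((\<lambda>x. perturbed_rhs f h \<gamma> d I \<epsilon> t x (u' t)) has_real_derivative ?f1 (u t) + \<epsilon> * \<gamma> t * k1 (u t, u' t)) (at (u t))"
        unfolding rhs by (intro DERIV_add P.f DERIV_cmult)
    qed
    have dy: "deriv (\<lambda>y. perturbed_rhs f h \<gamma> d I \<epsilon> t (u t) y) (u' t) = \<epsilon> * \<gamma> t * k2 (u t, u' t)" for t
    proof (rule DERIV_imp_deriv)
      have py: "((\<lambda>y. (u t, y)) has_derivative (\<lambda>v. (0, v))) (at (u' t))"
        by (auto intro!: derivative_eq_intros)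
      have "((\<lambda>y. k (u t, y)) has_derivative (\<lambda>v. k1 (u t, u' t) * fst (0, v) + k2 (u t, u' t) * snd (0, v))) (at (u' t))"
        using has_derivative_compose[OF py, where g = k and g' = "\<lambda>h. k1 (u t, u' t) * fst h + k2 (u t, u' t) * snd h"]
          P.k[OF d(3)[of t]] by simp
      then have "((\<lambda>y. k (u t, y)) has_real_derivative k2 (u t, u' t)) (at (u' t))"
        by (rule has_derivative_imp_has_field_derivative) simp
      then have "((\<lambda>y. f (u t) + \<epsilon> * \<gamma> t * k (u t, y)) has_real_derivative 0 + \<epsilon> * \<gamma> t * k2 (u t, u' t)) (at (u' t))"
        by (intro DERIV_add DERIV_const DERIV_cmult)
      then show "((\<lambda>y. perturbed_rhs f h \<gamma> d I \<epsilon> t (u t) y) has_real_derivative \<epsilon> * \<gamma> t * k2 (u t, u' t)) (at (u' t))"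
        unfolding rhs by simp
    qed
    have hyp: "hyperbolic_periodic (perturbed_rhs f h \<gamma> d I \<epsilon>) 1 u"
      unfolding hyperbolic_periodic_def u'[symmetric] dx dy using per fl by blast
    have "w = u" if w: "perturbed_solution f h \<gamma> d I J \<epsilon> w" "C2_near \<rho> w (\<lambda>t. q)" for w
    proof (rule un)
      show sw: "P.sol \<epsilon> w (deriv w)" using w(1) by (simp add: sol_iff)
      fix t
      have "((\<lambda>t. w t - q) has_real_derivative deriv w t) (at t)"
        using sw unfolding P.sol_def by (auto intro!: derivative_eq_intros)
      then have "deriv (\<lambda>t. w t - q) t = deriv w t" by (rule DERIV_imp_deriv)
      then show "\<bar>w t - q\<bar> \<le> r \<and> \<bar>deriv w t\<bar> \<le> r" using C2_near_bounds[OF w(2), of t] \<rho> by simp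
    qed
    then show ?thesis
      unfolding unique_hyperbolic_periodic_near_def using solD[OF s] hyp near by blast
  qed

  define r where "r = min rm rp"
  have r: "0 < r" "r \<le> rm" "r \<le> rp" using m p by (auto simp: r_def)
  define H where "H \<rho> e1 \<longleftrightarrow> (\<exists>e0>0. e0 \<le> e1 \<and> (\<exists>\<delta>>0. \<exists>C \<alpha> \<psi> \<psi>'.
     \<alpha> C1_differentiable_on {-e0<..<e0} \<and> \<alpha> 0 = \<alpha>0 \<and> ((\<lambda>\<epsilon>. \<bar>\<alpha> \<epsilon> - \<alpha>0\<bar>) \<longlongrightarrow> 0) (at 0) \<and>
     (\<forall>\<epsilon>. 0 < \<bar>\<epsilon>\<bar> \<and> \<bar>\<epsilon>\<bar> < e0 \<longrightarrow>
        P.sol \<epsilon> (\<psi> \<epsilon>) (\<psi>' \<epsilon>) \<and> C2_near \<rho> (\<psi> \<epsilon>) (\<lambda>t. \<psi>inf (t + \<alpha> \<epsilon>)) \<and>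
        0 \<le> C2_norm (\<lambda>t. \<psi> \<epsilon> t - \<psi>inf (t + \<alpha> \<epsilon>)) \<and> C2_norm (\<lambda>t. \<psi> \<epsilon> t - \<psi>inf (t + \<alpha> \<epsilon>)) \<le> C * \<bar>\<epsilon>\<bar> \<and>
        (\<forall>w w'. P.sol \<epsilon> w w' \<and> C2_near \<rho> w (\<lambda>t. \<psi>inf (t + \<alpha> \<epsilon>)) \<longrightarrow> w = \<psi> \<epsilon>) \<and>
        (\<exists>T. \<forall>t\<le>T. \<bar>\<psi> \<epsilon> t - \<psi>m\<bar> \<le> r \<and> \<bar>\<psi>' \<epsilon> t\<bar> \<le> r) \<and>
        (\<exists>T. \<forall>t\<ge>T. \<bar>\<psi> \<epsilon> t - \<psi>p\<bar> \<le> r \<and> \<bar>\<psi>' \<epsilon> t\<bar> \<le> r) \<and>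
        \<bar>\<alpha> \<epsilon> - \<alpha>0\<bar> < \<delta> \<and> phase_condition \<psi>inf (\<alpha> \<epsilon>) (\<psi> \<epsilon>) \<and>
        (\<forall>\<beta>. \<bar>\<beta> - \<alpha>0\<bar> < \<delta> \<and> (\<exists>w w'. P.sol \<epsilon> w w' \<and> C2_near \<rho> w (\<lambda>t. \<psi>inf (t + \<beta>)) \<and> phase_condition \<psi>inf \<beta> w)
            \<longrightarrow> \<beta> = \<alpha> \<epsilon>))))" for \<rho> e1
  \<comment> \<open>The statement fixes \<rho> before the zero of the Melnikov function is assumed,
    while the admissible radius comes from that zero. Hence a case distinction, with a dummy radius
    if the zero is not simple.\<close>
  obtain \<rho>1 where \<rho>1: "0 < \<rho>1"
    "\<And>\<rho> e1. 0 < \<rho> \<Longrightarrow> \<rho> \<le> \<rho>1 \<Longrightarrow> 0 < e1 \<Longrightarrow> simple_zero (melnikov \<psi>inf \<gamma>) \<alpha>0 \<Longrightarrow> H \<rho> e1"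
  proof (cases "simple_zero (melnikov \<psi>inf \<gamma>) \<alpha>0")
    case True
    then obtain \<mu> where "Q.Mel \<alpha>0 = 0" "\<mu> \<noteq> 0" "(Q.Mel has_real_derivative \<mu>) (at \<alpha>0)"
      unfolding simple_zero_def Mel by blast
    from Q.heteroclinic_persistence[OF this(1,3,2) r(1)] obtain \<rho>1 where
      "0 < \<rho>1" "\<And>\<rho> e1. 0 < \<rho> \<and> \<rho> \<le> \<rho>1 \<and> 0 < e1 \<Longrightarrow> H \<rho> e1"
      unfolding H_def[symmetric] by blast
    then show ?thesis using that by blast
  next
    case False
    then show ?thesis using that[of 1] by simp
  qed
  \<comment> \<open>One radius serves the heteroclinic solution and both periodic solutions; the
    latter then lie inside their squares of uniqueness.\<close>
  define \<rho> where "\<rho> = min \<rho>1 r"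
  have \<rho>: "0 < \<rho>" "\<rho> \<le> \<rho>1" "\<rho> \<le> rm" "\<rho> \<le> rp" using \<rho>1(1) r by (auto simp: \<rho>_def)
  obtain em' where em': "0 < em'" "\<And>\<epsilon>. \<bar>\<epsilon>\<bar> < em' \<Longrightarrow> \<exists>u u'. P.periodic_near \<psi>m rm \<rho> \<epsilon> u u'"
    using m(3)[OF \<rho>(1,3)] by blast
  obtain ep' where ep': "0 < ep'" "\<And>\<epsilon>. \<bar>\<epsilon>\<bar> < ep' \<Longrightarrow> \<exists>u u'. P.periodic_near \<psi>p rp \<rho> \<epsilon> u u'"
    using p(3)[OF \<rho>(1,4)] by blast
  define \<epsilon>1 where "\<epsilon>1 = min (min em em') (min ep ep')"
  have \<epsilon>1: "0 < \<epsilon>1" "\<epsilon>1 \<le> em" "\<epsilon>1 \<le> em'" "\<epsilon>1 \<le> ep" "\<epsilon>1 \<le> ep'"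
    using m p em' ep' by (auto simp: \<epsilon>1_def)
  have "\<forall>\<epsilon>. \<exists>u u'. \<bar>\<epsilon>\<bar> < \<epsilon>1 \<longrightarrow> P.periodic_near \<psi>m rm \<rho> \<epsilon> u u'" using em'(2) \<epsilon>1(3) by (meson less_le_trans)
  then obtain um um' where um: "\<And>\<epsilon>. \<bar>\<epsilon>\<bar> < \<epsilon>1 \<Longrightarrow> P.periodic_near \<psi>m rm \<rho> \<epsilon> (um \<epsilon>) (um' \<epsilon>)" by metis
  have "\<forall>\<epsilon>. \<exists>u u'. \<bar>\<epsilon>\<bar> < \<epsilon>1 \<longrightarrow> P.periodic_near \<psi>p rp \<rho> \<epsilon> u u'" using ep'(2) \<epsilon>1(5) by (meson less_le_trans)
  then obtain up up' where up: "\<And>\<epsilon>. \<bar>\<epsilon>\<bar> < \<epsilon>1 \<Longrightarrow> P.periodic_near \<psi>p rp \<rho> \<epsilon> (up \<epsilon>) (up' \<epsilon>)" by metis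
  show ?thesis
  proof (rule exI[of _ \<rho>], rule conjI[OF \<rho>(1)], rule exI[of _ \<epsilon>1], rule conjI[OF \<epsilon>1(1)],
      rule exI[of _ um], rule exI[of _ up], intro conjI allI impI)
    show "unique_hyperbolic_periodic_near f h \<gamma> d I J \<epsilon> \<rho> \<psi>m (um \<epsilon>)" if "\<bar>\<epsilon>\<bar> < \<epsilon>1" for \<epsilon>
      by (rule uhp[OF um[OF that] \<rho>(3)])
    show "unique_hyperbolic_periodic_near f h \<gamma> d I J \<epsilon> \<rho> \<psi>p (up \<epsilon>)" if "\<bar>\<epsilon>\<bar> < \<epsilon>1" for \<epsilon>
      by (rule uhp[OF up[OF that] \<rho>(4)])
    assume "simple_zero (melnikov \<psi>inf \<gamma>) \<alpha>0"
    then have "H \<rho> \<epsilon>1" by (rule \<rho>1(2)[OF \<rho>(1,2) \<epsilon>1(1)])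
    then obtain e0 \<delta> C \<alpha> \<psi> \<psi>' where e0: "0 < e0" "e0 \<le> \<epsilon>1" and \<delta>: "0 < \<delta>"
      and \<alpha>: "\<alpha> C1_differentiable_on {-e0<..<e0}" "\<alpha> 0 = \<alpha>0" "((\<lambda>\<epsilon>. \<bar>\<alpha> \<epsilon> - \<alpha>0\<bar>) \<longlongrightarrow> 0) (at 0)"
      and \<psi>: "\<And>\<epsilon>. 0 < \<bar>\<epsilon>\<bar> \<and> \<bar>\<epsilon>\<bar> < e0 \<Longrightarrow>
        P.sol \<epsilon> (\<psi> \<epsilon>) (\<psi>' \<epsilon>) \<and> C2_near \<rho> (\<psi> \<epsilon>) (\<lambda>t. \<psi>inf (t + \<alpha> \<epsilon>)) \<and>
        0 \<le> C2_norm (\<lambda>t. \<psi> \<epsilon> t - \<psi>inf (t + \<alpha> \<epsilon>)) \<and> C2_norm (\<lambda>t. \<psi> \<epsilon> t - \<psi>inf (t + \<alpha> \<epsilon>)) \<le> C * \<bar>\<epsilon>\<bar> \<and>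
        (\<forall>w w'. P.sol \<epsilon> w w' \<and> C2_near \<rho> w (\<lambda>t. \<psi>inf (t + \<alpha> \<epsilon>)) \<longrightarrow> w = \<psi> \<epsilon>) \<and>
        (\<exists>T. \<forall>t\<le>T. \<bar>\<psi> \<epsilon> t - \<psi>m\<bar> \<le> r \<and> \<bar>\<psi>' \<epsilon> t\<bar> \<le> r) \<and>
        (\<exists>T. \<forall>t\<ge>T. \<bar>\<psi> \<epsilon> t - \<psi>p\<bar> \<le> r \<and> \<bar>\<psi>' \<epsilon> t\<bar> \<le> r) \<and>
        \<bar>\<alpha> \<epsilon> - \<alpha>0\<bar> < \<delta> \<and> phase_condition \<psi>inf (\<alpha> \<epsilon>) (\<psi> \<epsilon>) \<and>
        (\<forall>\<beta>. \<bar>\<beta> - \<alpha>0\<bar> < \<delta> \<and> (\<exists>w w'. P.sol \<epsilon> w w' \<and> C2_near \<rho> w (\<lambda>t. \<psi>inf (t + \<beta>)) \<and> phase_condition \<psi>inf \<beta> w)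
            \<longrightarrow> \<beta> = \<alpha> \<epsilon>)"
      unfolding H_def by blast
    have bot: "((\<lambda>t. \<bar>\<psi> \<epsilon> t - um \<epsilon> t\<bar>) \<longlongrightarrow> 0) at_bot" if \<epsilon>: "0 < \<bar>\<epsilon>\<bar> \<and> \<bar>\<epsilon>\<bar> < e0" for \<epsilon>
    proof -
      have e: "\<bar>\<epsilon>\<bar> < \<epsilon>1" "\<bar>\<epsilon>\<bar> < em" using \<epsilon> e0 \<epsilon>1 by auto
      obtain T where T: "\<And>t. t \<le> T \<Longrightarrow> \<bar>\<psi> \<epsilon> t - \<psi>m\<bar> \<le> r \<and> \<bar>\<psi>' \<epsilon> t\<bar> \<le> r" using \<psi>[OF \<epsilon>] by blast
      have u: "P.sol \<epsilon> (um \<epsilon>) (um' \<epsilon>)" "\<And>t. \<bar>um \<epsilon> t - \<psi>m\<bar> \<le> \<rho> \<and> \<bar>um' \<epsilon> t\<bar> \<le> \<rho>"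
        using um[OF e(1)] unfolding P.periodic_near_def by blast+
      have "((\<lambda>t. \<psi> \<epsilon> t - um \<epsilon> t) \<longlongrightarrow> 0) at_bot"
      proof (rule m(4)[OF e(2) _ u(1)])
        show "P.sol \<epsilon> (\<psi> \<epsilon>) (\<psi>' \<epsilon>)" using \<psi>[OF \<epsilon>] by blast
        show "\<bar>\<psi> \<epsilon> t - \<psi>m\<bar> \<le> rm \<and> \<bar>\<psi>' \<epsilon> t\<bar> \<le> rm \<and> \<bar>um \<epsilon> t - \<psi>m\<bar> \<le> rm \<and> \<bar>um' \<epsilon> t\<bar> \<le> rm" if "t \<le> T" for t
          using T[OF that] u(2)[of t] r(2) \<rho>(3) by auto
      qed
      then show ?thesis by (rule tendsto_rabs_zero)
    qed
    have top: "((\<lambda>t. \<bar>\<psi> \<epsilon> t - up \<epsilon> t\<bar>) \<longlongrightarrow> 0) at_top" if \<epsilon>: "0 < \<bar>\<epsilon>\<bar> \<and> \<bar>\<epsilon>\<bar> < e0" for \<epsilon>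
    proof -
      have e: "\<bar>\<epsilon>\<bar> < \<epsilon>1" "\<bar>\<epsilon>\<bar> < ep" using \<epsilon> e0 \<epsilon>1 by auto
      obtain T where T: "\<And>t. T \<le> t \<Longrightarrow> \<bar>\<psi> \<epsilon> t - \<psi>p\<bar> \<le> r \<and> \<bar>\<psi>' \<epsilon> t\<bar> \<le> r" using \<psi>[OF \<epsilon>] by blast
      have u: "P.sol \<epsilon> (up \<epsilon>) (up' \<epsilon>)" "\<And>t. \<bar>up \<epsilon> t - \<psi>p\<bar> \<le> \<rho> \<and> \<bar>up' \<epsilon> t\<bar> \<le> \<rho>"
        using up[OF e(1)] unfolding P.periodic_near_def by blast+
      have "((\<lambda>t. \<psi> \<epsilon> t - up \<epsilon> t) \<longlongrightarrow> 0) at_top"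
      proof (rule p(4)[OF e(2) _ u(1)])
        show "P.sol \<epsilon> (\<psi> \<epsilon>) (\<psi>' \<epsilon>)" using \<psi>[OF \<epsilon>] by blast
        show "\<bar>\<psi> \<epsilon> t - \<psi>p\<bar> \<le> rp \<and> \<bar>\<psi>' \<epsilon> t\<bar> \<le> rp \<and> \<bar>up \<epsilon> t - \<psi>p\<bar> \<le> rp \<and> \<bar>up' \<epsilon> t\<bar> \<le> rp" if "T \<le> t" for t
          using T[OF that] u(2)[of t] r(3) \<rho>(4) by auto
      qed
      then show ?thesis by (rule tendsto_rabs_zero)
    qed
    have nlim: "((\<lambda>\<epsilon>. C2_norm (\<lambda>t. \<psi> \<epsilon> t - \<psi>inf (t + \<alpha> \<epsilon>))) \<longlongrightarrow> 0) (at 0)"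
    proof (rule Lim_null_comparison)
      show "\<forall>\<^sub>F \<epsilon> in at 0. norm (C2_norm (\<lambda>t. \<psi> \<epsilon> t - \<psi>inf (t + \<alpha> \<epsilon>))) \<le> C * \<bar>\<epsilon>\<bar>"
        unfolding eventually_at using e0(1) \<psi> by (intro exI[of _ e0]) (auto simp: dist_real_def)
      have "((\<lambda>\<epsilon>. C * \<bar>\<epsilon>\<bar>) \<longlongrightarrow> C * \<bar>0\<bar>) (at 0)" by (intro tendsto_intros)
      then show "((\<lambda>\<epsilon>. C * \<bar>\<epsilon>\<bar>) \<longlongrightarrow> 0) (at 0)" by simp
    qed
    have main: "perturbed_solution f h \<gamma> d I J \<epsilon> (\<psi> \<epsilon>) \<and>
           C2_near \<rho> (\<psi> \<epsilon>) (\<lambda>t. \<psi>inf (t + \<alpha> \<epsilon>)) \<and>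
           (\<forall>w. perturbed_solution f h \<gamma> d I J \<epsilon> w \<and>
                C2_near \<rho> w (\<lambda>t. \<psi>inf (t + \<alpha> \<epsilon>)) \<longrightarrow> w = \<psi> \<epsilon>) \<and>
           ((\<lambda>t. \<bar>\<psi> \<epsilon> t - um \<epsilon> t\<bar>) \<longlongrightarrow> 0) at_bot \<and>
           ((\<lambda>t. \<bar>\<psi> \<epsilon> t - up \<epsilon> t\<bar>) \<longlongrightarrow> 0) at_top \<and>
           \<bar>\<alpha> \<epsilon> - \<alpha>0\<bar> < \<delta> \<and> phase_condition \<psi>inf (\<alpha> \<epsilon>) (\<psi> \<epsilon>) \<and>
           (\<forall>\<beta>. \<bar>\<beta> - \<alpha>0\<bar> < \<delta> \<and>
                (\<exists>w. perturbed_solution f h \<gamma> d I J \<epsilon> w \<and>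
                     C2_near \<rho> w (\<lambda>t. \<psi>inf (t + \<beta>)) \<and> phase_condition \<psi>inf \<beta> w)
                \<longrightarrow> \<beta> = \<alpha> \<epsilon>)" if \<epsilon>: "0 < \<bar>\<epsilon>\<bar> \<and> \<bar>\<epsilon>\<bar> < e0" for \<epsilon>
    proof -
      have "perturbed_solution f h \<gamma> d I J \<epsilon> (\<psi> \<epsilon>)" by (rule solD[OF conjunct1[OF \<psi>[OF \<epsilon>]]])
      then show ?thesis using \<psi>[OF \<epsilon>] bot[OF \<epsilon>] top[OF \<epsilon>] unfolding sol_iff by blast
    qed
    show "\<exists>\<epsilon>0>0. \<epsilon>0 \<le> \<epsilon>1 \<and> (\<exists>\<delta>>0. \<exists>(\<alpha> :: real \<Rightarrow> real) (\<psi> :: real \<Rightarrow> real \<Rightarrow> real).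
        \<alpha> C1_differentiable_on {-\<epsilon>0<..<\<epsilon>0} \<and>
        \<alpha> 0 = \<alpha>0 \<and> ((\<lambda>\<epsilon>. \<bar>\<alpha> \<epsilon> - \<alpha>0\<bar>) \<longlongrightarrow> 0) (at 0) \<and>
        (\<forall>\<epsilon>. 0 < \<bar>\<epsilon>\<bar> \<and> \<bar>\<epsilon>\<bar> < \<epsilon>0 \<longrightarrow>
           perturbed_solution f h \<gamma> d I J \<epsilon> (\<psi> \<epsilon>) \<and>
           C2_near \<rho> (\<psi> \<epsilon>) (\<lambda>t. \<psi>inf (t + \<alpha> \<epsilon>)) \<and>
           (\<forall>w. perturbed_solution f h \<gamma> d I J \<epsilon> w \<and>
                C2_near \<rho> w (\<lambda>t. \<psi>inf (t + \<alpha> \<epsilon>)) \<longrightarrow> w = \<psi> \<epsilon>) \<and>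
           ((\<lambda>t. \<bar>\<psi> \<epsilon> t - um \<epsilon> t\<bar>) \<longlongrightarrow> 0) at_bot \<and>
           ((\<lambda>t. \<bar>\<psi> \<epsilon> t - up \<epsilon> t\<bar>) \<longlongrightarrow> 0) at_top \<and>
           \<bar>\<alpha> \<epsilon> - \<alpha>0\<bar> < \<delta> \<and> phase_condition \<psi>inf (\<alpha> \<epsilon>) (\<psi> \<epsilon>) \<and>
           (\<forall>\<beta>. \<bar>\<beta> - \<alpha>0\<bar> < \<delta> \<and>
                (\<exists>w. perturbed_solution f h \<gamma> d I J \<epsilon> w \<and>
                     C2_near \<rho> w (\<lambda>t. \<psi>inf (t + \<beta>)) \<and> phase_condition \<psi>inf \<beta> w)
                \<longrightarrow> \<beta> = \<alpha> \<epsilon>)) \<and>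
        ((\<lambda>\<epsilon>. C2_norm (\<lambda>t. \<psi> \<epsilon> t - \<psi>inf (t + \<alpha> \<epsilon>))) \<longlongrightarrow> 0) (at 0))"
      by (rule exI[of _ e0], rule conjI[OF e0(1) conjI[OF e0(2)]], rule exI[of _ \<delta>], rule conjI[OF \<delta>],
          rule exI[of _ \<alpha>], rule exI[of _ \<psi>], intro conjI \<alpha> nlim) (use main in blast)
  qed
qed

end
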